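(* Let $p$ be an odd prime. For any topological generator $a$ of $\mathbf{Z}_p^\times$ (with $a$ an integer, so that $c(a)$ is defined), we have an equality of pseudo-measures $$\zeta_p=\frac{\mathrm{Col}(c(a))}{\theta_a}\in Q(\mathbf{Z}_p^\times).$$
   Context: $\Lambda(\mathbf{Z}_p^\times)=\varprojlim_n\mathbf{Z}_p[(\mathbf{Z}/p^n\mathbf{Z})^\times]$ is the algebra (under convolution) of $\mathbf{Z}_p$-valued measures on $\mathbf{Z}_p^\times$, with $[g]$ the Dirac measure at $g$; $Q(\mathbf{Z}_p^\times)$ is its ring of fractions. A pseudo-measure is $\lambda\in Q(\mathbf{Z}_p^\times)$ with $([g]-[1])\lambda\in\Lambda(\mathbf{Z}_p^\times)$ for all $g\in\mathbf{Z}_p^\times$; for a non-trivial continuous character $\kappa:\mathbf{Z}_p^\times\to\mathbf{C}_p^\times$, $\int\kappa\cdot\lambda:=(\kappa(g)-1)^{-1}\int\kappa\cdot([g]-[1])\lambda$ for any $g$ with $\kappa(g)\neq1$. $\zeta_p$ (the Kubota--Leopoldt $p$-adic $L$-function) is the unique pseudo-measure on $\mathbf{Z}_p^\times$ with $\int x^k\cdot\zeta_p=(1-p^{k-1})\zeta(1-k)$ for all integers $k>0$, where $\zeta$ is the Riemann zeta function. Put $\theta_a=[a]-[1]$. For $n\ge1$ let $K_n=\mathbf{Q}_p(\mu_{p^n})$, $\mathscr{U}_n=\mathcal{O}_{K_n}^\times$, $\mathscr{U}_\infty=\varprojlim\mathscr{U}_n$ (limit under norm maps). Fix primitive $p^n$th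 roots of unity $\xi_{p^n}$ with $\xi_{p^{n+1}}^p=\xi_{p^n}$, and put $\pi_n=\xi_{p^n}-1$. For an integer $a$ prime to $p$, $c_n(a)=(\xi_{p^n}^a-1)/(\xi_{p^n}-1)\in\mathscr{U}_n$ and $c(a)=(c_n(a))_{n\ge1}\in\mathscr{U}_\infty$. On $\mathbf{Z}_p[[T]]$: $\varphi(f)(T)=f((1+T)^p-1)$; $\psi$ is the additive operator with $(\varphi\circ\psi)(f)(T)=\frac1p\sum_{\eta\in\mu_p}f(\eta(1+T)-1)$; $\mathcal{N}$ is the multiplicative operator with $(\varphi\circ\mathcal{N})(f)(T)=\prod_{\eta\in\mu_p}f(\eta(1+T)-1)$; $\partial=(1+T)\frac{d}{dT}$, which is bijective on $\mathbf{Z}_p[[T]]^{\psi=0}$; $\partial\log f=\partial f/f$. The Mahler transform $\mathscr{A}$, sending a measure $\mu$ on $\mathbf{Z}_p$ to $\int_{\mathbf{Z}_p}(1+T)^x\cdot\mu(x)\in\mathbf{Z}_p[[T]]$, restricts to an isomorphism $\Lambda(\mathbf{Z}_p^\times)\cong\mathbf{Z}_p[[T]]^{\psi=0}$ (measures on $\mathbf{Z}_p^\times$ being extended by zero). For $u=(u_n)_n\in\mathscr{U}_\infty$ there is a unique $f_u\in(\mathbf{Z}_p[[T]]^\times)^{\mathcal{N}=\mathrm{id}}$ with $f_u(\pi_n)=u_n$ for all $n\ge 1$ (Coleman). The Coleman map $\mathrm{Col}:\mathscr{U}_\infty\to\Lambda(\mathbf{Z}_p^\times)$ is $$\mathrm{Col}(u)=\mathscr{A}^{-1}\bigl(\partial^{-1}(1-\varphi\circ\psi)\,\partial\log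 f_u\bigr).$$
   Formalization: The identity is proved with a minus sign, ζ_p = −Col(c(a))/θ_a: with the stated definitions the printed sign is wrong (for p=3, a=2 the integral of x² against Col(c(a))/θ_a is −1/6, but (1−p)ζ(−1)=1/6). *)

theory Defs
  imports
    "HOL-Analysis.Analysis"
    "HOL-Computational_Algebra.Computational_Algebra"
    "HOL-Algebra.Algebraic_Closure_Type"
    "Berlekamp_Zassenhaus.Finite_Field"
begin

text \<open>
  The prime $p$ is the cardinality of a type of class \<^class>\<open>prime_card\<close>; every prime
  arises in this way.
\<close>

section \<open>The ring of p-adic integers and its field of fractions\<close>

text \<open>
  $\mathbf{Z}_p = \varprojlim_n \mathbf{Z}/p^n\mathbf{Z}$, a residue class modulo $p^n$ being given by
  its representative in $[0, p^n)$.
\<close>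

typedef (overloaded) ('p :: prime_card) padic_int =
  "{x :: nat \<Rightarrow> int. \<forall>n. 0 \<le> x n \<and> x n < int CARD('p) ^ n
      \<and> x (Suc n) mod int CARD('p) ^ n = x n}"
  morphisms padic_residue Abs_padic_int
  by (rule exI[of _ "\<lambda>_. 0"]) (simp add: prime_gt_0_nat[OF prime_card])

setup_lifting type_definition_padic_int

lemma card_pos [simp]: "0 < int CARD('p :: prime_card)"
  by (simp add: prime_gt_0_nat[OF prime_card])

lemma mod_Suc_power_mod [simp]:
  "(x mod int CARD('p :: prime_card) ^ Suc n) mod int CARD('p) ^ n = x mod int CARD('p) ^ n"
  by (rule mod_mod_cancel) (simp add: le_imp_power_dvd)

lemma mod_Suc_power_mod' [simp]:
  "(x mod (int CARD('p :: prime_card) * int CARD('p) ^ n)) mod int CARD('p) ^ n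
    = x mod int CARD('p) ^ n"
  by (rule mod_mod_cancel) simp

lemma residue_bounds [simp]:
  "0 \<le> padic_residue (x :: 'p :: prime_card padic_int) n"
  "padic_residue x n < int CARD('p) ^ n"
  using padic_residue[of x] by auto

lemma residue_Suc_mod [simp]:
  "padic_residue (x :: 'p :: prime_card padic_int) (Suc n) mod int CARD('p) ^ n = padic_residue x n"
  using padic_residue[of x] by auto

lemma residue_mod_self [simp]:
  "padic_residue (x :: 'p :: prime_card padic_int) n mod int CARD('p) ^ n = padic_residue x n"
  by (rule mod_pos_pos_trivial) simp_all

instantiation padic_int :: (prime_card) comm_ring_1
begin

lift_definition zero_padic_int :: "'a padic_int" is "\<lambda>n. 0 mod int CARD('a) ^ n" by simp

lift_definition one_padic_int :: "'a padic_int" is "\<lambda>n. 1 mod int CARD('a) ^ n"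
  by simp

lift_definition plus_padic_int :: "'a padic_int \<Rightarrow> 'a padic_int \<Rightarrow> 'a padic_int"
  is "\<lambda>x y n. (x n + y n) mod int CARD('a) ^ n"
  by (simp, metis mod_add_eq)

lift_definition times_padic_int :: "'a padic_int \<Rightarrow> 'a padic_int \<Rightarrow> 'a padic_int"
  is "\<lambda>x y n. (x n * y n) mod int CARD('a) ^ n"
  by (simp, metis mod_mult_eq)

lift_definition uminus_padic_int :: "'a padic_int \<Rightarrow> 'a padic_int"
  is "\<lambda>x n. (- x n) mod int CARD('a) ^ n"
  by (simp, metis mod_minus_eq)

lift_definition minus_padic_int :: "'a padic_int \<Rightarrow> 'a padic_int \<Rightarrow> 'a padic_int"
  is "\<lambda>x y n. (x n - y n) mod int CARD('a) ^ n"
  by (simp, metis mod_diff_eq)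

instance
proof
  fix a b c :: "'a padic_int"
  show "a * b * c = a * (b * c)"
    by transfer (simp add: mod_mult_left_eq mod_mult_right_eq mult.assoc)
  show "a * b = b * a"
    by transfer (simp add: mult.commute)
  show "1 * a = a"
    by transfer (auto simp: fun_eq_iff mod_mult_left_eq intro!: mod_pos_pos_trivial)
  show "a + b + c = a + (b + c)"
    by transfer (simp add: mod_add_left_eq mod_add_right_eq add.assoc)
  show "a + b = b + a"
    by transfer (simp add: add.commute)
  show "0 + a = a"
    by transfer (auto simp: fun_eq_iff intro!: mod_pos_pos_trivial)
  show "- a + a = 0"
    by transfer (simp add: mod_add_left_eq)
  show "a - b = a + - b"
    by transfer (simp add: mod_add_right_eq)
  show "(a + b) * c = a * c + b * c"
    by transfer (simp add: mod_mult_left_eq mod_add_eq distrib_right)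
  show "(0 :: 'a padic_int) \<noteq> 1"
  proof
    assume "(0 :: 'a padic_int) = 1"
    hence "(0 :: int) = 1 mod int CARD('a) ^ 1"
      by transfer (metis mod_0)
    thus False
      using prime_gt_1_nat[OF prime_card[where 'a = 'a]] by simp
  qed
qed

end

lemma residue_0 [simp]: "padic_residue (0 :: 'p :: prime_card padic_int) n = 0"
  by transfer simp

lemma residue_mult:
  "padic_residue (x * y :: 'p :: prime_card padic_int) n
    = (padic_residue x n * padic_residue y n) mod int CARD('p) ^ n"
  by transfer simp

lemma residue_add:
  "padic_residue (x + y :: 'p :: prime_card padic_int) n
    = (padic_residue x n + padic_residue y n) mod int CARD('p) ^ n"
  by transfer simp

lemma residue_of_nat:
  "padic_residue (of_nat m :: 'p :: prime_card padic_int) n = int m mod int CARD('p) ^ n"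
proof (induction m)
  case (Suc m)
  have "padic_residue (1 :: 'p padic_int) n = 1 mod int CARD('p) ^ n" by transfer simp
  thus ?case by (simp add: residue_add Suc mod_add_eq)
qed simp

lemma residue_mod_le:
  assumes "m \<le> n"
  shows "padic_residue (x :: 'p :: prime_card padic_int) n mod int CARD('p) ^ m = padic_residue x m"
  using assms
proof (induction n rule: dec_induct)
  case (step k)
  have "padic_residue x (Suc k) mod int CARD('p) ^ m
      = (padic_residue x (Suc k) mod int CARD('p) ^ k) mod int CARD('p) ^ m"
    using step by (intro mod_mod_cancel[symmetric] le_imp_power_dvd) simp
  thus ?case using step by simp
qed simp

instance padic_int :: (prime_card) ring_char_0
proof
  show "inj (of_nat :: nat \<Rightarrow> 'a padic_int)"
  proof (rule injI)
    fix k l :: nat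
    assume eq: "(of_nat k :: 'a padic_int) = of_nat l"
    define n where "n = max k l"
    have "2 \<le> CARD('a)" using prime_ge_2_nat[OF prime_card] .
    hence "n < CARD('a) ^ n"
      by (meson less_exp less_le_trans power_mono zero_le)
    hence "int k < int CARD('a) ^ n" "int l < int CARD('a) ^ n"
      by (simp_all add: n_def flip: of_nat_power)
    moreover have "int k mod int CARD('a) ^ n = int l mod int CARD('a) ^ n"
      using eq residue_of_nat[where 'p = 'a] by metis
    ultimately show "k = l" by simp
  qed
qed

instance padic_int :: (prime_card) idom
proof
  fix a b :: "'a padic_int"
  let ?p = "int CARD('a)"
  assume "a \<noteq> 0" "b \<noteq> 0"
  then obtain i j where i: "padic_residue a i \<noteq> 0" and j: "padic_residue b j \<noteq> 0"
    by (metis ext padic_residue_inject residue_0)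
  show "a * b \<noteq> 0"
  proof
    assume "a * b = 0"
    hence "(padic_residue a (i + j) * padic_residue b (i + j)) mod ?p ^ (i + j) = 0"
      by (metis residue_mult residue_0)
    hence dvd: "?p ^ (i + j) dvd padic_residue a (i + j) * padic_residue b (i + j)" by auto
    have *: "\<not> ?p ^ i dvd padic_residue a (i + j)" "\<not> ?p ^ j dvd padic_residue b (i + j)"
      using i j residue_mod_le[of i "i + j" a] residue_mod_le[of j "i + j" b]
      by (auto simp: dvd_eq_mod_eq_0)
    hence nz: "padic_residue a (i + j) \<noteq> 0" "padic_residue b (i + j) \<noteq> 0" by auto
    have p: "Factorial_Ring.prime ?p" by (simp add: prime_card)
    hence "\<not> is_unit ?p" using prime_gt_1_int[of ?p] by simp
    hence "i + j \<le> multiplicity ?p (padic_residue a (i + j) * padic_residue b (i + j))"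
      using dvd nz by (simp add: power_dvd_iff_le_multiplicity)
    also have "\<dots> = multiplicity ?p (padic_residue a (i + j)) + multiplicity ?p (padic_residue b (i + j))"
      using p nz by (intro prime_elem_multiplicity_mult_distrib) auto
    also have "\<dots> < i + j"
      using * nz \<open>\<not> is_unit ?p\<close> by (intro add_strict_mono) (simp_all add: power_dvd_iff_le_multiplicity)
    finally show False by simp
  qed
qed


text \<open>The inverse limit topology, which is the $p$-adic topology.\<close>

instantiation padic_int :: (prime_card) t2_space
begin

definition open_padic_int :: "'a padic_int set \<Rightarrow> bool" where
  "open_padic_int U \<longleftrightarrow>
    (\<forall>x\<in>U. \<exists>n. \<forall>y. padic_residue y n = padic_residue x n \<longrightarrow> y \<in> U)"

instance
proof
  show "open (UNIV :: 'a padic_int set)" by (simp add: open_padic_int_def)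
next
  fix S T :: "'a padic_int set"
  assume *: "open S" "open T"
  show "open (S \<inter> T)" unfolding open_padic_int_def
  proof
    fix x assume "x \<in> S \<inter> T"
    then obtain m n where
      m: "\<And>y. padic_residue y m = padic_residue x m \<Longrightarrow> y \<in> S" and
      n: "\<And>y. padic_residue y n = padic_residue x n \<Longrightarrow> y \<in> T"
      using * unfolding open_padic_int_def by (metis IntD1 IntD2)
    have "y \<in> S \<inter> T" if "padic_residue y (max m n) = padic_residue x (max m n)" for y
      using that m[of y] n[of y] residue_mod_le[of _ "max m n" x] residue_mod_le[of _ "max m n" y]
      by (metis IntI max.cobounded1 max.cobounded2)
    thus "\<exists>n. \<forall>y. padic_residue y n = padic_residue x n \<longrightarrow> y \<in> S \<inter> T" by blast
  qed
next
  fix K :: "'a padic_int set set"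
  assume "\<forall>S\<in>K. open S"
  thus "open (\<Union>K)" unfolding open_padic_int_def by (meson Union_iff)
next
  fix x y :: "'a padic_int"
  assume "x \<noteq> y"
  then obtain n where n: "padic_residue x n \<noteq> padic_residue y n"
    by (metis ext padic_residue_inject)
  let ?B = "\<lambda>x. {z. padic_residue z n = padic_residue (x :: 'a padic_int) n}"
  have "open (?B x)" "open (?B y)" by (auto simp: open_padic_int_def intro!: exI[of _ n])
  moreover have "x \<in> ?B x" "y \<in> ?B y" "?B x \<inter> ?B y = {}" using n by auto
  ultimately show "\<exists>U V. open U \<and> open V \<and> x \<in> U \<and> y \<in> V \<and> U \<inter> V = {}" by blast
qed

end

type_synonym 'p padic = "'p padic_int fract"

instance fract :: ("{idom, ring_char_0}") field_char_0
proof
  show "inj (of_nat :: nat \<Rightarrow> 'a fract)"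
    by (rule injI) (simp add: of_nat_fract eq_fract)
qed

definition padic_units :: "'p :: prime_card padic_int set" where
  "padic_units = {x. x dvd 1}"

definition topological_generator :: "'p :: prime_card padic_int \<Rightarrow> bool" where
  "topological_generator a \<longleftrightarrow> a \<in> padic_units
    \<and> padic_units \<subseteq> closure {x. \<exists>k. x = a ^ k \<or> x * a ^ k = 1}"


section \<open>The Iwasawa algebra\<close>

text \<open>Representatives in $[0, p^n)$ of $(\mathbf{Z}/p^n\mathbf{Z})^\times$; for $n = 0$ this is the trivial group.\<close>

definition unit_residues :: "'p :: prime_card itself \<Rightarrow> nat \<Rightarrow> int set" where
  "unit_residues _ n = {b. 0 \<le> b \<and> b < int CARD('p) ^ n \<and> coprime b (int CARD('p) ^ n)}"

text \<open>
  $\varprojlim_n \mathbf{Z}_p[(\mathbf{Z}/p^n\mathbf{Z})^\times]$: the element \<open>\<mu>\<close> has component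
  $\sum_b \mu_n(b)\,[b]$ at level $n$, so that $\mu_n(b)$ is the mass of $b + p^n\mathbf{Z}_p$.
\<close>

definition measure_family :: "(nat \<Rightarrow> int \<Rightarrow> 'p :: prime_card padic_int) \<Rightarrow> bool" where
  "measure_family \<mu> \<longleftrightarrow>
      (\<forall>n b. b \<notin> unit_residues TYPE('p) n \<longrightarrow> \<mu> n b = 0) \<and>
      (\<forall>n. \<forall>b\<in>unit_residues TYPE('p) n.
         \<mu> n b = (\<Sum>c | c \<in> unit_residues TYPE('p) (Suc n) \<and> c mod int CARD('p) ^ n = b. \<mu> (Suc n) c))"

typedef (overloaded) ('p :: prime_card) iwasawa =
  "{\<mu> :: nat \<Rightarrow> int \<Rightarrow> 'p padic_int. measure_family \<mu>}"
  morphisms mass Abs_iwasawa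
  by (rule exI[of _ "\<lambda>_ _. 0"]) (simp add: measure_family_def)

lemma measure_familyI:
  fixes \<mu> :: "nat \<Rightarrow> int \<Rightarrow> 'p :: prime_card padic_int"
  assumes "\<And>n b. b \<notin> unit_residues TYPE('p) n \<Longrightarrow> \<mu> n b = 0"
    and "\<And>n b. b \<in> unit_residues TYPE('p) n \<Longrightarrow>
      \<mu> n b = (\<Sum>c | c \<in> unit_residues TYPE('p) (Suc n) \<and> c mod int CARD('p) ^ n = b. \<mu> (Suc n) c)"
  shows "measure_family \<mu>"
  using assms unfolding measure_family_def by blast

lemma measure_familyD:
  fixes \<mu> :: "nat \<Rightarrow> int \<Rightarrow> 'p :: prime_card padic_int"
  assumes "measure_family \<mu>"
  shows "b \<notin> unit_residues TYPE('p) n \<Longrightarrow> \<mu> n b = 0"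
    and "b \<in> unit_residues TYPE('p) n \<Longrightarrow>
      \<mu> n b = (\<Sum>c | c \<in> unit_residues TYPE('p) (Suc n) \<and> c mod int CARD('p) ^ n = b. \<mu> (Suc n) c)"
  using assms unfolding measure_family_def by blast+

setup_lifting type_definition_iwasawa

lemma finite_unit_residues [simp]: "finite (unit_residues T n)"
  by (rule finite_subset[of _ "{0..<int CARD('a) ^ n}"]) (auto simp: unit_residues_def)

lemma unit_residues_mod:
  "b \<in> unit_residues TYPE('p :: prime_card) n \<Longrightarrow> b mod int CARD('p) ^ n = b"
  by (simp add: unit_residues_def)

lemma unit_residues_mod_iff:
  "b mod int CARD('p) ^ n \<in> unit_residues TYPE('p :: prime_card) n \<longleftrightarrow> coprime b (int CARD('p) ^ n)"
  by (simp add: unit_residues_def coprime_mod_left_iff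
      del: coprime_power_left_iff coprime_power_right_iff)

lemma unit_residues_mult [simp]:
  assumes "b \<in> unit_residues TYPE('p :: prime_card) n" "c \<in> unit_residues TYPE('p) n"
  shows "(b * c) mod int CARD('p) ^ n \<in> unit_residues TYPE('p) n"
  using assms by (simp only: unit_residues_mod_iff)
    (simp add: unit_residues_def coprime_mult_left_iff
      del: coprime_power_left_iff coprime_power_right_iff)

lemma unit_residues_Suc:
  assumes "b \<in> unit_residues TYPE('p :: prime_card) (Suc n)"
  shows "b mod int CARD('p) ^ n \<in> unit_residues TYPE('p) n"
  using assms by (simp only: unit_residues_mod_iff) (auto simp: unit_residues_def)

lemma one_mod_unit_residues [simp]:
  "1 mod int CARD('p) ^ n \<in> unit_residues TYPE('p :: prime_card) n"
  by (simp only: unit_residues_mod_iff) simp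

lemma residue_unit:
  assumes "g \<in> padic_units"
  shows "padic_residue (g :: 'p :: prime_card padic_int) n \<in> unit_residues TYPE('p) n"
proof -
  obtain h where "g * h = (1 :: 'p padic_int)" using assms by (auto simp: padic_units_def dvd_def)
  hence "(padic_residue g n * padic_residue h n) mod int CARD('p) ^ n
      = padic_residue (1 :: 'p padic_int) n"
    by (metis residue_mult)
  also have "\<dots> = 1 mod int CARD('p) ^ n" by transfer simp
  finally have "coprime (padic_residue g n * padic_residue h n) (int CARD('p) ^ n)"
    using one_mod_unit_residues[where 'p = 'p and n = n] by (metis unit_residues_mod_iff)
  thus ?thesis
    by (simp add: unit_residues_def coprime_mult_left_iff
      del: coprime_power_left_iff coprime_power_right_iff)
qed

lemma point_mass_compat:
  fixes u :: "nat \<Rightarrow> int"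
  assumes "u (Suc n) \<in> unit_residues TYPE('p :: prime_card) (Suc n)"
    and "u (Suc n) mod int CARD('p) ^ n = u n"
  shows "(if b = u n then 1 else 0 :: 'p padic_int) =
    (\<Sum>c | c \<in> unit_residues TYPE('p) (Suc n) \<and> c mod int CARD('p) ^ n = b.
       if c = u (Suc n) then 1 else 0)"
  using assms by (subst sum.delta) auto

lemma convolution_compat:
  fixes \<mu> \<nu> :: "nat \<Rightarrow> int \<Rightarrow> 'p :: prime_card padic_int"
  defines "U \<equiv> unit_residues TYPE('p)" and "q \<equiv> \<lambda>n. int CARD('p) ^ n"
  assumes \<mu>: "\<And>b. b \<in> U n \<Longrightarrow> \<mu> n b = (\<Sum>c | c \<in> U (Suc n) \<and> c mod q n = b. \<mu> (Suc n) c)"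
  assumes \<nu>: "\<And>b. b \<in> U n \<Longrightarrow> \<nu> n b = (\<Sum>c | c \<in> U (Suc n) \<and> c mod q n = b. \<nu> (Suc n) c)"
  assumes b: "b \<in> U n"
  shows "(\<Sum>(c, d) | c \<in> U n \<and> d \<in> U n \<and> (c * d) mod q n = b. \<mu> n c * \<nu> n d) =
    (\<Sum>x | x \<in> U (Suc n) \<and> x mod q n = b.
      \<Sum>(c, d) | c \<in> U (Suc n) \<and> d \<in> U (Suc n) \<and> (c * d) mod q (Suc n) = x.
        \<mu> (Suc n) c * \<nu> (Suc n) d)"
proof -
  let ?N = "Suc n"
  define S where "S = {(c, d). c \<in> U ?N \<and> d \<in> U ?N \<and> (c * d) mod q n = b}"
  define T where "T = {(c, d). c \<in> U n \<and> d \<in> U n \<and> (c * d) mod q n = b}"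
  define F where "F = (\<lambda>(c, d). \<mu> ?N c * \<nu> ?N d)"
  have finU [simp]: "finite (U k)" for k by (simp add: U_def)
  have mm: "(x mod q ?N) mod q n = x mod q n" for x
    unfolding q_def by (rule mod_Suc_power_mod)
  have fS: "finite S" by (rule finite_subset[of _ "U ?N \<times> U ?N"]) (auto simp: S_def)
  have fT: "finite T" by (rule finite_subset[of _ "U n \<times> U n"]) (auto simp: T_def)
  have "(\<Sum>x | x \<in> U ?N \<and> x mod q n = b.
      \<Sum>(c, d) | c \<in> U ?N \<and> d \<in> U ?N \<and> (c * d) mod q ?N = x. \<mu> ?N c * \<nu> ?N d)
    = (\<Sum>x | x \<in> U ?N \<and> x mod q n = b. \<Sum>z | z \<in> S \<and> (\<lambda>(c, d). (c * d) mod q ?N) z = x. F z)"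
    by (rule sum.cong[OF refl], rule sum.cong) (auto simp: S_def F_def mm)
  also have "\<dots> = (\<Sum>z\<in>S. F z)"
    using fS by (intro sum.group) (auto simp: S_def mm U_def q_def simp del: power_Suc)
  also have "\<dots> = (\<Sum>y\<in>T. \<Sum>z | z \<in> S \<and> (\<lambda>(c, d). (c mod q n, d mod q n)) z = y. F z)"
    using fS fT
    by (intro sum.group[symmetric]) (auto simp: S_def T_def mod_mult_eq U_def q_def unit_residues_Suc)
  also have "\<dots> = (\<Sum>(c, d)\<in>T. \<mu> n c * \<nu> n d)"
  proof (rule sum.cong[OF refl], clarify)
    fix c d assume cd: "(c, d) \<in> T"
    hence *: "c \<in> U n" "d \<in> U n" by (auto simp: T_def)
    have eq: "{z \<in> S. (\<lambda>(c, d). (c mod q n, d mod q n)) z = (c, d)} =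
      {x. x \<in> U ?N \<and> x mod q n = c} \<times> {x. x \<in> U ?N \<and> x mod q n = d}"
      using cd by (auto simp: S_def T_def) (metis mod_mult_eq)+
    show "(\<Sum>z | z \<in> S \<and> (\<lambda>(c, d). (c mod q n, d mod q n)) z = (c, d). F z) = \<mu> n c * \<nu> n d"
      unfolding eq \<mu>[OF *(1)] \<nu>[OF *(2)] F_def
      by (simp add: sum_product sum.cartesian_product)
  qed
  finally show ?thesis by (simp add: T_def)
qed

instantiation iwasawa :: (prime_card) comm_ring_1
begin

lift_definition zero_iwasawa :: "'a iwasawa" is "\<lambda>_ _. 0"
  by (simp add: measure_family_def)

lift_definition one_iwasawa :: "'a iwasawa" is
  "\<lambda>n b. if b = 1 mod int CARD('a) ^ n then 1 else 0"
  by (intro measure_familyI point_mass_compat mod_Suc_power_mod one_mod_unit_residues)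
     (use one_mod_unit_residues in auto)

lift_definition plus_iwasawa :: "'a iwasawa \<Rightarrow> 'a iwasawa \<Rightarrow> 'a iwasawa"
  is "\<lambda>\<mu> \<nu> n b. \<mu> n b + \<nu> n b"
  by (intro measure_familyI, simp add: measure_familyD(1), unfold sum.distrib)
     (intro arg_cong2[where f = "(+)"] measure_familyD(2))

lift_definition minus_iwasawa :: "'a iwasawa \<Rightarrow> 'a iwasawa \<Rightarrow> 'a iwasawa"
  is "\<lambda>\<mu> \<nu> n b. \<mu> n b - \<nu> n b"
  by (intro measure_familyI, simp add: measure_familyD(1), unfold sum_subtractf)
     (intro arg_cong2[where f = "(-)"] measure_familyD(2))

lift_definition uminus_iwasawa :: "'a iwasawa \<Rightarrow> 'a iwasawa" is "\<lambda>\<mu> n b. - \<mu> n b"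
  by (intro measure_familyI, simp add: measure_familyD(1), unfold sum_negf)
     (intro arg_cong[where f = uminus] measure_familyD(2))

lift_definition times_iwasawa :: "'a iwasawa \<Rightarrow> 'a iwasawa \<Rightarrow> 'a iwasawa"
  is "\<lambda>\<mu> \<nu> n b. \<Sum>(c, d) | c \<in> unit_residues TYPE('a) n \<and> d \<in> unit_residues TYPE('a) n
        \<and> (c * d) mod int CARD('a) ^ n = b. \<mu> n c * \<nu> n d"
  by (intro measure_familyI, blast intro!: sum.neutral dest: unit_residues_mult)
     (intro convolution_compat measure_familyD(2))

lemma mass_times_expand:
  fixes \<mu> \<nu> :: "'a iwasawa" and n
  defines "U \<equiv> unit_residues TYPE('a) n"
  shows "mass (\<mu> * \<nu>) n b =
    (\<Sum>c\<in>U. \<Sum>d\<in>U. if (c * d) mod int CARD('a) ^ n = b then mass \<mu> n c * mass \<nu> n d else 0)"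
proof -
  have fin: "finite U" by (simp add: U_def)
  have "mass (\<mu> * \<nu>) n b = (\<Sum>(c, d) | c \<in> U \<and> d \<in> U
        \<and> (c * d) mod int CARD('a) ^ n = b. mass \<mu> n c * mass \<nu> n d)"
    unfolding U_def by transfer simp
  also have "\<dots> = (\<Sum>z | z \<in> U \<times> U \<and> (fst z * snd z) mod int CARD('a) ^ n = b.
      mass \<mu> n (fst z) * mass \<nu> n (snd z))"
    by (rule sum.cong) auto
  also have "\<dots> = (\<Sum>z\<in>U \<times> U. if (fst z * snd z) mod int CARD('a) ^ n = b
        then mass \<mu> n (fst z) * mass \<nu> n (snd z) else 0)"
    using fin by (intro sum.inter_filter) simp
  also have "\<dots> = (\<Sum>c\<in>U. \<Sum>d\<in>U. if (c * d) mod int CARD('a) ^ n = b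
      then mass \<mu> n c * mass \<nu> n d else 0)"
    by (simp add: sum.cartesian_product case_prod_unfold)
  finally show ?thesis .
qed

lemma sum_mass_times:
  fixes \<mu> \<nu> :: "'a iwasawa" and n and f :: "int \<Rightarrow> 'a padic_int"
  defines "U \<equiv> unit_residues TYPE('a) n"
  shows "(\<Sum>b\<in>U. f b * mass (\<mu> * \<nu>) n b) =
    (\<Sum>c\<in>U. \<Sum>d\<in>U. f ((c * d) mod int CARD('a) ^ n) * (mass \<mu> n c * mass \<nu> n d))"
proof -
  have fin: "finite U" by (simp add: U_def)
  have "(\<Sum>b\<in>U. f b * mass (\<mu> * \<nu>) n b) = (\<Sum>b\<in>U. \<Sum>c\<in>U. \<Sum>d\<in>U.
      if (c * d) mod int CARD('a) ^ n = b then f b * (mass \<mu> n c * mass \<nu> n d) else 0)"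
    unfolding mass_times_expand U_def[symmetric] sum_distrib_left by (intro sum.cong refl) simp
  also have "\<dots> = (\<Sum>c\<in>U. \<Sum>b\<in>U. \<Sum>d\<in>U.
      if (c * d) mod int CARD('a) ^ n = b then f b * (mass \<mu> n c * mass \<nu> n d) else 0)"
    by (rule sum.swap)
  also have "\<dots> = (\<Sum>c\<in>U. \<Sum>d\<in>U. \<Sum>b\<in>U.
      if (c * d) mod int CARD('a) ^ n = b then f b * (mass \<mu> n c * mass \<nu> n d) else 0)"
    by (rule sum.cong[OF refl], rule sum.swap)
  also have "\<dots> = (\<Sum>c\<in>U. \<Sum>d\<in>U. f ((c * d) mod int CARD('a) ^ n) * (mass \<mu> n c * mass \<nu> n d))"
    using fin by (intro sum.cong refl) (simp add: sum.delta' U_def)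
  finally show ?thesis .
qed

lemma iwasawa_eqI:
  fixes \<mu> \<nu> :: "'a iwasawa"
  assumes "\<And>n b. mass \<mu> n b = mass \<nu> n b"
  shows "\<mu> = \<nu>"
  using assms by (metis ext mass_inject)

lemma mass_outside: "b \<notin> unit_residues TYPE('a) n \<Longrightarrow> mass (\<mu> :: 'a iwasawa) n b = 0"
  using mass[of \<mu>] measure_familyD(1) by auto

instance
proof
  fix a b c :: "'a iwasawa"
  have comm: "a * b = b * a" for a b :: "'a iwasawa"
  proof (rule iwasawa_eqI)
    fix n x
    let ?U = "unit_residues TYPE('a) n" and ?q = "int CARD('a) ^ n"
    have "mass (a * b) n x
        = (\<Sum>d\<in>?U. \<Sum>c\<in>?U. if (c * d) mod ?q = x then mass a n c * mass b n d else 0)"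
      unfolding mass_times_expand by (rule sum.swap)
    also have "\<dots> = mass (b * a) n x"
      unfolding mass_times_expand by (intro sum.cong refl) (simp only: mult.commute)
    finally show "mass (a * b) n x = mass (b * a) n x" .
  qed
  show "a * b = b * a" by (rule comm)
  have assoc: "mass (a * b * c) n x =
      (\<Sum>k\<in>unit_residues TYPE('a) n. \<Sum>i\<in>unit_residues TYPE('a) n. \<Sum>j\<in>unit_residues TYPE('a) n.
        (if (i * j * k) mod int CARD('a) ^ n = x then 1 else 0) *
        (mass a n i * mass b n j * mass c n k))" for a b c :: "'a iwasawa" and n x
  proof -
    define U where "U = unit_residues TYPE('a) n"
    let ?q = "int CARD('a) ^ n"
    have "mass (a * b * c) n x =
      (\<Sum>k\<in>U. \<Sum>y\<in>U. if (y * k) mod ?q = x then mass (a * b) n y * mass c n k else 0)"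
      unfolding mass_times_expand[of "a * b"] U_def by (rule sum.swap)
    also have "\<dots> = (\<Sum>k\<in>U. (\<Sum>y\<in>U. (if (y * k) mod ?q = x then 1 else 0) * mass (a * b) n y) * mass c n k)"
      unfolding sum_distrib_right by (intro sum.cong refl) simp
    also have "\<dots> = (\<Sum>k\<in>U. \<Sum>i\<in>U. \<Sum>j\<in>U. (if (i * j * k) mod ?q = x then 1 else 0) *
        (mass a n i * mass b n j * mass c n k))"
      unfolding U_def sum_mass_times sum_distrib_right
      by (intro sum.cong refl) (simp add: mod_mult_left_eq)
    finally show ?thesis by (simp add: U_def)
  qed
  show "a * b * c = a * (b * c)"
  proof (rule iwasawa_eqI)
    fix n x
    let ?U = "unit_residues TYPE('a) n"
    let ?G = "\<lambda>i j k. (if (i * j * k) mod int CARD('a) ^ n = x then 1 else 0) *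
        (mass a n i * mass b n j * mass c n k)"
    have "mass (a * b * c) n x = (\<Sum>k\<in>?U. \<Sum>i\<in>?U. \<Sum>j\<in>?U. ?G i j k)" by (rule assoc)
    also have "\<dots> = (\<Sum>i\<in>?U. \<Sum>k\<in>?U. \<Sum>j\<in>?U. ?G i j k)" by (rule sum.swap)
    also have "\<dots> = (\<Sum>i\<in>?U. \<Sum>j\<in>?U. \<Sum>k\<in>?U. ?G i j k)"
      by (rule sum.cong[OF refl], rule sum.swap)
    also have "\<dots> = mass (b * c * a) n x"
      unfolding assoc by (intro sum.cong refl) (simp add: mult_ac)
    finally show "mass (a * b * c) n x = mass (a * (b * c)) n x" by (simp add: comm)
  qed
  show "1 * a = a"
  proof (rule iwasawa_eqI)
    fix n x
    let ?U = "unit_residues TYPE('a) n" and ?q = "int CARD('a) ^ n"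
    have one: "mass (1 :: 'a iwasawa) n y = (if y = 1 mod ?q then 1 else 0)" for y
      by (simp add: one_iwasawa.rep_eq)
    have "mass (1 * a) n x = (\<Sum>d\<in>?U. \<Sum>c\<in>?U. if (c * d) mod ?q = x
        then (if c = 1 mod ?q then 1 else 0) * mass a n d else 0)"
      unfolding mass_times_expand one by (rule sum.swap)
    also have "\<dots> = (\<Sum>d\<in>?U. \<Sum>c\<in>?U. if c = 1 mod ?q then
        (if (c * d) mod ?q = x then mass a n d else 0) else 0)"
      by (intro sum.cong refl) simp
    also have "\<dots> = (\<Sum>d\<in>?U. if ((1 mod ?q) * d) mod ?q = x then mass a n d else 0)"
      by (simp add: sum.delta)
    also have "\<dots> = (\<Sum>d\<in>?U. if d = x then mass a n d else 0)"
      by (intro sum.cong refl) (simp add: mod_mult_left_eq unit_residues_mod)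
    also have "\<dots> = mass a n x" by (simp add: sum.delta mass_outside)
    finally show "mass (1 * a) n x = mass a n x" .
  qed
  show "(a + b) * c = a * c + b * c"
  proof (rule iwasawa_eqI)
    fix n x
    have pl: "mass (\<mu> + \<nu>) n y = mass \<mu> n y + mass \<nu> n y" for \<mu> \<nu> :: "'a iwasawa" and y
      by (simp add: plus_iwasawa.rep_eq)
    show "mass ((a + b) * c) n x = mass (a * c + b * c) n x"
      unfolding pl mass_times_expand sum.distrib[symmetric]
      by (intro sum.cong refl) (simp add: distrib_right)
  qed
  show "a + b + c = a + (b + c)" by transfer (simp add: add.assoc)
  show "a + b = b + a" by transfer (simp add: add.commute)
  show "0 + a = a" by transfer simp
  show "- a + a = 0" by transfer simp
  show "a - b = a + - b" by transfer simp
  show "(0 :: 'a iwasawa) \<noteq> 1"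
  proof
    assume "(0 :: 'a iwasawa) = 1"
    hence "mass (0 :: 'a iwasawa) 0 0 = mass (1 :: 'a iwasawa) 0 0" by simp
    moreover have "mass (0 :: 'a iwasawa) 0 0 = 0" "mass (1 :: 'a iwasawa) 0 0 = 1"
      by (simp_all add: zero_iwasawa.rep_eq one_iwasawa.rep_eq)
    ultimately show False by simp
  qed
qed

end

text \<open>The Dirac measure $[g]$, with the junk value $0$ if $g$ is not a unit.\<close>

lift_definition dirac :: "'p :: prime_card padic_int \<Rightarrow> 'p iwasawa" is
  "\<lambda>g n b. if g \<in> padic_units \<and> b = padic_residue g n then 1 else 0"
proof (rule measure_familyI)
  fix g :: "'p padic_int" and n b
  show "(if g \<in> padic_units \<and> b = padic_residue g n then 1 else 0 :: 'p padic_int) = 0"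
    if "b \<notin> unit_residues TYPE('p) n"
    using that residue_unit by auto
  show "(if g \<in> padic_units \<and> b = padic_residue g n then 1 else 0 :: 'p padic_int) =
      (\<Sum>c | c \<in> unit_residues TYPE('p) (Suc n) \<and> c mod int CARD('p) ^ n = b.
        if g \<in> padic_units \<and> c = padic_residue g (Suc n) then 1 else 0)"
  proof (cases "g \<in> padic_units")
    case True
    show ?thesis
      using point_mass_compat[of "padic_residue g" n b, OF residue_unit[OF True] residue_Suc_mod] True
      by simp
  qed simp
qed

definition theta :: "int \<Rightarrow> 'p :: prime_card iwasawa" where
  "theta a = dirac (of_int a) - dirac 1"

text \<open>
  $\int_{\mathbf{Z}_p^\times} f \cdot \mu$ for continuous $f : \mathbf{Z}_p^\times \to \mathbf{Z}_p$,
  as a limit of Riemann sums.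
\<close>

definition measure_integral :: "('p padic_int \<Rightarrow> 'p padic_int) \<Rightarrow> 'p :: prime_card iwasawa \<Rightarrow> 'p padic_int" where
  "measure_integral f \<mu> = lim (\<lambda>n. \<Sum>b\<in>unit_residues TYPE('p) n. f (of_int b) * mass \<mu> n b)"


section \<open>The total ring of fractions\<close>

definition nonzerodivisor :: "'a :: comm_ring_1 \<Rightarrow> bool" where
  "nonzerodivisor s \<longleftrightarrow> (\<forall>x. s * x = 0 \<longrightarrow> x = 0)"

lemma nonzerodivisor_1 [simp]: "nonzerodivisor 1"
  by (simp add: nonzerodivisor_def)

lemma nonzerodivisor_mult [simp]:
  "nonzerodivisor s \<Longrightarrow> nonzerodivisor t \<Longrightarrow> nonzerodivisor (s * t)"
  unfolding nonzerodivisor_def by (metis mult.assoc)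

lemma nonzerodivisor_cancel:
  "nonzerodivisor s \<Longrightarrow> s * x = s * y \<longleftrightarrow> x = y"
  by (metis nonzerodivisor_def right_diff_distrib right_minus_eq)

definition total_fracrel :: "'a :: comm_ring_1 \<times> 'a \<Rightarrow> 'a \<times> 'a \<Rightarrow> bool" where
  "total_fracrel x y \<longleftrightarrow>
    nonzerodivisor (snd x) \<and> nonzerodivisor (snd y) \<and> fst x * snd y = fst y * snd x"

lemma part_equivp_total_fracrel: "part_equivp total_fracrel"
proof (rule part_equivpI)
  show "\<exists>x. total_fracrel x (x :: 'a \<times> 'a)"
    by (rule exI[of _ "(0, 1)"]) (simp add: total_fracrel_def)
  show "symp (total_fracrel :: 'a \<times> 'a \<Rightarrow> _)" by (simp add: symp_def total_fracrel_def)
  show "transp (total_fracrel :: 'a \<times> 'a \<Rightarrow> _)"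
  proof (rule transpI)
    fix x y z :: "'a \<times> 'a"
    assume *: "total_fracrel x y" "total_fracrel y z"
    hence e: "fst x * snd y = fst y * snd x" "fst y * snd z = fst z * snd y"
      by (simp_all add: total_fracrel_def)
    have "snd y * (fst x * snd z) = (fst x * snd y) * snd z" by (simp only: mult_ac)
    also have "\<dots> = (fst y * snd z) * snd x" unfolding e(1) by (simp only: mult_ac)
    also have "\<dots> = snd y * (fst z * snd x)" unfolding e(2) by (simp only: mult_ac)
    finally show "total_fracrel x z" using * nonzerodivisor_cancel by (auto simp: total_fracrel_def)
  qed
qed

quotient_type (overloaded) 'a total_frac = "'a :: comm_ring_1 \<times> 'a" / partial: total_fracrel
  by (rule part_equivp_total_fracrel)

text \<open>As for \<^const>\<open>Fract\<close>, a fraction with inadmissible denominator is $0$.\<close>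

lift_definition Total_Frac :: "'a :: comm_ring_1 \<Rightarrow> 'a \<Rightarrow> 'a total_frac" is
  "\<lambda>a s. if nonzerodivisor s then (a, s) else (0, 1)"
  by (simp add: total_fracrel_def)

instantiation total_frac :: (comm_ring_1) comm_ring_1
begin

lift_definition zero_total_frac :: "'a total_frac" is "(0, 1)" by (simp add: total_fracrel_def)

lift_definition one_total_frac :: "'a total_frac" is "(1, 1)" by (simp add: total_fracrel_def)

lift_definition plus_total_frac :: "'a total_frac \<Rightarrow> 'a total_frac \<Rightarrow> 'a total_frac" is
  "\<lambda>x y. (fst x * snd y + fst y * snd x, snd x * snd y)"
proof -
  fix x x' y y' :: "'a \<times> 'a"
  assume *: "total_fracrel x x'" "total_fracrel y y'"
  have "(fst x * snd y + fst y * snd x) * (snd x' * snd y') =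
      (fst x * snd x') * (snd y * snd y') + (fst y * snd y') * (snd x * snd x')"
    by (simp add: algebra_simps)
  also have "\<dots> = (fst x' * snd x) * (snd y * snd y') + (fst y' * snd y) * (snd x * snd x')"
    using * by (simp add: total_fracrel_def)
  also have "\<dots> = (fst x' * snd y' + fst y' * snd x') * (snd x * snd y)"
    by (simp add: algebra_simps)
  finally show "total_fracrel (fst x * snd y + fst y * snd x, snd x * snd y)
      (fst x' * snd y' + fst y' * snd x', snd x' * snd y')"
    using * by (simp add: total_fracrel_def)
qed

lift_definition uminus_total_frac :: "'a total_frac \<Rightarrow> 'a total_frac" is "\<lambda>x. (- fst x, snd x)"
  by (simp add: total_fracrel_def)

definition minus_total_frac :: "'a total_frac \<Rightarrow> 'a total_frac \<Rightarrow> 'a total_frac" where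
  "x - y = x + - (y :: 'a total_frac)"

lift_definition times_total_frac :: "'a total_frac \<Rightarrow> 'a total_frac \<Rightarrow> 'a total_frac" is
  "\<lambda>x y. (fst x * fst y, snd x * snd y)"
proof -
  fix x x' y y' :: "'a \<times> 'a"
  assume *: "total_fracrel x x'" "total_fracrel y y'"
  have "fst x * fst y * (snd x' * snd y') = (fst x * snd x') * (fst y * snd y')"
    by (simp add: mult_ac)
  also have "\<dots> = fst x' * fst y' * (snd x * snd y)"
    using * by (simp add: total_fracrel_def mult_ac)
  finally show "total_fracrel (fst x * fst y, snd x * snd y) (fst x' * fst y', snd x' * snd y')"
    using * by (simp add: total_fracrel_def)
qed

instance
proof
  fix a b c :: "'a total_frac"
  show "a * b * c = a * (b * c)" by transfer (simp add: total_fracrel_def mult_ac)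
  show "a * b = b * a" by transfer (simp add: total_fracrel_def mult_ac)
  show "1 * a = a" by transfer (simp add: total_fracrel_def)
  show "a + b + c = a + (b + c)" by transfer (simp add: total_fracrel_def algebra_simps)
  show "a + b = b + a" by transfer (simp add: total_fracrel_def algebra_simps)
  show "0 + a = a" by transfer (simp add: total_fracrel_def)
  show "- a + a = 0" by transfer (simp add: total_fracrel_def algebra_simps)
  show "a - b = a + - b" by (simp add: minus_total_frac_def)
  show "(a + b) * c = a * c + b * c" by transfer (simp add: total_fracrel_def algebra_simps)
  show "(0 :: 'a total_frac) \<noteq> 1" by transfer (simp add: total_fracrel_def)
qed

end

abbreviation to_total_frac :: "'a :: comm_ring_1 \<Rightarrow> 'a total_frac" where
  "to_total_frac x \<equiv> Total_Frac x 1"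


section \<open>Pseudo-measures and the Kubota--Leopoldt zeta function\<close>

definition pseudo_measure :: "'p :: prime_card iwasawa total_frac \<Rightarrow> bool" where
  "pseudo_measure \<Lambda> \<longleftrightarrow>
    (\<forall>g\<in>padic_units. to_total_frac (dirac g - dirac 1) * \<Lambda> \<in> range to_total_frac)"

text \<open>
  The integral of a non-trivial continuous character
  $\kappa : \mathbf{Z}_p^\times \to \mathbf{Z}_p^\times$ against a pseudo-measure. It is
  independent of $g$, which is why it may be defined by quantifying over all $g$.
\<close>

definition pseudo_integral ::
    "('p padic_int \<Rightarrow> 'p padic_int) \<Rightarrow> 'p :: prime_card iwasawa total_frac \<Rightarrow> 'p padic" where
  "pseudo_integral \<kappa> \<Lambda> = (THE I. \<forall>g\<in>padic_units. \<forall>\<mu>.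
      \<kappa> g \<noteq> 1 \<longrightarrow> to_total_frac \<mu> = to_total_frac (dirac g - dirac 1) * \<Lambda> \<longrightarrow>
      I = Fract (measure_integral \<kappa> \<mu>) (\<kappa> g - 1))"

text \<open>
  The Riemann zeta function at \<open>s \<noteq> 1\<close>: the value at \<open>s\<close> of the holomorphic continuation of the
  Dirichlet series.
\<close>

definition riemann_zeta :: "complex \<Rightarrow> complex" where
  "riemann_zeta s = (THE z. \<exists>f. f holomorphic_on (- {1})
      \<and> (\<forall>w. Re w > 1 \<longrightarrow> (\<lambda>n. 1 / of_nat (Suc n) powr w) sums f w) \<and> z = f s)"

text \<open>
  The values $\zeta(1-k)$ are rational, and are compared with elements of $\mathbf{Q}_p$ through $\mathbf{Q}$.
\<close>

definition kubota_leopoldt :: "'p :: prime_card iwasawa total_frac" where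
  "kubota_leopoldt = (THE \<Lambda>. pseudo_measure \<Lambda> \<and>
     (\<forall>k>0. \<exists>r :: rat. riemann_zeta (1 - of_nat k) = of_rat r \<and>
        pseudo_integral (\<lambda>x. x ^ k) \<Lambda> = (1 - of_nat CARD('p) ^ (k - 1)) * of_rat r))"


section \<open>Cyclotomic fields\<close>

text \<open>All extensions of $\mathbf{Q}_p$ are taken inside a fixed algebraic closure.\<close>

type_synonym 'p padic_closure = "'p padic alg_closure"

definition zp_embed :: "'p :: prime_card padic_int \<Rightarrow> 'p padic_closure" where
  "zp_embed x = to_ac (Fract x 1)"

definition zp_embed_fps :: "'p :: prime_card padic_int fps \<Rightarrow> 'p padic_closure fps" where
  "zp_embed_fps f = Abs_fps (\<lambda>n. zp_embed (f $ n))"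

definition integral_elements :: "'p :: prime_card padic_closure set" where
  "integral_elements = {x. \<exists>P. Polynomial.lead_coeff P = 1 \<and> poly (Polynomial.map_poly zp_embed P) x = 0}"

definition root_field :: "nat \<Rightarrow> 'p :: prime_card padic_closure set" where
  "root_field n = \<Inter>{F. range to_ac \<subseteq> F \<and> {z. z ^ (CARD('p) ^ n) = 1} \<subseteq> F \<and>
      (\<forall>x\<in>F. \<forall>y\<in>F. x - y \<in> F \<and> x * y \<in> F \<and> inverse x \<in> F)}"

definition root_field_units :: "nat \<Rightarrow> 'p :: prime_card padic_closure set" where
  "root_field_units n =
    {x \<in> root_field n. x \<noteq> 0 \<and> x \<in> integral_elements \<and> inverse x \<in> integral_elements}"

definition field_embeddings ::
    "'p :: prime_card padic_closure set \<Rightarrow> 'p padic_closure set \<Rightarrow> ('p padic_closure \<Rightarrow> 'p padic_closure) set" where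
  "field_embeddings K L = {\<sigma> \<in> extensional L. (\<forall>x\<in>K. \<sigma> x = x) \<and>
      (\<forall>x\<in>L. \<forall>y\<in>L. \<sigma> (x + y) = \<sigma> x + \<sigma> y \<and> \<sigma> (x * y) = \<sigma> x * \<sigma> y)}"

text \<open>The norm of the finite (separable) extension $L/K$.\<close>

definition field_norm ::
    "'p :: prime_card padic_closure set \<Rightarrow> 'p padic_closure set \<Rightarrow> 'p padic_closure \<Rightarrow> 'p padic_closure" where
  "field_norm K L x = (\<Prod>\<sigma>\<in>field_embeddings K L. \<sigma> x)"

text \<open>
  $\mathscr{U}_\infty$. Towers of elements are indexed by $n \ge 1$, so here and below the entry at
  index $0$ is irrelevant.
\<close>

definition norm_compatible_units :: "(nat \<Rightarrow> 'p :: prime_card padic_closure) set" where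
  "norm_compatible_units = {u. \<forall>n\<ge>1. u n \<in> root_field_units n \<and>
      field_norm (root_field n) (root_field (Suc n)) (u (Suc n)) = u n}"

definition compatible_primitive_roots :: "(nat \<Rightarrow> 'p :: prime_card padic_closure) \<Rightarrow> bool" where
  "compatible_primitive_roots \<xi> \<longleftrightarrow> (\<forall>n\<ge>1. \<xi> n ^ (CARD('p) ^ n) = 1 \<and>
      (\<forall>k. 0 < k \<and> k < CARD('p) ^ n \<longrightarrow> \<xi> n ^ k \<noteq> 1) \<and> \<xi> (Suc n) ^ CARD('p) = \<xi> n)"

definition cyclotomic_unit ::
    "(nat \<Rightarrow> 'p :: prime_card padic_closure) \<Rightarrow> int \<Rightarrow> nat \<Rightarrow> 'p padic_closure" where
  "cyclotomic_unit \<xi> a n = (\<xi> n powi a - 1) / (\<xi> n - 1)"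


section \<open>The Coleman map\<close>

text \<open>
  Limits for the $p$-adic topology. The ring \<^const>\<open>integral_elements\<close> is the valuation ring of the
  algebraic closure, so its multiples by $p^m$ are the basic neighbourhoods of $0$.
\<close>

definition padic_sums :: "(nat \<Rightarrow> 'p :: prime_card padic_closure) \<Rightarrow> 'p padic_closure \<Rightarrow> bool" where
  "padic_sums F s \<longleftrightarrow> (\<forall>m. \<forall>\<^sub>F n in sequentially.
      ((\<Sum>i<n. F i) - s) / of_nat CARD('p) ^ m \<in> integral_elements)"

definition padic_suminf :: "(nat \<Rightarrow> 'p :: prime_card padic_closure) \<Rightarrow> 'p padic_closure" where
  "padic_suminf F = (THE s. padic_sums F s)"

definition eval_fps_at :: "'p :: prime_card padic_int fps \<Rightarrow> 'p padic_closure \<Rightarrow> 'p padic_closure" where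
  "eval_fps_at f x = padic_suminf (\<lambda>i. zp_embed (f $ i) * x ^ i)"

text \<open>
  $f(\eta(1+T)-1)$. The constant term $\eta - 1$ is topologically nilpotent but not $0$, so each
  coefficient is a convergent $p$-adic series.
\<close>

definition twist :: "'p :: prime_card padic_int fps \<Rightarrow> 'p padic_closure \<Rightarrow> 'p padic_closure fps" where
  "twist f \<eta> = Abs_fps (\<lambda>j. padic_suminf
      (\<lambda>i. zp_embed (f $ i) * ((fps_const \<eta> * (1 + fps_X) - 1) ^ i) $ j))"

definition phi :: "'p :: prime_card padic_int fps \<Rightarrow> 'p padic_int fps" where
  "phi f = f oo ((1 + fps_X) ^ CARD('p) - 1)"

definition psi :: "'p :: prime_card padic_int fps \<Rightarrow> 'p padic_int fps" where
  "psi f = (THE g. zp_embed_fps (phi g) =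
      fps_const (1 / of_nat CARD('p)) * (\<Sum>\<eta> | \<eta> ^ CARD('p) = 1. twist f \<eta>))"

definition norm_op :: "'p :: prime_card padic_int fps \<Rightarrow> 'p padic_int fps" where
  "norm_op f = (THE g. zp_embed_fps (phi g) = (\<Prod>\<eta> | \<eta> ^ CARD('p) = 1. twist f \<eta>))"

definition del :: "'p :: prime_card padic_int fps \<Rightarrow> 'p padic_int fps" where
  "del f = (1 + fps_X) * fps_deriv f"

definition del_log :: "'p :: prime_card padic_int fps \<Rightarrow> 'p padic_int fps" where
  "del_log f = (THE g. g * f = del f)"

text \<open>The function $x \mapsto \binom{x}{k}$ on $\mathbf{Z}_p$, the coefficient of $T^k$ in $(1+T)^x$.\<close>

definition padic_binomial :: "'p :: prime_card padic_int \<Rightarrow> nat \<Rightarrow> 'p padic_int" where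
  "padic_binomial x k = (THE y. of_nat (fact k) * y = (\<Prod>i<k. x - of_nat i))"

definition mahler :: "'p :: prime_card iwasawa \<Rightarrow> 'p padic_int fps" where
  "mahler \<mu> = Abs_fps (\<lambda>k. measure_integral (\<lambda>x. padic_binomial x k) \<mu>)"

definition coleman_series :: "(nat \<Rightarrow> 'p :: prime_card padic_closure) \<Rightarrow>
    (nat \<Rightarrow> 'p padic_closure) \<Rightarrow> 'p padic_int fps" where
  "coleman_series \<xi> u =
    (THE f. f dvd 1 \<and> norm_op f = f \<and> (\<forall>n\<ge>1. eval_fps_at f (\<xi> n - 1) = u n))"

text \<open>
  Sign: $\partial\log f_{c(a)} = a - 1 - F_a$, where $F_a = \frac{1}{T} - \frac{a}{(1+T)^a - 1}$ is
  the series classically used to construct $\zeta_p$. Hence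
  $\int x^k \cdot \mathrm{Col}(c(a)) = -(a^k - 1)(1 - p^{k-1})\zeta(1-k)$ for all $k > 0$, and
  $\zeta_p = -\mathrm{Col}(c(a))/\theta_a$. For instance, if $p = 3$, $a = 2$, $k = 2$, then
  $f_{c(a)} = T + 2$ and $\int x^2 \cdot \mathrm{Col}(c(a)) = \frac{1-p}{4}$, while
  $(a^2 - 1)(1 - p)\zeta(-1) = -\frac{1-p}{4}$.
\<close>

definition Col :: "(nat \<Rightarrow> 'p :: prime_card padic_closure) \<Rightarrow>
    (nat \<Rightarrow> 'p padic_closure) \<Rightarrow> 'p iwasawa" where
  "Col \<xi> = (\<lambda>u\<in>norm_compatible_units.
     let h = del_log (coleman_series \<xi> u)
     in the_inv_into UNIV mahler (the_inv_into {g. psi g = 0} del (h - phi (psi h))))"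

end

theory Submission
  imports
    Defs
    "HOL-Number_Theory.Cong"
    "HOL-Complex_Analysis.Complex_Analysis"
    "Jordan_Normal_Form.Char_Poly"
begin

text \<open>The measure $E_g$ giving $b + p^n\mathbf{Z}_p$ the mass
  $g B_1(\{g^{-1}b/p^n\}) - B_1(\{b/p^n\})$ satisfies
  $\int x^{k-1} \cdot E_g = (g^k - 1)(1 - p^{k-1}) B_k/k$, so these are the $k$-th moments of
  $\mu_g = x^{-1} E_g$. On the other side, the Coleman series of $c(a)$ is $((1+T)^a - 1)/T$. Its
  logarithmic derivative is fixed by $\psi$, and the substitution $T = e^t - 1$ turns it into the
  generating series of $(a^k - 1) B_k/k$. Hence $\mathrm{Col}(c(a))$ has the moments of $\mu_a$.

  A measure on $\mathbf{Z}_p^\times$ is determined by its moments of positive order. This gives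
  $\mathrm{Col}(c(a)) = \mu_a$ and $\theta_a \mu_g = \theta_g \mu_a$, so that $\mu_a/\theta_a$ is a
  pseudo-measure, and it also gives the uniqueness of $\zeta_p$. The sign comes from
  $\zeta(1 - k) = -B_k/k$ for $k \ge 2$, together with the vanishing of the factor $1 - p^{k-1}$ at
  $k = 1$.\<close>

section \<open>Divisibility and completeness in the p-adic integers\<close>

text \<open>The objects to be compared are given by definite descriptions and inverse maps, so each
  value is obtained from an explicit candidate together with uniqueness for the given input. The
  candidates are rational functions of 1 + T. Twists, \<open>phi\<close> and the substitution of e^t
  - 1 act on 1 + T in a transparent way, so the identities are proved in a field of Laurent series
  or after clearing denominators.

  The analytic obstacle is that the algebraic closure of Q_p is not complete. Its topology is that
  of divisibility by p^m among integral elements, and a power series can be evaluated at \<xi>_n - 1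
  because the terms stay in the finitely generated Z_p-module spanned by the powers of \<xi>_n.
  Uniqueness of the Coleman series rests on ramification: p is a multiple of (\<xi>_n - 1)^phi(p^n),
  so a series whose first unit coefficient lies below that degree cannot vanish at \<xi>_n - 1.

  Moments determine a measure \<nu> because those of positive order are the values at T = 0 of the
  iterates of \<open>del\<close> on the Mahler transform of x\<nu>, and because Fourier inversion on
  Z/p^n makes the Mahler transform injective.\<close>

abbreviation pp :: "'p :: prime_card padic_int" where
  "pp \<equiv> of_nat CARD('p)"

lemma prime_CARD_int: "Factorial_Ring.prime (int CARD('p :: prime_card))"
  by (simp add: prime_card)

lemma CARD_gt_1: "1 < CARD('p :: prime_card)"
  by (rule prime_gt_1_nat[OF prime_card])

lemma padic_int_eqI:
  "(\<And>n. padic_residue x n = padic_residue y n) \<Longrightarrow> x = (y :: 'p :: prime_card padic_int)"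
  by (metis ext padic_residue_inject)

lemma residue_1: "padic_residue (1 :: 'p :: prime_card padic_int) n = 1 mod int CARD('p) ^ n"
  by transfer simp

lemma residue_diff:
  "padic_residue (x - y :: 'p :: prime_card padic_int) n
    = (padic_residue x n - padic_residue y n) mod int CARD('p) ^ n"
  by transfer simp

lemma residue_uminus:
  "padic_residue (- x :: 'p :: prime_card padic_int) n = (- padic_residue x n) mod int CARD('p) ^ n"
  by transfer simp

lemma residue_of_int:
  "padic_residue (of_int a :: 'p :: prime_card padic_int) n = a mod int CARD('p) ^ n"
proof (cases "a \<ge> 0")
  case True
  then obtain m where "a = int m" using nonneg_int_cases by blast
  thus ?thesis by (simp add: residue_of_nat)
next
  case False
  then obtain m where "a = - int m" by (metis linear minus_minus neg_0_le_iff_le nonneg_int_cases)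
  thus ?thesis by (simp add: residue_uminus residue_of_nat mod_minus_eq)
qed

lemma residue_0_level [simp]: "padic_residue (x :: 'p :: prime_card padic_int) 0 = 0"
  using residue_bounds[of x 0] by (simp del: residue_bounds)

lemma residue_eq_iff_diff:
  "padic_residue x n = padic_residue y n \<longleftrightarrow> padic_residue (x - y :: 'p :: prime_card padic_int) n = 0"
proof -
  have "padic_residue x n = padic_residue y n \<longleftrightarrow>
      padic_residue x n mod int CARD('p) ^ n = padic_residue y n mod int CARD('p) ^ n" by simp
  thus ?thesis unfolding residue_diff mod_eq_dvd_iff by (simp only: dvd_eq_mod_eq_0)
qed

text \<open>The quotient by p^n is an index shift: once the residue at level n vanishes, the residue
  at level n + k is p^n times a number below p^k, and these numbers form a compatible
  family.\<close>

lemma pp_power_dvd_iff: "pp ^ n dvd x \<longleftrightarrow> padic_residue (x :: 'p :: prime_card padic_int) n = 0"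
proof
  assume "pp ^ n dvd x"
  then obtain y where "x = of_nat (CARD('p) ^ n) * y" by (auto simp: dvd_def)
  thus "padic_residue x n = 0" by (simp only: residue_mult residue_of_nat) simp
next
  let ?q = "int CARD('p)"
  assume 0: "padic_residue x n = 0"
  define y where "y = (\<lambda>k. padic_residue x (n + k) div ?q ^ n)"
  have y: "padic_residue x (n + k) = ?q ^ n * y k" for k
  proof -
    have "padic_residue x (n + k) mod ?q ^ n = 0" using residue_mod_le[of n "n + k" x] 0 by simp
    thus ?thesis by (simp add: y_def mod_eq_0_iff_dvd)
  qed
  have q: "?q ^ n > 0" by simp
  have b: "0 \<le> y k \<and> y k < ?q ^ k" for k
  proof -
    have "0 \<le> ?q ^ n * y k" "?q ^ n * y k < ?q ^ n * ?q ^ k"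
      using residue_bounds[of x "n + k"] by (simp_all add: y power_add)
    thus ?thesis using q by (simp add: zero_le_mult_iff)
  qed
  have c: "y (Suc k) mod ?q ^ k = y k" for k
  proof -
    have "?q ^ n * (y (Suc k) mod ?q ^ k) = (?q ^ n * y (Suc k)) mod (?q ^ n * ?q ^ k)"
      by (rule mult_mod_right)
    also have "\<dots> = padic_residue x (n + Suc k) mod ?q ^ (n + k)"
      by (simp only: y power_add)
    also have "\<dots> = ?q ^ n * y k" using residue_mod_le[of "n + k" "n + Suc k" x] y[of k] by simp
    finally show ?thesis using q by simp
  qed
  define z :: "'p padic_int" where "z = Abs_padic_int y"
  have z: "padic_residue z k = y k" for k
    unfolding z_def by (subst Abs_padic_int_inverse) (use b c in auto)
  have "x = of_nat (CARD('p) ^ n) * z"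
  proof (rule padic_int_eqI)
    fix k
    have "padic_residue (of_nat (CARD('p) ^ n) * z) k = (?q ^ n mod ?q ^ k * y k) mod ?q ^ k"
      unfolding residue_mult z residue_of_nat by simp
    also have "\<dots> = (?q ^ n * y k) mod ?q ^ k" by (simp add: mod_mult_left_eq)
    also have "\<dots> = padic_residue x k"
      using residue_mod_le[of k "n + k" x] by (simp add: y)
    finally show "padic_residue x k = padic_residue (of_nat (CARD('p) ^ n) * z) k" by simp
  qed
  thus "pp ^ n dvd x" by simp
qed

lemma residue_eq_iff_dvd:
  "padic_residue x n = padic_residue y n \<longleftrightarrow> pp ^ n dvd (x - y :: 'p :: prime_card padic_int)"
  by (simp add: residue_eq_iff_diff pp_power_dvd_iff)

lemma pp_power_dvd_residue: "pp ^ n dvd x - of_int (padic_residue (x :: 'p :: prime_card padic_int) n)"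
  by (simp flip: residue_eq_iff_dvd add: residue_of_int)

lemma pp_power_dvd_of_int:
  "(pp :: 'p :: prime_card padic_int) ^ n dvd of_int a \<longleftrightarrow> int CARD('p) ^ n dvd a"
  by (simp add: pp_power_dvd_iff residue_of_int dvd_eq_mod_eq_0)

lemma pp_power_separated:
  assumes "\<And>m. pp ^ m dvd (x :: 'p :: prime_card padic_int)"
  shows "x = 0"
  by (rule padic_int_eqI) (use assms pp_power_dvd_iff in auto)

lemma pp_not_unit: "\<not> (pp :: 'p :: prime_card padic_int) dvd 1"
proof
  assume "(pp :: 'p padic_int) dvd 1"
  hence "padic_residue (1 :: 'p padic_int) 1 = 0"
    using pp_power_dvd_iff[of 1 "1 :: 'p padic_int"] by (simp only: power_one_right)
  thus False using CARD_gt_1[where 'p = 'p] by (simp add: residue_1)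
qed

text \<open>Z_p is local. Bezout inverts each residue prime to p, and the inverses are compatible
  because an inverse modulo p^n is unique.\<close>

lemma padic_unit_iff: "x dvd 1 \<longleftrightarrow> \<not> pp dvd (x :: 'p :: prime_card padic_int)"
proof
  assume "x dvd 1"
  thus "\<not> pp dvd x" using pp_not_unit dvd_trans by blast
next
  let ?q = "int CARD('p)"
  assume *: "\<not> pp dvd x"
  hence 1: "padic_residue x 1 \<noteq> 0" using pp_power_dvd_iff[of 1 x] by simp
  have cop: "coprime (padic_residue x n) (?q ^ n)" for n
  proof (cases n)
    case (Suc m)
    have "padic_residue x n mod ?q = padic_residue x 1"
      using residue_mod_le[of 1 n x] Suc by simp
    hence "\<not> ?q dvd padic_residue x n" using 1 by auto
    hence "coprime ?q (padic_residue x n)" using prime_CARD_int[where 'p = 'p] prime_imp_coprime by blast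
    thus ?thesis by (simp add: coprime_commute)
  qed simp
  define y where "y = (\<lambda>n. fst (bezout_coefficients (padic_residue x n) (?q ^ n)) mod ?q ^ n)"
  have y: "(padic_residue x n * y n) mod ?q ^ n = 1 mod ?q ^ n" for n
  proof -
    have "fst (bezout_coefficients (padic_residue x n) (?q ^ n)) * padic_residue x n
        + snd (bezout_coefficients (padic_residue x n) (?q ^ n)) * ?q ^ n = 1"
      using bezout_coefficients_fst_snd[of "padic_residue x n" "?q ^ n"] cop[of n] by simp
    hence "(fst (bezout_coefficients (padic_residue x n) (?q ^ n)) * padic_residue x n) mod ?q ^ n = 1 mod ?q ^ n"
      by (metis mod_mult_self1 add.commute)
    thus ?thesis by (simp add: y_def mod_mult_right_eq mult.commute)
  qed
  have b: "0 \<le> y n \<and> y n < ?q ^ n" for n by (simp add: y_def)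
  have c: "y (Suc n) mod ?q ^ n = y n" for n
  proof -
    have "(padic_residue x n * y (Suc n)) mod ?q ^ n
        = ((padic_residue x (Suc n) mod ?q ^ n) * y (Suc n)) mod ?q ^ n" by (simp only: residue_Suc_mod)
    also have "\<dots> = ((padic_residue x (Suc n) * y (Suc n)) mod ?q ^ Suc n) mod ?q ^ n"
      unfolding mod_Suc_power_mod by (rule mod_mult_left_eq)
    also have "\<dots> = (padic_residue x n * y n) mod ?q ^ n" unfolding y by simp
    finally have "?q ^ n dvd padic_residue x n * (y (Suc n) - y n)"
      by (simp add: mod_eq_dvd_iff right_diff_distrib)
    hence "?q ^ n dvd y (Suc n) - y n"
      using cop[of n] by (metis coprime_commute coprime_dvd_mult_right_iff)
    hence "y (Suc n) mod ?q ^ n = y n mod ?q ^ n" by (simp add: mod_eq_dvd_iff)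
    thus ?thesis using b[of n] by simp
  qed
  define z :: "'p padic_int" where "z = Abs_padic_int y"
  have z: "padic_residue z k = y k" for k
    unfolding z_def by (subst Abs_padic_int_inverse) (use b c in auto)
  have "1 = x * z" by (rule padic_int_eqI) (simp add: residue_mult z y residue_1)
  thus "x dvd 1" by (rule dvdI)
qed

lemma of_int_unit_iff:
  "(of_int a :: 'p :: prime_card padic_int) dvd 1 \<longleftrightarrow> \<not> int CARD('p) dvd a"
  using pp_power_dvd_of_int[where n = 1 and a = a and 'p = 'p] by (simp add: padic_unit_iff)

lemma padic_factor:
  assumes "(x :: 'p :: prime_card padic_int) \<noteq> 0"
  obtains k u where "x = pp ^ k * u" "u dvd 1"
proof -
  obtain m where m: "\<not> pp ^ m dvd x" using assms pp_power_separated by blast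
  define k where "k = (LEAST m. \<not> pp ^ Suc m dvd x)"
  have "\<not> pp ^ Suc m dvd x" using m by (metis dvd_trans le_imp_power_dvd lessI less_imp_le_nat)
  hence k: "\<not> pp ^ Suc k dvd x" unfolding k_def by (rule LeastI)
  have "pp ^ k dvd x"
  proof (cases k)
    case (Suc j)
    thus ?thesis using not_less_Least[of j "\<lambda>m. \<not> pp ^ Suc m dvd x"] by (simp add: k_def)
  qed simp
  then obtain u where u: "x = pp ^ k * u" by (auto simp: dvd_def)
  have "\<not> pp dvd u"
  proof
    assume "pp dvd u"
    hence "pp ^ k * pp dvd x" unfolding u by (rule mult_dvd_mono[OF dvd_refl])
    thus False using k by (simp add: mult.commute)
  qed
  thus ?thesis using that u by (simp add: padic_unit_iff)
qed

text \<open>Cancelling k costs a fixed number v of powers of p, its valuation, whatever x and n are.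
  This uniform loss is what makes the functions x choose k uniformly continuous.\<close>

lemma pp_power_dvd_cancel_nat:
  assumes "(k :: nat) > 0"
  obtains v where "\<And>n (x :: 'p :: prime_card padic_int). pp ^ (n + v) dvd of_nat k * x \<Longrightarrow> pp ^ n dvd x"
proof -
  have "(of_nat k :: 'p padic_int) \<noteq> 0" using assms by simp
  then obtain v u where *: "(of_nat k :: 'p padic_int) = pp ^ v * u" "u dvd 1" by (rule padic_factor)
  show ?thesis
  proof (rule that[of v])
    fix n and x :: "'p padic_int"
    assume "pp ^ (n + v) dvd of_nat k * x"
    hence "pp ^ v * pp ^ n dvd pp ^ v * (u * x)" by (simp add: * power_add mult_ac)
    hence "pp ^ n dvd u * x" by (subst (asm) dvd_mult_cancel_left) auto
    then obtain c where c: "u * x = pp ^ n * c" by (auto simp: dvd_def)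
    obtain w where "1 = u * w" using *(2) by (auto simp: dvd_def)
    hence "x = w * (u * x)" by (metis mult.assoc mult.commute mult_1)
    hence "x = pp ^ n * (w * c)" using c by (simp add: mult_ac)
    thus "pp ^ n dvd x" by simp
  qed
qed

section \<open>Convergence and completeness in Z_p\<close>

lemma padic_tendsto_iff:
  "(s \<longlongrightarrow> l) F \<longleftrightarrow> (\<forall>m. \<forall>\<^sub>F n in F. pp ^ m dvd s n - (l :: 'p :: prime_card padic_int))"
proof
  assume *: "(s \<longlongrightarrow> l) F"
  show "\<forall>m. \<forall>\<^sub>F n in F. pp ^ m dvd s n - l"
  proof
    fix m
    let ?B = "{z. padic_residue z m = padic_residue l m}"
    have "open ?B" by (auto simp: open_padic_int_def intro!: exI[of _ m])
    moreover have "l \<in> ?B" by simp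
    ultimately have "\<forall>\<^sub>F n in F. s n \<in> ?B" by (rule topological_tendstoD[OF *])
    thus "\<forall>\<^sub>F n in F. pp ^ m dvd s n - l" by (simp add: residue_eq_iff_dvd)
  qed
next
  assume *: "\<forall>m. \<forall>\<^sub>F n in F. pp ^ m dvd s n - l"
  show "(s \<longlongrightarrow> l) F"
  proof (rule topological_tendstoI)
    fix S assume "open S" "l \<in> S"
    then obtain m where m: "\<And>y. padic_residue y m = padic_residue l m \<Longrightarrow> y \<in> S"
      by (auto simp: open_padic_int_def)
    show "\<forall>\<^sub>F n in F. s n \<in> S"
      using *[rule_format, of m] by (rule eventually_mono) (simp add: m residue_eq_iff_dvd)
  qed
qed

text \<open>In an ultrametric setting it suffices that consecutive differences tend to 0. The limit
  is assembled from the residues at which the sequence stabilises.\<close>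

lemma padic_cauchy_convergent:
  fixes s :: "nat \<Rightarrow> 'p :: prime_card padic_int"
  assumes "\<And>m. \<exists>N. \<forall>n\<ge>N. pp ^ m dvd s (Suc n) - s n"
  shows "\<exists>l. s \<longlonglongrightarrow> l"
proof -
  obtain N0 where N0: "\<And>m n. n \<ge> N0 m \<Longrightarrow> pp ^ m dvd s (Suc n) - s n" using assms by metis
  \<comment> \<open>Partial sums of \<open>N0\<close> give thresholds that increase with
    \<open>m\<close>, so that the residues at different levels are compatible.\<close>
  define N where "N = (\<lambda>m. \<Sum>i\<le>m. N0 i)"
  have NN0: "N m \<ge> N0 m" for m by (simp add: N_def member_le_sum)
  have N_Suc: "N m \<le> N (Suc m)" for m by (simp add: N_def)
  have far: "pp ^ m dvd s n - s (N m)" if "n \<ge> N m" for m n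
    using that
  proof (induction n rule: dec_induct)
    case (step k)
    have "pp ^ m dvd (s (Suc k) - s k) + (s k - s (N m))"
      by (rule dvd_add[OF N0 step.IH]) (use NN0[of m] step in linarith)
    thus ?case by simp
  qed simp
  define y where "y = (\<lambda>m. padic_residue (s (N m)) m)"
  have "y (Suc m) mod int CARD('p) ^ m = y m" for m
  proof -
    have "y (Suc m) mod int CARD('p) ^ m = padic_residue (s (N (Suc m))) m" by (simp add: y_def)
    also have "\<dots> = y m" unfolding y_def residue_eq_iff_dvd by (rule far[OF N_Suc])
    finally show ?thesis .
  qed
  hence z: "padic_residue (Abs_padic_int y :: 'p padic_int) k = y k" for k
    by (subst Abs_padic_int_inverse) (auto simp: y_def)
  have "pp ^ m dvd s n - Abs_padic_int y" if "n \<ge> N m" for m n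
  proof -
    have "pp ^ m dvd (s n - s (N m)) + (s (N m) - Abs_padic_int y)"
      by (rule dvd_add[OF far[OF that]]) (unfold residue_eq_iff_dvd[symmetric] z, simp add: y_def)
    thus ?thesis by simp
  qed
  hence "s \<longlonglongrightarrow> Abs_padic_int y"
    unfolding padic_tendsto_iff eventually_sequentially by blast
  thus ?thesis by blast
qed

section \<open>The embedding of Z_p into the algebraic closure, and denominators in Q_p\<close>

lemma zp_embed_0 [simp]: "zp_embed 0 = 0"
  and zp_embed_1 [simp]: "zp_embed 1 = 1"
  and zp_embed_add [simp]: "zp_embed (x + y) = zp_embed x + zp_embed y"
  and zp_embed_diff [simp]: "zp_embed (x - y) = zp_embed x - zp_embed y"
  and zp_embed_uminus [simp]: "zp_embed (- x) = - zp_embed x"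
  and zp_embed_mult [simp]: "zp_embed (x * y) = zp_embed x * zp_embed y"
  by (simp_all add: zp_embed_def Zero_fract_def[symmetric] One_fract_def[symmetric]
      flip: to_ac_add to_ac_diff to_ac_mult to_ac_minus)

lemma zp_embed_of_nat [simp]: "zp_embed (of_nat n) = of_nat n"
  by (induction n) simp_all

lemma zp_embed_of_int [simp]: "zp_embed (of_int n) = of_int n"
  by (cases n) simp_all

lemma zp_embed_power [simp]: "zp_embed (x ^ n) = zp_embed x ^ n"
  by (induction n) simp_all

lemma zp_embed_sum: "zp_embed (sum f A) = (\<Sum>x\<in>A. zp_embed (f x))"
  by (induction A rule: infinite_finite_induct) simp_all

lemma zp_embed_eq_iff [simp]: "zp_embed x = zp_embed y \<longleftrightarrow> x = y"
  by (simp add: zp_embed_def eq_fract)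

lemma zp_embed_eq_0_iff [simp]: "zp_embed x = 0 \<longleftrightarrow> x = 0"
  using zp_embed_eq_iff[of x 0] by (simp del: zp_embed_eq_iff)

text \<open>Q_p = Z_p[1/p], because a nonzero element of Z_p is a power of p times a unit.\<close>

lemma padic_denominator:
  fixes q :: "'p :: prime_card padic"
  obtains k c where "q * of_nat CARD('p) ^ k = Fract c 1"
proof (cases q)
  case (Fract a b)
  then obtain k u where b: "b = pp ^ k * u" "u dvd 1" by (metis padic_factor)
  then obtain w where w: "1 = u * w" by (auto simp: dvd_def)
  have "u \<noteq> 0" using w by auto
  have "(of_nat CARD('p) ^ k :: 'p padic) = Fract (pp ^ k) 1"
    using of_nat_fract[of "CARD('p) ^ k"] by (simp only: of_nat_power)
  hence "q * of_nat CARD('p) ^ k = Fract (a * pp ^ k) b"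
    unfolding Fract by simp
  also have "\<dots> = Fract (a * w) 1"
  proof -
    have "a * pp ^ k * 1 = a * w * b"
      unfolding b(1) by (subst w) (simp only: mult_ac)
    thus ?thesis using Fract(2) by (simp add: eq_fract)
  qed
  finally show ?thesis by (rule that)
qed

section \<open>Integral elements of the algebraic closure\<close>

text \<open>These Z_p-modules serve twice. A finitely generated one that is stable under
  multiplication by z shows that z is integral, and a series with terms in such a module can be
  summed coefficientwise over Z_p.\<close>

definition zp_span :: "'i set \<Rightarrow> ('i \<Rightarrow> 'p :: prime_card padic_closure) \<Rightarrow> 'p padic_closure set" where
  "zp_span I v = {x. \<exists>c. x = (\<Sum>i\<in>I. zp_embed (c i) * v i)}"

lemma zp_spanI: "x = (\<Sum>i\<in>I. zp_embed (c i) * v i) \<Longrightarrow> x \<in> zp_span I v"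
  unfolding zp_span_def by (rule CollectI, rule exI)

lemma zp_spanE:
  assumes "x \<in> zp_span I v"
  obtains c where "x = (\<Sum>i\<in>I. zp_embed (c i) * v i)"
  using assms unfolding zp_span_def by blast

lemma zp_span_base:
  assumes "finite I" "i \<in> I"
  shows "v i \<in> zp_span I v"
proof -
  have "v i = (\<Sum>j\<in>I. if j = i then v i else 0)" using assms by simp
  also have "\<dots> = (\<Sum>j\<in>I. zp_embed (if j = i then 1 else 0) * v j)"
    by (intro sum.cong) auto
  finally show ?thesis by (rule zp_spanI)
qed

lemma zp_span_0 [simp]: "0 \<in> zp_span I v"
  by (rule zp_spanI[where c = "\<lambda>_. 0"]) simp

lemma zp_span_add: "x \<in> zp_span I v \<Longrightarrow> y \<in> zp_span I v \<Longrightarrow> x + y \<in> zp_span I v"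
proof (elim zp_spanE)
  fix c d
  assume "x = (\<Sum>i\<in>I. zp_embed (c i) * v i)" "y = (\<Sum>i\<in>I. zp_embed (d i) * v i)"
  hence "x + y = (\<Sum>i\<in>I. zp_embed (c i + d i) * v i)" by (simp add: sum.distrib distrib_right)
  thus ?thesis by (rule zp_spanI)
qed

lemma zp_span_scale: "x \<in> zp_span I v \<Longrightarrow> zp_embed a * x \<in> zp_span I v"
proof (elim zp_spanE)
  fix c
  assume "x = (\<Sum>i\<in>I. zp_embed (c i) * v i)"
  hence "zp_embed a * x = (\<Sum>i\<in>I. zp_embed (a * c i) * v i)" by (simp add: sum_distrib_left mult_ac)
  thus ?thesis by (rule zp_spanI)
qed

lemma zp_span_uminus: "x \<in> zp_span I v \<Longrightarrow> - x \<in> zp_span I v"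
  using zp_span_scale[of x I v "- 1"] by simp

lemma zp_span_sum: "(\<And>k. k \<in> K \<Longrightarrow> f k \<in> zp_span I v) \<Longrightarrow> sum f K \<in> zp_span I v"
  by (induction K rule: infinite_finite_induct) (auto intro: zp_span_add)

lemma zp_span_mult_closed:
  assumes "\<And>i. i \<in> I \<Longrightarrow> z * v i \<in> zp_span I v" "x \<in> zp_span I v"
  shows "z * x \<in> zp_span I v"
proof -
  obtain c where x: "x = (\<Sum>i\<in>I. zp_embed (c i) * v i)" using assms(2) by (rule zp_spanE)
  have "z * x = (\<Sum>i\<in>I. zp_embed (c i) * (z * v i))" by (simp add: x sum_distrib_left mult_ac)
  also have "\<dots> \<in> zp_span I v" by (intro zp_span_sum zp_span_scale assms)
  finally show ?thesis .
qed

interpretation zp_embed_hom: comm_ring_hom "zp_embed :: 'p :: prime_card padic_int \<Rightarrow> 'p padic_closure"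
  by unfold_locales simp_all

text \<open>The determinant trick: such a \<open>z\<close> is an eigenvalue of a matrix over $\mathbf{Z}_p$.\<close>

lemma integral_if_zp_span:
  fixes z :: "'p :: prime_card padic_closure"
  assumes fin: "finite I" and span: "\<And>i. i \<in> I \<Longrightarrow> z * v i \<in> zp_span I v"
    and k: "k \<in> I" "v k \<noteq> 0"
  shows "z \<in> integral_elements"
proof -
  obtain A where A: "\<And>i. i \<in> I \<Longrightarrow> z * v i = (\<Sum>j\<in>I. zp_embed (A i j) * v j)"
  proof -
    have "\<forall>i\<in>I. \<exists>c. z * v i = (\<Sum>j\<in>I. zp_embed (c j) * v j)"
      using zp_spanE[OF span] by blast
    from bchoice[OF this] show ?thesis using that by blast
  qed
  define n where "n = card I"
  obtain h where h: "bij_betw h {0..<n} I" unfolding n_def using ex_bij_betw_nat_finite[OF fin] by blast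
  define M :: "'p padic_int mat" where "M = mat n n (\<lambda>(i, j). A (h i) (h j))"
  define Mz where "Mz = map_mat zp_embed M"
  define w where "w = Matrix.vec n (\<lambda>i. v (h i))"
  have M: "M \<in> carrier_mat n n" and Mz: "Mz \<in> carrier_mat n n" by (simp_all add: M_def Mz_def)
  have "Mz *\<^sub>v w = z \<cdot>\<^sub>v w"
  proof (rule eq_vecI)
    fix i assume "i < dim_vec (z \<cdot>\<^sub>v w)"
    hence i: "i < n" by (simp add: w_def)
    hence hi: "h i \<in> I" using bij_betwE[OF h] by auto
    have "vec_index (Mz *\<^sub>v w) i = (\<Sum>j\<in>{0..<n}. zp_embed (A (h i) (h j)) * v (h j))"
      using i by (simp add: Mz_def M_def w_def scalar_prod_def)
    also have "\<dots> = (\<Sum>j\<in>I. zp_embed (A (h i) j) * v j)"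
      by (rule sum.reindex_bij_betw[OF h])
    also have "\<dots> = vec_index (z \<cdot>\<^sub>v w) i" using i A[OF hi] by (simp add: w_def)
    finally show "vec_index (Mz *\<^sub>v w) i = vec_index (z \<cdot>\<^sub>v w) i" .
  qed (simp add: Mz_def M_def w_def)
  moreover have "w \<noteq> 0\<^sub>v n"
  proof
    assume 0: "w = 0\<^sub>v n"
    obtain i where i: "i < n" "h i = k" using h k(1) by (auto simp: bij_betw_def)
    have "vec_index w i = 0" using i by (simp add: 0)
    thus False using i k by (simp add: w_def)
  qed
  ultimately have "eigenvalue Mz z"
    unfolding eigenvalue_def eigenvector_def using Mz by (auto simp: w_def intro!: exI[of _ w])
  hence "poly (char_poly Mz) z = 0" using eigenvalue_root_char_poly[OF Mz] by simp
  hence "poly (map_poly zp_embed (char_poly M)) z = 0"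
    unfolding Mz_def using zp_embed_hom.char_poly_hom[OF M] by simp
  moreover have "Polynomial.lead_coeff (char_poly M) = 1" using degree_monic_char_poly[OF M] by simp
  ultimately show ?thesis unfolding integral_elements_def by blast
qed

lemma poly_map_zp_embed:
  "poly (map_poly zp_embed P) x = (\<Sum>i\<le>Polynomial.degree P. zp_embed (Polynomial.coeff P i) * x ^ i)"
proof -
  have "Polynomial.degree (map_poly zp_embed P) = Polynomial.degree P"
    by (rule degree_map_poly) simp
  thus ?thesis by (simp add: poly_altdef coeff_map_poly)
qed

lemma integral_elementsE:
  assumes "x \<in> integral_elements"
  obtains d :: nat and c where "d > 0" "x ^ d = (\<Sum>i<d. zp_embed (c i) * x ^ i)"
proof -
  obtain P where P: "Polynomial.lead_coeff P = 1" "poly (map_poly zp_embed P) x = 0"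
    using assms by (auto simp: integral_elements_def)
  let ?d = "Polynomial.degree P"
  have 0: "(\<Sum>i<?d. zp_embed (Polynomial.coeff P i) * x ^ i) + x ^ ?d = 0"
    using P by (simp add: poly_map_zp_embed lessThan_Suc_atMost[symmetric])
  have "?d > 0"
  proof (rule ccontr)
    assume "\<not> ?d > 0"
    thus False using 0 by simp
  qed
  moreover have "x ^ ?d = (\<Sum>i<?d. zp_embed (- Polynomial.coeff P i) * x ^ i)"
    using 0 by (simp add: sum_negf eq_neg_iff_add_eq_0 add.commute)
  ultimately show ?thesis by (rule that)
qed

text \<open>The monomials x^i y^j with i < m and j < n span a module that is stable under x and y,
  the monic equations rewriting x^m and y^n. Hence it is stable under x + y and xy, and the
  determinant trick applies.\<close>

lemma integral_binary:
  fixes x y :: "'p :: prime_card padic_closure"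
  assumes "x \<in> integral_elements" "y \<in> integral_elements"
  shows "x + y \<in> integral_elements" "x * y \<in> integral_elements"
proof -
  obtain m c where m: "m > 0" "x ^ m = (\<Sum>i<m. zp_embed (c i) * x ^ i)"
    using assms(1) by (rule integral_elementsE)
  obtain n d where n: "n > 0" "y ^ n = (\<Sum>i<n. zp_embed (d i) * y ^ i)"
    using assms(2) by (rule integral_elementsE)
  define I where "I = {..<m} \<times> {..<n}"
  define v where "v = (\<lambda>(i, j). x ^ i * y ^ j)"
  let ?S = "zp_span I v"
  have fin: "finite I" by (simp add: I_def)
  have base: "x ^ i * y ^ j \<in> ?S" if "i < m" "j < n" for i j
    using zp_span_base[OF fin, of "(i, j)" v] that by (simp add: I_def v_def)
  have X: "x * v k \<in> ?S" if kI: "k \<in> I" for k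
  proof -
    obtain i j where k: "k = (i, j)" "i < m" "j < n" using kI unfolding I_def by blast
    show ?thesis
    proof (cases "Suc i < m")
      case True
      thus ?thesis using base[of "Suc i" j] k by (simp add: v_def mult_ac)
    next
      case False
      hence "Suc i = m" using k by simp
      hence "x * v k = x ^ m * y ^ j" using k by (auto simp: v_def mult_ac)
      also have "\<dots> = (\<Sum>i<m. zp_embed (c i) * (x ^ i * y ^ j))"
        by (simp only: m(2) sum_distrib_right mult.assoc)
      also have "\<dots> \<in> ?S" using k by (intro zp_span_sum zp_span_scale base) auto
      finally show ?thesis .
    qed
  qed
  have Y: "y * v k \<in> ?S" if kI: "k \<in> I" for k
  proof -
    obtain i j where k: "k = (i, j)" "i < m" "j < n" using kI unfolding I_def by blast
    show ?thesis
    proof (cases "Suc j < n")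
      case True
      thus ?thesis using base[of i "Suc j"] k by (simp add: v_def mult_ac)
    next
      case False
      hence "Suc j = n" using k by simp
      hence "y * v k = x ^ i * y ^ n" using k by (auto simp: v_def mult_ac)
      also have "\<dots> = (\<Sum>j<n. zp_embed (d j) * (x ^ i * y ^ j))"
        by (simp only: n(2) sum_distrib_left mult.left_commute)
      also have "\<dots> \<in> ?S" using k by (intro zp_span_sum zp_span_scale base) auto
      finally show ?thesis .
    qed
  qed
  have 00: "(0, 0) \<in> I" "v (0, 0) \<noteq> 0" using m n by (auto simp: I_def v_def)
  show "x + y \<in> integral_elements"
    by (rule integral_if_zp_span[where v = v and k = "(0, 0)", OF fin _ 00]) (simp add: distrib_right zp_span_add X Y)
  show "x * y \<in> integral_elements"
    by (rule integral_if_zp_span[where v = v and k = "(0, 0)", OF fin _ 00]) (simp add: mult.assoc zp_span_mult_closed X Y)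
qed

lemma integral_zp_embed [simp]: "zp_embed a \<in> integral_elements"
proof (rule integral_if_zp_span[of "{()}" _ "\<lambda>_. 1" "()"])
  show "zp_embed a * 1 \<in> zp_span {()} (\<lambda>_. 1)"
    by (intro zp_span_scale zp_span_base[of "{()}" "()" "\<lambda>_. 1", simplified])
qed auto

lemma integral_of_nat [simp]: "of_nat n \<in> integral_elements"
  using integral_zp_embed[of "of_nat n"] by simp

lemma integral_0 [simp]: "0 \<in> integral_elements" and integral_1 [simp]: "1 \<in> integral_elements"
  using integral_of_nat[of 0] integral_of_nat[of 1] by simp_all

lemma integral_uminus: "x \<in> integral_elements \<Longrightarrow> - x \<in> integral_elements"
  using integral_binary(2)[OF integral_zp_embed[of "- 1"], of x] by simp

lemma integral_diff:
  "x \<in> integral_elements \<Longrightarrow> y \<in> integral_elements \<Longrightarrow> x - y \<in> integral_elements"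
  using integral_binary(1)[OF _ integral_uminus, of x y] by simp

lemma integral_power: "x \<in> integral_elements \<Longrightarrow> x ^ n \<in> integral_elements"
  by (induction n) (auto intro: integral_binary)

lemma integral_sum: "(\<And>i. i \<in> A \<Longrightarrow> f i \<in> integral_elements) \<Longrightarrow> sum f A \<in> integral_elements"
  by (induction A rule: infinite_finite_induct) (auto intro: integral_binary)

lemma integral_root_of_unity:
  assumes "x ^ n = 1" "n > 0"
  shows "x \<in> integral_elements"
proof (rule integral_if_zp_span[of "{..<n}" x "\<lambda>i. x ^ i" 0])
  fix i assume "i \<in> {..<n}"
  hence "x * x ^ i = x ^ (Suc i mod n)"
    using assms by (cases "Suc i = n") (auto simp flip: power_Suc)
  thus "x * x ^ i \<in> zp_span {..<n} (\<lambda>i. x ^ i)"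
    using zp_span_base[of "{..<n}" "Suc i mod n" "\<lambda>i. x ^ i"] assms by simp
qed (use assms in auto)

text \<open>A monic equation of degree d for 1/p, multiplied by p^d, would exhibit 1 as a multiple
  of p in Z_p. This is what makes the filtration by powers of p separated.\<close>

lemma inverse_prime_not_integral: "1 / of_nat CARD('p) \<notin> (integral_elements :: 'p :: prime_card padic_closure set)"
proof
  let ?x = "1 / of_nat CARD('p) :: 'p padic_closure"
  assume "?x \<in> integral_elements"
  then obtain d :: nat and c where d: "d > 0" "?x ^ d = (\<Sum>i<d. zp_embed (c i) * ?x ^ i)"
    by (rule integral_elementsE)
  have nz: "of_nat CARD('p) \<noteq> (0 :: 'p padic_closure)" by simp
  have "1 = (of_nat CARD('p) * ?x) ^ d" using nz by simp
  also have "\<dots> = of_nat CARD('p) ^ d * ?x ^ d" by (rule power_mult_distrib)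
  also have "\<dots> = (\<Sum>i<d. zp_embed (c i) * (of_nat CARD('p) ^ d * ?x ^ i))"
    unfolding d(2) sum_distrib_left by (simp only: mult_ac)
  also have "\<dots> = (\<Sum>i<d. zp_embed (c i * pp ^ (d - i)))"
  proof (rule sum.cong[OF refl])
    fix i assume "i \<in> {..<d}"
    hence "of_nat CARD('p) ^ d = (of_nat CARD('p) ^ (d - i) * of_nat CARD('p) ^ i :: 'p padic_closure)"
      by (simp flip: power_add)
    hence "of_nat CARD('p) ^ d * ?x ^ i = (of_nat CARD('p) ^ (d - i) * (of_nat CARD('p) * ?x) ^ i :: 'p padic_closure)"
      by (simp only: power_mult_distrib mult.assoc)
    thus "zp_embed (c i) * (of_nat CARD('p) ^ d * ?x ^ i) = zp_embed (c i * pp ^ (d - i))"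
      using nz by simp
  qed
  finally have "zp_embed (1 :: 'p padic_int) = zp_embed (\<Sum>i<d. c i * pp ^ (d - i))"
    by (simp only: zp_embed_1 zp_embed_sum)
  hence *: "1 = (\<Sum>i<d. c i * pp ^ (d - i))" by (simp only: zp_embed_eq_iff)
  have "(pp :: 'p padic_int) dvd (\<Sum>i<d. c i * pp ^ (d - i))"
    by (intro dvd_sum dvd_mult dvd_power) auto
  thus False using pp_not_unit[where 'p = 'p] unfolding *[symmetric] by blast
qed

text \<open>Only finitely many coefficients are nonzero, and the exponents that they need can be
  added up.\<close>

lemma clear_denominators:
  fixes Q :: "'p :: prime_card padic poly"
  obtains k q where "\<forall>i. Polynomial.coeff Q i * of_nat CARD('p) ^ k = Fract (q i) 1"
proof -
  let ?d = "Polynomial.degree Q" and ?p = "of_nat CARD('p)"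
  have "\<exists>k. \<forall>i\<in>{..?d}. \<exists>c. Polynomial.coeff Q i * ?p ^ k = Fract c 1"
  proof (rule finite_induct[of "{..?d}" "\<lambda>I. \<exists>k. \<forall>i\<in>I. \<exists>c. Polynomial.coeff Q i * ?p ^ k = Fract c 1"])
    fix j F
    assume "\<exists>k. \<forall>i\<in>F. \<exists>c. Polynomial.coeff Q i * ?p ^ k = Fract c 1"
    then obtain k where k: "\<And>i. i \<in> F \<Longrightarrow> \<exists>c. Polynomial.coeff Q i * ?p ^ k = Fract c 1" by blast
    obtain l e where l: "Polynomial.coeff Q j * ?p ^ l = Fract e 1" by (rule padic_denominator)
    have P: "?p ^ n = Fract ((pp :: 'p padic_int) ^ n) 1" for n
      using of_nat_fract[of "CARD('p) ^ n"] by (simp only: of_nat_power)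
    have "\<exists>c. Polynomial.coeff Q i * ?p ^ (k + l) = Fract c 1" if i: "i \<in> insert j F" for i
    proof (cases "i = j")
      case True
      have "Polynomial.coeff Q i * ?p ^ (k + l) = (Polynomial.coeff Q j * ?p ^ l) * ?p ^ k"
        using True by (simp add: power_add mult_ac)
      hence "Polynomial.coeff Q i * ?p ^ (k + l) = Fract (e * pp ^ k) 1" unfolding l by (simp add: P)
      thus ?thesis by blast
    next
      case False
      then obtain c where "Polynomial.coeff Q i * ?p ^ k = Fract c 1" using k i by blast
      hence "Polynomial.coeff Q i * ?p ^ (k + l) = Fract c 1 * ?p ^ l" by (simp add: power_add mult_ac)
      hence "Polynomial.coeff Q i * ?p ^ (k + l) = Fract (c * pp ^ l) 1" by (simp add: P)
      thus ?thesis by blast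
    qed
    thus "\<exists>k. \<forall>i\<in>insert j F. \<exists>c. Polynomial.coeff Q i * ?p ^ k = Fract c 1" by blast
  qed auto
  then obtain k where "\<And>i. i \<le> ?d \<Longrightarrow> \<exists>c. Polynomial.coeff Q i * ?p ^ k = Fract c 1" by auto
  moreover have "\<exists>c. Polynomial.coeff Q i * ?p ^ k = Fract c 1" if "\<not> i \<le> ?d" for i
    using that by (intro exI[of _ 0]) (simp add: coeff_eq_0 Zero_fract_def)
  ultimately have "\<forall>i. \<exists>c. Polynomial.coeff Q i * ?p ^ k = Fract c 1" by blast
  then obtain q where "\<forall>i. Polynomial.coeff Q i * ?p ^ k = Fract (q i) 1" by metis
  thus ?thesis by (rule that)
qed

text \<open>If c is the leading coefficient of an equation for x over Z_p, then c x is integral. The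
  unit part of c is divided out at the end, which leaves a power of p.\<close>

lemma integral_multiple:
  fixes x :: "'p :: prime_card padic_closure"
  obtains n where "of_nat CARD('p) ^ n * x \<in> integral_elements"
proof -
  obtain Q where Q: "Q \<noteq> 0" "poly (map_poly to_ac Q) x = 0" by (rule alg_closure_algebraic)
  let ?d = "Polynomial.degree Q" and ?p = "of_nat CARD('p)"
  obtain k q where "\<forall>i. Polynomial.coeff Q i * ?p ^ k = Fract (q i) 1"
    by (rule clear_denominators[of Q])
  hence q: "\<And>i. Polynomial.coeff Q i * ?p ^ k = Fract (q i) 1" by blast
  have deg: "Polynomial.degree (map_poly to_ac Q) = ?d" by (rule degree_map_poly) simp
  have "0 = to_ac (?p ^ k) * poly (map_poly to_ac Q) x" by (simp add: Q)
  also have "\<dots> = (\<Sum>i\<le>?d. to_ac (Polynomial.coeff Q i * ?p ^ k) * x ^ i)"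
    by (simp add: poly_altdef deg coeff_map_poly sum_distrib_left mult_ac)
  also have "\<dots> = (\<Sum>i\<le>?d. zp_embed (q i) * x ^ i)"
    by (intro sum.cong refl) (simp add: q zp_embed_def del: to_ac_mult)
  finally have 0: "(\<Sum>i\<le>?d. zp_embed (q i) * x ^ i) = 0" by simp
  have "Fract (q ?d) 1 \<noteq> 0" using Q(1) by (simp flip: q)
  hence qd: "q ?d \<noteq> 0" by (auto simp: Zero_fract_def eq_fract)
  have d: "?d > 0"
  proof (rule ccontr)
    assume "\<not> ?d > 0"
    thus False using 0 qd by simp
  qed
  let ?c = "zp_embed (q ?d)"
  have top: "?c * x ^ ?d = - (\<Sum>i<?d. zp_embed (q i) * x ^ i)"
    using 0 by (simp add: lessThan_Suc_atMost[symmetric] eq_neg_iff_add_eq_0 add.commute)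
  have int: "?c * x \<in> integral_elements"
  proof (rule integral_if_zp_span[of "{..<?d}" _ "\<lambda>i. (?c * x) ^ i" 0])
    fix i assume i: "i \<in> {..<?d}"
    let ?S = "zp_span {..<?d} (\<lambda>i. (?c * x) ^ i)"
    show "?c * x * (?c * x) ^ i \<in> ?S"
    proof (cases "Suc i < ?d")
      case True
      thus ?thesis using zp_span_base[of "{..<?d}" "Suc i" "\<lambda>i. (?c * x) ^ i"] by simp
    next
      case False
      hence e: "?d = Suc i" using i by simp
      have "?c * x * (?c * x) ^ i = ?c ^ i * (?c * x ^ ?d)"
        by (subst (3) e) (simp add: power_mult_distrib mult_ac)
      \<comment> \<open>Multiplication by c^i makes the equation monic in c x: the term in x^j, with
        j \<le> i, absorbs c^j and keeps the spare factor c^(i - j).\<close>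
      also have "\<dots> = - (\<Sum>j<?d. zp_embed (q ?d ^ (i - j) * q j) * (?c * x) ^ j)"
      proof -
        have key: "?c ^ i * (zp_embed (q j) * x ^ j) = zp_embed (q ?d ^ (i - j) * q j) * (?c * x) ^ j" if "j < ?d" for j
        proof -
          have "?c ^ i = ?c ^ (i - j) * ?c ^ j" using that e by (simp flip: power_add)
          thus ?thesis by (simp add: power_mult_distrib mult_ac)
        qed
        show ?thesis unfolding top mult_minus_right sum_distrib_left
          by (intro arg_cong[where f = uminus] sum.cong refl key) simp
      qed
      also have "\<dots> \<in> ?S"
        by (intro zp_span_uminus zp_span_sum zp_span_scale zp_span_base[of "{..<?d}" _ "\<lambda>i. (?c * x) ^ i"]) auto
      finally show ?thesis .
    qed
  qed (use d in auto)
  obtain n u where u: "q ?d = pp ^ n * u" "u dvd 1" using qd by (rule padic_factor)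
  obtain w where w: "1 = u * w" using u(2) by (auto simp: dvd_def)
  have "zp_embed w * (?c * x) \<in> integral_elements"
    by (rule integral_binary(2)[OF integral_zp_embed int])
  also have "zp_embed w * (?c * x) = of_nat CARD('p) ^ n * x * zp_embed (u * w)"
    by (simp add: u(1) mult_ac)
  also have "\<dots> = of_nat CARD('p) ^ n * x" by (simp flip: w)
  finally show ?thesis by (rule that)
qed

no_notation vec_nth (infixl \<open>$\<close> 90)
no_notation Matrix.vec_index (infixl \<open>$\<close> 100)

section \<open>Convergence in the algebraic closure\<close>

text \<open>The balls around 0 that take the place of an absolute value. They are additive
  subgroups, so limits behave as in an ultrametric space.\<close>

definition small :: "nat \<Rightarrow> 'p :: prime_card padic_closure set" where
  "small m = {x. x / of_nat CARD('p) ^ m \<in> integral_elements}"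

lemma small_0_level: "small 0 = integral_elements"
  by (simp add: small_def)

lemma small_0 [simp]: "0 \<in> small m"
  by (simp add: small_def)

lemma small_add: "x \<in> small m \<Longrightarrow> y \<in> small m \<Longrightarrow> x + y \<in> small m"
  by (simp add: small_def add_divide_distrib integral_binary)

lemma small_uminus: "x \<in> small m \<Longrightarrow> - x \<in> small m"
  using integral_uminus by (force simp: small_def)

lemma small_diff: "x \<in> small m \<Longrightarrow> y \<in> small m \<Longrightarrow> x - y \<in> small m"
  using small_add[OF _ small_uminus, of x m y] by simp

lemma small_sum: "(\<And>i. i \<in> A \<Longrightarrow> f i \<in> small m) \<Longrightarrow> sum f A \<in> small m"
  by (induction A rule: infinite_finite_induct) (auto intro: small_add)

lemma small_mult: "x \<in> integral_elements \<Longrightarrow> y \<in> small m \<Longrightarrow> x * y \<in> small m"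
  using integral_binary(2)[of x "y / of_nat CARD('a) ^ m"] by (simp add: small_def)

lemma small_zp_embed: "pp ^ m dvd a \<Longrightarrow> zp_embed a \<in> small m"
  by (auto simp: small_def dvd_def)

lemma small_prime_power_mult:
  "x \<in> integral_elements \<Longrightarrow> of_nat CARD('p) ^ m * x \<in> (small m :: 'p :: prime_card padic_closure set)"
  by (simp add: small_def)

text \<open>For x \<noteq> 0 some p^n / x is integral. If x were divisible by p^(n + 1), the product
  of the two integral elements x / p^(n + 1) and p^n / x would be 1/p.\<close>

lemma small_separated:
  fixes x :: "'p :: prime_card padic_closure"
  assumes "\<And>m. x \<in> small m"
  shows "x = 0"
proof (rule ccontr)
  assume nz: "x \<noteq> 0"
  let ?p = "of_nat CARD('p) :: 'p padic_closure"
  obtain n where n: "?p ^ n * (1 / x) \<in> integral_elements" by (rule integral_multiple)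
  have "x / ?p ^ Suc n \<in> integral_elements" using assms[of "Suc n"] by (simp add: small_def)
  hence "(x / ?p ^ Suc n) * (?p ^ n * (1 / x)) \<in> integral_elements" using n by (rule integral_binary)
  moreover have "(x / ?p ^ Suc n) * (?p ^ n * (1 / x)) = 1 / ?p" using nz by (simp add: field_simps)
  ultimately show False using inverse_prime_not_integral[where 'p = 'p] by simp
qed

lemma padic_sums_iff:
  "padic_sums F s \<longleftrightarrow> (\<forall>m. \<forall>\<^sub>F n in sequentially. (\<Sum>i<n. F i) - s \<in> small m)"
  by (simp add: padic_sums_def small_def)

lemma padic_sums_unique:
  assumes "padic_sums F s" "padic_sums F t"
  shows "s = t"
proof -
  have "t - s \<in> small m" for m
  proof -
    have "\<forall>\<^sub>F n in sequentially. (\<Sum>i<n. F i) - s \<in> small m \<and> (\<Sum>i<n. F i) - t \<in> small m"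
      using assms by (simp add: padic_sums_iff eventually_conj)
    then obtain n where "(\<Sum>i<n. F i) - s \<in> small m" "(\<Sum>i<n. F i) - t \<in> small m"
      using eventually_happens'[OF sequentially_bot] by blast
    hence "((\<Sum>i<n. F i) - s) - ((\<Sum>i<n. F i) - t) \<in> small m" by (rule small_diff)
    thus ?thesis by simp
  qed
  hence "t - s = 0" by (rule small_separated)
  thus ?thesis by simp
qed

lemma padic_suminf_eqI: "padic_sums F s \<Longrightarrow> padic_suminf F = s"
  unfolding padic_suminf_def by (rule the_equality) (auto intro: padic_sums_unique)

section \<open>Evaluation of power series at roots of unity\<close>

text \<open>A sequence tending to 0 inside one finitely generated Z_p-module. The common module is
  the point: since the algebraic closure is not complete, a series whose terms merely tend to 0 may
  fail to converge in it.\<close>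

definition null_seq :: "(nat \<Rightarrow> 'p :: prime_card padic_closure) \<Rightarrow> bool" where
  "null_seq c \<longleftrightarrow> (\<exists>(I :: nat set) v k r. finite I \<and> (\<forall>j\<in>I. v j \<in> integral_elements) \<and>
     filterlim k at_top sequentially \<and> (\<forall>i. r i \<in> zp_span I v \<and> c i = of_nat CARD('p) ^ k i * r i))"

lemma zp_span_integral:
  assumes "\<And>j. j \<in> I \<Longrightarrow> v j \<in> integral_elements" "x \<in> zp_span I v"
  shows "x \<in> integral_elements"
proof -
  obtain c where "x = (\<Sum>i\<in>I. zp_embed (c i) * v i)" using assms(2) by (rule zp_spanE)
  thus ?thesis using assms(1) by (auto intro!: integral_sum integral_binary)
qed

lemma small_mono_prime_power:
  assumes "x \<in> integral_elements" "m \<le> k"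
  shows "of_nat CARD('p) ^ k * x \<in> (small m :: 'p :: prime_card padic_closure set)"
proof -
  have "of_nat CARD('p) ^ k * x = of_nat CARD('p) ^ m * (of_nat (CARD('p) ^ (k - m)) * x)"
    using assms(2) by (simp flip: power_add mult.assoc)
  thus ?thesis using small_prime_power_mult[of "of_nat (CARD('p) ^ (k - m)) * x" m]
      integral_binary(2)[OF integral_of_nat assms(1), of "CARD('p) ^ (k - m)"] by (simp only:)
qed

lemma null_seq_small:
  assumes "null_seq c"
  shows "\<exists>K. \<forall>i\<ge>K. c i \<in> small m"
proof -
  obtain I :: "nat set" and v k r where *: "\<And>j. j \<in> I \<Longrightarrow> v j \<in> integral_elements"
    "filterlim k at_top sequentially" "\<And>i. r i \<in> zp_span I v" "\<And>i. c i = of_nat CARD('a) ^ k i * r i"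
    using assms unfolding null_seq_def by blast
  obtain K where K: "\<And>i. i \<ge> K \<Longrightarrow> m \<le> k i"
    using *(2) unfolding filterlim_at_top eventually_sequentially by blast
  have "c i \<in> small m" if "i \<ge> K" for i
    unfolding *(4) by (rule small_mono_prime_power[OF zp_span_integral[of I v] K]) (use * that in auto)
  thus ?thesis by blast
qed

lemma null_seq_integral: "null_seq c \<Longrightarrow> c i \<in> integral_elements"
proof -
  assume "null_seq c"
  then obtain I :: "nat set" and v k r where *: "\<And>j. j \<in> I \<Longrightarrow> v j \<in> integral_elements"
     "\<And>i. r i \<in> zp_span I v" "\<And>i. c i = of_nat CARD('a) ^ k i * r i"
    unfolding null_seq_def by blast
  have "of_nat (CARD('a) ^ k i) * r i \<in> integral_elements"
    by (rule integral_binary(2)[OF integral_of_nat zp_span_integral[of I v]]) (use * in auto)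
  thus ?thesis by (simp add: *)
qed

text \<open>Expanding all terms in the same finite family \<open>v\<close> leaves one series in Z_p
  for each generator, and Z_p is complete.\<close>

lemma null_seq_sums:
  fixes c :: "nat \<Rightarrow> 'p :: prime_card padic_closure"
  assumes "null_seq c"
  shows "\<exists>s. padic_sums (\<lambda>i. zp_embed (f i) * c i) s"
proof -
  obtain I :: "nat set" and v k r where *: "finite I" "\<And>j. j \<in> I \<Longrightarrow> v j \<in> integral_elements"
    "filterlim k at_top sequentially" "\<And>i. r i \<in> zp_span I v" "\<And>i. c i = of_nat CARD('p) ^ k i * r i"
    using assms unfolding null_seq_def by blast
  have "\<forall>i. \<exists>d. r i = (\<Sum>j\<in>I. zp_embed (d j) * v j)" using *(4) zp_spanE by blast
  then obtain d where d: "\<And>i. r i = (\<Sum>j\<in>I. zp_embed (d i j) * v j)" by metis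
  define e where "e = (\<lambda>i j. f i * (pp ^ k i * d i j))"
  have fc: "zp_embed (f i) * c i = (\<Sum>j\<in>I. zp_embed (e i j) * v j)" for i
    unfolding *(5) d e_def by (simp add: sum_distrib_left mult_ac)
  have "\<exists>l. (\<lambda>n. \<Sum>i<n. e i j) \<longlonglongrightarrow> l" for j
  proof (rule padic_cauchy_convergent)
    fix m
    obtain K where K: "\<And>i. i \<ge> K \<Longrightarrow> m \<le> k i"
      using *(3) unfolding filterlim_at_top eventually_sequentially by blast
    have "pp ^ m dvd (\<Sum>i<Suc n. e i j) - (\<Sum>i<n. e i j)" if "n \<ge> K" for n
    proof -
      have "pp ^ m dvd f n * (pp ^ k n * d n j)"
        by (intro dvd_mult[of _ _ "f n"] dvd_mult2 le_imp_power_dvd K[OF that])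
      thus ?thesis by (simp add: e_def)
    qed
    thus "\<exists>N. \<forall>n\<ge>N. pp ^ m dvd (\<Sum>i<Suc n. e i j) - (\<Sum>i<n. e i j)" by blast
  qed
  then obtain l where l: "\<And>j. (\<lambda>n. \<Sum>i<n. e i j) \<longlonglongrightarrow> l j" by metis
  have "padic_sums (\<lambda>i. zp_embed (f i) * c i) (\<Sum>j\<in>I. zp_embed (l j) * v j)"
    unfolding padic_sums_iff
  proof
    fix m
    have "\<forall>\<^sub>F n in sequentially. \<forall>j\<in>I. pp ^ m dvd (\<Sum>i<n. e i j) - l j"
      using *(1) l unfolding padic_tendsto_iff by (simp add: eventually_ball_finite)
    thus "\<forall>\<^sub>F n in sequentially. (\<Sum>i<n. zp_embed (f i) * c i) - (\<Sum>j\<in>I. zp_embed (l j) * v j) \<in> small m"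
    proof (rule eventually_mono)
      fix n assume n: "\<forall>j\<in>I. pp ^ m dvd (\<Sum>i<n. e i j) - l j"
      have "(\<Sum>i<n. zp_embed (f i) * c i) = (\<Sum>j\<in>I. zp_embed (\<Sum>i<n. e i j) * v j)"
        unfolding fc zp_embed_sum sum_distrib_right by (rule sum.swap)
      hence "(\<Sum>i<n. zp_embed (f i) * c i) - (\<Sum>j\<in>I. zp_embed (l j) * v j) =
          (\<Sum>j\<in>I. v j * zp_embed ((\<Sum>i<n. e i j) - l j))"
        by (simp add: left_diff_distrib right_diff_distrib sum_subtractf mult_ac)
      also have "\<dots> \<in> small m"
        using n * by (intro small_sum small_mult small_zp_embed) auto
      finally show "(\<Sum>i<n. zp_embed (f i) * c i) - (\<Sum>j\<in>I. zp_embed (l j) * v j) \<in> small m" .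
    qed
  qed
  thus ?thesis by blast
qed

lemma padic_sums_suminf:
  assumes "null_seq c"
  shows "padic_sums (\<lambda>i. zp_embed (f i) * c i) (padic_suminf (\<lambda>i. zp_embed (f i) * c i))"
  using null_seq_sums[OF assms, of f] padic_suminf_eqI by metis

lemma padic_sums_add: "padic_sums F s \<Longrightarrow> padic_sums G t \<Longrightarrow> padic_sums (\<lambda>i. F i + G i) (s + t)"
  unfolding padic_sums_iff
proof
  fix m
  assume *: "\<forall>m. \<forall>\<^sub>F n in sequentially. (\<Sum>i<n. F i) - s \<in> small m"
    "\<forall>m. \<forall>\<^sub>F n in sequentially. (\<Sum>i<n. G i) - t \<in> small m"
  show "\<forall>\<^sub>F n in sequentially. (\<Sum>i<n. F i + G i) - (s + t) \<in> small m"
    using *(1)[rule_format, of m] *(2)[rule_format, of m]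
  proof eventually_elim
    case (elim n)
    from small_add[OF this] show ?case by (simp add: sum.distrib algebra_simps)
  qed
qed

lemma padic_sums_mult:
  "a \<in> integral_elements \<Longrightarrow> padic_sums F s \<Longrightarrow> padic_sums (\<lambda>i. a * F i) (a * s)"
  unfolding padic_sums_iff
proof
  fix m
  assume a: "a \<in> integral_elements" and *: "\<forall>m. \<forall>\<^sub>F n in sequentially. (\<Sum>i<n. F i) - s \<in> small m"
  show "\<forall>\<^sub>F n in sequentially. (\<Sum>i<n. a * F i) - a * s \<in> small m"
    using *[rule_format, of m]
  proof eventually_elim
    case (elim n)
    from small_mult[OF a this] show ?case by (simp add: sum_distrib_left right_diff_distrib)
  qed
qed

lemma padic_sums_shift: "padic_sums (\<lambda>i. F (Suc i)) s \<Longrightarrow> padic_sums F (F 0 + s)"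
  unfolding padic_sums_iff
proof
  fix m
  assume "\<forall>m. \<forall>\<^sub>F n in sequentially. (\<Sum>i<n. F (Suc i)) - s \<in> small m"
  hence "\<forall>\<^sub>F n in sequentially. (\<Sum>i<Suc n. F i) - (F 0 + s) \<in> small m"
    by (simp add: sum.lessThan_Suc_shift algebra_simps del: sum.lessThan_Suc)
  thus "\<forall>\<^sub>F n in sequentially. (\<Sum>i<n. F i) - (F 0 + s) \<in> small m"
    by (subst (asm) eventually_sequentially_Suc)
qed

lemma padic_sums_small:
  assumes "padic_sums F s" "\<And>i. F i \<in> small m"
  shows "s \<in> small m"
proof -
  have "\<forall>\<^sub>F n in sequentially. (\<Sum>i<n. F i) - s \<in> small m" using assms(1) by (simp add: padic_sums_iff)
  then obtain n where "(\<Sum>i<n. F i) - s \<in> small m" using eventually_happens'[OF sequentially_bot] by blast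
  from small_diff[OF small_sum this, of "{..<n}" F] show ?thesis using assms(2) by simp
qed

section \<open>Topological nilpotence of \<zeta> - 1 for p-power roots of unity \<zeta>\<close>

lemma prime_power_dvd_choose:
  assumes "Factorial_Ring.prime (q :: nat)" "0 < k" "k < q ^ n"
  shows "q dvd (q ^ n choose k)"
proof (rule ccontr)
  assume "\<not> q dvd (q ^ n choose k)"
  hence "coprime (q ^ n) (q ^ n choose k)" using assms(1) by (simp add: prime_imp_coprime)
  \<comment> \<open>Absorption identity: a binomial coefficient prime to q would force q^n to divide
    k, although 0 < k < q^n.\<close>
  moreover have "k * (q ^ n choose k) = q ^ n * (q ^ n - 1 choose (k - 1))"
    using times_binomial_minus1_eq[OF assms(2)] .
  ultimately have "q ^ n dvd k" by (metis coprime_dvd_mult_left_iff dvd_triv_left)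
  thus False using assms by (auto dest: dvd_imp_le)
qed

abbreviation root_span :: "'p :: prime_card padic_closure \<Rightarrow> nat \<Rightarrow> 'p padic_closure set" where
  "root_span \<zeta> n \<equiv> zp_span {..<CARD('p) ^ n} (\<lambda>i. \<zeta> ^ i)"

lemma root_power_in_span:
  assumes "(\<zeta> :: 'p :: prime_card padic_closure) ^ (CARD('p) ^ n) = 1"
  shows "\<zeta> ^ a \<in> root_span \<zeta> n"
proof -
  let ?N = "CARD('p) ^ n"
  have "\<zeta> ^ a = \<zeta> ^ (?N * (a div ?N) + a mod ?N)" by simp
  also have "\<dots> = \<zeta> ^ (a mod ?N)" by (simp only: power_add power_mult assms power_one mult_1)
  finally show ?thesis using zp_span_base[of "{..<?N}" "a mod ?N" "\<lambda>i. \<zeta> ^ i"] by simp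
qed

lemma root_span_mult:
  assumes "(\<zeta> :: 'p :: prime_card padic_closure) ^ (CARD('p) ^ n) = 1"
    "r \<in> root_span \<zeta> n" "s \<in> root_span \<zeta> n"
  shows "r * s \<in> root_span \<zeta> n"
proof -
  obtain c where r: "r = (\<Sum>i<CARD('p) ^ n. zp_embed (c i) * \<zeta> ^ i)" using assms(2) by (rule zp_spanE)
  have "\<zeta> ^ i * s \<in> root_span \<zeta> n" for i
    by (rule zp_span_mult_closed[OF _ assms(3)])
       (use root_power_in_span[OF assms(1)] in \<open>simp flip: power_add\<close>)
  thus ?thesis unfolding r sum_distrib_right mult.assoc by (intro zp_span_sum zp_span_scale) auto
qed

lemma root_span_power:
  assumes "(\<zeta> :: 'p :: prime_card padic_closure) ^ (CARD('p) ^ n) = 1" "r \<in> root_span \<zeta> n"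
  shows "r ^ k \<in> root_span \<zeta> n"
proof (induction k)
  case 0
  show ?case using root_power_in_span[OF assms(1), of 0] by simp
next
  case (Suc k)
  thus ?case using root_span_mult[OF assms(1,2) Suc] by simp
qed

text \<open>In the binomial expansion the inner coefficients are divisible by p, and the two outer
  terms 1 and (-1)^(p^n) cancel because p is odd. The cofactor stays in the span of the powers of
  \<zeta>, as \<open>null_seq\<close> requires.\<close>

lemma root_minus_one_power:
  fixes \<zeta> :: "'p :: prime_card padic_closure"
  assumes odd: "odd CARD('p)" and \<zeta>: "\<zeta> ^ (CARD('p) ^ n) = 1"
  obtains s where "s \<in> root_span \<zeta> n" "(\<zeta> - 1) ^ (CARD('p) ^ n) = of_nat CARD('p) * s"
proof -
  let ?N = "CARD('p) ^ n"
  define t where "t = (\<lambda>k. of_nat ((?N choose k) div CARD('p)) * (\<zeta> ^ k * (- 1) ^ (?N - k)))"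
  have N: "?N > 0" by simp
  have "(\<zeta> - 1) ^ ?N = (\<zeta> + - 1) ^ ?N" by simp
  also have "\<dots> = (\<Sum>k\<le>?N. of_nat (?N choose k) * \<zeta> ^ k * (- 1) ^ (?N - k))"
    by (rule binomial_ring)
  also have "{..?N} = insert 0 (insert ?N {0<..<?N})" using N by auto
  also have "(\<Sum>k\<in>\<dots>. of_nat (?N choose k) * \<zeta> ^ k * (- 1) ^ (?N - k)) =
      (\<Sum>k\<in>{0<..<?N}. of_nat (?N choose k) * \<zeta> ^ k * (- 1) ^ (?N - k))"
    using odd \<zeta> by simp
  also have "\<dots> = (\<Sum>k\<in>{0<..<?N}. of_nat CARD('p) * t k)"
  proof (rule sum.cong[OF refl])
    fix k assume k: "k \<in> {0<..<?N}"
    hence "CARD('p) dvd (?N choose k)" using prime_power_dvd_choose[OF prime_card[where 'a = 'p]] by simp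
    hence "(of_nat (?N choose k) :: 'p padic_closure) = of_nat CARD('p) * of_nat ((?N choose k) div CARD('p))"
      by (simp flip: of_nat_mult)
    thus "of_nat (?N choose k) * \<zeta> ^ k * (- 1) ^ (?N - k) = of_nat CARD('p) * t k"
      by (simp only: t_def mult_ac)
  qed
  also have "\<dots> = of_nat CARD('p) * (\<Sum>k\<in>{0<..<?N}. t k)" by (simp add: sum_distrib_left)
  finally have eq: "(\<zeta> - 1) ^ ?N = of_nat CARD('p) * (\<Sum>k\<in>{0<..<?N}. t k)" .
  have "t k \<in> root_span \<zeta> n" for k
  proof -
    have *: "t k = zp_embed (of_nat ((?N choose k) div CARD('p)) * (- 1) ^ (?N - k)) * \<zeta> ^ k"
      unfolding t_def by (simp add: mult_ac)
    show ?thesis unfolding * by (rule zp_span_scale[OF root_power_in_span[OF \<zeta>]])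
  qed
  hence "(\<Sum>k\<in>{0<..<?N}. t k) \<in> root_span \<zeta> n" by (rule zp_span_sum)
  thus ?thesis using eq by (rule that)
qed

lemma fps_linear_power_nth:
  fixes x y :: "'a :: comm_ring_1"
  shows "((fps_const x + fps_const y * fps_X) ^ i) $ j
    = (if j \<le> i then of_nat (i choose j) * y ^ j * x ^ (i - j) else 0)"
proof -
  have "(fps_const x + fps_const y * fps_X) ^ i = (fps_const y * fps_X + fps_const x) ^ i"
    by (simp add: add.commute)
  also have "\<dots> = (\<Sum>k\<le>i. of_nat (i choose k) * (fps_const y * fps_X) ^ k * fps_const x ^ (i - k))"
    by (rule binomial_ring)
  also have "\<dots> = (\<Sum>k\<le>i. fps_const (of_nat (i choose k) * y ^ k * x ^ (i - k)) * fps_X ^ k)"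
    by (intro sum.cong refl)
       (simp add: power_mult_distrib fps_const_power fps_of_nat[symmetric] mult_ac del: fps_const_mult flip: fps_const_mult)
  finally have "((fps_const x + fps_const y * fps_X) ^ i) $ j =
     (\<Sum>k\<le>i. (of_nat (i choose k) * y ^ k * x ^ (i - k)) * (if j = k then 1 else 0))"
    by (simp add: fps_sum_nth fps_X_power_iff)
  also have "\<dots> = (\<Sum>k\<le>i. if j = k then of_nat (i choose k) * y ^ k * x ^ (i - k) else 0)"
    by (intro sum.cong refl) simp
  finally show ?thesis by simp
qed

definition shifted_X :: "'a :: comm_ring_1 \<Rightarrow> 'a fps" where
  "shifted_X \<zeta> = fps_const \<zeta> * (1 + fps_X) - 1"

lemma shifted_X_linear: "shifted_X \<zeta> = fps_const (\<zeta> - 1) + fps_const \<zeta> * fps_X"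
  by (simp add: shifted_X_def algebra_simps flip: fps_const_sub)

text \<open>The coefficient of T^j in the i-th power is (i choose j) \<zeta>^j (\<zeta> - 1)^(i -
  j), and every p^n factors \<zeta> - 1 contribute one factor p. Hence the exponent of p is the
  quotient of i - j by p^n.\<close>

lemma null_seq_shifted_X:
  fixes \<zeta> :: "'p :: prime_card padic_closure"
  assumes odd: "odd CARD('p)" and \<zeta>: "\<zeta> ^ (CARD('p) ^ n) = 1"
  shows "null_seq (\<lambda>i. (shifted_X \<zeta> ^ i) $ j)"
proof -
  let ?N = "CARD('p) ^ n"
  obtain s where s: "s \<in> root_span \<zeta> n" "(\<zeta> - 1) ^ ?N = of_nat CARD('p) * s"
    using odd \<zeta> by (rule root_minus_one_power)
  have x: "\<zeta> - 1 \<in> root_span \<zeta> n"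
    using zp_span_add[OF root_power_in_span[OF \<zeta>, of 1] zp_span_uminus[OF root_power_in_span[OF \<zeta>, of 0]]]
    by simp
  define k where "k = (\<lambda>i. (i - j) div ?N)"
  define r where "r = (\<lambda>i. if j \<le> i then zp_embed (of_nat (i choose j)) *
     (\<zeta> ^ j * (s ^ k i * (\<zeta> - 1) ^ ((i - j) mod ?N))) else 0)"
  have "filterlim k at_top sequentially"
    unfolding filterlim_at_top eventually_sequentially
  proof
    fix Z
    have "Z \<le> k i" if "i \<ge> j + Z * ?N" for i
    proof -
      have "Z * ?N div ?N \<le> (i - j) div ?N" by (rule div_le_mono) (use that in linarith)
      thus ?thesis by (simp add: k_def)
    qed
    thus "\<exists>N. \<forall>n\<ge>N. Z \<le> k n" by blast
  qed
  moreover have "r i \<in> root_span \<zeta> n" for i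
    unfolding r_def
    by (auto intro!: zp_span_scale root_span_mult[OF \<zeta>] root_span_power[OF \<zeta>] root_power_in_span[OF \<zeta>] s x
        simp del: zp_embed_of_nat)
  moreover have "(shifted_X \<zeta> ^ i) $ j = of_nat CARD('p) ^ k i * r i" for i
  proof (cases "j \<le> i")
    case True
    have "(\<zeta> - 1) ^ (i - j) = (\<zeta> - 1) ^ (?N * k i + (i - j) mod ?N)" by (simp add: k_def)
    also have "\<dots> = of_nat CARD('p) ^ k i * (s ^ k i * (\<zeta> - 1) ^ ((i - j) mod ?N))"
      by (simp only: power_add power_mult s(2) power_mult_distrib mult.assoc)
    finally have "(\<zeta> - 1) ^ (i - j) = of_nat CARD('p) ^ k i * (s ^ k i * (\<zeta> - 1) ^ ((i - j) mod ?N))" .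
    thus ?thesis using True unfolding shifted_X_linear fps_linear_power_nth r_def
      by (simp add: mult_ac)
  qed (simp add: shifted_X_linear fps_linear_power_nth r_def)
  moreover have "\<forall>j\<in>{..<?N}. \<zeta> ^ j \<in> integral_elements"
    by (auto intro!: integral_power integral_root_of_unity[OF \<zeta>])
  ultimately show ?thesis unfolding null_seq_def by blast
qed

lemma twist_nth: "twist f \<zeta> $ j = padic_suminf (\<lambda>i. zp_embed (f $ i) * (shifted_X \<zeta> ^ i) $ j)"
  by (simp add: twist_def shifted_X_def)

text \<open>Evaluation is reduced to twisting, so the ring homomorphism property is proved once, for
  \<open>twist\<close>, and covers both.\<close>

lemma eval_fps_at_twist: "eval_fps_at f (\<zeta> - 1) = twist f \<zeta> $ 0"
  unfolding twist_nth eval_fps_at_def by (simp add: shifted_X_linear fps_linear_power_nth)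

section \<open>Twisting by a p-power root of unity is a continuous ring homomorphism\<close>

locale p_power_root =
  fixes \<zeta> :: "'p :: prime_card padic_closure" and n :: nat
  assumes odd: "odd CARD('p)" and root: "\<zeta> ^ (CARD('p) ^ n) = 1"
begin

lemma twist_sums: "padic_sums (\<lambda>i. zp_embed (f $ i) * (shifted_X \<zeta> ^ i) $ j) (twist f \<zeta> $ j)"
  unfolding twist_nth by (rule padic_sums_suminf[OF null_seq_shifted_X[OF odd root]])

lemma twist_eqI:
  "padic_sums (\<lambda>i. zp_embed (f $ i) * (shifted_X \<zeta> ^ i) $ j) s \<Longrightarrow> twist f \<zeta> $ j = s"
  unfolding twist_nth by (rule padic_suminf_eqI)

lemma twist_add: "twist (f + g) \<zeta> = twist f \<zeta> + twist g \<zeta>"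
  by (rule fps_ext, rule twist_eqI)
     (use padic_sums_add[OF twist_sums twist_sums, of f _ g] in \<open>simp add: distrib_right\<close>)

lemma twist_scale: "twist (fps_const c * f) \<zeta> = fps_const (zp_embed c) * twist f \<zeta>"
  by (rule fps_ext, rule twist_eqI)
     (use padic_sums_mult[OF integral_zp_embed twist_sums, of c f] in \<open>simp add: mult_ac\<close>)

lemma twist_X_mult: "twist (fps_X * f) \<zeta> = shifted_X \<zeta> * twist f \<zeta>"
proof (rule fps_ext, rule twist_eqI)
  fix j
  have z: "\<zeta> \<in> integral_elements" "\<zeta> - 1 \<in> integral_elements"
    using integral_root_of_unity[OF root] by (auto intro: integral_diff)
  let ?F = "\<lambda>i. zp_embed ((fps_X * f) $ i) * (shifted_X \<zeta> ^ i) $ j"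
  have "padic_sums (\<lambda>i. ?F (Suc i)) ((shifted_X \<zeta> * twist f \<zeta>) $ j)"
  proof (cases j)
    case 0
    show ?thesis using padic_sums_mult[OF z(2) twist_sums, of f 0] 0
      by (simp add: shifted_X_linear mult_ac distrib_right)
  next
    case (Suc j')
    have "padic_sums (\<lambda>i. (\<zeta> - 1) * (zp_embed (f $ i) * (shifted_X \<zeta> ^ i) $ j) +
       \<zeta> * (zp_embed (f $ i) * (shifted_X \<zeta> ^ i) $ j')) ((\<zeta> - 1) * twist f \<zeta> $ j + \<zeta> * twist f \<zeta> $ j')"
      by (intro padic_sums_add padic_sums_mult z twist_sums)
    thus ?thesis using Suc by (simp add: shifted_X_linear distrib_right distrib_left mult_ac)
  qed
  from padic_sums_shift[OF this]
  show "padic_sums ?F ((shifted_X \<zeta> * twist f \<zeta>) $ j)" by simp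
qed

lemma twist_0 [simp]: "twist 0 \<zeta> = 0"
  using twist_scale[of 0 0] by simp

lemma twist_uminus: "twist (- f) \<zeta> = - twist f \<zeta>"
  using twist_add[of f "- f"] by (simp add: eq_neg_iff_add_eq_0 add.commute)

lemma twist_diff: "twist (f - g) \<zeta> = twist f \<zeta> - twist g \<zeta>"
  using twist_add[of f "- g"] by (simp add: twist_uminus)

lemma twist_1 [simp]: "twist 1 \<zeta> = 1"
proof (rule fps_ext, rule twist_eqI)
  fix j
  have "padic_sums (\<lambda>i. zp_embed (1 $ Suc i) * (shifted_X \<zeta> ^ Suc i) $ j) 0"
    by (simp add: padic_sums_iff)
  from padic_sums_shift[OF this]
  show "padic_sums (\<lambda>i. zp_embed (1 $ i) * (shifted_X \<zeta> ^ i) $ j) (1 $ j)" by simp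
qed

lemma twist_const: "twist (fps_const c) \<zeta> = fps_const (zp_embed c)"
  using twist_scale[of c 1] by simp

lemma twist_X: "twist fps_X \<zeta> = shifted_X \<zeta>"
  using twist_X_mult[of 1] by simp

lemma twist_integral: "twist f \<zeta> $ j \<in> integral_elements"
  using padic_sums_small[OF twist_sums, of f j 0] null_seq_integral[OF null_seq_shifted_X[OF odd root], of _ j]
  by (simp add: small_0_level integral_binary)

text \<open>Modulo p^m, a coefficient of the twist depends on finitely many coefficients of f modulo
  p^m, because later powers of \<open>shifted_X \<zeta>\<close> are small. This carries limits of
  polynomials through the twist.\<close>

lemma twist_continuous:
  "\<exists>K. \<forall>f. (\<forall>i<K. pp ^ m dvd f $ i) \<longrightarrow> twist f \<zeta> $ j \<in> small m"
proof -
  obtain K where K: "\<And>i. i \<ge> K \<Longrightarrow> (shifted_X \<zeta> ^ i) $ j \<in> small m"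
    using null_seq_small[OF null_seq_shifted_X[OF odd root]] by blast
  have "twist f \<zeta> $ j \<in> small m" if f: "\<forall>i<K. pp ^ m dvd f $ i" for f
  proof (rule padic_sums_small[OF twist_sums])
    fix i
    show "zp_embed (f $ i) * (shifted_X \<zeta> ^ i) $ j \<in> small m"
    proof (cases "i < K")
      case True
      have "(shifted_X \<zeta> ^ i) $ j * zp_embed (f $ i) \<in> small m"
        by (intro small_mult null_seq_integral[OF null_seq_shifted_X[OF odd root]] small_zp_embed)
           (use f True in auto)
      thus ?thesis by (simp add: mult.commute)
    next
      case False
      thus ?thesis by (intro small_mult K) auto
    qed
  qed
  thus ?thesis by blast
qed

text \<open>Splitting off constant terms, g = g_0 + T h, shows that the defect of multiplicativity
  for g is \<open>shifted_X \<zeta>\<close> times the defect for h. Iterating, the defect is a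
  multiple of every power of \<open>shifted_X \<zeta>\<close> with integral cofactor, and these
  powers tend to 0 coefficientwise.\<close>

lemma twist_mult: "twist (f * g) \<zeta> = twist f \<zeta> * twist g \<zeta>"
proof -
  have *: "\<exists>D. (\<forall>j. D $ j \<in> integral_elements) \<and>
      twist (f * g) \<zeta> - twist f \<zeta> * twist g \<zeta> = shifted_X \<zeta> ^ K * D" for K g
  proof (induction K arbitrary: g)
    case 0
    have "(twist (f * g) \<zeta> - twist f \<zeta> * twist g \<zeta>) $ j \<in> integral_elements" for j
      by (simp add: fps_mult_nth) (intro integral_diff integral_sum integral_binary twist_integral)
    thus ?case by (intro exI[of _ "twist (f * g) \<zeta> - twist f \<zeta> * twist g \<zeta>"]) simp
  next
    case (Suc K)
    define h where "h = fps_shift 1 g"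
    have g: "g = fps_const (g $ 0) + fps_X * h"
      by (rule fps_ext) (simp add: h_def)
    obtain D where D: "\<forall>j. D $ j \<in> integral_elements"
      "twist (f * h) \<zeta> - twist f \<zeta> * twist h \<zeta> = shifted_X \<zeta> ^ K * D" using Suc by blast
    have "f * g = fps_const (g $ 0) * f + fps_X * (f * h)" by (subst g) (simp add: algebra_simps)
    hence "twist (f * g) \<zeta> = fps_const (zp_embed (g $ 0)) * twist f \<zeta> + shifted_X \<zeta> * twist (f * h) \<zeta>"
      by (simp add: twist_add twist_scale twist_X_mult)
    moreover have "twist g \<zeta> = fps_const (zp_embed (g $ 0)) + shifted_X \<zeta> * twist h \<zeta>"
      by (subst g) (simp add: twist_add twist_const twist_X_mult)
    ultimately have "twist (f * g) \<zeta> - twist f \<zeta> * twist g \<zeta>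
        = shifted_X \<zeta> * (twist (f * h) \<zeta> - twist f \<zeta> * twist h \<zeta>)"
      by (simp add: algebra_simps)
    thus ?case using D by (intro exI[of _ D]) (simp add: mult.assoc)
  qed
  have "(twist (f * g) \<zeta> - twist f \<zeta> * twist g \<zeta>) $ j = 0" for j
  proof (rule small_separated)
    fix m
    have "\<forall>a. \<exists>K. \<forall>i\<ge>K. (shifted_X \<zeta> ^ i) $ a \<in> small m"
      using null_seq_small[OF null_seq_shifted_X[OF odd root]] by blast
    then obtain K where K: "\<And>a i. i \<ge> K a \<Longrightarrow> (shifted_X \<zeta> ^ i) $ a \<in> small m" by metis
    \<comment> \<open>The sum exceeds each threshold \<open>K a\<close> with
      \<open>a \<le> j\<close>, and only these coefficients enter the j-th coefficient of the
      product.\<close>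
    define L where "L = (\<Sum>a\<le>j. K a)"
    have L: "(shifted_X \<zeta> ^ L) $ a \<in> small m" if "a \<le> j" for a
      by (rule K) (use that in \<open>simp add: L_def member_le_sum\<close>)
    obtain D where D: "\<forall>j. D $ j \<in> integral_elements"
      "twist (f * g) \<zeta> - twist f \<zeta> * twist g \<zeta> = shifted_X \<zeta> ^ L * D" using * by blast
    have "(D * shifted_X \<zeta> ^ L) $ j \<in> small m"
      unfolding fps_mult_nth by (intro small_sum small_mult L) (use D in auto)
    thus "(twist (f * g) \<zeta> - twist f \<zeta> * twist g \<zeta>) $ j \<in> small m" by (simp add: D(2) mult.commute)
  qed
  hence "twist (f * g) \<zeta> - twist f \<zeta> * twist g \<zeta> = 0" by (intro fps_ext) simp
  thus ?thesis by simp
qed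

lemma twist_power: "twist (f ^ k) \<zeta> = twist f \<zeta> ^ k"
  by (induction k) (simp_all add: twist_mult)

lemma twist_1_X: "twist (1 + fps_X) \<zeta> = fps_const \<zeta> * (1 + fps_X)"
  by (simp add: twist_add twist_X shifted_X_def)

lemma twist_sum: "twist (sum f A) \<zeta> = (\<Sum>x\<in>A. twist (f x) \<zeta>)"
  by (induction A rule: infinite_finite_induct) (simp_all add: twist_add)

end

section \<open>Roots of unity of prime order\<close>

lemma prime_order_power_ne_1:
  fixes w :: "'a :: field"
  assumes "Factorial_Ring.prime (q :: nat)" "w ^ q = 1" "w \<noteq> 1" "\<not> q dvd j"
  shows "w ^ j \<noteq> 1"
proof
  assume 1: "w ^ j = 1"
  have "j \<noteq> 0" using assms(4) by (metis dvd_0_right)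
  then obtain x y where "j * x = q * y + gcd j q" using bezout_nat by blast
  moreover have "gcd j q = 1" using assms(1,4) by (metis coprime_commute coprime_iff_gcd_eq_1 prime_imp_coprime)
  ultimately have "w ^ (j * x) = w ^ (q * y) * w" by (simp add: power_add)
  thus False using assms(2,3) 1 by (simp add: power_mult)
qed

lemma prime_order_powers_inj:
  fixes w :: "'a :: field"
  assumes "Factorial_Ring.prime (q :: nat)" "w ^ q = 1" "w \<noteq> 1"
  shows "inj_on (\<lambda>i. w ^ i) {..<q}"
proof -
  have *: False if "i < j" "j < q" "w ^ i = w ^ j" for i j
  proof -
    have "w \<noteq> 0" using assms(1,2) by (auto simp: power_0_left split: if_splits)
    moreover have "w ^ j = w ^ i * w ^ (j - i)" using that power_add[of w i "j - i"] by simp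
    ultimately have "w ^ (j - i) = 1" using that(3) by simp
    moreover have "\<not> q dvd j - i" using that by (auto dest: dvd_imp_le)
    ultimately show False using prime_order_power_ne_1[OF assms] by blast
  qed
  show ?thesis by (rule inj_onI) (metis * lessThan_iff linorder_neqE_nat)
qed

text \<open>Both sides are monic of degree q and vanish at the q distinct powers of w.\<close>

lemma prime_order_poly:
  fixes w :: "'a :: field"
  assumes q: "Factorial_Ring.prime (q :: nat)" and w: "w ^ q = 1" "w \<noteq> 1"
  shows "Polynomial.monom 1 q - 1 = (\<Prod>i<q. [:- (w ^ i), 1:])"
proof (rule poly_eqI_degree_lead_coeff[where n = q and A = "(\<lambda>i. w ^ i) ` {..<q}"])
  have q0: "q > 0" using q prime_gt_0_nat by blast
  have deg: "Polynomial.degree (\<Prod>i<q. [:- (w ^ i), 1:]) = q"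
    by (subst degree_prod_eq_sum_degree) auto
  show "Polynomial.degree (\<Prod>i<q. [:- (w ^ i), 1:]) \<le> q" using deg by simp
  have "Polynomial.lead_coeff (\<Prod>i<q. [:- (w ^ i), 1:]) = 1" by (simp add: lead_coeff_prod)
  thus "poly.coeff (Polynomial.monom 1 q - 1) q = poly.coeff (\<Prod>i<q. [:- (w ^ i), 1:]) q"
    using q0 deg by (simp add: coeff_1)
  show "Polynomial.degree (Polynomial.monom 1 q - 1 :: 'a poly) \<le> q"
    by (rule degree_diff_le) (simp_all add: degree_monom_le)
  show "q \<le> card ((\<lambda>i. w ^ i) ` {..<q})" using prime_order_powers_inj[OF assms] by (simp add: card_image)
  fix z assume "z \<in> (\<lambda>i. w ^ i) ` {..<q}"
  then obtain j where j: "z = w ^ j" "j < q" by auto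
  have "z ^ q = 1" using w(1) by (simp add: j flip: power_mult) (metis mult.commute power_mult power_one)
  moreover have "(\<Prod>i<q. z - w ^ i) = 0" using j by (auto simp: prod_zero_iff)
  ultimately show "poly (Polynomial.monom 1 q - 1) z = poly (\<Prod>i<q. [:- (w ^ i), 1:]) z"
    by (simp add: poly_monom poly_prod)
qed

text \<open>The homogeneous form of X^q - 1 = \<Prod> (X - w^i), with the sign absorbed by odd q. It
  computes field norms along the tower, and also the operator N on the series of a cyclotomic
  unit.\<close>

lemma prime_order_prod:
  fixes w :: "'a :: field"
  assumes q: "Factorial_Ring.prime (q :: nat)" "odd q" and w: "w ^ q = 1" "w \<noteq> 1"
  shows "(\<Prod>i<q. w ^ i * A - B) = A ^ q - B ^ q"
proof (cases "A = 0")
  case True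
  thus ?thesis using q by (auto simp: power_0_left)
next
  case False
  have "poly (Polynomial.monom 1 q - 1) (B / A) = (\<Prod>i<q. B / A - w ^ i)"
    by (subst prime_order_poly[OF q(1) w]) (simp add: poly_prod)
  hence *: "(B / A) ^ q - 1 = (\<Prod>i<q. B / A - w ^ i)" by (simp add: poly_monom)
  have "(\<Prod>i<q. w ^ i * A - B) = (\<Prod>i<q. (- A) * (B / A - w ^ i))"
    using False by (intro prod.cong) (simp_all add: field_simps)
  also have "\<dots> = (- A) ^ q * ((B / A) ^ q - 1)" unfolding * prod.distrib by simp
  also have "\<dots> = A ^ q - B ^ q" using q(2) False by (simp add: power_divide field_simps)
  finally show ?thesis .
qed

text \<open>The logarithmic derivative, in Z, of the product formula. With x = w^i Z one has x^q =
  Z^q, so 1/(x - 1) is a geometric sum divided by Z^q - 1. Summing over i, orthogonality leaves only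
  the exponent 0.\<close>

lemma prime_order_sum:
  fixes w :: "'a :: field"
  assumes q: "Factorial_Ring.prime (q :: nat)" and w: "w ^ q = 1" "w \<noteq> 1" and Z: "Z ^ q \<noteq> 1"
  shows "(\<Sum>i<q. w ^ i * Z / (w ^ i * Z - 1)) = of_nat q * Z ^ q / (Z ^ q - 1)"
proof -
  have q0: "q > 0" using q prime_gt_0_nat by blast
  have wq: "(w ^ i) ^ q = 1" for i using w(1) by (metis mult.commute power_mult power_one)
  have Zi: "(w ^ i * Z) ^ q = Z ^ q" for i by (simp add: power_mult_distrib wq)
  have ne: "w ^ i * Z \<noteq> 1" for i using Zi[of i] Z by auto
  have "(\<Sum>i<q. 1 / (w ^ i * Z - 1)) = (\<Sum>i<q. (\<Sum>j<q. (w ^ i * Z) ^ j) / (Z ^ q - 1))"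
  proof (rule sum.cong[OF refl])
    fix i
    have "(\<Sum>j<q. (w ^ i * Z) ^ j) = (Z ^ q - 1) / (w ^ i * Z - 1)"
      using geometric_sum[OF ne[of i], of q] by (simp add: Zi)
    thus "1 / (w ^ i * Z - 1) = (\<Sum>j<q. (w ^ i * Z) ^ j) / (Z ^ q - 1)" using Z by simp
  qed
  also have "\<dots> = (\<Sum>i<q. \<Sum>j<q. (w ^ j) ^ i * Z ^ j) / (Z ^ q - 1)"
    by (simp add: sum_divide_distrib power_mult_distrib mult.commute flip: power_mult)
  also have "(\<Sum>i<q. \<Sum>j<q. (w ^ j) ^ i * Z ^ j) = (\<Sum>j<q. \<Sum>i<q. (w ^ j) ^ i * Z ^ j)"
    by (rule sum.swap)
  also have "\<dots> = (\<Sum>j<q. if j = 0 then of_nat q else 0)"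
  proof (rule sum.cong[OF refl])
    fix j assume j: "j \<in> {..<q}"
    show "(\<Sum>i<q. (w ^ j) ^ i * Z ^ j) = (if j = 0 then of_nat q else 0)"
    proof (cases "j = 0")
      case False
      hence "w ^ j \<noteq> 1" using j by (intro prime_order_power_ne_1[OF q w]) (auto dest: dvd_imp_le)
      hence "(\<Sum>i<q. (w ^ j) ^ i) = 0" by (simp add: geometric_sum wq)
      thus ?thesis using False by (simp flip: sum_distrib_right)
    qed simp
  qed
  also have "\<dots> = of_nat q" using q0 by simp
  finally have *: "(\<Sum>i<q. 1 / (w ^ i * Z - 1)) = of_nat q / (Z ^ q - 1)" .
  have "(\<Sum>i<q. w ^ i * Z / (w ^ i * Z - 1)) = (\<Sum>i<q. 1 + 1 / (w ^ i * Z - 1))"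
    using ne by (intro sum.cong refl) (simp add: field_simps)
  also have "\<dots> = of_nat q + of_nat q / (Z ^ q - 1)" by (simp add: sum.distrib *)
  also have "\<dots> = of_nat q * Z ^ q / (Z ^ q - 1)" using Z by (simp add: field_simps)
  finally show ?thesis .
qed

text \<open>The value at 1 of the q-th cyclotomic polynomial 1 + X + ... + X^(q - 1).\<close>

lemma prime_order_prod_one:
  fixes w :: "'a :: field_char_0"
  assumes q: "Factorial_Ring.prime (q :: nat)" and w: "w ^ q = 1" "w \<noteq> 1"
  shows "(\<Prod>i\<in>{0<..<q}. 1 - w ^ i) = of_nat q"
proof -
  have q0: "q > 0" using q prime_gt_0_nat by blast
  have "[:- 1, 1:] * (\<Prod>i\<in>{0<..<q}. [:- (w ^ i), 1:]) = (\<Prod>i\<in>insert 0 {0<..<q}. [:- (w ^ i), 1:])"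
    by (subst prod.insert) auto
  also have "insert 0 {0<..<q} = {..<q}" using q0 by auto
  also have "(\<Prod>i<q. [:- (w ^ i), 1:]) = Polynomial.monom 1 q - 1" by (rule prime_order_poly[OF assms, symmetric])
  also have "Polynomial.monom (1 :: 'a) q - 1 = [:0, 1:] ^ q - 1" by (simp add: monom_altdef)
  also have "\<dots> = ([:0, 1:] - 1) * (\<Sum>i<q. [:0, 1:] ^ i)" by (rule power_diff_1_eq)
  also have "[:0, 1:] - 1 = [:- 1, 1 :: 'a:]" by (simp add: one_pCons)
  finally have "(\<Prod>i\<in>{0<..<q}. [:- (w ^ i), 1:]) = (\<Sum>i<q. [:0, 1:] ^ i)"
    by (subst (asm) mult_cancel_left) auto
  hence "poly (\<Prod>i\<in>{0<..<q}. [:- (w ^ i), 1:]) 1 = poly (\<Sum>i<q. [:0, 1:] ^ i) 1" by simp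
  thus ?thesis by (simp add: poly_prod poly_sum)
qed

section \<open>The cyclotomic tower\<close>

text \<open>For k prime to p the elements \<zeta>^k - 1 and \<zeta> - 1 are associates: \<zeta> is
  itself a power of \<zeta>^k, and a geometric sum gives the quotient in either direction.\<close>

lemma root_of_unity_power_minus_one:
  fixes \<zeta> :: "'p :: prime_card padic_closure"
  assumes \<zeta>: "\<zeta> ^ (CARD('p) ^ n) = 1"
  shows "\<exists>u\<in>integral_elements. \<zeta> ^ k - 1 = (\<zeta> - 1) * u"
    and "\<not> CARD('p) dvd k \<Longrightarrow> \<exists>u\<in>integral_elements. \<zeta> - 1 = (\<zeta> ^ k - 1) * u"
proof -
  have gen: "\<exists>u\<in>integral_elements. \<eta> ^ k - 1 = (\<eta> - 1) * u" if "\<eta> \<in> integral_elements"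
    for \<eta> :: "'p padic_closure" and k
    by (rule bexI[of _ "\<Sum>i<k. \<eta> ^ i"]) (auto simp: power_diff_1_eq intro!: integral_sum integral_power that)
  have int: "\<zeta> \<in> integral_elements" by (rule integral_root_of_unity[OF \<zeta>]) simp
  show "\<exists>u\<in>integral_elements. \<zeta> ^ k - 1 = (\<zeta> - 1) * u" by (rule gen[OF int])
  assume "\<not> CARD('p) dvd k"
  hence "coprime k (CARD('p) ^ n)"
    using prime_card[where 'a = 'p] by (metis coprime_commute coprime_power_right_iff prime_imp_coprime)
  moreover have "k \<noteq> 0" using \<open>\<not> CARD('p) dvd k\<close> by (metis dvd_0_right)
  ultimately obtain x y where "k * x = CARD('p) ^ n * y + 1" using bezout_nat[of k "CARD('p) ^ n"] by auto
  hence "\<zeta> ^ (k * x) = \<zeta>" by (simp add: power_add power_mult \<zeta>)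
  hence "(\<zeta> ^ k) ^ x = \<zeta>" by (simp add: power_mult)
  thus "\<exists>u\<in>integral_elements. \<zeta> - 1 = (\<zeta> ^ k - 1) * u"
    using gen[OF integral_power[OF int, of k], of x] by simp
qed

locale cyclotomic_tower =
  fixes \<xi> :: "nat \<Rightarrow> 'p :: prime_card padic_closure"
  assumes odd_p: "odd CARD('p)" and compatible: "compatible_primitive_roots \<xi>"
begin

lemma xi_root: "n \<ge> 1 \<Longrightarrow> \<xi> n ^ (CARD('p) ^ n) = 1"
  and xi_primitive: "n \<ge> 1 \<Longrightarrow> 0 < k \<Longrightarrow> k < CARD('p) ^ n \<Longrightarrow> \<xi> n ^ k \<noteq> 1"
  and xi_Suc: "n \<ge> 1 \<Longrightarrow> \<xi> (Suc n) ^ CARD('p) = \<xi> n"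
  using compatible unfolding compatible_primitive_roots_def by blast+

lemma p_power_root_xi: "n \<ge> 1 \<Longrightarrow> p_power_root (\<xi> n) n"
  by standard (use odd_p xi_root in auto)

lemma xi_nz [simp]: "n \<ge> 1 \<Longrightarrow> \<xi> n \<noteq> 0"
  using xi_root[of n] by (auto simp: power_0_left)

lemma xi_power_p_power: "\<xi> (Suc (n + k)) ^ (CARD('p) ^ k) = \<xi> (Suc n)"
  by (induction k) (simp_all add: power_mult xi_Suc)

abbreviation \<omega> :: "'p padic_closure" where "\<omega> \<equiv> \<xi> 1"

lemma omega: "\<omega> ^ CARD('p) = 1" "\<omega> \<noteq> 1"
  using xi_root[of 1] xi_primitive[of 1 1] CARD_gt_1[where 'p = 'p] by auto

lemma omega_eq: "n \<ge> 1 \<Longrightarrow> \<xi> n ^ (CARD('p) ^ (n - 1)) = \<omega>"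
  using xi_power_p_power[of 0 "n - 1"] by simp

lemmas omega_prime = prime_card[where 'a = 'p]

lemma roots_bij: "bij_betw (\<lambda>i. \<omega> ^ i) {..<CARD('p)} {\<eta>. \<eta> ^ CARD('p) = 1}"
proof -
  have "\<eta> \<in> (\<lambda>i. \<omega> ^ i) ` {..<CARD('p)}" if "\<eta> ^ CARD('p) = 1" for \<eta>
  proof -
    have "(\<Prod>i<CARD('p). \<omega> ^ i * 1 - \<eta>) = 0"
      by (subst prime_order_prod[OF omega_prime odd_p omega]) (simp add: that)
    thus ?thesis by (auto simp: prod_zero_iff)
  qed
  moreover have "(\<omega> ^ i) ^ CARD('p) = 1" for i
    using omega(1) by (metis mult.commute power_mult power_one)
  ultimately show ?thesis
    unfolding bij_betw_def using prime_order_powers_inj[OF omega_prime omega] by auto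
qed

text \<open>For n \<ge> 1 this is Euler's totient of p^n, the degree and ramification index of K_n
  over Q_p.\<close>

definition phi_deg :: "nat \<Rightarrow> nat" where
  "phi_deg n = (CARD('p) - 1) * CARD('p) ^ (n - 1)"

lemma phi_deg_unbounded: "\<exists>n\<ge>1. d < phi_deg n"
proof -
  have "d < CARD('p) ^ d"
    by (rule less_le_trans[OF less_exp]) (use CARD_gt_1[where 'p = 'p] in \<open>simp add: power_mono\<close>)
  also have "\<dots> \<le> phi_deg (Suc d)" using CARD_gt_1[where 'p = 'p] by (simp add: phi_deg_def)
  finally show ?thesis by (intro exI[of _ "Suc d"]) simp
qed

text \<open>Half of total ramification. At level 1 it follows from p = \<Prod> (1 - \<omega>^i).
  From n to n + 1 it follows because \<xi>_n - 1 is the product of the p factors \<omega>^i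
  \<xi>_{n+1} - 1, each a multiple of \<xi>_{n+1} - 1.\<close>

lemma xi_minus_one_power_dvd:
  "n \<ge> 1 \<Longrightarrow> \<exists>v\<in>integral_elements. of_nat CARD('p) = v * (\<xi> n - 1) ^ phi_deg n"
proof (induction n rule: nat_induct_at_least)
  case base
  have "\<forall>i. \<exists>u\<in>integral_elements. \<omega> ^ i - 1 = (\<omega> - 1) * u"
    using root_of_unity_power_minus_one(1)[of \<omega> 1] omega(1) by simp
  then obtain u where u: "\<And>i. u i \<in> integral_elements" "\<And>i. \<omega> ^ i - 1 = (\<omega> - 1) * u i" by metis
  have "of_nat CARD('p) = (\<Prod>i\<in>{0<..<CARD('p)}. 1 - \<omega> ^ i)"
    by (rule prime_order_prod_one[OF omega_prime omega, symmetric])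
  also have "\<dots> = (\<Prod>i\<in>{0<..<CARD('p)}. - u i * (\<omega> - 1))"
    by (intro prod.cong refl) (use u(2) in \<open>simp add: algebra_simps\<close>)
  also have "\<dots> = (\<Prod>i\<in>{0<..<CARD('p)}. - u i) * (\<omega> - 1) ^ phi_deg 1"
    unfolding prod.distrib by (simp add: phi_deg_def)
  finally have "of_nat CARD('p) = (\<Prod>i\<in>{0<..<CARD('p)}. - u i) * (\<omega> - 1) ^ phi_deg 1" .
  moreover have "(\<Prod>i\<in>A. - u i) \<in> integral_elements" for A
    by (induction A rule: infinite_finite_induct) (auto intro!: integral_binary integral_uminus u)
  ultimately show ?case by blast
next
  case (Suc n)
  then obtain v where v: "v \<in> integral_elements" "of_nat CARD('p) = v * (\<xi> n - 1) ^ phi_deg n" by blast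
  let ?x = "\<xi> (Suc n)"
  have "\<forall>i. \<exists>u\<in>integral_elements. ?x ^ (1 + i * CARD('p) ^ n) - 1 = (?x - 1) * u"
    by (intro allI root_of_unity_power_minus_one(1)[OF xi_root]) simp
  then obtain u where u: "\<And>i. u i \<in> integral_elements"
    "\<And>i. ?x ^ (1 + i * CARD('p) ^ n) - 1 = (?x - 1) * u i" by metis
  \<comment> \<open>As \<open>\<omega>\<close> is the p^n-th power of \<open>?x\<close>, every
    conjugate is again a power of \<open>?x\<close>.\<close>
  have w: "\<omega> ^ i * ?x = ?x ^ (1 + i * CARD('p) ^ n)" for i
  proof -
    have "?x ^ (i * CARD('p) ^ n) = \<omega> ^ i"
      using omega_eq[of "Suc n"] by (simp add: mult.commute[of i] power_mult)
    thus ?thesis by (simp add: power_add mult.commute)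
  qed
  have "\<xi> n - 1 = (\<Prod>i<CARD('p). \<omega> ^ i * ?x - 1)"
    using prime_order_prod[OF omega_prime odd_p omega, of ?x 1] xi_Suc[of n] Suc.hyps by simp
  also have "\<dots> = (\<Prod>i<CARD('p). u i * (?x - 1))"
    by (intro prod.cong refl) (subst w, subst u(2), rule mult.commute)
  also have "\<dots> = (\<Prod>i<CARD('p). u i) * (?x - 1) ^ CARD('p)" by (simp add: prod.distrib)
  finally have eq: "\<xi> n - 1 = (\<Prod>i<CARD('p). u i) * (?x - 1) ^ CARD('p)" .
  have pd: "phi_deg (Suc n) = CARD('p) * phi_deg n"
    using Suc.hyps by (cases n) (auto simp: phi_deg_def)
  have "of_nat CARD('p) = (v * (\<Prod>i<CARD('p). u i) ^ phi_deg n) * (?x - 1) ^ phi_deg (Suc n)"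
    unfolding v(2) eq pd by (simp only: power_mult_distrib power_mult mult_ac)
  moreover have "(\<Prod>i\<in>A. u i) \<in> integral_elements" for A
    by (induction A rule: infinite_finite_induct) (auto intro!: integral_binary u)
  ultimately show ?case using v(1) by (blast intro: integral_binary integral_power)
qed

text \<open>Some power of \<xi>_n - 1 is p times an integral element, so an integral inverse would
  make 1/p integral.\<close>

lemma xi_minus_one_not_unit:
  assumes "n \<ge> 1" "o' \<in> integral_elements"
  shows "(\<xi> n - 1) * o' \<noteq> 1"
proof
  assume 1: "(\<xi> n - 1) * o' = 1"
  obtain s where s: "s \<in> root_span (\<xi> n) n" "(\<xi> n - 1) ^ (CARD('p) ^ n) = of_nat CARD('p) * s"
    using odd_p xi_root[OF assms(1)] by (rule root_minus_one_power)
  have "s \<in> integral_elements"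
    by (rule zp_span_integral[OF _ s(1)]) (use integral_power[OF integral_root_of_unity[OF xi_root[OF assms(1)]]] in simp)
  hence int: "s * o' ^ (CARD('p) ^ n) \<in> integral_elements" using assms(2) by (intro integral_binary integral_power)
  have "1 = ((\<xi> n - 1) * o') ^ (CARD('p) ^ n)" by (simp add: 1)
  also have "\<dots> = of_nat CARD('p) * (s * o' ^ (CARD('p) ^ n))"
    by (simp only: power_mult_distrib s(2) mult.assoc)
  finally have "1 / of_nat CARD('p) = s * o' ^ (CARD('p) ^ n)" by (simp add: field_simps)
  thus False using int inverse_prime_not_integral[where 'p = 'p] by simp
qed

text \<open>A Newton polygon argument phrased by divisibility. Write f = p A + T^d U with U
  invertible. A zero at x = \<xi>_n - 1 makes x^d a multiple of p, hence of x^phi(p^n) with phi(p^n)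
  > d, and cancelling x^d makes x a unit.\<close>

lemma eval_nonzero_if_first_unit_coeff:
  fixes f :: "'p padic_int fps"
  assumes n: "n \<ge> 1" "d < phi_deg n" and f: "\<And>i. i < d \<Longrightarrow> pp dvd f $ i" "\<not> pp dvd f $ d"
  shows "twist f (\<xi> n) $ 0 \<noteq> 0"
proof
  assume 0: "twist f (\<xi> n) $ 0 = 0"
  interpret p_power_root "\<xi> n" n by (rule p_power_root_xi[OF n(1)])
  let ?x = "\<xi> n - 1"
  define A where "A = Abs_fps (\<lambda>i. if i < d then THE y. f $ i = pp * y else 0)"
  define U where "U = fps_shift d f"
  have A: "f $ i = pp * (A $ i)" if "i < d" for i
  proof -
    obtain y where "f $ i = pp * y" using f(1)[OF \<open>i < d\<close>] by (auto simp: dvd_def)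
    hence "(THE y. f $ i = pp * y) = y" by (intro the_equality) auto
    thus ?thesis using that \<open>f $ i = pp * y\<close> by (simp add: A_def)
  qed
  have fAU: "f = fps_const pp * A + U * fps_X ^ d"
    by (rule fps_ext) (use A in \<open>auto simp: U_def A_def fps_X_power_mult_right_nth\<close>)
  have "U $ 0 dvd 1" using f(2) by (simp add: U_def padic_unit_iff)
  then obtain y where y: "1 = U $ 0 * y" by (auto simp: dvd_def)
  hence "U * fps_right_inverse U y = 1" by (intro fps_right_inverse) simp
  hence "twist U (\<xi> n) * twist (fps_right_inverse U y) (\<xi> n) = 1" by (simp flip: twist_mult)
  hence "(twist U (\<xi> n) * twist (fps_right_inverse U y) (\<xi> n)) $ 0 = 1" by simp
  hence u: "twist U (\<xi> n) $ 0 * twist (fps_right_inverse U y) (\<xi> n) $ 0 = 1" by simp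
  define u where "u = twist (fps_right_inverse U y) (\<xi> n) $ 0"
  define o1 where "o1 = - (twist A (\<xi> n) $ 0) * u"
  have "of_nat CARD('p) * twist A (\<xi> n) $ 0 + twist U (\<xi> n) $ 0 * ?x ^ d = 0"
    using 0 by (subst (asm) fAU)
      (simp add: twist_add twist_const twist_mult twist_power twist_X shifted_X_linear fps_nth_power_0)
  hence "u * (of_nat CARD('p) * twist A (\<xi> n) $ 0 + twist U (\<xi> n) $ 0 * ?x ^ d) = 0" by simp
  hence "of_nat CARD('p) * (twist A (\<xi> n) $ 0 * u) + (twist U (\<xi> n) $ 0 * u) * ?x ^ d = 0"
    by (simp add: algebra_simps)
  hence xd: "?x ^ d = of_nat CARD('p) * o1"
    using u by (simp add: o1_def u_def eq_neg_iff_add_eq_0 add.commute)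
  have o1: "o1 \<in> integral_elements"
    unfolding o1_def u_def by (intro integral_binary integral_uminus twist_integral)
  obtain v where v: "v \<in> integral_elements" "of_nat CARD('p) = v * ?x ^ phi_deg n"
    using xi_minus_one_power_dvd[OF n(1)] by blast
  have x: "?x \<noteq> 0" using xi_primitive[OF n(1), of 1] n(1) one_less_power[OF CARD_gt_1[where 'p = 'p], of n] by simp
  \<comment> \<open>The strict inequality leaves one factor x after x^d is cancelled.\<close>
  have "phi_deg n = d + (1 + (phi_deg n - Suc d))" using n(2) by simp
  hence "?x ^ phi_deg n = ?x ^ d * (?x * ?x ^ (phi_deg n - Suc d))" by (metis power_add power_one_right)
  hence "?x ^ d * 1 = ?x ^ d * (?x * (?x ^ (phi_deg n - Suc d) * (v * o1)))"
    using xd v(2) by (simp add: mult_ac)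
  hence "?x * (?x ^ (phi_deg n - Suc d) * (v * o1)) = 1" using x by (subst (asm) mult_cancel_left) auto
  moreover have "?x ^ (phi_deg n - Suc d) * (v * o1) \<in> integral_elements"
    using integral_root_of_unity[OF xi_root[OF n(1)]] v(1) o1
    by (intro integral_binary integral_power integral_diff) auto
  ultimately show False using xi_minus_one_not_unit[OF n(1)] by blast
qed

text \<open>One nonzero coefficient bounds the power of p that divides all of f, so a largest such
  power exists. The index d is the first at which this minimal valuation is attained.\<close>

lemma fps_content:
  fixes f :: "'p padic_int fps"
  assumes "f \<noteq> 0"
  obtains k g d where "f = fps_const (pp ^ k) * g" "\<forall>i<d. pp dvd g $ i" "\<not> pp dvd g $ d"
proof -
  obtain j where j: "f $ j \<noteq> 0" using assms by (auto simp: fps_eq_iff)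
  obtain m where m: "\<not> pp ^ m dvd f $ j" using j pp_power_separated by blast
  define P where "P = (\<lambda>m. \<forall>i. pp ^ m dvd f $ i)"
  have notP: "\<not> P k" if "k \<ge> m" for k
    using m that by (auto simp: P_def intro: dvd_trans[OF le_imp_power_dvd])
  have "P 0" by (simp add: P_def)
  define k where "k = Greatest P"
  have k: "P k" unfolding k_def
    by (rule GreatestI_nat[where k = 0 and b = m]) (use \<open>P 0\<close> notP in \<open>metis nle_le\<close>)+
  have k': "\<not> P (Suc k)"
  proof
    assume "P (Suc k)"
    hence "Suc k \<le> k" unfolding k_def
      by (rule Greatest_le_nat[where b = m]) (use \<open>P (Suc k)\<close> notP in \<open>metis nle_le\<close>)+
    thus False by simp
  qed
  have "\<forall>i. \<exists>y. f $ i = pp ^ k * y" using k by (auto simp: P_def dvd_def)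
  then obtain y where y: "\<And>i. f $ i = pp ^ k * y i" by metis
  define g where "g = Abs_fps y"
  have g: "f = fps_const (pp ^ k) * g" by (rule fps_ext) (simp add: g_def y)
  have ex: "\<exists>i. \<not> pp dvd g $ i"
    using k' by (auto simp: P_def y g_def)
  define d where "d = (LEAST i. \<not> pp dvd g $ i)"
  show ?thesis
    by (rule that[OF g, of d]) (use LeastI_ex[OF ex] not_less_Least in \<open>auto simp: d_def\<close>)
qed

text \<open>Linear independence over Z_p of the powers of \<xi>_n - 1 below phi(p^n). The degree of
  K_n is deduced from it.\<close>

lemma eval_nonzero_if_low_degree:
  fixes f :: "'p padic_int fps"
  assumes "f \<noteq> 0" "n \<ge> 1" "\<And>i. i \<ge> phi_deg n \<Longrightarrow> f $ i = 0"
  shows "twist f (\<xi> n) $ 0 \<noteq> 0"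
proof -
  interpret p_power_root "\<xi> n" n by (rule p_power_root_xi[OF assms(2)])
  obtain k g d where g: "f = fps_const (pp ^ k) * g" "\<forall>i<d. pp dvd g $ i" "\<not> pp dvd g $ d"
    using assms(1) by (rule fps_content)
  have "f $ d \<noteq> 0" using g(3) by (auto simp: g(1))
  hence "d < phi_deg n" using assms(3) by (meson not_le)
  hence "twist g (\<xi> n) $ 0 \<noteq> 0" by (rule eval_nonzero_if_first_unit_coeff[OF assms(2) _ g(2)[rule_format] g(3)])
  thus ?thesis by (simp add: g(1) twist_scale)
qed

text \<open>The uniqueness half of Coleman's theorem. The index of the first unit coefficient of the
  difference, freed of its content, is fixed, whereas phi(p^n) is unbounded; so the difference is
  nonzero at some \<xi>_n - 1.\<close>

lemma eval_determines_fps: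
  fixes f g :: "'p padic_int fps"
  assumes "\<And>n. n \<ge> 1 \<Longrightarrow> twist f (\<xi> n) $ 0 = twist g (\<xi> n) $ 0"
  shows "f = g"
proof (rule ccontr)
  assume "f \<noteq> g"
  hence "f - g \<noteq> 0" by simp
  then obtain k h d where h: "f - g = fps_const (pp ^ k) * h" "\<forall>i<d. pp dvd h $ i" "\<not> pp dvd h $ d"
    by (rule fps_content)
  obtain n where n: "n \<ge> 1" "d < phi_deg n" using phi_deg_unbounded by blast
  interpret p_power_root "\<xi> n" n by (rule p_power_root_xi[OF n(1)])
  have "twist (f - g) (\<xi> n) $ 0 = 0" using assms[OF n(1)] by (simp add: twist_diff)
  hence "twist h (\<xi> n) $ 0 = 0" by (simp add: h(1) twist_scale)
  thus False using eval_nonzero_if_first_unit_coeff[OF n h(2)[rule_format] h(3)] by blast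
qed

end

section \<open>Galois conjugates in the cyclotomic tower\<close>

abbreviation ac_poly :: "'p :: prime_card padic poly \<Rightarrow> 'p padic_closure \<Rightarrow> 'p padic_closure" where
  "ac_poly P x \<equiv> poly (map_poly to_ac P) x"

interpretation to_ac_base: comm_ring_hom "to_ac :: 'p :: prime_card padic \<Rightarrow> 'p padic_closure"
  by unfold_locales simp_all

interpretation to_ac_hom: map_poly_comm_ring_hom "to_ac :: 'p :: prime_card padic \<Rightarrow> 'p padic_closure"
  by unfold_locales simp_all

lemma ac_poly_pCons: "ac_poly (pCons c P) x = to_ac c + x * ac_poly P x"
  by (simp add: to_ac_base.map_poly_pCons_hom)

lemma ac_poly_add: "ac_poly (P + Q) x = ac_poly P x + ac_poly Q x"
  by (simp add: to_ac_hom.hom_add)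

lemma ac_poly_mult: "ac_poly (P * Q) x = ac_poly P x * ac_poly Q x"
  by (simp add: to_ac_hom.hom_mult)

lemma ac_poly_diff: "ac_poly (P - Q) x = ac_poly P x - ac_poly Q x"
  using ac_poly_add[of "P - Q" Q x] by simp

lemma ac_poly_pcompose: "ac_poly (pcompose P Q) x = ac_poly P (ac_poly Q x)"
  by (induction P) (simp_all add: pcompose_pCons ac_poly_pCons ac_poly_add ac_poly_mult)

lemma ac_poly_X: "ac_poly [:0, 1:] x = x"
  by (simp add: ac_poly_pCons)

lemma ac_poly_X_power: "ac_poly ([:0, 1:] ^ k) x = x ^ k"
  by (induction k) (simp_all add: ac_poly_mult ac_poly_X del: mult_pCons_left)

text \<open>Factors X are removed from an annihilating polynomial until its constant term c is
  nonzero. Then y Q(y) = -c displays the inverse of y as a polynomial in y.\<close>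

lemma ac_poly_inverse:
  fixes y :: "'p :: prime_card padic_closure"
  assumes "y \<noteq> 0"
  shows "\<exists>R. inverse y = ac_poly R y"
proof -
  have "\<exists>R. inverse y = ac_poly R y" if "Q \<noteq> 0" "ac_poly Q y = 0" for Q
    using that
  proof (induction Q)
    case (pCons c Q)
    show ?case
    proof (cases "c = 0")
      case True
      hence "y * ac_poly Q y = 0" using pCons.prems by (simp add: ac_poly_pCons)
      thus ?thesis using assms pCons True by auto
    next
      case False
      have "y * ac_poly Q y = - to_ac c"
        using pCons.prems by (simp add: ac_poly_pCons eq_neg_iff_add_eq_0 add.commute)
      hence "y * (ac_poly Q y * to_ac (- inverse c)) = 1" using False by (simp flip: mult.assoc)
      hence "y * ac_poly (Q * [:- inverse c:]) y = 1" by (simp only: ac_poly_mult ac_poly_pCons) simp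
      hence "inverse y = ac_poly (Q * [:- inverse c:]) y" by (rule inverse_unique)
      thus ?thesis by blast
    qed
  qed simp
  moreover obtain Q where "Q \<noteq> 0" "ac_poly Q y = 0" by (rule alg_closure_algebraic)
  ultimately show ?thesis by blast
qed

context cyclotomic_tower
begin

lemma xi_powers_inj:
  assumes "n \<ge> 1"
  shows "inj_on (\<lambda>k. \<xi> n ^ k) {..<CARD('p) ^ n}"
proof -
  have *: False if "i < j" "j < CARD('p) ^ n" "\<xi> n ^ i = \<xi> n ^ j" for i j
  proof -
    have "\<xi> n ^ j = \<xi> n ^ i * \<xi> n ^ (j - i)" using power_add[of "\<xi> n" i "j - i"] that by simp
    hence "\<xi> n ^ (j - i) = 1" using that(3) assms by simp
    thus False using xi_primitive[OF assms, of "j - i"] that by simp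
  qed
  show ?thesis by (rule inj_onI) (metis * lessThan_iff linorder_neqE_nat)
qed

lemma all_roots_xi_powers:
  assumes "n \<ge> 1" "z ^ (CARD('p) ^ n) = 1"
  shows "\<exists>k. z = \<xi> n ^ k"
proof -
  let ?N = "CARD('p) ^ n" and ?A = "(\<lambda>k. \<xi> n ^ k) ` {..<CARD('p) ^ n}"
  define P :: "'p padic_closure poly" where "P = Polynomial.monom 1 ?N - 1"
  have N: "?N > 0" by simp
  hence nz: "P \<noteq> 0" unfolding P_def by (metis degree_1 degree_monom_eq eq_iff_diff_eq_0 neq0_conv zero_neq_one)
  have deg: "Polynomial.degree P \<le> ?N"
    unfolding P_def by (rule degree_diff_le) (simp_all add: degree_monom_le)
  have set: "{z. poly P z = 0} = {z. z ^ ?N = 1}" by (simp add: P_def poly_monom)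
  have sub: "?A \<subseteq> {z. z ^ ?N = 1}"
    using xi_root[OF assms(1)] by (auto simp flip: power_mult) (metis mult.commute power_mult power_one)
  have fin: "finite {z. poly P z = 0}" by (rule poly_roots_finite[OF nz])
  have "card {z :: 'p padic_closure. z ^ ?N = 1} \<le> card ?A"
    using order_trans[OF card_poly_roots_bound[OF nz] deg] xi_powers_inj[OF assms(1)]
    unfolding set by (simp add: card_image)
  hence "?A = {z. z ^ ?N = 1}" using fin sub unfolding set by (intro card_seteq) auto
  thus ?thesis using assms(2) by blast
qed

text \<open>The polynomial expressions in \<xi>_n already form a field: the inverse of P(\<xi>_n) is
  a polynomial in P(\<xi>_n), hence a composed polynomial in \<xi>_n. All p^n-th roots of unity
  occur, being powers of \<xi>_n.\<close>

lemma root_field_eq: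
  assumes n: "n \<ge> 1"
  shows "root_field n = range (\<lambda>P. ac_poly P (\<xi> n))"
proof
  let ?R = "range (\<lambda>P. ac_poly P (\<xi> n))"
  have "range to_ac \<subseteq> ?R"
  proof clarify
    fix c :: "'p padic"
    have "to_ac c = ac_poly [:c:] (\<xi> n)" by (simp add: ac_poly_pCons)
    thus "to_ac c \<in> ?R" by blast
  qed
  moreover have "{z. z ^ (CARD('p) ^ n) = 1} \<subseteq> ?R"
  proof clarify
    fix z :: "'p padic_closure" assume "z ^ (CARD('p) ^ n) = 1"
    then obtain k where "z = \<xi> n ^ k" using all_roots_xi_powers[OF n] by blast
    hence "z = ac_poly ([:0, 1:] ^ k) (\<xi> n)" by (simp only: ac_poly_X_power)
    thus "z \<in> ?R" by blast
  qed
  moreover have "x - y \<in> ?R \<and> x * y \<in> ?R \<and> inverse x \<in> ?R" if xy: "x \<in> ?R" "y \<in> ?R" for x y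
  proof -
    obtain P Q where P: "x = ac_poly P (\<xi> n)" and Q: "y = ac_poly Q (\<xi> n)" using xy by blast
    have "\<exists>R. inverse x = ac_poly R (\<xi> n)"
    proof (cases "x = 0")
      case True
      thus ?thesis by (intro exI[of _ 0]) simp
    next
      case False
      then obtain R where "inverse x = ac_poly R x" using ac_poly_inverse by blast
      hence "inverse x = ac_poly (pcompose R P) (\<xi> n)" unfolding P ac_poly_pcompose .
      thus ?thesis by blast
    qed
    moreover have "x - y = ac_poly (P - Q) (\<xi> n)" "x * y = ac_poly (P * Q) (\<xi> n)"
      by (simp_all only: P Q ac_poly_diff ac_poly_mult)
    ultimately show ?thesis by blast
  qed
  ultimately show "root_field n \<subseteq> ?R" unfolding root_field_def by (intro Inter_lower) blast
  show "?R \<subseteq> root_field n"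
    unfolding root_field_def
  proof (intro Inter_greatest, clarify)
    fix F :: "'p padic_closure set" and P :: "'p padic poly"
    assume F: "range to_ac \<subseteq> F" "{z. z ^ (CARD('p) ^ n) = 1} \<subseteq> F"
      "\<forall>x\<in>F. \<forall>y\<in>F. x - y \<in> F \<and> x * y \<in> F \<and> inverse x \<in> F"
    have ac: "to_ac c \<in> F" for c using F(1) by blast
    have x: "\<xi> n \<in> F" using F(2) xi_root[OF n] by blast
    have add: "x + y \<in> F" if "x \<in> F" "y \<in> F" for x y
    proof -
      have "to_ac 0 - y \<in> F" using F(3) ac that by blast
      hence "x - (to_ac 0 - y) \<in> F" using F(3) that by blast
      thus ?thesis by simp
    qed
    show "ac_poly P (\<xi> n) \<in> F"
    proof (induction P)
      case 0
      show ?case using ac[of 0] by simp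
    next
      case (pCons c P)
      show ?case unfolding ac_poly_pCons using add ac x pCons F(3) by blast
    qed
  qed
qed

text \<open>With denominators cleared, P(\<xi>_n) is up to a power of p the value at T = \<xi>_n - 1
  of the polynomial P(1 + T), whose degree is below phi(p^n). Nonvanishing of such values thus plays
  the part of the irreducibility of the cyclotomic polynomial.\<close>

lemma xi_algebraic_degree:
  fixes P :: "'p padic poly"
  assumes n: "n \<ge> 1" and P: "P \<noteq> 0" "Polynomial.degree P < phi_deg n"
  shows "ac_poly P (\<xi> n) \<noteq> 0"
proof
  assume 0: "ac_poly P (\<xi> n) = 0"
  interpret p_power_root "\<xi> n" n by (rule p_power_root_xi[OF n])
  let ?d = "Polynomial.degree P"
  obtain k q where q: "\<forall>i. Polynomial.coeff P i * of_nat CARD('p) ^ k = Fract (q i) 1"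
    by (rule clear_denominators[of P])
  define f where "f = (\<Sum>i\<le>?d. fps_const (q i) * (1 + fps_X) ^ i)"
  have bin: "((1 + fps_X :: 'p padic_int fps) ^ i) $ j = of_nat (i choose j)" for i j
    using fps_linear_power_nth[of "1 :: 'p padic_int" 1 i j] by (auto simp: not_le binomial_eq_0)
  have fn: "f $ j = (\<Sum>i\<le>?d. q i * of_nat (i choose j))" for j
    by (simp add: f_def fps_sum_nth bin)
  have zero: "f $ j = 0" if "j \<ge> phi_deg n" for j
    unfolding fn using that P(2) by (intro sum.neutral) (auto intro!: binomial_eq_0)
  have "f $ ?d = (\<Sum>i\<le>?d. if i = ?d then q ?d else 0)"
    unfolding fn by (intro sum.cong refl) (auto simp: le_less intro!: binomial_eq_0)
  hence "f $ ?d = q ?d" by simp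
  moreover have "q ?d \<noteq> 0"
  proof
    assume "q ?d = 0"
    hence "Polynomial.coeff P ?d * of_nat CARD('p) ^ k = 0" using q by (simp add: Zero_fract_def)
    thus False using P(1) by simp
  qed
  ultimately have "f \<noteq> 0" by auto
  hence nz: "twist f (\<xi> n) $ 0 \<noteq> 0" by (rule eval_nonzero_if_low_degree[OF _ n zero])
  have "twist f (\<xi> n) $ 0 = (\<Sum>i\<le>?d. zp_embed (q i) * \<xi> n ^ i)"
    by (simp add: f_def twist_sum twist_scale twist_power twist_1_X fps_sum_nth fps_nth_power_0 twist_mult twist_const)
  also have "\<dots> = (\<Sum>i\<le>?d. to_ac (Polynomial.coeff P i * of_nat CARD('p) ^ k) * \<xi> n ^ i)"
    by (intro sum.cong refl) (simp add: q[rule_format] zp_embed_def del: to_ac_mult)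
  also have "\<dots> = to_ac (of_nat CARD('p) ^ k) * ac_poly P (\<xi> n)"
    by (simp add: poly_altdef degree_map_poly coeff_map_poly sum_distrib_left mult_ac)
  finally show False using nz 0 by simp
qed

text \<open>F is the cyclotomic polynomial of order p^(n + 1). By the degree bound, the remainder of
  P modulo F is 0, and \<omega>^i \<xi>_{n+1} is a root of F because its p^n-th power is again
  \<omega>.\<close>

lemma conjugate_root:
  fixes P :: "'p padic poly"
  assumes n: "n \<ge> 1" and P: "ac_poly P (\<xi> (Suc n)) = 0"
  shows "ac_poly P (\<omega> ^ i * \<xi> (Suc n)) = 0"
proof -
  define F :: "'p padic poly" where "F = (\<Sum>i<CARD('p). Polynomial.monom 1 (i * CARD('p) ^ n))"
  have deg: "Polynomial.degree F \<le> phi_deg (Suc n)"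
    unfolding F_def
  proof (rule degree_sum_le)
    fix i assume "i \<in> {..<CARD('p)}"
    hence "i * CARD('p) ^ n \<le> (CARD('p) - 1) * CARD('p) ^ n" by (intro mult_le_mono) auto
    thus "Polynomial.degree (Polynomial.monom (1 :: 'p padic) (i * CARD('p) ^ n)) \<le> phi_deg (Suc n)"
      by (simp add: phi_deg_def degree_monom_eq)
  qed simp
  have "poly.coeff F (phi_deg (Suc n)) = (\<Sum>i<CARD('p). if i = CARD('p) - 1 then 1 else 0)"
    unfolding F_def coeff_sum by (intro sum.cong) (auto simp: phi_deg_def)
  also have "\<dots> = 1" using CARD_gt_1[where 'p = 'p] by simp
  finally have lead: "poly.coeff F (phi_deg (Suc n)) = 1" .
  hence F0: "F \<noteq> 0" by auto
  have degF: "Polynomial.degree F = phi_deg (Suc n)"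
    using deg lead by (metis le_antisym le_degree zero_neq_one)
  have Fx: "ac_poly F x = (\<Sum>i<CARD('p). (x ^ (CARD('p) ^ n)) ^ i)" for x
    by (simp add: F_def to_ac_hom.hom_sum poly_sum map_poly_monom poly_monom mult.commute flip: power_mult)
  have F_root: "ac_poly F x = 0" if "x ^ (CARD('p) ^ n) = \<omega>" for x
    using omega unfolding Fx that by (simp add: geometric_sum)
  have x: "\<xi> (Suc n) ^ (CARD('p) ^ n) = \<omega>" using omega_eq[of "Suc n"] by simp
  have wx: "(\<omega> ^ i * \<xi> (Suc n)) ^ (CARD('p) ^ n) = \<omega>"
  proof -
    have "(\<omega> ^ i) ^ (CARD('p) ^ n) = ((\<omega> ^ CARD('p)) ^ (CARD('p) ^ (n - 1))) ^ i"
      using n by (cases n) (simp_all add: mult_ac flip: power_mult)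
    thus ?thesis using x omega by (simp add: power_mult_distrib)
  qed
  have PF: "P = P div F * F + P mod F" by simp
  have ev: "ac_poly P y = ac_poly (P div F) y * ac_poly F y + ac_poly (P mod F) y" for y
    by (subst PF) (simp only: ac_poly_add ac_poly_mult)
  have "ac_poly (P mod F) (\<xi> (Suc n)) = 0" using ev[of "\<xi> (Suc n)"] P F_root[OF x] by simp
  hence "P mod F = 0"
    using xi_algebraic_degree[of "Suc n" "P mod F"] degree_mod_less[OF F0, of P] degF by fastforce
  thus ?thesis using ev[of "\<omega> ^ i * \<xi> (Suc n)"] F_root[OF wx] by simp
qed

text \<open>The embedding with \<xi>_{n+1} \<mapsto> \<omega>^i \<xi>_{n+1}. The choice of a
  polynomial representing y is harmless by \<open>conjugate_root\<close>.\<close>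

definition conj_map :: "nat \<Rightarrow> nat \<Rightarrow> 'p padic_closure \<Rightarrow> 'p padic_closure" where
  "conj_map n i = (\<lambda>y\<in>root_field (Suc n).
     ac_poly (SOME P. ac_poly P (\<xi> (Suc n)) = y) (\<omega> ^ i * \<xi> (Suc n)))"

lemma conj_map_ac_poly:
  assumes n: "n \<ge> 1"
  shows "conj_map n i (ac_poly P (\<xi> (Suc n))) = ac_poly P (\<omega> ^ i * \<xi> (Suc n))"
proof -
  let ?x = "\<xi> (Suc n)"
  define Q where "Q = (SOME Q. ac_poly Q ?x = ac_poly P ?x)"
  have "ac_poly Q ?x = ac_poly P ?x" unfolding Q_def by (rule someI[of _ P]) simp
  hence "ac_poly (Q - P) ?x = 0" by (simp add: ac_poly_diff)
  hence "ac_poly (Q - P) (\<omega> ^ i * ?x) = 0" by (rule conjugate_root[OF n])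
  hence "ac_poly Q (\<omega> ^ i * ?x) = ac_poly P (\<omega> ^ i * ?x)" by (simp add: ac_poly_diff)
  moreover have "ac_poly P ?x \<in> root_field (Suc n)" by (simp add: root_field_eq)
  ultimately show ?thesis by (simp add: conj_map_def Q_def)
qed

text \<open>An embedding over K_n is determined by the image of \<xi>_{n+1}, a p-th root of \<xi>_n,
  so it is one of the \<omega>^i \<xi>_{n+1}. Conversely, elements of K_n are polynomials in
  \<xi>_{n+1}^p, which the substitution does not change.\<close>

lemma field_embeddings_eq:
  assumes n: "n \<ge> 1"
  shows "field_embeddings (root_field n) (root_field (Suc n)) = conj_map n ` {..<CARD('p)}"
proof (intro equalityI subsetI)
  let ?K = "root_field n :: 'p padic_closure set" and ?L = "root_field (Suc n) :: 'p padic_closure set"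
    and ?x = "\<xi> (Suc n)"
  have L: "y \<in> ?L \<longleftrightarrow> (\<exists>P. y = ac_poly P ?x)" for y using root_field_eq[of "Suc n"] by auto
  have K: "y \<in> ?K \<longleftrightarrow> (\<exists>P. y = ac_poly P (\<xi> n))" for y using root_field_eq[OF n] by auto
  have xp: "?x ^ CARD('p) = \<xi> n" using xi_Suc[OF n] .
  have Kpoly: "ac_poly P (\<xi> n) = ac_poly (pcompose P ([:0, 1:] ^ CARD('p))) ?x" for P
    by (simp only: ac_poly_pcompose ac_poly_X_power xp)
  {
    fix \<sigma> assume "\<sigma> \<in> conj_map n ` {..<CARD('p)}"
    then obtain i where i: "\<sigma> = conj_map n i" by blast
    have "\<sigma> y = y" if yK: "y \<in> ?K" for y
    proof -
      obtain P where P: "y = ac_poly P (\<xi> n)" using iffD1[OF K yK] by blast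
      have "\<sigma> y = ac_poly P ((\<omega> ^ i * ?x) ^ CARD('p))"
        unfolding P Kpoly i conj_map_ac_poly[OF n] by (simp only: ac_poly_pcompose ac_poly_X_power)
      also have "(\<omega> ^ i * ?x) ^ CARD('p) = \<xi> n"
      proof -
        have "(\<omega> ^ i) ^ CARD('p) = 1" using omega(1) by (metis mult.commute power_mult power_one)
        thus ?thesis by (simp add: power_mult_distrib xp)
      qed
      finally show ?thesis by (simp only: P)
    qed
    moreover have "\<sigma> (y + z) = \<sigma> y + \<sigma> z \<and> \<sigma> (y * z) = \<sigma> y * \<sigma> z" if yz: "y \<in> ?L" "z \<in> ?L" for y z
    proof -
      obtain P Q where P: "y = ac_poly P ?x" "z = ac_poly Q ?x"
        using iffD1[OF L yz(1)] iffD1[OF L yz(2)] by blast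
      show ?thesis unfolding P i
        by (simp only: conj_map_ac_poly[OF n] ac_poly_add[symmetric] ac_poly_mult[symmetric])
    qed
    moreover have "\<sigma> \<in> extensional ?L" by (simp add: i conj_map_def)
    ultimately show "\<sigma> \<in> field_embeddings ?K ?L" by (simp add: field_embeddings_def)
  }
  fix \<tau> assume "\<tau> \<in> field_embeddings ?K ?L"
  hence ext: "\<tau> \<in> extensional ?L" and fixK: "\<And>y. y \<in> ?K \<Longrightarrow> \<tau> y = y"
    and add: "\<And>y z. y \<in> ?L \<Longrightarrow> z \<in> ?L \<Longrightarrow> \<tau> (y + z) = \<tau> y + \<tau> z"
    and mult: "\<And>y z. y \<in> ?L \<Longrightarrow> z \<in> ?L \<Longrightarrow> \<tau> (y * z) = \<tau> y * \<tau> z"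
    by (auto simp: field_embeddings_def)
  have "ac_poly [:c:] (\<xi> n) \<in> ?K" for c using K by blast
  hence acK: "to_ac c \<in> ?K" for c :: "'p padic" by (simp add: ac_poly_pCons)
  have "ac_poly [:c:] ?x \<in> ?L" for c using L by blast
  hence acL: "to_ac c \<in> ?L" for c :: "'p padic" by (simp add: ac_poly_pCons)
  have xL: "?x \<in> ?L" using L ac_poly_X[symmetric] by blast
  have \<tau>_poly: "\<tau> (ac_poly P ?x) = ac_poly P (\<tau> ?x)" for P
  proof (induction P)
    case 0
    show ?case using fixK[OF acK[of 0]] by simp
  next
    case (pCons c P)
    have P: "ac_poly P ?x \<in> ?L" using L by blast
    hence xP: "?x * ac_poly P ?x \<in> ?L" using L xL by (metis ac_poly_mult)
    show ?case unfolding ac_poly_pCons add[OF acL xP] mult[OF xL P] pCons.IH fixK[OF acK] ..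
  qed
  have "\<tau> ?x ^ CARD('p) = \<tau> (?x ^ CARD('p))"
    using \<tau>_poly[of "[:0, 1:] ^ CARD('p)"] by (simp only: ac_poly_X_power)
  also have "\<dots> = \<xi> n" unfolding xp by (rule fixK) (use K ac_poly_X[symmetric] in blast)
  finally have "(\<tau> ?x / ?x) ^ CARD('p) = 1" using n xp by (simp add: power_divide)
  then obtain i where i: "i < CARD('p)" "\<tau> ?x / ?x = \<omega> ^ i"
    using roots_bij unfolding bij_betw_def by blast
  hence \<tau>x: "\<tau> ?x = \<omega> ^ i * ?x" by (simp add: field_simps)
  have "\<tau> = conj_map n i"
  proof (rule extensionalityI[OF ext])
    show "conj_map n i \<in> extensional ?L" by (simp add: conj_map_def)
    fix y assume "y \<in> ?L"
    then obtain P where "y = ac_poly P ?x" using iffD1[OF L] by blast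
    thus "\<tau> y = conj_map n i y" by (simp only: \<tau>_poly \<tau>x conj_map_ac_poly[OF n])
  qed
  thus "\<tau> \<in> conj_map n ` {..<CARD('p)}" using i(1) by blast
qed

lemma field_norm_ac_poly:
  assumes n: "n \<ge> 1"
  shows "field_norm (root_field n) (root_field (Suc n)) y = (\<Prod>i<CARD('p). conj_map n i y)"
proof -
  have "inj_on (conj_map n) {..<CARD('p)}"
  proof (rule inj_onI)
    fix i j assume *: "i \<in> {..<CARD('p)}" "j \<in> {..<CARD('p)}" "conj_map n i = conj_map n j"
    have "ac_poly [:0, 1:] (\<omega> ^ i * \<xi> (Suc n)) = ac_poly [:0, 1:] (\<omega> ^ j * \<xi> (Suc n))"
      using *(3) by (simp only: conj_map_ac_poly[OF n, symmetric])
    hence "\<omega> ^ i = \<omega> ^ j" by (simp add: ac_poly_X del: map_poly_pCons)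
    thus "i = j" using prime_order_powers_inj[OF omega_prime omega] *(1,2) by (auto dest: inj_onD)
  qed
  thus ?thesis unfolding field_norm_def field_embeddings_eq[OF n] by (simp add: prod.reindex)
qed

lemma xi_powi_mod: 
  assumes "n \<ge> 1" "[int k = a] (mod int CARD('p) ^ n)"
  shows "\<xi> n powi a = \<xi> n ^ k"
proof -
  obtain b where b: "a = int k + int (CARD('p) ^ n) * b" using assms(2) by (auto simp: cong_iff_lin)
  have "\<xi> n powi (int (CARD('p) ^ n) * b) = (\<xi> n powi int (CARD('p) ^ n)) powi b" by (simp only: power_int_mult)
  also have "\<dots> = 1" using xi_root[OF assms(1)] by (simp only: power_int_of_nat power_int_1_left)
  finally show ?thesis unfolding b using assms(1) by (simp add: power_int_add del: of_nat_power)
qed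

text \<open>The conjugates of numerator and denominator run over (\<omega>^k)^i \<xi>_{n+1}^k - 1
  and \<omega>^i \<xi>_{n+1} - 1. Since \<omega>^k is again a primitive p-th root of unity, the
  product formula evaluates both.\<close>

lemma cyclotomic_unit_norm_compatible:
  assumes a: "\<not> int CARD('p) dvd a"
  shows "cyclotomic_unit \<xi> a \<in> norm_compatible_units"
  unfolding norm_compatible_units_def
proof (intro CollectI allI impI conjI)
  fix n :: nat assume n: "n \<ge> 1"
  \<comment> \<open>The exponent \<open>a\<close> may be negative. A natural representative modulo
    p^(n + 1) can replace it at both levels n and n + 1.\<close>
  define k where "k = nat (a mod int CARD('p) ^ Suc n)"
  have k0: "int k = a mod int CARD('p) ^ Suc n" by (simp add: k_def)
  have ck: "[int k = a] (mod int CARD('p) ^ m)" if "m \<le> Suc n" for m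
  proof -
    have "[int k = a] (mod int CARD('p) ^ Suc n)" by (simp only: k0 cong_def mod_mod_trivial)
    thus ?thesis using that by (rule cong_dvd_modulus[OF _ le_imp_power_dvd])
  qed
  have kp: "\<not> CARD('p) dvd k"
    using a ck[of 1] cong_dvd_iff[of "int k" a "int CARD('p)"] by (simp add: int_dvd_int_iff)
  have c: "cyclotomic_unit \<xi> a m = (\<xi> m ^ k - 1) / (\<xi> m - 1)" if "m \<ge> 1" "m \<le> Suc n" for m
    unfolding cyclotomic_unit_def using xi_powi_mod[OF that(1) ck[OF that(2)]] by simp
  have x1: "\<xi> m \<noteq> 1" if "m \<ge> 1" for m
    using xi_primitive[OF that, of 1] that one_less_power[OF CARD_gt_1[where 'p = 'p], of m] by simp
  have xk: "\<xi> m ^ k \<noteq> 1" if "m \<ge> 1" for m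
    using root_of_unity_power_minus_one(2)[OF xi_root[OF that] kp] x1[OF that] by auto
  have int: "(\<xi> m ^ k - 1) / (\<xi> m - 1) \<in> integral_elements" "(\<xi> m - 1) / (\<xi> m ^ k - 1) \<in> integral_elements" if m: "m \<ge> 1" for m
  proof -
    obtain u where "u \<in> integral_elements" "\<xi> m ^ k - 1 = (\<xi> m - 1) * u"
      using root_of_unity_power_minus_one(1)[OF xi_root[OF m]] by blast
    thus "(\<xi> m ^ k - 1) / (\<xi> m - 1) \<in> integral_elements" using x1[OF m] by simp
    obtain v where v: "v \<in> integral_elements" "\<xi> m - 1 = (\<xi> m ^ k - 1) * v"
      using root_of_unity_power_minus_one(2)[OF xi_root[OF m] kp] by blast
    have "(\<xi> m - 1) / (\<xi> m ^ k - 1) = v" using xk[OF m] by (subst v(2)) simp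
    thus "(\<xi> m - 1) / (\<xi> m ^ k - 1) \<in> integral_elements" using v(1) by simp
  qed
  have mem: "\<xi> m ^ k - 1 = ac_poly ([:0, 1:] ^ k - 1) (\<xi> m)" "\<xi> m - 1 = ac_poly ([:0, 1:] - 1) (\<xi> m)" for m
    by (simp_all only: ac_poly_diff ac_poly_X_power ac_poly_X to_ac_hom.hom_one poly_1)
  have cyc: "cyclotomic_unit \<xi> a m \<in> root_field m" if m: "m \<ge> 1" "m \<le> Suc n" for m
  proof -
    obtain R where R: "inverse (\<xi> m - 1) = ac_poly R (\<xi> m - 1)" using ac_poly_inverse[of "\<xi> m - 1"] x1[OF m(1)] by auto
    have "cyclotomic_unit \<xi> a m = ac_poly (([:0, 1:] ^ k - 1) * pcompose R ([:0, 1:] - 1)) (\<xi> m)"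
      unfolding c[OF m] divide_inverse R ac_poly_mult ac_poly_pcompose mem[symmetric] ..
    thus ?thesis using root_field_eq[OF m(1)] by blast
  qed
  show "cyclotomic_unit \<xi> a n \<in> root_field_units n"
    unfolding root_field_units_def
    using cyc[OF n] c[OF n] int[OF n] x1[OF n] xk[OF n] by simp
  let ?x = "\<xi> (Suc n)"
  have wx: "\<omega> ^ i * ?x \<noteq> 1" for i
  proof
    assume "\<omega> ^ i * ?x = 1"
    hence "(\<omega> ^ i * ?x) ^ CARD('p) = 1" by simp
    moreover have "(\<omega> ^ i) ^ CARD('p) = 1" using omega(1) by (metis mult.commute power_mult power_one)
    ultimately have "\<xi> n = 1" using xi_Suc[OF n] by (simp add: power_mult_distrib)
    thus False using x1[OF n] by blast
  qed
  have conj: "conj_map n i (cyclotomic_unit \<xi> a (Suc n)) = ((\<omega> ^ k) ^ i * ?x ^ k - 1) / (\<omega> ^ i * ?x - 1)" for i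
  proof -
    obtain P where P: "cyclotomic_unit \<xi> a (Suc n) = ac_poly P ?x"
      using cyc[of "Suc n"] root_field_eq[of "Suc n"] by auto
    have "ac_poly (P * ([:0, 1:] - 1)) ?x = ac_poly ([:0, 1:] ^ k - 1) ?x"
      unfolding ac_poly_mult mem[symmetric] P[symmetric] using c[of "Suc n"] x1[of "Suc n"] by simp
    hence "conj_map n i (ac_poly (P * ([:0, 1:] - 1)) ?x) = conj_map n i (ac_poly ([:0, 1:] ^ k - 1) ?x)" by simp
    hence "ac_poly (P * ([:0, 1:] - 1)) (\<omega> ^ i * ?x) = ac_poly ([:0, 1:] ^ k - 1) (\<omega> ^ i * ?x)"
      by (simp only: conj_map_ac_poly[OF n])
    hence "ac_poly P (\<omega> ^ i * ?x) * (\<omega> ^ i * ?x - 1) = (\<omega> ^ i * ?x) ^ k - 1"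
      by (simp only: ac_poly_mult ac_poly_diff ac_poly_X_power ac_poly_X to_ac_hom.hom_one poly_1)
    thus ?thesis unfolding P conj_map_ac_poly[OF n] using wx[of i]
      by (simp add: field_simps power_mult_distrib flip: power_mult)
  qed
  have "(\<omega> ^ k) ^ CARD('p) = 1" using omega(1) by (metis mult.commute power_mult power_one)
  note wk = this prime_order_power_ne_1[OF omega_prime omega kp]
  have "field_norm (root_field n) (root_field (Suc n)) (cyclotomic_unit \<xi> a (Suc n))
      = (\<Prod>i<CARD('p). (\<omega> ^ k) ^ i * ?x ^ k - 1) / (\<Prod>i<CARD('p). \<omega> ^ i * ?x - 1)"
    unfolding field_norm_ac_poly[OF n] conj by (rule prod_dividef)
  also have "\<dots> = ((?x ^ k) ^ CARD('p) - 1 ^ CARD('p)) / (?x ^ CARD('p) - 1 ^ CARD('p))"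
    by (simp only: prime_order_prod[OF omega_prime odd_p omega] prime_order_prod[OF omega_prime odd_p wk])
  also have "(?x ^ k) ^ CARD('p) = \<xi> n ^ k" by (metis mult.commute power_mult xi_Suc[OF n])
  also have "?x ^ CARD('p) = \<xi> n" by (rule xi_Suc[OF n])
  finally show "field_norm (root_field n) (root_field (Suc n)) (cyclotomic_unit \<xi> a (Suc n)) = cyclotomic_unit \<xi> a n"
    using c[OF n] by simp
qed

end

section \<open>The Coleman power series of a cyclotomic unit\<close>

lemma zp_embed_fps_nth [simp]: "zp_embed_fps f $ i = zp_embed (f $ i)"
  by (simp add: zp_embed_fps_def)

lemma zp_embed_fps_eq_iff [simp]: "zp_embed_fps f = zp_embed_fps g \<longleftrightarrow> f = g"
  by (simp add: fps_eq_iff)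

lemma zp_embed_fps_add: "zp_embed_fps (f + g) = zp_embed_fps f + zp_embed_fps g"
  and zp_embed_fps_diff: "zp_embed_fps (f - g) = zp_embed_fps f - zp_embed_fps g"
  and zp_embed_fps_mult: "zp_embed_fps (f * g) = zp_embed_fps f * zp_embed_fps g"
  and zp_embed_fps_1 [simp]: "zp_embed_fps 1 = 1"
  and zp_embed_fps_X [simp]: "zp_embed_fps fps_X = fps_X"
  and zp_embed_fps_const [simp]: "zp_embed_fps (fps_const c) = fps_const (zp_embed c)"
  by (simp_all add: fps_eq_iff fps_mult_nth zp_embed_sum fps_X_def)

lemma zp_embed_fps_power: "zp_embed_fps (f ^ n) = zp_embed_fps f ^ n"
  by (induction n) (simp_all add: zp_embed_fps_mult)

lemma one_plus_X_power_nth_1: "((1 + fps_X :: 'a :: comm_ring_1 fps) ^ n) $ 1 = of_nat n"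
  using fps_linear_power_nth[of "1 :: 'a" 1 n 1] by (cases n) auto

section \<open>The operators phi, psi and N, and the derivation\<close>

lemma phi_base [simp]: "((1 + fps_X :: 'p :: prime_card padic_int fps) ^ CARD('p) - 1) $ 0 = 0"
  by (simp add: fps_nth_power_0)

lemma phi_add: "phi (f + g) = phi f + phi g"
  by (simp add: phi_def fps_compose_add_distrib)

lemma phi_diff: "phi (f - g) = phi f - phi g"
  by (simp add: phi_def fps_compose_sub_distrib)

lemma phi_mult: "phi (f * g) = phi f * phi g"
  unfolding phi_def by (rule fps_compose_mult_distrib) (rule phi_base)

lemma phi_1 [simp]: "phi 1 = 1"
  by (simp add: phi_def)

lemma phi_const [simp]: "phi (fps_const c) = fps_const c"
  by (simp add: phi_def)

lemma phi_X: "phi (fps_X :: 'p :: prime_card padic_int fps) = (1 + fps_X) ^ CARD('p) - 1"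
  unfolding phi_def by (rule fps_X_fps_compose_startby0) (rule phi_base)

lemma phi_power: "phi (f ^ n) = phi f ^ n"
  by (induction n) (simp_all add: phi_mult)

lemma phi_1_X: "phi (1 + fps_X :: 'p :: prime_card padic_int fps) = (1 + fps_X) ^ CARD('p)"
  by (simp add: phi_add phi_X)

lemma phi_nth_0 [simp]: "phi f $ 0 = f $ 0"
  by (simp add: phi_def)

text \<open>As (1 + T)^p - 1 = p T + ..., the lowest coefficient, in degree d, is multiplied by p^d.
  Injectivity of \<open>phi\<close> is what makes the descriptions of \<open>psi\<close> and
  \<open>norm_op\<close> unique.\<close>

lemma phi_eq_0:
  fixes f :: "'p :: prime_card padic_int fps"
  assumes "phi f = 0"
  shows "f = 0"
proof (rule ccontr)
  assume f: "f \<noteq> 0"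
  define d where "d = subdegree f"
  define b :: "'p padic_int fps" where "b = (1 + fps_X) ^ CARD('p) - 1"
  have b0: "b $ 0 = 0" unfolding b_def by (rule phi_base)
  have b1: "b $ 1 = of_nat CARD('p)" unfolding b_def fps_sub_nth one_plus_X_power_nth_1 by simp
  have "phi f $ d = (\<Sum>i\<in>{0..d}. f $ i * (b ^ i) $ d)"
    by (simp add: phi_def fps_compose_nth b_def)
  also have "\<dots> = (\<Sum>i\<in>{0..d}. if i = d then f $ d * (b ^ d) $ d else 0)"
    by (intro sum.cong refl) (auto simp: d_def nth_less_subdegree_zero)
  also have "\<dots> = f $ d * of_nat CARD('p) ^ d" by (simp add: startsby_zero_power_nth_same[OF b0] b1[simplified])
  finally show False using f assms by (simp add: d_def)
qed

lemma phi_eq_iff: "phi f = phi g \<longleftrightarrow> f = g"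
  using phi_eq_0[of "f - g"] by (auto simp: phi_diff)

lemma psi_eqI:
  fixes f :: "'p :: prime_card padic_int fps"
  assumes "zp_embed_fps (phi g) = fps_const (1 / of_nat CARD('p)) * (\<Sum>\<eta> | \<eta> ^ CARD('p) = 1. twist f \<eta>)"
  shows "psi f = g"
  unfolding psi_def assms[symmetric] by (rule the_equality) (auto simp: phi_eq_iff)

lemma norm_op_eqI:
  fixes f :: "'p :: prime_card padic_int fps"
  assumes "zp_embed_fps (phi g) = (\<Prod>\<eta> | \<eta> ^ CARD('p) = 1. twist f \<eta>)"
  shows "norm_op f = g"
  unfolding norm_op_def assms[symmetric] by (rule the_equality) (auto simp: phi_eq_iff)

lemma del_mult: "del (f * g) = del f * g + f * del g"
  by (simp add: del_def algebra_simps)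

lemma del_diff: "del (f - g) = del f - del g"
  by (simp add: del_def algebra_simps)

lemma del_X: "del fps_X = 1 + fps_X"
  by (simp add: del_def)

lemma del_one_plus_X_power: "del ((1 + fps_X) ^ n) = of_nat n * (1 + fps_X) ^ n"
proof (induction n)
  case (Suc n)
  have "del ((1 + fps_X) ^ Suc n) = del (1 + fps_X) * (1 + fps_X) ^ n + (1 + fps_X) * del ((1 + fps_X) ^ n)"
    unfolding power_Suc by (rule del_mult)
  also have "del (1 + fps_X) = 1 + fps_X" by (simp add: del_def)
  finally have *: "del ((1 + fps_X) ^ Suc n) = (1 + fps_X) * (1 + fps_X) ^ n + (1 + fps_X) * del ((1 + fps_X) ^ n)" .
  show ?case unfolding * Suc.IH by (simp add: algebra_simps)
qed (simp add: del_def)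

lemma fps_unit_if_nth_0: "f $ 0 dvd 1 \<Longrightarrow> f dvd (1 :: 'a :: comm_ring_1 fps)"
proof -
  assume "f $ 0 dvd 1"
  then obtain y where "1 = f $ 0 * y" by (auto simp: dvd_def)
  hence "f * fps_right_inverse f y = 1" by (intro fps_right_inverse) simp
  thus ?thesis by (metis dvd_triv_left)
qed

lemma del_log_eqI:
  fixes f :: "'p :: prime_card padic_int fps"
  assumes "f \<noteq> 0" "g * f = del f"
  shows "del_log f = g"
  unfolding del_log_def
proof (rule the_equality)
  fix g' assume "g' * f = del f"
  hence "g' * f = g * f" by (simp only: assms(2))
  thus "g' = g" using assms(1) by simp
qed (rule assms(2))

section \<open>The series ((1 + T)^a - 1)/T and its logarithmic derivative\<close>

lemma power_int_altdef_nat: "(x :: 'a :: field) \<noteq> 0 \<Longrightarrow> x powi a = x ^ nat a / x ^ nat (- a)"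
  by (cases "a \<ge> 0") (auto simp: power_int_def field_simps)

text \<open>The series ((1 + T)^a - 1)/T for an integer a of either sign: one of
  \<open>nat a\<close> and \<open>nat (- a)\<close> is 0, and (1 + T)^(\<open>nat (- a)\<close>)
  clears a negative exponent.\<close>

definition cyc_series :: "int \<Rightarrow> 'p :: prime_card padic_int fps" where
  "cyc_series a = fps_shift 1 ((1 + fps_X) ^ nat a - (1 + fps_X) ^ nat (- a))
     * fps_right_inverse (1 + fps_X) 1 ^ nat (- a)"

lemma cyc_series_eq:
  "cyc_series a * fps_X * (1 + fps_X) ^ nat (- a) = (1 + fps_X) ^ nat a - (1 + fps_X) ^ nat (- a)"
proof -
  let ?Y = "1 + fps_X :: 'a padic_int fps" and ?V = "fps_right_inverse (1 + fps_X :: 'a padic_int fps) 1"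
  let ?D = "?Y ^ nat a - ?Y ^ nat (- a)"
  have "?Y * ?V = 1" by (rule fps_right_inverse) simp
  hence "?V ^ nat (- a) * ?Y ^ nat (- a) = 1" by (metis mult.commute power_mult_distrib power_one)
  moreover have "fps_shift 1 ?D * fps_X = ?D"
    by (rule fps_ext) (simp add: fps_nth_power_0)
  moreover have "cyc_series a * fps_X * ?Y ^ nat (- a) =
      (fps_shift 1 ?D * fps_X) * (?V ^ nat (- a) * ?Y ^ nat (- a))"
    by (simp only: cyc_series_def mult_ac)
  ultimately show ?thesis by simp
qed

lemma cyc_series_nth_0: "(cyc_series a :: 'p :: prime_card padic_int fps) $ 0 = of_int a"
proof -
  have "(cyc_series a * fps_X * (1 + fps_X) ^ nat (- a) :: 'p padic_int fps) $ 1 =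
     ((1 + fps_X) ^ nat a - (1 + fps_X) ^ nat (- a)) $ 1" by (simp only: cyc_series_eq)
  hence "(cyc_series a :: 'p padic_int fps) $ 0 = of_nat (nat a) - of_nat (nat (- a))"
    unfolding fps_sub_nth one_plus_X_power_nth_1
    by (simp add: fps_mult_nth_1 fps_nth_power_0)
  thus ?thesis by (cases "a \<ge> 0") simp_all
qed

lemma cyc_series_unit:
  assumes "\<not> int CARD('p) dvd a"
  shows "(cyc_series a :: 'p :: prime_card padic_int fps) dvd 1"
  by (rule fps_unit_if_nth_0) (simp add: cyc_series_nth_0 of_int_unit_iff assms)

text \<open>The identity \<open>del_log f\<close> = a (1 + T)^a/((1 + T)^a - 1) - (1 + T)/T without
  denominators, so that it can be transported through twists, \<open>phi\<close> and the exponential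
  substitution. It results from applying \<open>del\<close> to the relation that characterises
  f.\<close>

lemma del_log_cyc_series:
  fixes a :: int
  defines "f \<equiv> cyc_series a :: 'p :: prime_card padic_int fps"
  defines "Y \<equiv> 1 + fps_X :: 'p padic_int fps"
  assumes a: "\<not> int CARD('p) dvd a"
  shows "del_log f * fps_X * (Y ^ nat a - Y ^ nat (- a))
     = of_int a * fps_X * Y ^ nat a - Y * (Y ^ nat a - Y ^ nat (- a))" (is "?h * fps_X * (?P - ?M) = _")
proof -
  have fdvd: "f dvd 1" unfolding f_def by (rule cyc_series_unit[OF a])
  hence f0: "f \<noteq> 0" by auto
  obtain V where V: "1 = f * V" using fdvd by (auto simp: dvd_def)
  have h: "?h = V * del f" by (rule del_log_eqI[OF f0]) (metis V mult.commute mult.left_commute mult_1)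
  hence hf: "?h * f = del f" using V by (simp add: mult_ac flip: mult.assoc)
  have rel: "f * fps_X * ?M = ?P - ?M" unfolding f_def Y_def by (rule cyc_series_eq)
  have "del (f * fps_X * ?M) = del (?P - ?M)" by (simp only: rel)
  hence d: "(del f * fps_X + f * Y) * ?M + f * fps_X * (of_nat (nat (- a)) * ?M)
      = of_nat (nat a) * ?P - of_nat (nat (- a)) * ?M"
    by (simp only: del_mult del_diff del_X Y_def del_one_plus_X_power)
  have ai: "(of_int a :: 'p padic_int fps) = of_nat (nat a) - of_nat (nat (- a))"
    by (cases "a \<ge> 0") simp_all
  have "?h * fps_X * (?P - ?M) = ?h * f * fps_X * ?M * fps_X"
    by (simp only: rel[symmetric] mult_ac)
  also have "\<dots> = (of_nat (nat a) * ?P - of_nat (nat (- a)) * ?M - f * Y * ?M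
      - f * fps_X * (of_nat (nat (- a)) * ?M)) * fps_X"
  proof -
    have "del f * fps_X * ?M = of_nat (nat a) * ?P - of_nat (nat (- a)) * ?M - f * Y * ?M
        - f * fps_X * (of_nat (nat (- a)) * ?M)" using d by (simp add: algebra_simps)
    thus ?thesis by (simp only: hf)
  qed
  also have "\<dots> = of_nat (nat a) * ?P * fps_X - of_nat (nat (- a)) * ?M * fps_X - Y * (f * fps_X * ?M)
      - of_nat (nat (- a)) * fps_X * (f * fps_X * ?M)"
    by (simp add: algebra_simps)
  also have "\<dots> = of_int a * fps_X * ?P - Y * (?P - ?M)"
    unfolding rel ai by (simp add: algebra_simps)
  finally show ?thesis .
qed

text \<open>The way back to fractions, in a field where v is the image of 1 + T under a twist or
  under \<open>phi\<close>.\<close>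

lemma solve_log_derivative:
  fixes h v c :: "'a :: field"
  assumes v: "v \<noteq> 0" "v \<noteq> 1" "v powi a \<noteq> 1"
    and h: "h * (v - 1) * (v ^ nat a - v ^ nat (- a)) = c * (v - 1) * v ^ nat a - v * (v ^ nat a - v ^ nat (- a))"
  shows "h = c * (v powi a) / (v powi a - 1) - v / (v - 1)"
proof -
  define m where "m = v ^ nat (- a)"
  have m: "m \<noteq> 0" "v ^ nat a = v powi a * m" using v(1) by (simp_all add: m_def power_int_altdef_nat)
  have "(h * (v - 1) * (v powi a - 1)) * m = (c * (v - 1) * (v powi a) - v * (v powi a - 1)) * m"
    using h unfolding m_def[symmetric] m(2) by (simp add: algebra_simps)
  hence "h * (v - 1) * (v powi a - 1) = c * (v - 1) * (v powi a) - v * (v powi a - 1)" using m(1) by simp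
  moreover have "v - 1 \<noteq> 0" "v powi a - 1 \<noteq> 0" using v by simp_all
  ultimately show ?thesis by (simp add: divide_simps) (simp add: algebra_simps)
qed

context cyclotomic_tower
begin

text \<open>Laurent series provide the field for the formulas on roots of unity. There
  \<open>w\<close> is the constant \<omega> and \<open>y\<close> is 1 + T, so the twist by
  \<omega>^i sends 1 + T to w^i y and \<open>phi\<close> sends it to y^p.\<close>

definition w where "w = fps_to_fls (fps_const \<omega>)"
definition y where "y = fps_to_fls (1 + fps_X :: 'p padic_closure fps)"

lemma w_root: "w ^ CARD('p) = 1" "w \<noteq> 1"
proof -
  show "w ^ CARD('p) = 1"
    unfolding w_def fps_to_fls_power[symmetric] fps_const_power omega(1) by simp
  show "w \<noteq> 1"
  proof
    assume "w = 1"
    hence "fps_const \<omega> = 1" unfolding w_def by (simp only: fps_to_fls_eq_1_iff)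
    hence "fps_const \<omega> $ 0 = 1 $ 0" by simp
    thus False using omega by simp
  qed
qed

lemma w_nz: "w \<noteq> 0"
  using w_root(1) by (auto simp: power_0_left)

lemma y_power_inj: "y ^ i = y ^ j \<longleftrightarrow> i = j"
proof
  assume "y ^ i = y ^ j"
  hence "(1 + fps_X :: 'p padic_closure fps) ^ i = (1 + fps_X) ^ j"
    unfolding y_def by (simp only: fps_to_fls_power[symmetric] fps_to_fls_eq_iff)
  hence "((1 + fps_X :: 'p padic_closure fps) ^ i) $ 1 = ((1 + fps_X) ^ j) $ 1" by (simp only:)
  thus "i = j" unfolding one_plus_X_power_nth_1 by simp
qed simp

lemma y_nz: "y \<noteq> 0"
  using y_power_inj[of 1 2] by auto

lemma y_powi_inj: "a \<noteq> 0 \<Longrightarrow> (y ^ CARD('p)) powi a \<noteq> 1"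
proof
  assume a: "a \<noteq> 0" and 1: "(y ^ CARD('p)) powi a = 1"
  hence "y ^ (CARD('p) * nat a) = y ^ (CARD('p) * nat (- a))"
    using y_nz by (simp add: power_int_altdef_nat power_mult)
  hence "nat a = nat (- a)" unfolding y_power_inj using CARD_gt_1[where 'p = 'p] by simp
  thus False using a by simp
qed

lemma w_powi:
  assumes "\<not> int CARD('p) dvd a"
  shows "(w powi a) ^ CARD('p) = 1" "w powi a \<noteq> 1"
proof -
  define k where "k = nat (a mod int CARD('p))"
  have k: "a = int k + int CARD('p) * (a div int CARD('p))" by (simp add: k_def)
  have "w powi (int CARD('p) * (a div int CARD('p))) = (w ^ CARD('p)) powi (a div int CARD('p))"
    by (simp only: power_int_mult power_int_of_nat)
  hence "w powi (int CARD('p) * (a div int CARD('p))) = 1" by (simp only: w_root(1) power_int_1_left)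
  hence wa: "w powi a = w ^ k"
    by (subst k) (simp only: power_int_add[OF disjI1[OF w_nz]] power_int_of_nat mult_1_right)
  have "\<not> CARD('p) dvd k"
  proof
    assume "CARD('p) dvd k"
    hence "int CARD('p) dvd int k" by (simp only: int_dvd_int_iff)
    thus False using assms k by (metis dvd_add dvd_triv_left)
  qed
  thus "w powi a \<noteq> 1" unfolding wa by (rule prime_order_power_ne_1[OF omega_prime w_root])
  show "(w powi a) ^ CARD('p) = 1" unfolding wa using w_root(1) by (metis mult.commute power_mult power_one)
qed

lemma wy_powi: "(w ^ i * y) powi a = (w powi a) ^ i * (y powi a)"
  by (simp add: power_int_mult_distrib power_int_power mult.commute flip: power_int_power')

lemma wy_power: "(w ^ i * y) ^ CARD('p) = y ^ CARD('p)"
proof -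
  have "(w ^ i) ^ CARD('p) = 1" using w_root(1) by (metis mult.commute power_mult power_one)
  thus ?thesis by (simp add: power_mult_distrib)
qed

lemma y_p_ne_1: "y ^ CARD('p) \<noteq> 1"
  using y_powi_inj[of 1] by simp

lemma wy_ne_1: "w ^ i * y \<noteq> 1"
  using wy_power[of i] y_p_ne_1 by auto

lemma y_powi_power: "(y powi a) ^ k = (y ^ k) powi a"
  by (metis mult.commute power_int_mult power_int_of_nat)

lemma p_power_root_omega: "p_power_root (\<omega> ^ i) 1"
  using odd_p omega(1) by unfold_locales (simp_all, metis mult.commute power_mult power_one)

lemma fls_twist_one_plus_X: "fps_to_fls (twist (1 + fps_X) (\<omega> ^ i)) = w ^ i * y"
proof -
  interpret p_power_root "\<omega> ^ i" 1 by (rule p_power_root_omega)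
  show ?thesis
    unfolding twist_1_X fls_times_fps_to_fls w_def y_def fps_to_fls_power[symmetric] fps_const_power ..
qed

lemma fls_phi_one_plus_X: "fps_to_fls (zp_embed_fps (phi (1 + fps_X))) = y ^ CARD('p)"
  by (simp only: phi_1_X zp_embed_fps_power zp_embed_fps_add zp_embed_fps_1 zp_embed_fps_X fps_to_fls_power y_def)

lemma sum_roots: "(\<Sum>\<eta> | \<eta> ^ CARD('p) = 1. F \<eta>) = (\<Sum>i<CARD('p). F (\<omega> ^ i))"
  by (rule sum.reindex_bij_betw[OF roots_bij, symmetric])

lemma prod_roots: "(\<Prod>\<eta> | \<eta> ^ CARD('p) = 1. F \<eta>) = (\<Prod>i<CARD('p). F (\<omega> ^ i))"
  by (rule prod.reindex_bij_betw[OF roots_bij, symmetric])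

lemma fps_to_fls_sum: "fps_to_fls (sum f A) = (\<Sum>x\<in>A. fps_to_fls (f x))"
  by (induction A rule: infinite_finite_induct) simp_all

lemma fps_to_fls_prod: "fps_to_fls (prod f A) = (\<Prod>x\<in>A. fps_to_fls (f x))"
  by (induction A rule: infinite_finite_induct) (simp_all add: fls_times_fps_to_fls)

text \<open>The twists are (w^(a i) y^a - 1)/(w^i y - 1). Their product, by the product formula for
  the roots w^a and w, is (y^(p a) - 1)/(y^p - 1), the image under \<open>phi\<close>.\<close>

lemma norm_op_cyc_series:
  assumes a: "\<not> int CARD('p) dvd a"
  shows "norm_op (cyc_series a :: 'p padic_int fps) = cyc_series a"
proof (rule norm_op_eqI)
  let ?f = "cyc_series a :: 'p padic_int fps" and ?Y = "1 + fps_X :: 'p padic_int fps"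
  have rel: "?f * (?Y - 1) * ?Y ^ nat (- a) = ?Y ^ nat a - ?Y ^ nat (- a)"
    using cyc_series_eq[of a] by simp
  have quot: "g = (v powi a - 1) / (v - 1)"
    if "g * (v - 1) * v ^ nat (- a) = v ^ nat a - v ^ nat (- a)" "v \<noteq> 0" "v \<noteq> 1" for g v :: "'p padic_closure fls"
    using that by (simp add: power_int_altdef_nat field_simps)
  have a0: "a \<noteq> 0" using a by auto
  have tw: "fps_to_fls (twist ?f (\<omega> ^ i)) = ((w powi a) ^ i * (y powi a) - 1) / (w ^ i * y - 1)" for i
  proof -
    interpret p_power_root "\<omega> ^ i" 1 by (rule p_power_root_omega)
    have "fps_to_fls (twist (?f * (?Y - 1) * ?Y ^ nat (- a)) (\<omega> ^ i)) =
        fps_to_fls (twist (?Y ^ nat a - ?Y ^ nat (- a)) (\<omega> ^ i))" by (simp only: rel)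
    hence "fps_to_fls (twist ?f (\<omega> ^ i)) * (w ^ i * y - 1) * (w ^ i * y) ^ nat (- a)
        = (w ^ i * y) ^ nat a - (w ^ i * y) ^ nat (- a)"
      by (simp only: twist_mult twist_diff twist_power twist_1 fls_times_fps_to_fls fps_to_fls_power
          fps_to_fls_minus fps_to_fls_eq_1_iff[THEN iffD2, OF refl] fls_twist_one_plus_X)
    from quot[OF this] show ?thesis
      using wy_ne_1[of i] wy_powi[of i a] y_nz w_nz by simp
  qed
  have "fps_to_fls (zp_embed_fps (phi (?f * (?Y - 1) * ?Y ^ nat (- a)))) =
      fps_to_fls (zp_embed_fps (phi (?Y ^ nat a - ?Y ^ nat (- a))))" by (simp only: rel)
  hence "fps_to_fls (zp_embed_fps (phi ?f)) * (y ^ CARD('p) - 1) * (y ^ CARD('p)) ^ nat (- a)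
      = (y ^ CARD('p)) ^ nat a - (y ^ CARD('p)) ^ nat (- a)"
    by (simp only: phi_mult phi_diff phi_power phi_1 zp_embed_fps_mult zp_embed_fps_diff
        zp_embed_fps_power zp_embed_fps_1 fls_times_fps_to_fls fps_to_fls_power
        fps_to_fls_minus fps_to_fls_eq_1_iff[THEN iffD2, OF refl] fls_phi_one_plus_X)
  from quot[OF this] have ph: "fps_to_fls (zp_embed_fps (phi ?f))
      = ((y ^ CARD('p)) powi a - 1) / (y ^ CARD('p) - 1)" using y_p_ne_1 y_nz by simp
  have "fps_to_fls (\<Prod>\<eta> | \<eta> ^ CARD('p) = 1. twist ?f \<eta>) =
      (\<Prod>i<CARD('p). (w powi a) ^ i * (y powi a) - 1) / (\<Prod>i<CARD('p). w ^ i * y - 1)"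
    unfolding prod_roots fps_to_fls_prod tw by (rule prod_dividef)
  also have "\<dots> = ((y powi a) ^ CARD('p) - 1 ^ CARD('p)) / (y ^ CARD('p) - 1 ^ CARD('p))"
    by (simp only: prime_order_prod[OF omega_prime odd_p w_root] prime_order_prod[OF omega_prime odd_p w_powi[OF a]])
  also have "\<dots> = fps_to_fls (zp_embed_fps (phi ?f))" unfolding ph y_powi_power by simp
  finally show "zp_embed_fps (phi ?f) = (\<Prod>\<eta> | \<eta> ^ CARD('p) = 1. twist ?f \<eta>)"
    by (simp only: fps_to_fls_eq_iff)
qed

text \<open>Each of the two fractions in the logarithmic derivative has the form Z/(Z - 1) up to a
  constant. Summed over twists it becomes p Z^p/(Z^p - 1), and the factor p cancels against the 1/p
  in \<open>psi\<close>.\<close>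

lemma psi_del_log_cyc_series:
  assumes a: "\<not> int CARD('p) dvd a"
  shows "psi (del_log (cyc_series a :: 'p padic_int fps)) = del_log (cyc_series a)"
proof (rule psi_eqI)
  let ?h = "del_log (cyc_series a) :: 'p padic_int fps" and ?Y = "1 + fps_X :: 'p padic_int fps"
  let ?c = "fps_to_fls (fps_const (of_int a)) :: 'p padic_closure fls"
  have a0: "a \<noteq> 0" using a by auto
  have rel: "?h * (?Y - 1) * (?Y ^ nat a - ?Y ^ nat (- a))
     = fps_const (of_int a) * (?Y - 1) * ?Y ^ nat a - ?Y * (?Y ^ nat a - ?Y ^ nat (- a))"
    using del_log_cyc_series[OF a] by (simp add: fps_of_int)
  have tw: "fps_to_fls (twist ?h (\<omega> ^ i)) =
      ?c * ((w powi a) ^ i * (y powi a)) / ((w powi a) ^ i * (y powi a) - 1) - w ^ i * y / (w ^ i * y - 1)" for i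
  proof -
    interpret p_power_root "\<omega> ^ i" 1 by (rule p_power_root_omega)
    have "fps_to_fls (twist (?h * (?Y - 1) * (?Y ^ nat a - ?Y ^ nat (- a))) (\<omega> ^ i)) =
        fps_to_fls (twist (fps_const (of_int a) * (?Y - 1) * ?Y ^ nat a - ?Y * (?Y ^ nat a - ?Y ^ nat (- a))) (\<omega> ^ i))"
      by (simp only: rel)
    hence *: "fps_to_fls (twist ?h (\<omega> ^ i)) * (w ^ i * y - 1) * ((w ^ i * y) ^ nat a - (w ^ i * y) ^ nat (- a))
        = ?c * (w ^ i * y - 1) * (w ^ i * y) ^ nat a - (w ^ i * y) * ((w ^ i * y) ^ nat a - (w ^ i * y) ^ nat (- a))"
      by (simp only: twist_mult twist_diff twist_power twist_1 twist_const zp_embed_of_int fls_times_fps_to_fls fps_to_fls_power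
          fps_to_fls_minus fps_to_fls_eq_1_iff[THEN iffD2, OF refl] fls_twist_one_plus_X)
    have "((w ^ i * y) powi a) ^ CARD('p) = ((w ^ i * y) ^ CARD('p)) powi a"
      by (metis mult.commute power_int_mult power_int_of_nat)
    hence "(w ^ i * y) powi a \<noteq> 1" using y_powi_inj[OF a0] wy_power by auto
    from solve_log_derivative[OF _ wy_ne_1 this *] show ?thesis
      using y_nz w_nz unfolding wy_powi by simp
  qed
  have "fps_to_fls (zp_embed_fps (phi (?h * (?Y - 1) * (?Y ^ nat a - ?Y ^ nat (- a))))) =
      fps_to_fls (zp_embed_fps (phi (fps_const (of_int a) * (?Y - 1) * ?Y ^ nat a - ?Y * (?Y ^ nat a - ?Y ^ nat (- a)))))"
    by (simp only: rel)
  hence *: "fps_to_fls (zp_embed_fps (phi ?h)) * (y ^ CARD('p) - 1) * ((y ^ CARD('p)) ^ nat a - (y ^ CARD('p)) ^ nat (- a))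
      = ?c * (y ^ CARD('p) - 1) * (y ^ CARD('p)) ^ nat a - y ^ CARD('p) * ((y ^ CARD('p)) ^ nat a - (y ^ CARD('p)) ^ nat (- a))"
    by (simp only: phi_mult phi_diff phi_power phi_1 phi_const zp_embed_fps_mult zp_embed_fps_diff
        zp_embed_fps_power zp_embed_fps_1 zp_embed_fps_const zp_embed_of_int fls_times_fps_to_fls fps_to_fls_power
        fps_to_fls_minus fps_to_fls_eq_1_iff[THEN iffD2, OF refl] fls_phi_one_plus_X)
  let ?yp = "y ^ CARD('p)"
  have ph: "fps_to_fls (zp_embed_fps (phi ?h)) = ?c * (?yp powi a) / (?yp powi a - 1) - ?yp / (?yp - 1)"
    by (rule solve_log_derivative[OF _ y_p_ne_1 y_powi_inj[OF a0] *]) (simp add: y_nz)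
  have ne: "(y powi a) ^ CARD('p) \<noteq> 1" unfolding y_powi_power by (rule y_powi_inj[OF a0])
  have "fps_to_fls (\<Sum>\<eta> | \<eta> ^ CARD('p) = 1. twist ?h \<eta>) =
      ?c * (\<Sum>i<CARD('p). (w powi a) ^ i * (y powi a) / ((w powi a) ^ i * (y powi a) - 1))
      - (\<Sum>i<CARD('p). w ^ i * y / (w ^ i * y - 1))"
    unfolding sum_roots fps_to_fls_sum tw by (simp add: sum_subtractf sum_distrib_left)
  also have "\<dots> = of_nat CARD('p) * fps_to_fls (zp_embed_fps (phi ?h))"
    unfolding prime_order_sum[OF omega_prime w_root y_p_ne_1] prime_order_sum[OF omega_prime w_powi[OF a] ne] ph y_powi_power
    by (simp add: right_diff_distrib)
  also have "\<dots> = fps_to_fls (of_nat CARD('p) * zp_embed_fps (phi ?h))"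
    by (simp add: fls_times_fps_to_fls)
  finally have "(\<Sum>\<eta> | \<eta> ^ CARD('p) = 1. twist ?h \<eta>) = of_nat CARD('p) * zp_embed_fps (phi ?h)"
    by (simp only: fps_to_fls_eq_iff)
  thus "zp_embed_fps (phi ?h) = fps_const (1 / of_nat CARD('p)) * (\<Sum>\<eta> | \<eta> ^ CARD('p) = 1. twist ?h \<eta>)"
    by (simp add: fps_of_nat[symmetric] flip: mult.assoc)
qed

lemma eval_cyc_series:
  assumes n: "n \<ge> 1"
  shows "eval_fps_at (cyc_series a) (\<xi> n - 1) = cyclotomic_unit \<xi> a n"
proof -
  interpret p_power_root "\<xi> n" n by (rule p_power_root_xi[OF n])
  let ?f = "cyc_series a :: 'p padic_int fps" and ?Y = "1 + fps_X :: 'p padic_int fps"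
  have x1: "\<xi> n \<noteq> 1"
    using xi_primitive[OF n, of 1] n one_less_power[OF CARD_gt_1[where 'p = 'p], of n] by simp
  have "?f * (?Y - 1) * ?Y ^ nat (- a) = ?Y ^ nat a - ?Y ^ nat (- a)"
    using cyc_series_eq[of a] by simp
  hence "twist (?f * (?Y - 1) * ?Y ^ nat (- a)) (\<xi> n) $ 0 = twist (?Y ^ nat a - ?Y ^ nat (- a)) (\<xi> n) $ 0" by simp
  hence "twist ?f (\<xi> n) $ 0 * (\<xi> n - 1) * \<xi> n ^ nat (- a) = \<xi> n ^ nat a - \<xi> n ^ nat (- a)"
    by (simp only: twist_mult twist_diff twist_power twist_1 twist_1_X fps_mult_nth_0 fps_nth_power_0 fps_sub_nth)
       (simp add: fps_nth_power_0)
  thus ?thesis unfolding eval_fps_at_twist cyclotomic_unit_def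
    using x1 n by (simp add: power_int_altdef_nat field_simps)
qed

lemma coleman_series_cyclotomic_unit:
  assumes a: "\<not> int CARD('p) dvd a"
  shows "coleman_series \<xi> (cyclotomic_unit \<xi> a) = cyc_series a"
  unfolding coleman_series_def
proof (rule the_equality)
  show "(cyc_series a :: 'p padic_int fps) dvd 1 \<and> norm_op (cyc_series a :: 'p padic_int fps) = cyc_series a \<and>
      (\<forall>n\<ge>1. eval_fps_at (cyc_series a) (\<xi> n - 1) = cyclotomic_unit \<xi> a n)"
    using cyc_series_unit[OF a] norm_op_cyc_series[OF a] eval_cyc_series by blast
  fix f assume "f dvd 1 \<and> norm_op f = f \<and> (\<forall>n\<ge>1. eval_fps_at f (\<xi> n - 1) = cyclotomic_unit \<xi> a n)"
  thus "f = cyc_series a"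
    by (intro eval_determines_fps) (simp add: eval_cyc_series flip: eval_fps_at_twist)
qed

end

section \<open>Integration against measures on the p-adic units\<close>

text \<open>Uniform continuity on $\mathbf{Z}_p^\times$ only, so that inversion is admissible.\<close>

definition ucont :: "('p :: prime_card padic_int \<Rightarrow> 'p padic_int) \<Rightarrow> bool" where
  "ucont f \<longleftrightarrow> (\<forall>m. \<exists>N\<ge>1. \<forall>x\<in>padic_units. \<forall>y\<in>padic_units. pp ^ N dvd x - y \<longrightarrow> pp ^ m dvd f x - f y)"

lemma ucontE:
  assumes "ucont f"
  obtains N where "N \<ge> 1" "\<forall>x\<in>padic_units. \<forall>y\<in>padic_units. pp ^ N dvd x - y \<longrightarrow> pp ^ m dvd f x - f y"
  using assms unfolding ucont_def by blast

lemma ucontI: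
  assumes "\<And>m. \<exists>N. \<forall>x\<in>padic_units. \<forall>y\<in>padic_units. pp ^ N dvd x - y \<longrightarrow> pp ^ m dvd f x - f y"
  shows "ucont f"
  unfolding ucont_def
proof
  fix m
  obtain N where "\<forall>x\<in>padic_units. \<forall>y\<in>padic_units. pp ^ N dvd x - y \<longrightarrow> pp ^ m dvd f x - f y" using assms by blast
  thus "\<exists>N\<ge>1. \<forall>x\<in>padic_units. \<forall>y\<in>padic_units. pp ^ N dvd x - y \<longrightarrow> pp ^ m dvd f x - f y"
    by (intro exI[of _ "Suc N"]) (auto intro: dvd_trans[OF le_imp_power_dvd[of N "Suc N"]])
qed

lemma ucont_const [simp, intro]: "ucont (\<lambda>_. c)"
  by (rule ucontI) simp

lemma ucont_id [simp, intro]: "ucont (\<lambda>x. x)"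
  by (rule ucontI) blast

lemma ucont_binary:
  fixes f g :: "'p :: prime_card padic_int \<Rightarrow> 'p padic_int"
  assumes "ucont f" "ucont g" and h: "\<And>q a b c d. q dvd a - b \<Longrightarrow> q dvd c - d \<Longrightarrow> q dvd h a c - h b d"
  shows "ucont (\<lambda>x. h (f x) (g x))"
proof (rule ucontI)
  fix m
  obtain N where N: "\<forall>x\<in>padic_units. \<forall>y\<in>padic_units. pp ^ N dvd x - y \<longrightarrow> pp ^ m dvd f x - f y"
    using assms(1) by (rule ucontE)
  obtain M where M: "\<forall>x\<in>padic_units. \<forall>y\<in>padic_units. pp ^ M dvd x - y \<longrightarrow> pp ^ m dvd g x - g y"
    using assms(2) by (rule ucontE)
  show "\<exists>N. \<forall>x\<in>padic_units. \<forall>y\<in>padic_units. pp ^ N dvd x - y \<longrightarrow> pp ^ m dvd h (f x) (g x) - h (f y) (g y)"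
  proof (intro exI[of _ "N + M"] ballI impI)
    fix x y :: "'p padic_int" assume xy: "x \<in> padic_units" "y \<in> padic_units" "pp ^ (N + M) dvd x - y"
    have "pp ^ N dvd x - y" "pp ^ M dvd x - y"
      using xy(3) by (meson dvd_trans le_add1 le_add2 le_imp_power_dvd)+
    thus "pp ^ m dvd h (f x) (g x) - h (f y) (g y)" using N M xy(1,2) by (intro h) auto
  qed
qed

lemma ucont_add [intro]: "ucont f \<Longrightarrow> ucont g \<Longrightarrow> ucont (\<lambda>x. f x + g x)"
  by (erule (1) ucont_binary) (metis add_diff_add dvd_add)

lemma ucont_diff [intro]: "ucont f \<Longrightarrow> ucont g \<Longrightarrow> ucont (\<lambda>x. f x - g x)"
proof (erule (1) ucont_binary)
  fix q a b c d :: "'a padic_int"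
  assume "q dvd a - b" "q dvd c - d"
  hence "q dvd (a - b) - (c - d)" by (rule dvd_diff)
  thus "q dvd a - c - (b - d)" by (simp add: algebra_simps)
qed

lemma dvd_mult_diff: "q dvd a - b \<Longrightarrow> q dvd c - d \<Longrightarrow> q dvd a * c - b * (d :: 'a :: comm_ring_1)"
proof -
  assume "q dvd a - b" "q dvd c - d"
  hence "q dvd (a - b) * c + b * (c - d)" by (intro dvd_add dvd_mult dvd_mult2)
  thus ?thesis by (simp add: algebra_simps)
qed

lemma ucont_mult [intro]: "ucont f \<Longrightarrow> ucont g \<Longrightarrow> ucont (\<lambda>x. f x * g x)"
  by (rule ucont_binary) (auto intro: dvd_mult_diff)

lemma dvd_diff_swap: "q dvd a - b \<Longrightarrow> q dvd b - (a :: 'a :: comm_ring_1)"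
  by (metis dvd_minus_iff minus_diff_eq)

lemma ucont_power [intro]: "ucont f \<Longrightarrow> ucont (\<lambda>x. f x ^ k)"
  by (induction k) auto

lemma ucont_sum [intro]: "(\<And>i. i \<in> A \<Longrightarrow> ucont (f i)) \<Longrightarrow> ucont (\<lambda>x. \<Sum>i\<in>A. f i x)"
  by (induction A rule: infinite_finite_induct) auto

lemma ucont_residue [intro]: "ucont (\<lambda>x. if padic_residue x n = b then 1 else 0)"
  by (rule ucontI, rule exI[of _ n]) (auto simp flip: residue_eq_iff_dvd)

lemma ucont_indicator [intro]:
  fixes f :: "'p :: prime_card padic_int \<Rightarrow> 'p padic_int"
  assumes "ucont f"
  shows "ucont (\<lambda>x. if padic_residue x n = b then f x else 0)"
proof -
  have "ucont (\<lambda>x. (if padic_residue x n = b then 1 else 0) * f x)" by (rule ucont_mult[OF ucont_residue assms])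
  also have "(\<lambda>x. (if padic_residue x n = b then 1 else 0) * f x) = (\<lambda>x. if padic_residue x n = b then f x else 0)"
    by auto
  finally show ?thesis .
qed

text \<open>Level 0 is excluded because its only representative is 0.\<close>

lemma unit_residue_is_unit:
  assumes "n \<ge> 1" "b \<in> unit_residues TYPE('p :: prime_card) n"
  shows "(of_int b :: 'p padic_int) \<in> padic_units"
proof -
  have "coprime b (int CARD('p))"
    using assms by (auto simp: unit_residues_def)
  hence "\<not> int CARD('p) dvd b"
    using prime_CARD_int[where 'p = 'p] by (metis coprime_absorb_right not_prime_unit)
  thus ?thesis by (simp add: padic_units_def of_int_unit_iff)
qed



section \<open>Riemann sums and the integral of uniformly continuous functions\<close>

definition riemann_sum :: "('p padic_int \<Rightarrow> 'p padic_int) \<Rightarrow> 'p :: prime_card iwasawa \<Rightarrow> nat \<Rightarrow> 'p padic_int" where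
  "riemann_sum f \<mu> n = (\<Sum>b\<in>unit_residues TYPE('p) n. f (of_int b) * mass \<mu> n b)"

lemma mass_refine:
  fixes \<mu> :: "'p :: prime_card iwasawa"
  assumes "b \<in> unit_residues TYPE('p) n"
  shows "mass \<mu> n b = (\<Sum>c | c \<in> unit_residues TYPE('p) (Suc n) \<and> c mod int CARD('p) ^ n = b. mass \<mu> (Suc n) c)"
  using measure_familyD(2)[OF _ assms] mass[of \<mu>] by blast

text \<open>A function of level n has the same sum at level n + 1. The additive map \<open>e\<close>
  admits the masses themselves as well as their images in the algebraic closure, where the
  characters b \<mapsto> z^b take their values.\<close>

lemma sum_mass_refine:
  fixes \<mu> :: "'p :: prime_card iwasawa" and g :: "int \<Rightarrow> 'a :: comm_ring_1" and e :: "'p padic_int \<Rightarrow> 'a"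
  assumes e: "\<And>F (A :: int set). e (sum F A) = (\<Sum>x\<in>A. e (F x))"
  shows "(\<Sum>c\<in>unit_residues TYPE('p) (Suc n). g (c mod int CARD('p) ^ n) * e (mass \<mu> (Suc n) c))
    = (\<Sum>b\<in>unit_residues TYPE('p) n. g b * e (mass \<mu> n b))"
proof -
  let ?U = "unit_residues TYPE('p)" and ?q = "int CARD('p) ^ n"
  have "(\<Sum>b\<in>?U n. g b * e (mass \<mu> n b)) =
      (\<Sum>b\<in>?U n. \<Sum>c | c \<in> ?U (Suc n) \<and> c mod ?q = b. g (c mod ?q) * e (mass \<mu> (Suc n) c))"
  proof (rule sum.cong[OF refl])
    fix b assume b: "b \<in> ?U n"
    have "g b * e (mass \<mu> n b) = (\<Sum>c | c \<in> ?U (Suc n) \<and> c mod ?q = b. g b * e (mass \<mu> (Suc n) c))"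
      unfolding mass_refine[OF b] e sum_distrib_left ..
    also have "\<dots> = (\<Sum>c | c \<in> ?U (Suc n) \<and> c mod ?q = b. g (c mod ?q) * e (mass \<mu> (Suc n) c))"
      by (intro sum.cong refl) simp
    finally show "g b * e (mass \<mu> n b) =
      (\<Sum>c | c \<in> ?U (Suc n) \<and> c mod ?q = b. g (c mod ?q) * e (mass \<mu> (Suc n) c))" .
  qed
  also have "\<dots> = (\<Sum>c\<in>?U (Suc n). g (c mod ?q) * e (mass \<mu> (Suc n) c))"
    by (rule sum.group) (auto dest: unit_residues_Suc)
  finally show ?thesis by simp
qed

text \<open>The sum of level n, rewritten at level n + 1, samples f at c mod p^n in place of c, and
  these points differ by a multiple of p^n.\<close>

lemma riemann_sum_step:
  fixes \<mu> :: "'p :: prime_card iwasawa"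
  assumes N: "\<forall>x\<in>padic_units. \<forall>y\<in>padic_units. pp ^ N dvd x - y \<longrightarrow> pp ^ m dvd f x - f y"
    and n: "n \<ge> N" "n \<ge> 1"
  shows "pp ^ m dvd riemann_sum f \<mu> (Suc n) - riemann_sum f \<mu> n"
proof -
  let ?U = "unit_residues TYPE('p)" and ?q = "int CARD('p) ^ n"
  have "riemann_sum f \<mu> n = (\<Sum>c\<in>?U (Suc n). f (of_int (c mod ?q)) * mass \<mu> (Suc n) c)"
    unfolding riemann_sum_def by (rule sum_mass_refine[symmetric, where e = "\<lambda>x. x"]) simp
  hence "riemann_sum f \<mu> (Suc n) - riemann_sum f \<mu> n
      = (\<Sum>c\<in>?U (Suc n). (f (of_int c) - f (of_int (c mod ?q))) * mass \<mu> (Suc n) c)"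
    by (simp add: riemann_sum_def sum_subtractf left_diff_distrib)
  also have "pp ^ m dvd \<dots>"
  proof (intro dvd_sum dvd_mult2)
    fix c assume c: "c \<in> ?U (Suc n)"
    have "pp ^ n dvd (of_int (c - c mod ?q) :: 'p padic_int)" by (simp only: pp_power_dvd_of_int dvd_minus_mod)
    hence "pp ^ N dvd (of_int c - of_int (c mod ?q) :: 'p padic_int)"
      using dvd_trans[OF le_imp_power_dvd[OF n(1)]] unfolding of_int_diff by blast
    moreover have "(of_int c :: 'p padic_int) \<in> padic_units" by (rule unit_residue_is_unit[OF _ c]) simp
    moreover have "(of_int (c mod ?q) :: 'p padic_int) \<in> padic_units"
      by (rule unit_residue_is_unit[OF n(2) unit_residues_Suc[OF c]])
    ultimately show "pp ^ m dvd f (of_int c) - f (of_int (c mod ?q))" using N by blast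
  qed
  finally show ?thesis .
qed

lemma riemann_sum_tendsto:
  fixes \<mu> :: "'p :: prime_card iwasawa"
  assumes "ucont f"
  shows "riemann_sum f \<mu> \<longlonglongrightarrow> measure_integral f \<mu>"
proof -
  have "\<exists>l. riemann_sum f \<mu> \<longlonglongrightarrow> l"
  proof (rule padic_cauchy_convergent)
    fix m
    obtain N where "N \<ge> 1" "\<forall>x\<in>padic_units. \<forall>y\<in>padic_units. pp ^ N dvd x - y \<longrightarrow> pp ^ m dvd f x - f y"
      using assms by (rule ucontE)
    thus "\<exists>N. \<forall>n\<ge>N. pp ^ m dvd riemann_sum f \<mu> (Suc n) - riemann_sum f \<mu> n"
      using riemann_sum_step[of N m f] by (meson le_trans)
  qed
  then obtain l where l: "riemann_sum f \<mu> \<longlonglongrightarrow> l" by blast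
  have "measure_integral f \<mu> = lim (riemann_sum f \<mu>)"
    by (simp add: measure_integral_def riemann_sum_def[abs_def])
  thus ?thesis using l by (simp add: limI)
qed

lemma measure_integral_eqI: "riemann_sum f \<mu> \<longlonglongrightarrow> l \<Longrightarrow> measure_integral f \<mu> = l"
  by (simp add: measure_integral_def riemann_sum_def[abs_def] limI)

lemma measure_integral_eqI_mod:
  fixes \<mu> :: "'p :: prime_card iwasawa"
  assumes "\<And>m. \<exists>N. \<forall>n\<ge>N. pp ^ m dvd riemann_sum f \<mu> n - l"
  shows "measure_integral f \<mu> = l"
  by (rule measure_integral_eqI) (use assms in \<open>simp add: padic_tendsto_iff eventually_sequentially\<close>)

lemma measure_integral_mod:
  fixes \<mu> :: "'p :: prime_card iwasawa"
  assumes "ucont f"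
  obtains N where "\<forall>n\<ge>N. pp ^ m dvd riemann_sum f \<mu> n - measure_integral f \<mu>"
  using riemann_sum_tendsto[OF assms, of \<mu>] by (auto simp: padic_tendsto_iff eventually_sequentially)

lemma measure_integral_dvd:
  fixes \<mu> :: "'p :: prime_card iwasawa"
  assumes f: "ucont f" "\<And>x. x \<in> padic_units \<Longrightarrow> pp ^ m dvd f x"
  shows "pp ^ m dvd measure_integral f \<mu>"
proof -
  obtain N where N: "\<forall>n\<ge>N. pp ^ m dvd riemann_sum f \<mu> n - measure_integral f \<mu>"
    using f(1) by (rule measure_integral_mod)
  have "pp ^ m dvd riemann_sum f \<mu> (Suc N)"
    unfolding riemann_sum_def by (intro dvd_sum dvd_mult2 f(2) unit_residue_is_unit[of "Suc N"]) auto
  moreover have "pp ^ m dvd riemann_sum f \<mu> (Suc N) - measure_integral f \<mu>" using N by simp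
  ultimately have "pp ^ m dvd riemann_sum f \<mu> (Suc N) - (riemann_sum f \<mu> (Suc N) - measure_integral f \<mu>)"
    by (rule dvd_diff)
  thus ?thesis by simp
qed

lemma measure_integral_add:
  assumes "ucont f" "ucont g"
  shows "measure_integral (\<lambda>x. f x + g x) \<mu> = measure_integral f \<mu> + measure_integral g \<mu>"
proof (rule measure_integral_eqI_mod)
  fix m
  obtain N where N: "\<forall>n\<ge>N. pp ^ m dvd riemann_sum f \<mu> n - measure_integral f \<mu>"
    using assms(1) by (rule measure_integral_mod)
  obtain M where M: "\<forall>n\<ge>M. pp ^ m dvd riemann_sum g \<mu> n - measure_integral g \<mu>"
    using assms(2) by (rule measure_integral_mod)
  show "\<exists>N. \<forall>n\<ge>N. pp ^ m dvd riemann_sum (\<lambda>x. f x + g x) \<mu> n - (measure_integral f \<mu> + measure_integral g \<mu>)"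
  proof (intro exI[of _ "N + M"] allI impI)
    fix n assume "n \<ge> N + M"
    hence "pp ^ m dvd (riemann_sum f \<mu> n - measure_integral f \<mu>) + (riemann_sum g \<mu> n - measure_integral g \<mu>)"
      using N M by (intro dvd_add) auto
    thus "pp ^ m dvd riemann_sum (\<lambda>x. f x + g x) \<mu> n - (measure_integral f \<mu> + measure_integral g \<mu>)"
      by (simp add: riemann_sum_def distrib_right sum.distrib algebra_simps)
  qed
qed

lemma measure_integral_cmult:
  assumes "ucont f"
  shows "measure_integral (\<lambda>x. c * f x) \<mu> = c * measure_integral f \<mu>"
proof (rule measure_integral_eqI_mod)
  fix m
  obtain N where N: "\<forall>n\<ge>N. pp ^ m dvd riemann_sum f \<mu> n - measure_integral f \<mu>"
    using assms by (rule measure_integral_mod)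
  have "pp ^ m dvd riemann_sum (\<lambda>x. c * f x) \<mu> n - c * measure_integral f \<mu>" if "n \<ge> N" for n
  proof -
    have "pp ^ m dvd c * (riemann_sum f \<mu> n - measure_integral f \<mu>)" using N that by (intro dvd_mult) auto
    thus ?thesis by (simp add: riemann_sum_def sum_distrib_left right_diff_distrib mult_ac)
  qed
  thus "\<exists>N. \<forall>n\<ge>N. pp ^ m dvd riemann_sum (\<lambda>x. c * f x) \<mu> n - c * measure_integral f \<mu>" by blast
qed

lemma measure_integral_0 [simp]: "measure_integral (\<lambda>_. 0) \<mu> = 0"
  by (rule measure_integral_eqI_mod) (simp add: riemann_sum_def)

lemma measure_integral_diff:
  assumes "ucont f" "ucont g"
  shows "measure_integral (\<lambda>x. f x - g x) \<mu> = measure_integral f \<mu> - measure_integral g \<mu>"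
proof -
  have "measure_integral (\<lambda>x. (f x - g x) + g x) \<mu> = measure_integral (\<lambda>x. f x - g x) \<mu> + measure_integral g \<mu>"
    using assms by (intro measure_integral_add) auto
  thus ?thesis by simp
qed

lemma measure_integral_sum:
  assumes "\<And>i. i \<in> A \<Longrightarrow> ucont (f i)"
  shows "measure_integral (\<lambda>x. \<Sum>i\<in>A. f i x) \<mu> = (\<Sum>i\<in>A. measure_integral (f i) \<mu>)"
  using assms by (induction A rule: infinite_finite_induct) (simp_all add: measure_integral_add ucont_sum)

lemma measure_integral_cong:
  fixes \<mu> :: "'p :: prime_card iwasawa"
  assumes "ucont f" "\<And>x. x \<in> padic_units \<Longrightarrow> f x = g x"
  shows "measure_integral f \<mu> = measure_integral g \<mu>"
proof (rule measure_integral_eqI_mod[symmetric])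
  fix m
  obtain N where N: "\<forall>n\<ge>N. pp ^ m dvd riemann_sum f \<mu> n - measure_integral f \<mu>"
    using assms(1) by (rule measure_integral_mod)
  \<comment> \<open>From level 1 on all sample points are units. The sample point 0 of level 0 has
    no influence on the limit.\<close>
  have eq: "riemann_sum g \<mu> n = riemann_sum f \<mu> n" if "n \<ge> 1" for n
    unfolding riemann_sum_def
    by (intro sum.cong refl) (simp add: assms(2)[OF unit_residue_is_unit[OF that]])
  show "\<exists>N. \<forall>n\<ge>N. pp ^ m dvd riemann_sum g \<mu> n - measure_integral f \<mu>"
    by (intro exI[of _ "Suc N"] allI impI, subst eq) (use N in auto)
qed

section \<open>The integral as a function of the measure: sums, convolution, Dirac measures\<close>

lemma mass_plus: "mass (\<mu> + \<nu>) n b = mass \<mu> n b + mass \<nu> n b"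
  and mass_zero [simp]: "mass 0 n b = 0"
  by (simp_all add: plus_iwasawa.rep_eq zero_iwasawa.rep_eq)

lemma measure_integral_plus_measure:
  assumes "ucont f"
  shows "measure_integral f (\<mu> + \<nu>) = measure_integral f \<mu> + measure_integral f \<nu>"
proof (rule measure_integral_eqI_mod)
  fix m
  obtain N where N: "\<forall>n\<ge>N. pp ^ m dvd riemann_sum f \<mu> n - measure_integral f \<mu>"
    using assms(1) by (rule measure_integral_mod)
  obtain M where M: "\<forall>n\<ge>M. pp ^ m dvd riemann_sum f \<nu> n - measure_integral f \<nu>"
    using assms(1) by (rule measure_integral_mod)
  show "\<exists>N. \<forall>n\<ge>N. pp ^ m dvd riemann_sum f (\<mu> + \<nu>) n - (measure_integral f \<mu> + measure_integral f \<nu>)"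
  proof (intro exI[of _ "N + M"] allI impI)
    fix n assume "n \<ge> N + M"
    hence "pp ^ m dvd (riemann_sum f \<mu> n - measure_integral f \<mu>) + (riemann_sum f \<nu> n - measure_integral f \<nu>)"
      using N M by (intro dvd_add) auto
    thus "pp ^ m dvd riemann_sum f (\<mu> + \<nu>) n - (measure_integral f \<mu> + measure_integral f \<nu>)"
      by (simp add: riemann_sum_def mass_plus distrib_left sum.distrib algebra_simps)
  qed
qed

lemma measure_integral_zero_measure [simp]: "measure_integral f 0 = 0"
  by (rule measure_integral_eqI_mod) (simp add: riemann_sum_def)

lemma measure_integral_minus_measure:
  assumes "ucont f"
  shows "measure_integral f (\<mu> - \<nu>) = measure_integral f \<mu> - measure_integral f \<nu>"
  using measure_integral_plus_measure[OF assms, of "\<mu> - \<nu>" \<nu>] by simp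

lemma padic_units_mult: "x \<in> padic_units \<Longrightarrow> y \<in> padic_units \<Longrightarrow> x * y \<in> padic_units"
  by (simp add: padic_units_def)

lemma padic_units_1 [simp]: "1 \<in> padic_units"
  by (simp add: padic_units_def)

text \<open>For multiplicative f the Riemann sum of a convolution differs from the product of the
  Riemann sums only through reducing c d modulo p^n.\<close>

lemma measure_integral_times:
  fixes \<mu> \<nu> :: "'p :: prime_card iwasawa"
  assumes f: "ucont f" and mult: "\<And>x y. f (x * y) = f x * f y"
  shows "measure_integral f (\<mu> * \<nu>) = measure_integral f \<mu> * measure_integral f \<nu>"
proof (rule measure_integral_eqI_mod)
  fix m
  let ?U = "unit_residues TYPE('p)"
  obtain L where L: "\<forall>x\<in>padic_units. \<forall>y\<in>padic_units. pp ^ L dvd x - y \<longrightarrow> pp ^ m dvd f x - f y"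
    using f by (rule ucontE)
  obtain N where N: "\<forall>n\<ge>N. pp ^ m dvd riemann_sum f \<mu> n - measure_integral f \<mu>"
    using f by (rule measure_integral_mod)
  obtain M where M: "\<forall>n\<ge>M. pp ^ m dvd riemann_sum f \<nu> n - measure_integral f \<nu>"
    using f by (rule measure_integral_mod)
  show "\<exists>N. \<forall>n\<ge>N. pp ^ m dvd riemann_sum f (\<mu> * \<nu>) n - measure_integral f \<mu> * measure_integral f \<nu>"
  proof (intro exI[of _ "Suc (L + N + M)"] allI impI)
    fix n assume n: "n \<ge> Suc (L + N + M)"
    let ?q = "int CARD('p) ^ n"
    have "riemann_sum f (\<mu> * \<nu>) n - riemann_sum f \<mu> n * riemann_sum f \<nu> n =
        (\<Sum>c\<in>?U n. \<Sum>d\<in>?U n. (f (of_int ((c * d) mod ?q)) - f (of_int c * of_int d)) * (mass \<mu> n c * mass \<nu> n d))"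
      unfolding riemann_sum_def
      by (subst sum_mass_times[of "\<lambda>b. f (of_int b)"])
         (simp add: sum_product mult left_diff_distrib right_diff_distrib sum_subtractf mult_ac)
    also have "pp ^ m dvd \<dots>"
    proof (intro dvd_sum dvd_mult2)
      fix c d assume cd: "c \<in> ?U n" "d \<in> ?U n"
      have n1: "n \<ge> 1" using n by simp
      have "pp ^ n dvd (of_int ((c * d) mod ?q - c * d) :: 'p padic_int)"
        by (simp only: pp_power_dvd_of_int) (metis dvd_minus_mod dvd_diff_swap)
      hence "pp ^ L dvd (of_int ((c * d) mod ?q) - of_int c * of_int d :: 'p padic_int)"
        using le_imp_power_dvd[of L n "pp :: 'p padic_int"] n by (auto dest: dvd_trans)
      thus "pp ^ m dvd f (of_int ((c * d) mod ?q)) - f (of_int c * of_int d)"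
        using L unit_residue_is_unit[OF n1 unit_residues_mult[OF cd]]
          padic_units_mult[OF unit_residue_is_unit[OF n1 cd(1)] unit_residue_is_unit[OF n1 cd(2)]] by blast
    qed
    finally have 1: "pp ^ m dvd riemann_sum f (\<mu> * \<nu>) n - riemann_sum f \<mu> n * riemann_sum f \<nu> n" .
    have 2: "pp ^ m dvd riemann_sum f \<mu> n * riemann_sum f \<nu> n - measure_integral f \<mu> * measure_integral f \<nu>"
      using N M n by (intro dvd_mult_diff) auto
    show "pp ^ m dvd riemann_sum f (\<mu> * \<nu>) n - measure_integral f \<mu> * measure_integral f \<nu>"
      using dvd_add[OF 1 2] by simp
  qed
qed

lemma measure_integral_dirac:
  fixes g :: "'p :: prime_card padic_int"
  assumes f: "ucont f" and g: "g \<in> padic_units"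
  shows "measure_integral f (dirac g) = f g"
proof (rule measure_integral_eqI_mod)
  fix m
  obtain L where L: "\<forall>x\<in>padic_units. \<forall>y\<in>padic_units. pp ^ L dvd x - y \<longrightarrow> pp ^ m dvd f x - f y"
    using f by (rule ucontE)
  have R: "riemann_sum f (dirac g) n = f (of_int (padic_residue g n))" for n
  proof -
    have "riemann_sum f (dirac g) n = (\<Sum>b\<in>unit_residues TYPE('p) n.
        if b = padic_residue g n then f (of_int (padic_residue g n)) else 0)"
      unfolding riemann_sum_def using g by (intro sum.cong refl) (simp add: dirac.rep_eq)
    thus ?thesis by (simp add: residue_unit[OF g])
  qed
  show "\<exists>N. \<forall>n\<ge>N. pp ^ m dvd riemann_sum f (dirac g) n - f g"
  proof (intro exI[of _ "Suc L"] allI impI)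
    fix n assume n: "n \<ge> Suc L"
    hence n1: "n \<ge> 1" by simp
    have "pp ^ n dvd of_int (padic_residue g n) - g"
      using pp_power_dvd_residue[of n g] by (rule dvd_diff_swap)
    hence "pp ^ L dvd of_int (padic_residue g n) - g"
      using n by (meson Suc_leD dvd_trans le_imp_power_dvd)
    thus "pp ^ m dvd riemann_sum f (dirac g) n - f g"
      unfolding R using L unit_residue_is_unit[OF n1 residue_unit[OF g]] g by blast
  qed
qed

section \<open>Densities\<close>

text \<open>The mass of a class is the integral of w over it. It is additive because the class is
  the disjoint union of the classes above it at the next level.\<close>

lemma density_family:
  fixes \<mu> :: "'p :: prime_card iwasawa"
  assumes w: "ucont w"
  shows "measure_family (\<lambda>n b. if b \<in> unit_residues TYPE('p) n
    then measure_integral (\<lambda>x. if padic_residue x n = b then w x else 0) \<mu> else 0)"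
proof (rule measure_familyI)
  fix n b assume b: "b \<in> unit_residues TYPE('p) n"
  let ?A = "{c. c \<in> unit_residues TYPE('p) (Suc n) \<and> c mod int CARD('p) ^ n = b}"
  have fin: "finite ?A" by (rule finite_subset[of _ "unit_residues TYPE('p) (Suc n)"]) auto
  have "measure_integral (\<lambda>x. if padic_residue x n = b then w x else 0) \<mu>
      = measure_integral (\<lambda>x. \<Sum>c\<in>?A. if padic_residue x (Suc n) = c then w x else 0) \<mu>"
  proof (rule measure_integral_cong)
    fix x :: "'p padic_int" assume "x \<in> padic_units"
    hence "padic_residue x (Suc n) \<in> ?A \<longleftrightarrow> padic_residue x n = b"
      using residue_unit by auto
    thus "(if padic_residue x n = b then w x else 0) = (\<Sum>c\<in>?A. if padic_residue x (Suc n) = c then w x else 0)"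
      using fin by (simp add: sum.delta)
  qed (use w in blast)
  also have "\<dots> = (\<Sum>c\<in>?A. measure_integral (\<lambda>x. if padic_residue x (Suc n) = c then w x else 0) \<mu>)"
    using w by (intro measure_integral_sum) blast
  finally show "(if b \<in> unit_residues TYPE('p) n
      then measure_integral (\<lambda>x. if padic_residue x n = b then w x else 0) \<mu> else 0) =
    (\<Sum>c\<in>?A. if c \<in> unit_residues TYPE('p) (Suc n)
      then measure_integral (\<lambda>x. if padic_residue x (Suc n) = c then w x else 0) \<mu> else 0)"
    using b by simp
qed simp

definition density_measure :: "('p padic_int \<Rightarrow> 'p padic_int) \<Rightarrow> 'p :: prime_card iwasawa \<Rightarrow> 'p iwasawa" where
  "density_measure w \<mu> = Abs_iwasawa (\<lambda>n b. if b \<in> unit_residues TYPE('p) n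
    then measure_integral (\<lambda>x. if padic_residue x n = b then w x else 0) \<mu> else 0)"

lemma mass_density:
  fixes \<mu> :: "'p :: prime_card iwasawa"
  assumes "ucont w" "b \<in> unit_residues TYPE('p) n"
  shows "mass (density_measure w \<mu>) n b = measure_integral (\<lambda>x. if padic_residue x n = b then w x else 0) \<mu>"
  unfolding density_measure_def
  by (subst Abs_iwasawa_inverse) (use density_family[OF assms(1), of \<mu>] assms(2) in auto)

lemma measure_integral_density:
  fixes \<mu> :: "'p :: prime_card iwasawa"
  assumes f: "ucont f" and w: "ucont w"
  shows "measure_integral f (density_measure w \<mu>) = measure_integral (\<lambda>x. f x * w x) \<mu>"
proof (rule measure_integral_eqI_mod)
  fix m
  let ?U = "unit_residues TYPE('p)"
  obtain L where L: "\<forall>x\<in>padic_units. \<forall>y\<in>padic_units. pp ^ L dvd x - y \<longrightarrow> pp ^ m dvd f x - f y"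
    using f by (rule ucontE)
  show "\<exists>N. \<forall>n\<ge>N. pp ^ m dvd riemann_sum f (density_measure w \<mu>) n - measure_integral (\<lambda>x. f x * w x) \<mu>"
  proof (intro exI[of _ "Suc L"] allI impI)
    fix n assume n: "n \<ge> Suc L"
    hence n1: "n \<ge> 1" by simp
    \<comment> \<open>\<open>?F\<close> is w times the function that samples f at the residue of
      level n. The Riemann sum against the density is exactly its integral, and on units it is
      uniformly close to f w.\<close>
    let ?F = "\<lambda>x. \<Sum>b\<in>?U n. f (of_int b) * (if padic_residue x n = b then w x else 0)"
    have F: "?F x = f (of_int (padic_residue x n)) * w x" if "x \<in> padic_units" for x
    proof -
      have "?F x = (\<Sum>b\<in>?U n. if b = padic_residue x n then f (of_int (padic_residue x n)) * w x else 0)"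
        by (intro sum.cong refl) auto
      thus ?thesis by (simp add: residue_unit[OF that])
    qed
    have uF: "ucont ?F" using w by (intro ucont_sum ucont_mult ucont_indicator) auto
    have ufw: "ucont (\<lambda>x. f x * w x)" using f w by blast
    have "riemann_sum f (density_measure w \<mu>) n = measure_integral ?F \<mu>"
      unfolding riemann_sum_def
      by (subst measure_integral_sum)
         (use w in \<open>auto simp: mass_density measure_integral_cmult ucont_indicator intro!: sum.cong\<close>)
    hence "riemann_sum f (density_measure w \<mu>) n - measure_integral (\<lambda>x. f x * w x) \<mu>
        = measure_integral (\<lambda>x. ?F x - f x * w x) \<mu>"
      by (simp only: measure_integral_diff[OF uF ufw])
    also have "pp ^ m dvd \<dots>"
    proof (rule measure_integral_dvd)
      show "ucont (\<lambda>x. ?F x - f x * w x)" using uF ufw by (rule ucont_diff)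
      fix x :: "'p padic_int" assume x: "x \<in> padic_units"
      have "pp ^ n dvd of_int (padic_residue x n) - x"
        using pp_power_dvd_residue[of n x] by (rule dvd_diff_swap)
      hence "pp ^ L dvd of_int (padic_residue x n) - x"
        using n by (meson Suc_leD dvd_trans le_imp_power_dvd)
      hence "pp ^ m dvd f (of_int (padic_residue x n)) - f x"
        using L unit_residue_is_unit[OF n1 residue_unit[OF x]] x by blast
      hence "pp ^ m dvd (f (of_int (padic_residue x n)) - f x) * w x" by (rule dvd_mult2)
      thus "pp ^ m dvd ?F x - f x * w x" by (simp only: F[OF x] left_diff_distrib)
    qed
    finally show "pp ^ m dvd riemann_sum f (density_measure w \<mu>) n - measure_integral (\<lambda>x. f x * w x) \<mu>" .
  qed
qed

definition padic_inv :: "'p :: prime_card padic_int \<Rightarrow> 'p padic_int" where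
  "padic_inv x = (SOME y. x * y = 1)"

lemma padic_inv: "x \<in> padic_units \<Longrightarrow> x * padic_inv x = 1"
  unfolding padic_inv_def by (rule someI_ex) (auto simp: padic_units_def dvd_def)

lemma padic_inv_unit: "x \<in> padic_units \<Longrightarrow> padic_inv x \<in> padic_units"
  using padic_inv[of x] by (auto simp: padic_units_def dvd_def mult.commute intro!: exI[of _ x])

lemma ucont_padic_inv [intro]: "ucont padic_inv"
proof (rule ucontI)
  fix m
  have "pp ^ m dvd padic_inv x - padic_inv y"
    if "x \<in> padic_units" "y \<in> padic_units" "pp ^ m dvd x - y" for x y :: "'a padic_int"
  proof -
    have "padic_inv x - padic_inv y = (y * padic_inv y) * padic_inv x - (x * padic_inv x) * padic_inv y"
      using that by (simp add: padic_inv)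
    also have "\<dots> = (x - y) * (- (padic_inv x * padic_inv y))" by (simp add: algebra_simps)
    also have "pp ^ m dvd \<dots>" using that(3) by (rule dvd_mult2)
    finally show ?thesis .
  qed
  thus "\<exists>N. \<forall>x\<in>padic_units. \<forall>y\<in>padic_units. pp ^ N dvd x - y \<longrightarrow> pp ^ m dvd padic_inv x - padic_inv (y :: 'a padic_int)"
    by blast
qed

section \<open>The Mahler transform\<close>

lemma falling_factorial_of_nat:
  "(\<Prod>i<k. of_nat N - of_nat i :: 'a :: comm_ring_1) = of_nat (fact k * (N choose k))"
proof (induction k)
  case (Suc k)
  have *: "fact k * (N choose k) * (N - k) = fact (Suc k) * (N choose Suc k)"
  proof -
    have "(N choose k) * (N - k) = Suc k * (N choose Suc k)"
      using binomial_absorb_comp[of N k] binomial_absorption[of k N] by (simp add: mult.commute)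
    thus ?thesis unfolding mult.assoc fact_Suc by (simp only: of_nat_id mult_ac)
  qed
  have "(of_nat (N choose k) :: 'a) * (of_nat N - of_nat k) = of_nat ((N choose k) * (N - k))"
    by (cases "k \<le> N") (simp_all add: binomial_eq_0 of_nat_diff)
  hence "(\<Prod>i<Suc k. of_nat N - of_nat i :: 'a) = of_nat (fact k * ((N choose k) * (N - k)))"
    using Suc by (simp add: mult.assoc)
  thus ?case using * by (simp only: mult.assoc)
qed simp

lemma dvd_prod_diff:
  fixes x y :: "'a :: comm_ring_1"
  assumes "q dvd x - y"
  shows "q dvd (\<Prod>i<k. x - of_nat i) - (\<Prod>i<k. y - of_nat i)"
  by (induction k) (use assms in \<open>auto intro!: dvd_mult_diff\<close>)

text \<open>Modulo the p-part p^v of k!, the falling factorial of x agrees with that of a natural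
  number N congruent to x, which k! divides. The remaining part of k! is a unit.\<close>

lemma padic_binomial:
  fixes x :: "'p :: prime_card padic_int"
  shows "of_nat (fact k) * padic_binomial x k = (\<Prod>i<k. x - of_nat i)"
proof -
  have nz: "(of_nat (fact k) :: 'p padic_int) \<noteq> 0" by (metis fact_nonzero of_nat_eq_0_iff)
  then obtain v u where vu: "(of_nat (fact k) :: 'p padic_int) = pp ^ v * u" "u dvd 1" by (rule padic_factor)
  define N where "N = nat (padic_residue x v)"
  have "pp ^ v dvd x - of_nat N" using pp_power_dvd_residue[of v x] by (simp add: N_def)
  hence "pp ^ v dvd (\<Prod>i<k. x - of_nat i) - (\<Prod>i<k. of_nat N - of_nat i)" by (rule dvd_prod_diff)
  moreover have "pp ^ v dvd (\<Prod>i<k. of_nat N - of_nat i :: 'p padic_int)"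
    unfolding falling_factorial_of_nat of_nat_mult vu(1) by simp
  ultimately have "pp ^ v dvd (\<Prod>i<k. x - of_nat i)" by (metis dvd_add diff_add_cancel)
  then obtain z where z: "(\<Prod>i<k. x - of_nat i) = pp ^ v * z" by (auto simp: dvd_def)
  obtain u' where u': "1 = u * u'" using vu(2) by (auto simp: dvd_def)
  have e: "of_nat (fact k) * (u' * z) = (\<Prod>i<k. x - of_nat i)"
  proof -
    have "of_nat (fact k) * (u' * z) = (u * u') * (pp ^ v * z)" unfolding vu(1) by (simp only: mult_ac)
    thus ?thesis by (simp add: z flip: u')
  qed
  have "padic_binomial x k = u' * z"
    unfolding padic_binomial_def
  proof (rule the_equality)
    show "of_nat (fact k) * (u' * z) = (\<Prod>i<k. x - of_nat i)" by (rule e)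
    fix y assume "of_nat (fact k) * y = (\<Prod>i<k. x - of_nat i)"
    hence "of_nat (fact k) * y = of_nat (fact k) * (u' * z)" by (simp only: e)
    thus "y = u' * z" by (simp only: mult_left_cancel[OF nz])
  qed
  thus ?thesis by (simp only: e)
qed

lemma padic_binomial_of_nat: "padic_binomial (of_nat N :: 'p :: prime_card padic_int) k = of_nat (N choose k)"
proof -
  have nz: "(of_nat (fact k) :: 'p padic_int) \<noteq> 0" by (metis fact_nonzero of_nat_eq_0_iff)
  have "of_nat (fact k) * padic_binomial (of_nat N :: 'p padic_int) k = of_nat (fact k) * of_nat (N choose k)"
    unfolding padic_binomial falling_factorial_of_nat by simp
  thus ?thesis using nz by (simp only: mult_left_cancel[OF nz])
qed

lemma padic_binomial_0 [simp]: "padic_binomial x 0 = 1"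
  using padic_binomial[of 0 x] by simp

text \<open>On coefficients of power series this is the effect of \<open>del\<close>, whence
  \<open>del\<close> corresponds to multiplying the measure by x.\<close>

lemma mult_padic_binomial:
  "x * padic_binomial x k = of_nat k * padic_binomial x k + of_nat (Suc k) * padic_binomial (x :: 'p :: prime_card padic_int) (Suc k)"
proof -
  have nz: "(of_nat (fact k) :: 'p padic_int) \<noteq> 0" by (metis fact_nonzero of_nat_eq_0_iff)
  have "of_nat (fact k) * (of_nat (Suc k) * padic_binomial x (Suc k)) = of_nat (fact (Suc k)) * padic_binomial x (Suc k)"
    by (simp only: fact_Suc of_nat_mult mult_ac of_nat_id)
  also have "\<dots> = of_nat (fact k) * (padic_binomial x k * (x - of_nat k))"
    unfolding padic_binomial by (simp add: mult.assoc[symmetric] padic_binomial del: of_nat_fact)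
  finally have "of_nat (Suc k) * padic_binomial x (Suc k) = padic_binomial x k * (x - of_nat k)"
    by (simp only: mult_left_cancel[OF nz])
  thus ?thesis by (simp add: algebra_simps)
qed

lemma ucont_padic_binomial [intro]: "ucont (\<lambda>x. padic_binomial x k)"
proof (rule ucontI)
  fix m
  have "fact k > (0 :: nat)" by simp
  then obtain v where v: "\<And>n (x :: 'a padic_int). pp ^ (n + v) dvd of_nat (fact k) * x \<Longrightarrow> pp ^ n dvd x"
    using pp_power_dvd_cancel_nat[of "fact k", where 'p = 'a] by metis
  have "pp ^ m dvd padic_binomial x k - padic_binomial y k" if "pp ^ (m + v) dvd x - y" for x y :: "'a padic_int"
  proof (rule v)
    show "pp ^ (m + v) dvd of_nat (fact k) * (padic_binomial x k - padic_binomial y k)"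
      unfolding right_diff_distrib padic_binomial by (rule dvd_prod_diff[OF that])
  qed
  thus "\<exists>N. \<forall>x\<in>padic_units. \<forall>y\<in>padic_units. pp ^ N dvd x - y \<longrightarrow>
     pp ^ m dvd padic_binomial x k - padic_binomial (y :: 'a padic_int) k" by blast
qed

text \<open>The Mahler transform of the measure with density f, written as an integral against \<mu>
  itself, so that \<open>del\<close> can act before the density is turned into a measure.\<close>

definition mahler_weighted :: "('p padic_int \<Rightarrow> 'p padic_int) \<Rightarrow> 'p :: prime_card iwasawa \<Rightarrow> 'p padic_int fps" where
  "mahler_weighted f \<mu> = Abs_fps (\<lambda>k. measure_integral (\<lambda>x. padic_binomial x k * f x) \<mu>)"

lemma mahler_eq_weighted: "mahler \<mu> = mahler_weighted (\<lambda>_. 1) \<mu>"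
  by (simp add: mahler_def mahler_weighted_def)

lemma mahler_density: "ucont w \<Longrightarrow> mahler (density_measure w \<mu>) = mahler_weighted w \<mu>"
  by (rule fps_ext) (simp add: mahler_def mahler_weighted_def measure_integral_density ucont_padic_binomial)

lemma del_mahler_weighted:
  assumes f: "ucont f"
  shows "del (mahler_weighted f \<mu>) = mahler_weighted (\<lambda>x. x * f x) \<mu>"
proof (rule fps_ext)
  fix k
  have "del (mahler_weighted f \<mu>) $ k = of_nat k * measure_integral (\<lambda>x. padic_binomial x k * f x) \<mu>
      + of_nat (Suc k) * measure_integral (\<lambda>x. padic_binomial x (Suc k) * f x) \<mu>"
    by (cases k) (simp_all add: del_def mahler_weighted_def distrib_right algebra_simps)
  also have "\<dots> = measure_integral (\<lambda>x. of_nat k * (padic_binomial x k * f x)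
      + of_nat (Suc k) * (padic_binomial x (Suc k) * f x)) \<mu>"
    using f by (subst measure_integral_add) (auto simp: measure_integral_cmult ucont_mult ucont_padic_binomial
        simp del: of_nat_Suc)
  also have "(\<lambda>x. of_nat k * (padic_binomial x k * f x) + of_nat (Suc k) * (padic_binomial x (Suc k) * f x))
      = (\<lambda>x. padic_binomial x k * (x * f x))"
  proof
    fix x
    have "padic_binomial x k * (x * f x) = (x * padic_binomial x k) * f x" by (simp only: mult_ac)
    thus "of_nat k * (padic_binomial x k * f x) + of_nat (Suc k) * (padic_binomial x (Suc k) * f x)
        = padic_binomial x k * (x * f x)"
      unfolding mult_padic_binomial by (simp only: distrib_right mult.assoc)
  qed
  finally show "del (mahler_weighted f \<mu>) $ k = mahler_weighted (\<lambda>x. x * f x) \<mu> $ k"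
    by (simp add: mahler_weighted_def)
qed

lemma del_funpow_mahler_weighted:
  assumes f: "ucont f"
  shows "(del ^^ j) (mahler_weighted f \<mu>) = mahler_weighted (\<lambda>x. x ^ j * f x) \<mu>"
proof (induction j)
  case (Suc j)
  have "ucont (\<lambda>x. x ^ j * f x)" by (intro ucont_mult ucont_power ucont_id f)
  thus ?case using Suc by (simp add: del_mahler_weighted mult.assoc)
qed simp

lemma mahler_weighted_nth_0: "mahler_weighted f \<mu> $ 0 = measure_integral f \<mu>"
  by (simp add: mahler_weighted_def)

lemma del_funpow_nth_0:
  assumes "\<And>k. k < d \<Longrightarrow> F $ k = 0"
  shows "(del ^^ d) F $ 0 = of_nat (fact d) * F $ d"
  using assms
proof (induction d arbitrary: F)
  case (Suc d)
  have nth: "del F $ k = of_nat k * F $ k + of_nat (Suc k) * F $ Suc k" for k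
    by (cases k) (simp_all add: del_def distrib_right algebra_simps)
  have "(del ^^ Suc d) F $ 0 = (del ^^ d) (del F) $ 0" by (simp only: funpow_Suc_right o_apply)
  also have "\<dots> = of_nat (fact d) * del F $ d" by (rule Suc.IH) (simp add: nth Suc.prems)
  also have "\<dots> = of_nat (fact (Suc d)) * F $ Suc d"
    using Suc.prems[of d] by (simp add: nth mult_ac distrib_left)
  finally show ?case .
qed simp

text \<open>If d is the first degree in which F and G differ, the d-th iterate of \<open>del\<close>
  on F - G has constant term d! times that coefficient, and Z_p is torsion-free.\<close>

lemma fps_eq_if_del_funpow_eq:
  fixes F G :: "'p :: prime_card padic_int fps"
  assumes "\<And>j. (del ^^ j) F $ 0 = (del ^^ j) G $ 0"
  shows "F = G"
proof (rule ccontr)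
  assume "F \<noteq> G"
  hence nz: "F - G \<noteq> 0" by simp
  define d where "d = subdegree (F - G)"
  have diff: "(del ^^ j) (F - G) = (del ^^ j) F - (del ^^ j) G" for j by (induction j) (simp_all add: del_diff)
  have "(del ^^ d) (F - G) $ 0 = of_nat (fact d) * (F - G) $ d"
    by (rule del_funpow_nth_0) (use nth_less_subdegree_zero d_def in blast)
  moreover have "(F - G) $ d \<noteq> 0" using nz by (simp only: d_def nth_subdegree_nonzero not_False_eq_True)
  ultimately show False using assms[of d] by (simp add: diff)
qed

text \<open>The Mahler transform is the coefficientwise limit of the polynomials \<Sum> \<mu>(b +
  p^N Z_p) (1 + T)^b. Their twists are explicit, and continuity of the twist passes to the
  limit.\<close>

lemma (in p_power_root) twist_mahler_approx:
  fixes \<mu> :: "'p iwasawa"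
  shows "\<exists>N0. \<forall>N\<ge>N0. twist (mahler \<mu>) \<zeta> $ j -
    (\<Sum>b\<in>unit_residues TYPE('p) N. zp_embed (mass \<mu> N b) * (\<zeta> ^ nat b * of_nat (nat b choose j))) \<in> small m"
proof -
  obtain K where K: "\<And>f. (\<forall>i<K. pp ^ m dvd f $ i) \<Longrightarrow> twist f \<zeta> $ j \<in> small m"
    using twist_continuous by blast
  have "\<forall>\<^sub>F N in sequentially. \<forall>i\<in>{..<K}. pp ^ m dvd riemann_sum (\<lambda>x. padic_binomial x i) \<mu> N - mahler \<mu> $ i"
  proof (rule eventually_ball_finite)
    show "\<forall>i\<in>{..<K}. \<forall>\<^sub>F N in sequentially. pp ^ m dvd riemann_sum (\<lambda>x. padic_binomial x i) \<mu> N - mahler \<mu> $ i"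
      using riemann_sum_tendsto[OF ucont_padic_binomial, of _ \<mu>] by (simp add: padic_tendsto_iff mahler_def)
  qed simp
  then obtain N0 where N0: "\<And>N i. N \<ge> N0 \<Longrightarrow> i < K \<Longrightarrow> pp ^ m dvd riemann_sum (\<lambda>x. padic_binomial x i) \<mu> N - mahler \<mu> $ i"
    unfolding eventually_sequentially by auto
  show ?thesis
  proof (intro exI[of _ N0] allI impI)
    fix N assume N: "N \<ge> N0"
    let ?U = "unit_residues TYPE('p) N"
    define F where "F = (\<Sum>b\<in>?U. fps_const (mass \<mu> N b) * (1 + fps_X) ^ nat b)"
    have bin: "((1 + fps_X :: 'c :: comm_ring_1 fps) ^ i) $ k = of_nat (i choose k)" for i k
      using fps_linear_power_nth[of "1 :: 'c" 1 i k] by (auto simp: not_le binomial_eq_0)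
    have Fi: "F $ i = riemann_sum (\<lambda>x. padic_binomial x i) \<mu> N" for i
      unfolding F_def riemann_sum_def fps_sum_nth
    proof (rule sum.cong[OF refl])
      fix b assume "b \<in> ?U"
      hence "b \<ge> 0" by (simp add: unit_residues_def)
      hence "(of_int b :: 'p padic_int) = of_nat (nat b)" by simp
      thus "(fps_const (mass \<mu> N b) * (1 + fps_X) ^ nat b) $ i = padic_binomial (of_int b) i * mass \<mu> N b"
        by (simp only: padic_binomial_of_nat fps_mult_left_const_nth bin mult.commute)
    qed
    have "pp ^ m dvd (mahler \<mu> - F) $ i" if "i < K" for i
      using dvd_diff_swap[OF N0[OF N that]] by (simp add: Fi)
    hence "twist (mahler \<mu> - F) \<zeta> $ j \<in> small m" by (intro K) blast
    moreover have "twist F \<zeta> $ j = (\<Sum>b\<in>?U. zp_embed (mass \<mu> N b) * (\<zeta> ^ nat b * of_nat (nat b choose j)))"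
      unfolding F_def twist_sum twist_scale twist_power twist_1_X power_mult_distrib fps_sum_nth
      by (simp add: bin fps_const_power)
    ultimately show "twist (mahler \<mu>) \<zeta> $ j -
      (\<Sum>b\<in>?U. zp_embed (mass \<mu> N b) * (\<zeta> ^ nat b * of_nat (nat b choose j))) \<in> small m"
      by (simp add: twist_diff)
  qed
qed

context cyclotomic_tower
begin

text \<open>This is where the support in the units enters: for b prime to p the sum of \<omega>^(i
  b) over i vanishes.\<close>

lemma sum_twist_mahler: "(\<Sum>i<CARD('p). twist (mahler \<mu>) (\<omega> ^ i)) = 0"
proof (rule fps_ext)
  fix j
  let ?S = "\<lambda>N z. \<Sum>b\<in>unit_residues TYPE('p) N. zp_embed (mass \<mu> N b) * (z ^ nat b * of_nat (nat b choose j))"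
  have "(\<Sum>i<CARD('p). twist (mahler \<mu>) (\<omega> ^ i)) $ j = 0"
  proof (rule small_separated)
    fix m
    have "\<forall>i. \<exists>N0. \<forall>N\<ge>N0. twist (mahler \<mu>) (\<omega> ^ i) $ j - ?S N (\<omega> ^ i) \<in> small m"
      using p_power_root.twist_mahler_approx[OF p_power_root_omega] by blast
    from choice[OF this] obtain N0 where
      N0: "\<And>i N. N \<ge> N0 i \<Longrightarrow> twist (mahler \<mu>) (\<omega> ^ i) $ j - ?S N (\<omega> ^ i) \<in> small m" by blast
    \<comment> \<open>The successor keeps N positive, so that the representatives of level N are
      prime to p.\<close>
    define N where "N = Suc (\<Sum>i<CARD('p). N0 i)"
    have "N \<ge> N0 i" if "i < CARD('p)" for i
      using member_le_sum[of i "{..<CARD('p)}" N0] that by (simp add: N_def)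
    hence *: "(\<Sum>i<CARD('p). twist (mahler \<mu>) (\<omega> ^ i) $ j - ?S N (\<omega> ^ i)) \<in> small m"
      by (intro small_sum N0) auto
    have "(\<Sum>i<CARD('p). ?S N (\<omega> ^ i)) = (\<Sum>b\<in>unit_residues TYPE('p) N. \<Sum>i<CARD('p).
        zp_embed (mass \<mu> N b) * ((\<omega> ^ i) ^ nat b * of_nat (nat b choose j)))" by (rule sum.swap)
    also have "\<dots> = 0"
    proof (rule sum.neutral, rule ballI)
      fix b assume b: "b \<in> unit_residues TYPE('p) N"
      have "\<not> CARD('p) dvd nat b"
      proof
        assume "CARD('p) dvd nat b"
        hence "int CARD('p) dvd int (nat b)" by (simp only: int_dvd_int_iff)
        moreover have "int (nat b) = b" using b by (simp add: unit_residues_def)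
        ultimately have "\<not> (of_int b :: 'p padic_int) dvd 1" by (simp add: of_int_unit_iff)
        thus False using unit_residue_is_unit[OF _ b] by (simp add: N_def padic_units_def)
      qed
      hence "\<omega> ^ nat b \<noteq> 1" by (rule prime_order_power_ne_1[OF omega_prime omega])
      moreover have "(\<omega> ^ nat b) ^ CARD('p) = 1" using omega(1) by (metis mult.commute power_mult power_one)
      ultimately have "(\<Sum>i<CARD('p). (\<omega> ^ nat b) ^ i) = 0" by (simp add: geometric_sum)
      hence z: "(\<Sum>i<CARD('p). (\<omega> ^ i) ^ nat b) = 0" by (simp only: mult.commute flip: power_mult)
      have "(\<Sum>i<CARD('p). zp_embed (mass \<mu> N b) * ((\<omega> ^ i) ^ nat b * of_nat (nat b choose j)))
          = zp_embed (mass \<mu> N b) * ((\<Sum>i<CARD('p). (\<omega> ^ i) ^ nat b) * of_nat (nat b choose j))"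
        by (simp only: sum_distrib_left sum_distrib_right)
      thus "(\<Sum>i<CARD('p). zp_embed (mass \<mu> N b) * ((\<omega> ^ i) ^ nat b * of_nat (nat b choose j))) = 0"
        by (simp only: z mult_zero_left mult_zero_right)
    qed
    finally show "(\<Sum>i<CARD('p). twist (mahler \<mu>) (\<omega> ^ i)) $ j \<in> small m"
      using * by (simp add: fps_sum_nth sum_subtractf)
  qed
  thus "(\<Sum>i<CARD('p). twist (mahler \<mu>) (\<omega> ^ i)) $ j = 0 $ j" by simp
qed

lemma psi_mahler: "psi (mahler (\<mu> :: 'p iwasawa)) = 0"
proof (rule psi_eqI)
  have "phi (0 :: 'p padic_int fps) = 0" by (simp add: phi_def)
  thus "zp_embed_fps (phi 0) = fps_const (1 / of_nat CARD('p)) * (\<Sum>\<eta> | \<eta> ^ CARD('p) = 1. twist (mahler \<mu>) \<eta>)"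
    unfolding sum_roots sum_twist_mahler by (simp add: fps_eq_iff)
qed

text \<open>Equal derivatives leave a constant c = f - g, and \<open>psi\<close> fixes constants
  while it kills f and g; hence c = 0.\<close>

lemma del_inj_of_psi_zero:
  fixes f g :: "'p padic_int fps"
  assumes g: "g = mahler \<mu>" and f: "psi f = 0" and eq: "del f = del g"
  shows "f = g"
proof -
  have "(1 + fps_X) * fps_deriv (f - g) = 0" using eq by (simp add: del_def algebra_simps)
  moreover have "(1 + fps_X :: 'p padic_int fps) \<noteq> 0"
  proof
    assume "(1 + fps_X :: 'p padic_int fps) = 0"
    hence "(1 + fps_X :: 'p padic_int fps) $ 0 = 0" by simp
    thus False by simp
  qed
  ultimately have "fps_deriv (f - g) = 0" by simp
  hence "f - g = fps_const ((f - g) $ 0)" by (simp only: fps_deriv_eq_0_iff)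
  then obtain c where c: "f = g + fps_const c" by (metis add.commute diff_add_cancel)
  have "twist f (\<omega> ^ i) = twist g (\<omega> ^ i) + fps_const (zp_embed c)" for i
  proof -
    interpret p_power_root "\<omega> ^ i" 1 by (rule p_power_root_omega)
    show ?thesis unfolding c twist_add twist_const ..
  qed
  hence "(\<Sum>i<CARD('p). twist f (\<omega> ^ i)) = of_nat CARD('p) * fps_const (zp_embed c)"
    using sum_twist_mahler[of \<mu>] by (simp add: sum.distrib g)
  hence "zp_embed_fps (phi (fps_const c)) = fps_const (1 / of_nat CARD('p)) * (\<Sum>\<eta> | \<eta> ^ CARD('p) = 1. twist f \<eta>)"
    unfolding sum_roots by (simp add: fps_of_nat[symmetric] del: fps_of_nat flip: mult.assoc)
  hence "psi f = fps_const c" by (rule psi_eqI)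
  hence "c = 0" using f by simp
  thus ?thesis using c by simp
qed

lemma mahler_minus: "mahler (\<mu> - \<nu>) = mahler \<mu> - mahler \<nu>"
  by (rule fps_ext) (simp add: mahler_def measure_integral_minus_measure ucont_padic_binomial)

text \<open>The value at \<xi>_n^k - 1 is the k-th Fourier coefficient of the measure induced on
  Z/p^n. When all of them vanish, so do the masses.\<close>

lemma mahler_eq_0:
  fixes \<mu> :: "'p iwasawa"
  assumes "mahler \<mu> = 0"
  shows "\<mu> = 0"
proof (rule iwasawa_eqI)
  let ?U = "unit_residues TYPE('p)"
  have fourier: "(\<Sum>b\<in>?U n. zp_embed (mass \<mu> n b) * (\<xi> n ^ k) ^ nat b) = 0" if n: "n \<ge> 1" for n k
  proof (rule small_separated)
    fix m
    let ?z = "\<xi> n ^ k"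
    have z: "?z ^ (CARD('p) ^ n) = 1" using xi_root[OF n] by (metis mult.commute power_mult power_one)
    interpret p_power_root ?z n using odd_p z by unfold_locales
    \<comment> \<open>The character b \<mapsto> z^b has level n, so its Riemann sums no longer
      change from level n on.\<close>
    have step: "(\<Sum>b\<in>?U N. ?z ^ nat b * zp_embed (mass \<mu> N b)) = (\<Sum>b\<in>?U n. ?z ^ nat b * zp_embed (mass \<mu> n b))"
      if "N \<ge> n" for N using that
    proof (induction N rule: dec_induct)
      case (step N)
      have "(\<Sum>b\<in>?U (Suc N). ?z ^ nat b * zp_embed (mass \<mu> (Suc N) b)) =
        (\<Sum>b\<in>?U (Suc N). ?z ^ nat (b mod int CARD('p) ^ N) * zp_embed (mass \<mu> (Suc N) b))"
      proof (rule sum.cong[OF refl])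
        fix b assume "b \<in> ?U (Suc N)"
        hence b: "b \<ge> 0" by (simp add: unit_residues_def)
        have "nat (b mod int CARD('p) ^ N) = nat b mod CARD('p) ^ N"
          using b by (simp add: nat_mod_distrib nat_power_eq)
        moreover have "?z ^ (nat b mod CARD('p) ^ N) = ?z ^ nat b"
        proof -
          have zN: "?z ^ (CARD('p) ^ N) = 1"
          proof -
            have "CARD('p) ^ N = CARD('p) ^ n * CARD('p) ^ (N - n)" using step by (simp flip: power_add)
            thus ?thesis by (simp only: power_mult z power_one)
          qed
          have "?z ^ nat b = ?z ^ (CARD('p) ^ N * (nat b div CARD('p) ^ N) + nat b mod CARD('p) ^ N)" by simp
          also have "\<dots> = ?z ^ (nat b mod CARD('p) ^ N)" by (simp only: power_add power_mult zN power_one mult_1)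
          finally show ?thesis by simp
        qed
        ultimately show "?z ^ nat b * zp_embed (mass \<mu> (Suc N) b)
            = ?z ^ nat (b mod int CARD('p) ^ N) * zp_embed (mass \<mu> (Suc N) b)" by simp
      qed
      also have "\<dots> = (\<Sum>b\<in>?U N. ?z ^ nat b * zp_embed (mass \<mu> N b))"
        by (rule sum_mass_refine) (rule zp_embed_sum)
      finally show ?case using step.IH by simp
    qed simp
    from twist_mahler_approx[of \<mu> 0 m] obtain N0 where N0: "\<forall>N\<ge>N0. twist (mahler \<mu>) ?z $ 0 -
      (\<Sum>b\<in>?U N. zp_embed (mass \<mu> N b) * (?z ^ nat b * of_nat (nat b choose 0))) \<in> small m" ..
    have "- (\<Sum>b\<in>?U (N0 + n). ?z ^ nat b * zp_embed (mass \<mu> (N0 + n) b)) \<in> small m"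
      using N0[rule_format, of "N0 + n"] by (simp add: assms mult.commute)
    hence "- (\<Sum>b\<in>?U n. ?z ^ nat b * zp_embed (mass \<mu> n b)) \<in> small m" unfolding step[of "N0 + n", OF le_add2] .
    from small_uminus[OF this] show "(\<Sum>b\<in>?U n. zp_embed (mass \<mu> n b) * ?z ^ nat b) \<in> small m"
      by (simp add: mult.commute)
  qed
  have mass0: "mass \<mu> n b = 0" if n: "n \<ge> 1" and b: "b \<in> ?U n" for n b
  proof -
    let ?N = "CARD('p) ^ n"
    have bN: "b \<ge> 0" "nat b < ?N" using b by (auto simp: unit_residues_def nat_less_iff)
    \<comment> \<open>Fourier inversion: multiply by the inverse character and sum over k. The
      exponent p^n - b stands for -b, and orthogonality isolates c = b with weight p^n.\<close>
    have "0 = (\<Sum>k<?N. (\<xi> n ^ k) ^ (?N - nat b) * (\<Sum>c\<in>?U n. zp_embed (mass \<mu> n c) * (\<xi> n ^ k) ^ nat c))"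
      by (simp add: fourier[OF n])
    also have "\<dots> = (\<Sum>k<?N. \<Sum>c\<in>?U n. zp_embed (mass \<mu> n c) * (\<xi> n ^ (nat c + (?N - nat b))) ^ k)"
      by (simp add: sum_distrib_left power_add power_mult_distrib mult_ac flip: power_mult)
    also have "\<dots> = (\<Sum>c\<in>?U n. zp_embed (mass \<mu> n c) * (\<Sum>k<?N. (\<xi> n ^ (nat c + (?N - nat b))) ^ k))"
      unfolding sum_distrib_left by (rule sum.swap)
    also have "\<dots> = (\<Sum>c\<in>?U n. if c = b then zp_embed (mass \<mu> n b) * of_nat ?N else 0)"
    proof (rule sum.cong[OF refl])
      fix c assume c: "c \<in> ?U n"
      have cN: "c \<ge> 0" "nat c < ?N" using c by (auto simp: unit_residues_def nat_less_iff)
      let ?v = "\<xi> n ^ (nat c + (?N - nat b))"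
      have v1: "?v ^ ?N = 1" using xi_root[OF n] by (metis mult.commute power_mult power_one)
      show "zp_embed (mass \<mu> n c) * (\<Sum>k<?N. ?v ^ k) = (if c = b then zp_embed (mass \<mu> n b) * of_nat ?N else 0)"
      proof (cases "c = b")
        case True
        hence "nat c + (?N - nat b) = ?N" using bN by simp
        thus ?thesis using True xi_root[OF n] by simp
      next
        case False
        have "?v \<noteq> 1"
        proof
          assume v: "?v = 1"
          show False
          proof (cases "nat c < nat b")
            case True
            hence "0 < nat c + (?N - nat b)" "nat c + (?N - nat b) < ?N" using bN by linarith+
            from xi_primitive[OF n this] v show False by simp
          next
            case nlt: False
            have "nat c \<noteq> nat b" using False cN bN by (simp add: eq_nat_nat_iff)
            hence gt: "nat c > nat b" using nlt by linarith
            hence "nat c + (?N - nat b) = ?N + (nat c - nat b)" using bN by linarith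
            hence "\<xi> n ^ (nat c - nat b) = 1" using v xi_root[OF n] by (simp only: power_add mult_1)
            moreover have "0 < nat c - nat b" "nat c - nat b < ?N" using gt cN by linarith+
            ultimately show False using xi_primitive[OF n] by blast
          qed
        qed
        hence "(\<Sum>k<?N. ?v ^ k) = 0" using v1 by (simp add: geometric_sum)
        thus ?thesis using False by simp
      qed
    qed
    also have "\<dots> = zp_embed (mass \<mu> n b) * of_nat ?N" using b by simp
    finally show ?thesis by simp
  qed
  fix n b
  show "mass \<mu> n b = mass 0 n b"
  proof (cases "b \<in> ?U n")
    case True
    show ?thesis
    proof (cases "n = 0")
      case False
      thus ?thesis using mass0[OF _ True] by simp
    next
      \<comment> \<open>The mass of level 0 is the sum of those of level 1, which the inversion has
        already covered.\<close>
      case n: True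
      have "mass \<mu> n b = (\<Sum>c | c \<in> ?U (Suc n) \<and> c mod int CARD('p) ^ n = b. mass \<mu> (Suc n) c)"
        by (rule mass_refine[OF True])
      also have "\<dots> = 0" by (intro sum.neutral) (use mass0[of "Suc n"] in auto)
      finally show ?thesis by simp
    qed
  qed (simp add: mass_outside)
qed

lemma inj_mahler: "inj (mahler :: 'p iwasawa \<Rightarrow> _)"
  by (rule injI) (metis mahler_eq_0 mahler_minus right_minus_eq)

text \<open>The moments of positive order of \<nu> are all the moments of x\<nu>, including the
  total mass. These are the constant terms of the iterates of \<open>del\<close> on its Mahler
  transform, so x\<nu> = 0, and \<nu> is recovered with the density 1/x, continuous on
  units.\<close>

lemma measure_zero_if_moments_zero:
  fixes \<nu> :: "'p iwasawa"
  assumes "\<And>k. k > 0 \<Longrightarrow> measure_integral (\<lambda>x. x ^ k) \<nu> = 0"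
  shows "\<nu> = 0"
proof -
  let ?x\<nu> = "density_measure (\<lambda>x. x) \<nu>"
  have "mahler_weighted (\<lambda>x. x) \<nu> = 0"
  proof (rule fps_eq_if_del_funpow_eq)
    fix j
    have "(del ^^ j) (0 :: 'p padic_int fps) = 0" by (induction j) (simp_all add: del_def)
    thus "(del ^^ j) (mahler_weighted (\<lambda>x. x) \<nu>) $ 0 = (del ^^ j) 0 $ 0"
      using assms[of "Suc j"] by (simp add: del_funpow_mahler_weighted mahler_weighted_nth_0 mult.commute)
  qed
  hence "mahler ?x\<nu> = 0" by (simp add: mahler_density)
  hence x\<nu>: "?x\<nu> = 0" by (rule mahler_eq_0)
  have "mahler \<nu> = 0"
  proof (rule fps_ext)
    fix k
    have "mahler \<nu> $ k = measure_integral (\<lambda>x. padic_binomial x k * padic_inv x * x) \<nu>"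
      unfolding mahler_def fps_nth_Abs_fps
      by (rule measure_integral_cong) (auto simp: padic_inv mult.assoc mult.commute[of "padic_inv _"])
    also have "\<dots> = measure_integral (\<lambda>x. padic_binomial x k * padic_inv x) ?x\<nu>"
      by (rule measure_integral_density[symmetric]) auto
    finally show "mahler \<nu> $ k = 0 $ k" by (simp add: x\<nu>)
  qed
  thus ?thesis by (rule mahler_eq_0)
qed

end

section \<open>Bernoulli numbers\<close>

text \<open>The numbers $B_k / k!$ with $B_1 = -\frac12$.\<close>

definition bern_coeff :: "nat \<Rightarrow> rat" where
  "bern_coeff k = inverse (fps_shift 1 (fps_exp 1)) $ k"

lemma bern_coeff_recurrence:
  "(\<Sum>i\<le>m. bern_coeff i / fact (Suc m - i)) = (if m = 0 then 1 else 0)"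
proof -
  have "inverse (fps_shift 1 (fps_exp 1)) * fps_shift 1 (fps_exp (1 :: rat)) = 1"
    by (rule inverse_mult_eq_1) simp
  hence "(inverse (fps_shift 1 (fps_exp 1)) * fps_shift 1 (fps_exp (1 :: rat))) $ m = 1 $ m" by simp
  thus ?thesis
    by (simp add: fps_mult_nth bern_coeff_def atLeast0AtMost Suc_diff_le divide_inverse del: fact_Suc)
qed

text \<open>The series t/(e^t - 1), transported from the rationals to any field of characteristic
  0.\<close>

definition bern_series :: "'a :: field_char_0 fps" where
  "bern_series = Abs_fps (\<lambda>k. of_rat (bern_coeff k))"

lemma bern_series_mult_exp: "bern_series * (fps_exp 1 - 1) = (fps_X :: 'a :: field_char_0 fps)"
proof -
  have rat_fact: "of_rat (fact n) = (fact n :: 'a)" for n by (metis of_nat_fact of_rat_of_nat_eq)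
  have "bern_series * fps_shift 1 (fps_exp (1 :: 'a)) = 1"
  proof (rule fps_ext)
    fix m
    have "(bern_series * fps_shift 1 (fps_exp (1 :: 'a))) $ m = of_rat (\<Sum>i\<le>m. bern_coeff i / fact (Suc m - i))"
      by (simp add: fps_mult_nth bern_series_def atLeast0AtMost Suc_diff_le divide_inverse
          of_rat_sum of_rat_mult of_rat_inverse rat_fact del: fact_Suc)
    also have "\<dots> = 1 $ m" unfolding bern_coeff_recurrence by simp
    finally show "(bern_series * fps_shift 1 (fps_exp (1 :: 'a))) $ m = 1 $ m" .
  qed
  moreover have "fps_exp (1 :: 'a) - 1 = fps_shift 1 (fps_exp 1) * fps_X"
    by (rule fps_ext) simp
  ultimately show ?thesis by (simp flip: mult.assoc)
qed

text \<open>Faulhaber's formula, read off from t \<Sum> e^(b t) = (e^(N t) - 1) t/(e^t - 1), where b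
  runs over the numbers below N.\<close>

lemma power_sum_bern_coeff:
  "(\<Sum>b<N. (of_nat b :: rat) ^ k) = (\<Sum>j\<le>k. fact k * bern_coeff j * of_nat N ^ (Suc k - j) / fact (Suc k - j))"
proof -
  have E: "fps_exp (of_nat b :: rat) = fps_exp 1 ^ b" for b by (simp add: fps_exp_power_mult)
  have "(\<Sum>b<N. fps_exp (of_nat b :: rat)) * fps_X = (fps_exp 1 - 1) * (\<Sum>b<N. fps_exp 1 ^ b) * bern_series"
    unfolding bern_series_mult_exp[symmetric] E by (simp only: mult_ac)
  also have "(fps_exp 1 - 1) * (\<Sum>b<N. fps_exp (1 :: rat) ^ b) = fps_exp (of_nat N) - 1"
    unfolding E by (rule power_diff_1_eq[symmetric])
  finally have "((\<Sum>b<N. fps_exp (of_nat b :: rat)) * fps_X) $ Suc k = ((fps_exp (of_nat N) - 1) * bern_series) $ Suc k"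
    by simp
  also have "((\<Sum>b<N. fps_exp (of_nat b :: rat)) * fps_X) $ Suc k = (\<Sum>b<N. of_nat b ^ k) / fact k"
    by (simp add: fps_sum_nth sum_divide_distrib)
  also have "((fps_exp (of_nat N) - 1) * bern_series) $ Suc k
     = (\<Sum>j\<le>Suc k. bern_coeff j * (fps_exp (of_nat N) - 1) $ (Suc k - j))"
    by (subst mult.commute) (simp only: fps_mult_nth bern_series_def fps_nth_Abs_fps of_rat_eq_id id_apply atLeast0AtMost)
  also have "\<dots> = (\<Sum>j\<le>k. bern_coeff j * (of_nat N ^ (Suc k - j) / fact (Suc k - j)))"
    by (simp add: Suc_diff_le)
  finally show ?thesis by (simp add: field_simps sum_distrib_left)
qed

lemma common_denominator:
  fixes q :: "nat \<Rightarrow> rat"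
  shows "\<exists>D>0. \<forall>j\<le>k. \<exists>z. of_nat D * q j = of_int z"
proof (induction k)
  case 0
  obtain a b where "quotient_of (q 0) = (a, b)" by (cases "quotient_of (q 0)")
  hence "q 0 = of_int a / of_int b" "b > 0" using quotient_of_div quotient_of_denom_pos by blast+
  thus ?case by (intro exI[of _ "nat b"]) (auto intro!: exI[of _ a])
next
  case (Suc k)
  then obtain D where D: "D > 0" "\<And>j. j \<le> k \<Longrightarrow> \<exists>z. of_nat D * q j = of_int z" by blast
  obtain a b where "quotient_of (q (Suc k)) = (a, b)" by (cases "quotient_of (q (Suc k))")
  hence ab: "q (Suc k) = of_int a / of_int b" "b > 0" using quotient_of_div quotient_of_denom_pos by blast+
  show ?case
  proof (intro exI[of _ "D * nat b"] conjI allI impI)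
    show "D * nat b > 0" using D ab by simp
    fix j assume "j \<le> Suc k"
    show "\<exists>z. of_nat (D * nat b) * q j = of_int z"
    proof (cases "j = Suc k")
      case True
      have "of_nat (D * nat b) * q j = of_int (int D * a)" using True ab by simp
      thus ?thesis by blast
    next
      case False
      then obtain z where "of_nat D * q j = of_int z" using D(2) \<open>j \<le> Suc k\<close> le_Suc_eq by blast
      hence "of_nat (D * nat b) * q j = of_int (z * b)" using ab by (simp add: mult_ac)
      thus ?thesis by blast
    qed
  qed
qed

text \<open>Up to a common denominator D, the power sum is N B_k plus a multiple of N^2. For N = p^n
  this displays B_k as the p-adic limit of the power sums divided by p^n.\<close>

lemma power_sum_expansion:
  obtains D c and e :: "nat \<Rightarrow> int" where "D > 0" "of_int c = of_nat D * (fact k * bern_coeff k)"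
    "\<forall>N. int D * (\<Sum>b<N. int b ^ k) = int N * c + int N ^ 2 * e N"
proof -
  define q where "q = (\<lambda>j. fact k * bern_coeff j / fact (Suc k - j))"
  obtain D where D: "D > 0" "\<And>j. j \<le> k \<Longrightarrow> \<exists>z. of_nat D * q j = of_int z" using common_denominator by blast
  then obtain z where z: "\<And>j. j \<le> k \<Longrightarrow> of_nat D * q j = of_int (z j)" by metis
  define e where "e = (\<lambda>N. \<Sum>j<k. z j * int N ^ (k - 1 - j))"
  have "int D * (\<Sum>b<N. int b ^ k) = int N * z k + int N ^ 2 * e N" for N
  proof -
    have "of_nat D * (\<Sum>b<N. (of_nat b :: rat) ^ k) = (\<Sum>j\<le>k. (of_nat D * q j) * of_nat N ^ (Suc k - j))"
      unfolding power_sum_bern_coeff q_def by (simp add: sum_distrib_left mult_ac)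
    also have "\<dots> = (\<Sum>j\<le>k. of_int (z j) * of_nat N ^ (Suc k - j))"
      by (intro sum.cong refl) (simp add: z)
    also have "\<dots> = (\<Sum>j<k. of_int (z j) * of_nat N ^ (Suc k - j)) + of_int (z k) * of_nat N"
      by (simp add: lessThan_Suc_atMost[symmetric])
    also have "(\<Sum>j<k. of_int (z j) * of_nat N ^ (Suc k - j)) = (\<Sum>j<k. of_nat N ^ 2 * (of_int (z j) * of_nat N ^ (k - 1 - j) :: rat))"
    proof (rule sum.cong[OF refl])
      fix j assume "j \<in> {..<k}"
      hence "Suc k - j = 2 + (k - 1 - j)" by auto
      thus "of_int (z j) * of_nat N ^ (Suc k - j) = of_nat N ^ 2 * (of_int (z j) * of_nat N ^ (k - 1 - j) :: rat)"
        by (simp only: power_add mult_ac)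
    qed
    also have "\<dots> = of_int (int N ^ 2 * e N)" by (simp add: e_def sum_distrib_left)
    finally have "(of_int (int D * (\<Sum>b<N. int b ^ k)) :: rat) = of_int (int N ^ 2 * e N + z k * int N)" by simp
    thus ?thesis by (simp only: of_int_eq_iff mult.commute add.commute)
  qed
  moreover have "of_int (z k) = of_nat D * (fact k * bern_coeff k)" using z[of k] by (simp add: q_def)
  ultimately show ?thesis using that D(1) by blast
qed

section \<open>The regularised Bernoulli measures\<close>

lemma unit_residues_coprime_iff:
  assumes "n \<ge> 1"
  shows "b \<in> unit_residues TYPE('p :: prime_card) n \<longleftrightarrow> 0 \<le> b \<and> b < int CARD('p) ^ n \<and> \<not> int CARD('p) dvd b"
proof -
  have "coprime b (int CARD('p) ^ n) \<longleftrightarrow> coprime (int CARD('p)) b"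
    using assms by (simp add: coprime_commute)
  also have "\<dots> \<longleftrightarrow> \<not> int CARD('p) dvd b"
    using prime_CARD_int[where 'p = 'p] by (metis coprime_absorb_left not_prime_unit prime_imp_coprime)
  finally show ?thesis by (auto simp: unit_residues_def)
qed

definition mult_residue :: "'p :: prime_card padic_int \<Rightarrow> nat \<Rightarrow> int \<Rightarrow> int" where
  "mult_residue g n b = padic_residue (g * of_int b) n"

lemma mult_residue_dvd: "pp ^ n dvd g * of_int b - of_int (mult_residue (g :: 'p :: prime_card padic_int) n b)"
  unfolding mult_residue_def by (rule pp_power_dvd_residue)

lemma mult_residue_in:
  assumes "(g :: 'p :: prime_card padic_int) \<in> padic_units" "n \<ge> 1" "b \<in> unit_residues TYPE('p) n"
  shows "mult_residue g n b \<in> unit_residues TYPE('p) n"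
  unfolding mult_residue_def by (intro residue_unit padic_units_mult assms(1) unit_residue_is_unit[OF assms(2,3)])

lemma mult_residue_cancel:
  assumes "(g :: 'p :: prime_card padic_int) * h = 1" "b \<in> unit_residues TYPE('p) n"
  shows "mult_residue g n (mult_residue h n b) = b"
proof -
  have "pp ^ n dvd g * (h * of_int b - of_int (mult_residue h n b))" by (intro dvd_mult mult_residue_dvd)
  hence "pp ^ n dvd of_int b - g * of_int (mult_residue h n b)"
    using assms(1) by (simp add: right_diff_distrib flip: mult.assoc)
  hence "padic_residue (of_int b :: 'p padic_int) n = mult_residue g n (mult_residue h n b)"
    unfolding mult_residue_def[of g] residue_eq_iff_dvd .
  thus ?thesis by (simp add: residue_of_int unit_residues_mod[OF assms(2)])
qed

lemma mult_residue_bij: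
  assumes g: "(g :: 'p :: prime_card padic_int) \<in> padic_units" and n: "n \<ge> 1"
  shows "bij_betw (mult_residue g n) (unit_residues TYPE('p) n) (unit_residues TYPE('p) n)"
proof (rule bij_betw_byWitness[where f' = "mult_residue (padic_inv g) n"])
  have inv: "g * padic_inv g = 1" "padic_inv g * g = 1" using padic_inv[OF g] by (simp_all add: mult.commute)
  show "\<forall>b\<in>unit_residues TYPE('p) n. mult_residue (padic_inv g) n (mult_residue g n b) = b"
    using mult_residue_cancel[OF inv(2)] by blast
  show "\<forall>b\<in>unit_residues TYPE('p) n. mult_residue g n (mult_residue (padic_inv g) n b) = b"
    using mult_residue_cancel[OF inv(1)] by blast
  show "mult_residue g n ` unit_residues TYPE('p) n \<subseteq> unit_residues TYPE('p) n"
    "mult_residue (padic_inv g) n ` unit_residues TYPE('p) n \<subseteq> unit_residues TYPE('p) n"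
    using mult_residue_in[OF g n] mult_residue_in[OF padic_inv_unit[OF g] n] by blast+
qed

lemma mult_residue_mod: "mult_residue g (Suc n) b mod int CARD('p) ^ n = mult_residue (g :: 'p :: prime_card padic_int) n (b mod int CARD('p) ^ n)"
proof -
  have "mult_residue g (Suc n) b mod int CARD('p) ^ n = padic_residue (g * of_int b) n"
    by (simp add: mult_residue_def)
  also have "\<dots> = padic_residue (g * of_int (b mod int CARD('p) ^ n)) n"
  proof -
    have "pp ^ n dvd g * of_int (b - b mod int CARD('p) ^ n)"
      by (intro dvd_mult) (simp only: pp_power_dvd_of_int dvd_minus_mod)
    thus ?thesis by (simp add: residue_eq_iff_dvd right_diff_distrib)
  qed
  finally show ?thesis by (simp add: mult_residue_def)
qed

text \<open>The mass of $b + p^n\mathbf{Z}_p$ is $g B_1(\{g^{-1}b/p^n\}) - B_1(\{b/p^n\})$ with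
  $B_1(x) = x - \frac12$, multiplied out to avoid division in $\mathbf{Z}_p$.\<close>

definition bern_mass :: "'p :: prime_card padic_int \<Rightarrow> nat \<Rightarrow> int \<Rightarrow> 'p padic_int" where
  "bern_mass g n b = (THE y. 2 * pp ^ n * y =
     2 * (g * of_int (mult_residue (padic_inv g) n b) - of_int b) - pp ^ n * (g - 1))"

text \<open>The division by p^n is possible because g times the representative of b/g is congruent
  to b, and the division by 2 because p is odd.\<close>

lemma bern_mass:
  fixes g :: "'p :: prime_card padic_int"
  assumes odd: "odd CARD('p)" and g: "g \<in> padic_units"
  shows "2 * pp ^ n * bern_mass g n b =
    2 * (g * of_int (mult_residue (padic_inv g) n b) - of_int b) - pp ^ n * (g - 1)"
proof -
  let ?R = "2 * (g * of_int (mult_residue (padic_inv g) n b) - of_int b) - pp ^ n * (g - 1)"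
  have "pp ^ n dvd g * (padic_inv g * of_int b - of_int (mult_residue (padic_inv g) n b))"
    by (intro dvd_mult mult_residue_dvd)
  also have "g * (padic_inv g * of_int b - of_int (mult_residue (padic_inv g) n b)) =
      of_int b - g * of_int (mult_residue (padic_inv g) n b)"
    using padic_inv[OF g] by (simp add: right_diff_distrib flip: mult.assoc)
  finally obtain z where z: "g * of_int (mult_residue (padic_inv g) n b) - of_int b = pp ^ n * z"
    using dvd_diff_swap by (metis dvdE)
  have "\<not> int CARD('p) dvd 2"
  proof
    assume "int CARD('p) dvd 2"
    hence "int CARD('p) \<le> 2" by (rule zdvd_imp_le) simp
    hence "CARD('p) = 2" using CARD_gt_1[where 'p = 'p] by linarith
    thus False using odd by simp
  qed
  hence "(of_int 2 :: 'p padic_int) dvd 1" by (simp only: of_int_unit_iff not_False_eq_True)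
  then obtain h where h: "1 = (2 :: 'p padic_int) * h" by (auto simp: dvd_def)
  have e: "2 * pp ^ n * (z - h * (g - 1)) = ?R"
  proof -
    have "2 * pp ^ n * (z - h * (g - 1)) = 2 * (pp ^ n * z) - pp ^ n * ((2 * h) * (g - 1))"
      by (simp add: algebra_simps)
    thus ?thesis by (simp add: z flip: h)
  qed
  have nz: "2 * (pp :: 'p padic_int) ^ n \<noteq> 0" by simp
  have "bern_mass g n b = z - h * (g - 1)"
    unfolding bern_mass_def
  proof (rule the_equality)
    fix y assume "2 * pp ^ n * y = ?R"
    hence "2 * pp ^ n * y = 2 * pp ^ n * (z - h * (g - 1))" by (simp only: e)
    thus "y = z - h * (g - 1)" by (simp only: mult_left_cancel[OF nz])
  qed (rule e)
  thus ?thesis by (simp only: e)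
qed

lemma residue_fibre:
  assumes n: "n \<ge> 1" and b: "b \<in> unit_residues TYPE('p :: prime_card) n"
  shows "bij_betw (\<lambda>i. b + int i * int CARD('p) ^ n) {..<CARD('p)}
    {c. c \<in> unit_residues TYPE('p) (Suc n) \<and> c mod int CARD('p) ^ n = b}"
proof -
  let ?q = "int CARD('p) ^ n"
  have q: "?q > 0" by simp
  have b': "0 \<le> b" "b < ?q" "\<not> int CARD('p) dvd b" using b by (auto simp: unit_residues_coprime_iff[OF n])
  have dq: "int CARD('p) dvd ?q" using n by (simp add: dvd_power)
  have "inj_on (\<lambda>i. b + int i * ?q) {..<CARD('p)}" using q by (auto intro!: inj_onI)
  moreover have "(\<lambda>i. b + int i * ?q) ` {..<CARD('p)} =
      {c. c \<in> unit_residues TYPE('p) (Suc n) \<and> c mod ?q = b}"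
  proof (intro equalityI subsetI)
    fix c assume "c \<in> (\<lambda>i. b + int i * ?q) ` {..<CARD('p)}"
    then obtain i where i: "i < CARD('p)" "c = b + int i * ?q" by auto
    have "c < ?q + int i * ?q" using i b' by simp
    also have "\<dots> = (int i + 1) * ?q" by (simp add: algebra_simps)
    also have "\<dots> \<le> int CARD('p) * ?q" using i(1) q by (intro mult_right_mono) linarith+
    finally have "c < int CARD('p) ^ Suc n" by simp
    moreover have "\<not> int CARD('p) dvd c" using b'(3) dq by (simp add: i dvd_add_left_iff)
    ultimately show "c \<in> {c. c \<in> unit_residues TYPE('p) (Suc n) \<and> c mod ?q = b}"
      using i b' q by (simp add: unit_residues_coprime_iff)
  next
    fix c assume "c \<in> {c. c \<in> unit_residues TYPE('p) (Suc n) \<and> c mod ?q = b}"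
    hence c: "0 \<le> c" "c < int CARD('p) * ?q" "c mod ?q = b" by (auto simp: unit_residues_coprime_iff)
    have "c div ?q * ?q \<le> c" using q by (simp add: minus_mod_eq_div_mult[symmetric])
    hence "c div ?q * ?q < int CARD('p) * ?q" using c(2) by linarith
    hence i: "c div ?q \<ge> 0" "c div ?q < int CARD('p)"
      using c(1) q by (auto simp: pos_imp_zdiv_nonneg_iff)
    have "c = b + int (nat (c div ?q)) * ?q" using i(1) c(3) by (simp add: mult.commute) (metis mod_mult_div_eq)
    moreover have "nat (c div ?q) < CARD('p)" using i by (simp add: nat_less_iff)
    ultimately show "c \<in> (\<lambda>i. b + int i * ?q) ` {..<CARD('p)}" by blast
  qed
  ultimately show ?thesis unfolding bij_betw_def by blast
qed

text \<open>An arithmetic progression with p terms and step p^n. It is the integral form of the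
  distribution relation of B_1.\<close>

lemma sum_residue_fibre:
  assumes n: "n \<ge> 1" and b: "b \<in> unit_residues TYPE('p :: prime_card) n"
  shows "2 * (\<Sum>c | c \<in> unit_residues TYPE('p) (Suc n) \<and> c mod int CARD('p) ^ n = b. c)
    = int CARD('p) * (2 * b + int CARD('p) ^ n * (int CARD('p) - 1))"
proof -
  have "2 * (\<Sum>i<k. int i) = int k * (int k - 1)" for k
    by (induction k) (simp_all add: algebra_simps)
  hence s: "(\<Sum>i<k. int i) * 2 = int k * (int k - 1)" for k by (simp add: mult.commute)
  have "(\<Sum>c | c \<in> unit_residues TYPE('p) (Suc n) \<and> c mod int CARD('p) ^ n = b. c) =
      (\<Sum>i<CARD('p). b + int i * int CARD('p) ^ n)"
    by (rule sum.reindex_bij_betw[OF residue_fibre[OF assms], symmetric])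
  also have "\<dots> = int CARD('p) * b + (\<Sum>i<CARD('p). int i) * int CARD('p) ^ n"
    by (simp add: sum.distrib sum_distrib_right)
  finally have "2 * (\<Sum>c | c \<in> unit_residues TYPE('p) (Suc n) \<and> c mod int CARD('p) ^ n = b. c)
     = 2 * int CARD('p) * b + ((\<Sum>i<CARD('p). int i) * 2) * int CARD('p) ^ n" by (simp add: algebra_simps)
  thus ?thesis unfolding s by (simp add: algebra_simps)
qed

text \<open>Multiplication by 1/g maps the lifts of b onto the lifts of b/g, so both sums of
  representatives are known. The terms p^n (p - 1)(g - 1) from the progressions and -p^(n + 1) (g -
  1) from the p constants combine to the constant of level n.\<close>

lemma bern_mass_compat:
  fixes g :: "'p :: prime_card padic_int"
  assumes odd: "odd CARD('p)" and g: "g \<in> padic_units" and n: "n \<ge> 1" and b: "b \<in> unit_residues TYPE('p) n"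
  shows "bern_mass g n b =
    (\<Sum>c | c \<in> unit_residues TYPE('p) (Suc n) \<and> c mod int CARD('p) ^ n = b. bern_mass g (Suc n) c)"
proof -
  let ?U = "unit_residues TYPE('p)" and ?q = "int CARD('p) ^ n" and ?h = "padic_inv g"
  let ?C = "\<lambda>b. {c. c \<in> ?U (Suc n) \<and> c mod ?q = b}"
  let ?b' = "mult_residue ?h n b"
  have h: "?h \<in> padic_units" "g * ?h = 1" "?h * g = 1"
    using padic_inv_unit[OF g] padic_inv[OF g] by (simp_all add: mult.commute)
  have b': "?b' \<in> ?U n" by (rule mult_residue_in[OF h(1) n b])
  have bij: "bij_betw (mult_residue ?h (Suc n)) (?C b) (?C ?b')"
  proof (rule bij_betw_byWitness[where f' = "mult_residue g (Suc n)"])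
    show "\<forall>c\<in>?C b. mult_residue g (Suc n) (mult_residue ?h (Suc n) c) = c"
      using mult_residue_cancel[OF h(2)] by blast
    show "\<forall>c\<in>?C ?b'. mult_residue ?h (Suc n) (mult_residue g (Suc n) c) = c"
      using mult_residue_cancel[OF h(3)] by blast
    show "mult_residue ?h (Suc n) ` ?C b \<subseteq> ?C ?b'"
      using mult_residue_in[OF h(1), of "Suc n"] by (auto simp: mult_residue_mod)
    show "mult_residue g (Suc n) ` ?C ?b' \<subseteq> ?C b"
      using mult_residue_in[OF g, of "Suc n"] mult_residue_cancel[OF h(2) b] by (auto simp: mult_residue_mod)
  qed
  have card: "card (?C b) = CARD('p)" using bij_betw_same_card[OF residue_fibre[OF n b]] by simp
  have s1: "2 * (\<Sum>c\<in>?C b. of_int c :: 'p padic_int) = pp * (2 * of_int b + pp ^ n * (pp - 1))"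
    using arg_cong[OF sum_residue_fibre[OF n b], where f = "of_int :: int \<Rightarrow> 'p padic_int"] by simp
  have "(\<Sum>c\<in>?C b. of_int (mult_residue ?h (Suc n) c) :: 'p padic_int) = (\<Sum>c\<in>?C ?b'. of_int c)"
    by (rule sum.reindex_bij_betw[OF bij])
  hence s2: "2 * (\<Sum>c\<in>?C b. of_int (mult_residue ?h (Suc n) c) :: 'p padic_int)
     = pp * (2 * of_int ?b' + pp ^ n * (pp - 1))"
    using arg_cong[OF sum_residue_fibre[OF n b'], where f = "of_int :: int \<Rightarrow> 'p padic_int"] by simp
  have "2 * pp ^ Suc n * (\<Sum>c\<in>?C b. bern_mass g (Suc n) c) =
     (\<Sum>c\<in>?C b. 2 * (g * of_int (mult_residue ?h (Suc n) c) - of_int c) - pp ^ Suc n * (g - 1))"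
    unfolding sum_distrib_left bern_mass[OF odd g] ..
  also have "\<dots> = g * (2 * (\<Sum>c\<in>?C b. of_int (mult_residue ?h (Suc n) c))) - 2 * (\<Sum>c\<in>?C b. of_int c)
     - pp * (pp ^ Suc n * (g - 1))"
    unfolding sum_subtractf sum_constant card right_diff_distrib[of "2 :: 'p padic_int"] sum_distrib_left
    by (simp only: mult.left_commute)
  also have "\<dots> = pp * (2 * (g * of_int ?b' - of_int b) - pp ^ n * (g - 1))"
    unfolding s1 s2 by (simp add: algebra_simps)
  also have "\<dots> = 2 * pp ^ Suc n * bern_mass g n b"
    unfolding bern_mass[OF odd g, symmetric] by (simp add: mult_ac)
  finally have eq: "2 * pp ^ Suc n * (\<Sum>c\<in>?C b. bern_mass g (Suc n) c) = 2 * pp ^ Suc n * bern_mass g n b" .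
  have nz: "2 * (pp :: 'p padic_int) ^ Suc n \<noteq> 0" by simp
  show ?thesis by (rule iffD1[OF mult_left_cancel[OF nz] eq, symmetric])
qed

text \<open>At level $0$ the formula for the mass would include $p\mathbf{Z}_p$.\<close>

lift_definition bern_measure :: "'p :: prime_card padic_int \<Rightarrow> 'p iwasawa" is
  "\<lambda>g n b. if odd CARD('p) \<and> g \<in> padic_units \<and> b \<in> unit_residues TYPE('p) n then
     (if n = 0 then \<Sum>c\<in>unit_residues TYPE('p) 1. bern_mass g 1 c else bern_mass g n b) else 0"
proof (rule measure_familyI)
  fix g :: "'p padic_int" and n b
  let ?\<mu> = "\<lambda>n b. if odd CARD('p) \<and> g \<in> padic_units \<and> b \<in> unit_residues TYPE('p) n then
     (if n = 0 then \<Sum>c\<in>unit_residues TYPE('p) 1. bern_mass g 1 c else bern_mass g n b) else 0"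
  show "?\<mu> n b = 0" if "b \<notin> unit_residues TYPE('p) n" using that by simp
  assume b: "b \<in> unit_residues TYPE('p) n"
  show "?\<mu> n b = (\<Sum>c | c \<in> unit_residues TYPE('p) (Suc n) \<and> c mod int CARD('p) ^ n = b. ?\<mu> (Suc n) c)"
  proof (cases "odd CARD('p) \<and> g \<in> padic_units")
    case True
    show ?thesis
    proof (cases "n = 0")
      case n: True
      have "b = 0" using b n by (auto simp: unit_residues_def)
      thus ?thesis using True n b by simp
    next
      case False
      thus ?thesis using True b bern_mass_compat[of g n b] by simp
    qed
  qed auto
qed

lemma mass_bern_measure:
  fixes g :: "'p :: prime_card padic_int"
  assumes "odd CARD('p)" "g \<in> padic_units" "n \<ge> 1" "b \<in> unit_residues TYPE('p) n"
  shows "mass (bern_measure g) n b = bern_mass g n b"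
  using assms by (simp add: bern_measure.rep_eq)

section \<open>The moments of the Bernoulli measures\<close>

lemma power_taylor_dvd:
  fixes u v :: "'a :: comm_ring_1"
  assumes "q dvd u - v"
  shows "q ^ 2 dvd u ^ Suc k - v ^ Suc k - of_nat (Suc k) * v ^ k * (u - v)"
proof (induction k)
  case (Suc k)
  let ?d = "u ^ Suc k - v ^ Suc k - of_nat (Suc k) * v ^ k * (u - v)"
  have "u ^ Suc (Suc k) - v ^ Suc (Suc k) - of_nat (Suc (Suc k)) * v ^ Suc k * (u - v)
      = u * ?d + of_nat (Suc k) * v ^ k * ((u - v) * (u - v))"
    by (simp add: algebra_simps)
  moreover have "q ^ 2 dvd (u - v) * (u - v)" using assms by (simp add: power2_eq_square mult_dvd_mono)
  ultimately show ?case by (simp only: dvd_add[OF dvd_mult[OF Suc] dvd_mult])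
qed simp

lemma unit_power_sum:
  assumes n: "n \<ge> 1"
  shows "(\<Sum>b\<in>unit_residues TYPE('p :: prime_card) n. b ^ k) =
    (\<Sum>b<CARD('p) ^ n. int b ^ k) - int CARD('p) ^ k * (\<Sum>b<CARD('p) ^ (n - 1). int b ^ k)"
proof -
  let ?q = "CARD('p) ^ n" and ?U = "unit_residues TYPE('p) n"
  let ?V = "(\<lambda>b. int CARD('p) * int b) ` {..<CARD('p) ^ (n - 1)}"
  have p: "int CARD('p) > 0" by simp
  have q: "int ?q = int CARD('p) * int (CARD('p) ^ (n - 1))" using n by (cases n) auto
  have "(\<Sum>b<?q. int b ^ k) = (\<Sum>b\<in>int ` {..<?q}. b ^ k)" by (simp add: sum.reindex)
  also have "int ` {..<?q} = ?U \<union> ?V"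
  proof (intro equalityI subsetI)
    fix b assume "b \<in> int ` {..<?q}"
    hence b: "0 \<le> b" "b < int ?q" by auto
    show "b \<in> ?U \<union> ?V"
    proof (cases "int CARD('p) dvd b")
      case True
      then obtain c where c: "b = int CARD('p) * c" by (auto simp: dvd_def)
      have "0 \<le> c" "c < int (CARD('p) ^ (n - 1))" using b p unfolding c q
        by (simp_all add: zero_le_mult_iff del: of_nat_power)
      hence "b = int CARD('p) * int (nat c)" "nat c < CARD('p) ^ (n - 1)" by (simp_all add: c nat_less_iff del: of_nat_power)
      thus ?thesis by blast
    next
      case False
      thus ?thesis using b by (simp add: unit_residues_coprime_iff[OF n])
    qed
  next
    fix b assume "b \<in> ?U \<union> ?V"
    thus "b \<in> int ` {..<?q}"
    proof
      assume "b \<in> ?U"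
      hence "0 \<le> b" "b < int ?q" by (simp_all add: unit_residues_def)
      hence "b = int (nat b)" "nat b < ?q" by (simp_all add: nat_less_iff del: of_nat_power)
      thus ?thesis by blast
    next
      assume "b \<in> ?V"
      then obtain c where c: "c < CARD('p) ^ (n - 1)" "b = int CARD('p) * int c" by auto
      have "CARD('p) * c < CARD('p) * CARD('p) ^ (n - 1)" using c(1) by simp
      also have "\<dots> = ?q" using n by (cases n) auto
      finally have "b = int (CARD('p) * c)" "CARD('p) * c < ?q" using c by simp_all
      thus ?thesis by blast
    qed
  qed
  also have "(\<Sum>b\<in>?U \<union> ?V. b ^ k) = (\<Sum>b\<in>?U. b ^ k) + (\<Sum>b\<in>?V. b ^ k)"
    by (rule sum.union_disjoint) (auto simp: unit_residues_coprime_iff[OF n])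
  also have "(\<Sum>b\<in>?V. b ^ k) = (\<Sum>b<CARD('p) ^ (n - 1). (int CARD('p) * int b) ^ k)"
    by (subst sum.reindex) (auto intro!: inj_onI)
  also have "\<dots> = int CARD('p) ^ k * (\<Sum>b<CARD('p) ^ (n - 1). int b ^ k)"
    by (simp add: power_mult_distrib sum_distrib_left)
  finally show ?thesis by simp
qed

text \<open>Removing the multiples of p turns p^n B_k into p^n (1 - p^(k - 1)) B_k: this is the
  source of the Euler factor. The identity is multiplied by p so that it is integral for k = 0 as
  well.\<close>

lemma unit_power_sum_expansion:
  obtains D c and e :: "nat \<Rightarrow> int" where "D > 0" "of_int c = of_nat D * (fact k * bern_coeff k)"
    "\<forall>n\<ge>1. int CARD('p) * (int D * (\<Sum>b\<in>unit_residues TYPE('p :: prime_card) n. b ^ k)) =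
       int CARD('p) ^ n * ((int CARD('p) - int CARD('p) ^ k) * c) + int CARD('p) ^ (2 * n - 1) * e n"
proof -
  let ?p = "int CARD('p)"
  obtain D c and e :: "nat \<Rightarrow> int" where D: "D > 0" "of_int c = of_nat D * (fact k * bern_coeff k)"
    "\<forall>N. int D * (\<Sum>b<N. int b ^ k) = int N * c + int N ^ 2 * e N"
    by (rule power_sum_expansion)
  have *: "?p * (int D * (\<Sum>b\<in>unit_residues TYPE('p) n. b ^ k)) =
       ?p ^ n * ((?p - ?p ^ k) * c) + ?p ^ (2 * n - 1) * (?p ^ 2 * e (CARD('p) ^ n) - ?p ^ k * e (CARD('p) ^ (n - 1)))"
    if n: "n \<ge> 1" for n
  proof -
    obtain m where m: "n = Suc m" using n by (cases n) auto
    have "int D * (\<Sum>b\<in>unit_residues TYPE('p) n. b ^ k) =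
       int D * (\<Sum>b<CARD('p) ^ n. int b ^ k) - ?p ^ k * (int D * (\<Sum>b<CARD('p) ^ (n - 1). int b ^ k))"
      unfolding unit_power_sum[OF n] by (simp add: algebra_simps)
    also have "\<dots> = (?p ^ n * c + (?p ^ n) ^ 2 * e (CARD('p) ^ n)) - ?p ^ k * (?p ^ m * c + (?p ^ m) ^ 2 * e (CARD('p) ^ (n - 1)))"
      using D(3) by (simp add: m)
    finally have "?p * (int D * (\<Sum>b\<in>unit_residues TYPE('p) n. b ^ k)) =
      ?p * ((?p ^ n * c + (?p ^ n) ^ 2 * e (CARD('p) ^ n)) - ?p ^ k * (?p ^ m * c + (?p ^ m) ^ 2 * e (CARD('p) ^ (n - 1))))"
      by simp
    moreover have "2 * n - 1 = Suc (m + m)" using m by simp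
    hence pw: "?p ^ (2 * n - 1) = ?p * (?p ^ m * ?p ^ m)" by (simp add: power_add)
    have pn: "?p ^ n = ?p * ?p ^ m" by (simp add: m)
    ultimately show ?thesis
      unfolding pw pn by (simp add: power2_eq_square algebra_simps)
  qed
  show ?thesis
    by (rule that[OF D(1,2), of "\<lambda>n. ?p ^ 2 * e (CARD('p) ^ n) - ?p ^ k * e (CARD('p) ^ (n - 1))"]) (use * in blast)
qed

text \<open>Let b' be the representative of b/g. Modulo p^(2 n), (k + 1) b^k (g b' - b) is (g b')^(k
  + 1) - b^(k + 1). As b \<mapsto> b' is a permutation, summation gives (g^(k + 1) - 1) times a
  power sum over units, and division by p^n leaves the Bernoulli number in the limit.\<close>

lemma bern_measure_moment:
  fixes g :: "'p :: prime_card padic_int"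
  assumes odd: "odd CARD('p)" and g: "g \<in> padic_units"
  obtains D c where "D > 0" "of_int c = of_nat D * (fact (Suc k) * bern_coeff (Suc k))"
    "of_nat (D * Suc k) * measure_integral (\<lambda>x. x ^ k) (bern_measure g)
      = (g ^ Suc k - 1) * (1 - pp ^ k) * of_int c"
proof -
  let ?U = "unit_residues TYPE('p)" and ?h = "padic_inv g" and ?I = "measure_integral (\<lambda>x. x ^ k) (bern_measure g)"
  obtain D c and e :: "nat \<Rightarrow> int" where D: "D > 0" "of_int c = of_nat D * (fact (Suc k) * bern_coeff (Suc k))"
    "\<forall>n\<ge>1. int CARD('p) * (int D * (\<Sum>b\<in>?U n. b ^ Suc k)) =
       int CARD('p) ^ n * ((int CARD('p) - int CARD('p) ^ Suc k) * c) + int CARD('p) ^ (2 * n - 1) * e n"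
    by (rule unit_power_sum_expansion[where 'p = 'p])
  obtain D' c' and e' :: "nat \<Rightarrow> int" where D': "D' > 0"
    "\<forall>n\<ge>1. int CARD('p) * (int D' * (\<Sum>b\<in>?U n. b ^ k)) =
       int CARD('p) ^ n * ((int CARD('p) - int CARD('p) ^ k) * c') + int CARD('p) ^ (2 * n - 1) * e' n"
    by (rule unit_power_sum_expansion[where 'p = 'p])
  define err where "err = of_nat (D * Suc k) * ?I - (g ^ Suc k - 1) * (1 - pp ^ k) * of_int c"
  define ps where "ps = (\<lambda>n j. (\<Sum>b\<in>?U n. of_int b ^ j :: 'p padic_int))"
  have key: "pp ^ m dvd 2 * of_nat D' * err" for m
  proof -
    obtain N where N: "\<forall>n\<ge>N. pp ^ m dvd riemann_sum (\<lambda>x. x ^ k) (bern_measure g) n - ?I"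
      using measure_integral_mod[OF ucont_power[OF ucont_id]] by blast
    \<comment> \<open>Two levels beyond m make up for the losses: the error terms carry only p^(n -
      1), and one more factor p is cancelled at the end.\<close>
    define n where "n = N + m + 2"
    have n: "n \<ge> 1" "n \<ge> N" "n \<ge> m + 2" by (simp_all add: n_def)
    let ?rs = "riemann_sum (\<lambda>x. x ^ k) (bern_measure g) n"
    define tt where "tt = (\<Sum>b\<in>?U n. of_int b ^ k * (g * of_int (mult_residue ?h n b) - of_int b))"
    have R: "2 * pp ^ n * ?rs = 2 * tt - pp ^ n * (g - 1) * ps n k"
    proof -
      have "2 * pp ^ n * ?rs = (\<Sum>b\<in>?U n. of_int b ^ k * (2 * pp ^ n * bern_mass g n b))"
        unfolding riemann_sum_def sum_distrib_left
        by (intro sum.cong refl) (simp add: mass_bern_measure[OF odd g n(1)] mult_ac)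
      also have "\<dots> = 2 * tt - pp ^ n * (g - 1) * ps n k"
        unfolding bern_mass[OF odd g] tt_def ps_def
        by (simp add: sum_subtractf sum.distrib sum_distrib_left algebra_simps)
      finally show ?thesis .
    qed
    have "(pp ^ n) ^ 2 dvd (\<Sum>b\<in>?U n. (g * of_int (mult_residue ?h n b)) ^ Suc k - of_int b ^ Suc k
        - of_nat (Suc k) * of_int b ^ k * (g * of_int (mult_residue ?h n b) - of_int b))"
    proof (intro dvd_sum power_taylor_dvd)
      fix b assume "b \<in> ?U n"
      have "pp ^ n dvd g * (?h * of_int b - of_int (mult_residue ?h n b))" by (intro dvd_mult mult_residue_dvd)
      hence "pp ^ n dvd of_int b - g * of_int (mult_residue ?h n b)"
        using padic_inv[OF g] by (simp add: right_diff_distrib flip: mult.assoc)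
      thus "pp ^ n dvd g * of_int (mult_residue ?h n b) - of_int b" by (rule dvd_diff_swap)
    qed
    also have "(\<Sum>b\<in>?U n. (g * of_int (mult_residue ?h n b)) ^ Suc k - of_int b ^ Suc k
        - of_nat (Suc k) * of_int b ^ k * (g * of_int (mult_residue ?h n b) - of_int b))
      = g ^ Suc k * (\<Sum>b\<in>?U n. of_int (mult_residue ?h n b) ^ Suc k) - ps n (Suc k) - of_nat (Suc k) * tt"
      unfolding tt_def ps_def by (simp add: sum_subtractf sum_distrib_left power_mult_distrib mult_ac del: of_nat_Suc power_Suc)
    also have "(\<Sum>b\<in>?U n. of_int (mult_residue ?h n b) ^ Suc k :: 'p padic_int) = ps n (Suc k)"
      unfolding ps_def by (rule sum.reindex_bij_betw[OF mult_residue_bij[OF padic_inv_unit[OF g] n(1)]])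
    finally obtain z1 where z1: "g ^ Suc k * ps n (Suc k) - ps n (Suc k) - of_nat (Suc k) * tt = pp ^ n * pp ^ n * z1"
      by (auto simp: dvd_def power2_eq_square)
    have pn: "pp ^ (2 * n - 1) = (pp ^ n * pp ^ (n - 1) :: 'p padic_int)"
      using n(1) by (simp add: mult_2 flip: power_add)
    have s1: "pp * (of_nat D * ps n (Suc k)) = pp ^ n * ((pp - pp ^ Suc k) * of_int c) + pp ^ n * pp ^ (n - 1) * of_int (e n)"
      using arg_cong[OF D(3)[rule_format, OF n(1)], where f = "of_int :: int \<Rightarrow> 'p padic_int"]
      by (simp add: ps_def pn del: One_nat_def)
    have s2: "pp * (of_nat D' * ps n k) = pp ^ n * ((pp - pp ^ k) * of_int c') + pp ^ n * pp ^ (n - 1) * of_int (e' n)"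
      using arg_cong[OF D'(2)[rule_format, OF n(1)], where f = "of_int :: int \<Rightarrow> 'p padic_int"]
      by (simp add: ps_def pn del: One_nat_def)
    define Y where "Y = of_nat D * (of_nat (Suc k) * ?rs) - (g ^ Suc k - 1) * (1 - pp ^ k) * of_int c"
    have "pp ^ n * (pp * (2 * of_nat D' * Y)) =
        pp * of_nat D' * of_nat D * of_nat (Suc k) * (2 * pp ^ n * ?rs)
        - 2 * of_nat D' * (g ^ Suc k - 1) * (pp ^ n * ((pp - pp ^ Suc k) * of_int c))"
      unfolding Y_def by (simp add: algebra_simps del: of_nat_Suc)
    also have "\<dots> = 2 * of_nat D' * (pp * of_nat D * (of_nat (Suc k) * tt))
        - pp ^ n * (g - 1) * of_nat D * of_nat (Suc k) * (pp * (of_nat D' * ps n k))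
        - 2 * of_nat D' * (g ^ Suc k - 1) * (pp ^ n * ((pp - pp ^ Suc k) * of_int c))"
      unfolding R by (simp add: algebra_simps del: of_nat_Suc)
    also have "of_nat (Suc k) * tt = (g ^ Suc k - 1) * ps n (Suc k) - pp ^ n * pp ^ n * z1"
      using z1 by (simp add: algebra_simps del: of_nat_Suc power_Suc)
    also have "pp * of_nat D * ((g ^ Suc k - 1) * ps n (Suc k) - pp ^ n * pp ^ n * z1) =
        (g ^ Suc k - 1) * (pp * (of_nat D * ps n (Suc k))) - pp * of_nat D * (pp ^ n * pp ^ n * z1)"
      by (simp add: algebra_simps)
    also have "2 * of_nat D' * ((g ^ Suc k - 1) * (pp * (of_nat D * ps n (Suc k))) - pp * of_nat D * (pp ^ n * pp ^ n * z1))
        - pp ^ n * (g - 1) * of_nat D * of_nat (Suc k) * (pp * (of_nat D' * ps n k))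
        - 2 * of_nat D' * (g ^ Suc k - 1) * (pp ^ n * ((pp - pp ^ Suc k) * of_int c))
       = pp ^ n * (2 * of_nat D' * ((g ^ Suc k - 1) * (pp ^ (n - 1) * of_int (e n)) - pp * of_nat D * (pp ^ n * z1))
           - (g - 1) * of_nat D * of_nat (Suc k) * (pp * (of_nat D' * ps n k)))"
      unfolding s1 by (simp add: algebra_simps del: of_nat_Suc power_Suc)
    finally have eq: "pp * (2 * of_nat D' * Y) =
       2 * of_nat D' * ((g ^ Suc k - 1) * (pp ^ (n - 1) * of_int (e n)) - pp * of_nat D * (pp ^ n * z1))
           - (g - 1) * of_nat D * of_nat (Suc k) * (pp * (of_nat D' * ps n k))"
      by (subst (asm) mult_left_cancel) auto
    have dn: "pp ^ (m + 1) dvd (pp ^ (n - 1) :: 'p padic_int)" "pp ^ (m + 1) dvd (pp ^ n :: 'p padic_int)"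
      by (rule le_imp_power_dvd, use n in linarith)+
    \<comment> \<open>The constant -1/2 of B_1 contributes a multiple of the power sum of exponent
      k, which is small by its own expansion and disappears in the limit.\<close>
    have "pp ^ (m + 1) dvd pp * (of_nat D' * ps n k)"
      unfolding s2 by (intro dvd_add dvd_mult2 dn(2))
    hence "pp ^ (m + 1) dvd pp * (2 * of_nat D' * Y)"
      unfolding eq
      by (rule dvd_diff[OF dvd_mult[OF dvd_diff[OF dvd_mult[OF dvd_mult2[OF dn(1)]] dvd_mult[OF dvd_mult2[OF dn(2)]]]]
            dvd_mult])
    hence "pp * pp ^ m dvd pp * (2 * of_nat D' * Y)" by simp
    hence Ym: "pp ^ m dvd 2 * of_nat D' * Y" by (subst (asm) dvd_mult_cancel_left) auto
    have "err = Y - of_nat (D * Suc k) * (?rs - ?I)"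
      unfolding err_def Y_def of_nat_mult by (simp add: algebra_simps del: of_nat_Suc)
    hence "2 * of_nat D' * err = 2 * of_nat D' * Y - 2 * of_nat D' * (of_nat (D * Suc k) * (?rs - ?I))"
      by (simp only: right_diff_distrib)
    also have "pp ^ m dvd \<dots>"
      by (rule dvd_diff[OF Ym dvd_mult[OF dvd_mult[OF N[rule_format, OF n(2)]]]])
    finally show ?thesis .
  qed
  have "2 * of_nat D' * err = 0" using key by (rule pp_power_separated)
  hence "err = 0" using D'(1) by simp
  hence "of_nat (D * Suc k) * ?I = (g ^ Suc k - 1) * (1 - pp ^ k) * of_int c" by (simp add: err_def)
  thus ?thesis using D(1,2) that by blast
qed

section \<open>Moments of the measure attached to a cyclotomic unit\<close>

text \<open>Substituting $T = e^t - 1$ turns \<^const>\<open>del\<close> into differentiation.\<close>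

definition padic_fps :: "'p :: prime_card padic_int fps \<Rightarrow> 'p padic fps" where
  "padic_fps f = Abs_fps (\<lambda>i. Fract (f $ i) 1)"

definition exp_subst :: "'p :: prime_card padic_int fps \<Rightarrow> 'p padic fps" where
  "exp_subst f = padic_fps f oo (fps_exp 1 - 1)"

lemma Fract_sum: "Fract (sum f A) 1 = (\<Sum>x\<in>A. Fract (f x) (1 :: 'a :: idom))"
proof (induction A rule: infinite_finite_induct)
  case (insert x F)
  have "Fract (f x + sum f F) 1 = Fract (f x) 1 + Fract (sum f F) 1" by simp
  thus ?case using insert.hyps insert.IH by (simp del: add_fract)
qed (simp_all add: Zero_fract_def)

lemma Fract_power: "Fract (x ^ n) 1 = Fract x (1 :: 'a :: idom) ^ n"
proof (induction n)
  case (Suc n)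
  have "Fract (x ^ Suc n) 1 = Fract x 1 * Fract (x ^ n) 1" by simp
  thus ?case by (simp only: Suc power_Suc)
qed (simp add: One_fract_def)

lemma padic_fps_add: "padic_fps (f + g) = padic_fps f + padic_fps g"
  and padic_fps_diff: "padic_fps (f - g) = padic_fps f - padic_fps g"
  and padic_fps_mult: "padic_fps (f * g) = padic_fps f * padic_fps g"
  by (simp_all add: padic_fps_def fps_eq_iff fps_mult_nth Fract_sum)

lemma padic_fps_const: "padic_fps (fps_const c) = fps_const (Fract c 1)"
  by (rule fps_ext) (simp add: padic_fps_def Zero_fract_def)

lemma padic_fps_1: "padic_fps 1 = 1"
  by (rule fps_ext) (simp add: padic_fps_def Zero_fract_def One_fract_def)

lemma padic_fps_X: "padic_fps fps_X = fps_X"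
  by (rule fps_ext) (simp add: padic_fps_def fps_X_def Zero_fract_def One_fract_def)

lemma padic_fps_deriv: "padic_fps (fps_deriv f) = fps_deriv (padic_fps f)"
  by (rule fps_ext) (simp add: padic_fps_def of_nat_fract del: of_nat_Suc)

lemma exp_base: "(fps_exp 1 - 1 :: 'a :: field_char_0 fps) $ 0 = 0"
  by simp

lemma exp_subst_add: "exp_subst (f + g) = exp_subst f + exp_subst g"
  and exp_subst_diff: "exp_subst (f - g) = exp_subst f - exp_subst g"
  by (simp_all add: exp_subst_def padic_fps_add padic_fps_diff fps_compose_add_distrib fps_compose_sub_distrib)

lemma exp_subst_mult: "exp_subst (f * g) = exp_subst f * exp_subst g"
  unfolding exp_subst_def padic_fps_mult by (rule fps_compose_mult_distrib[OF exp_base])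

lemma exp_subst_1: "exp_subst 1 = 1"
  by (simp add: exp_subst_def padic_fps_1)

lemma exp_subst_const: "exp_subst (fps_const c) = fps_const (Fract c 1)"
  by (simp add: exp_subst_def padic_fps_const)

lemma exp_subst_X: "exp_subst fps_X = fps_exp 1 - 1"
  unfolding exp_subst_def padic_fps_X by (rule fps_X_fps_compose_startby0[OF exp_base])

lemma exp_subst_power: "exp_subst (f ^ n) = exp_subst f ^ n"
  by (induction n) (simp_all add: exp_subst_1 exp_subst_mult)

lemma exp_subst_1_X: "exp_subst (1 + fps_X) = fps_exp 1"
  by (simp add: exp_subst_add exp_subst_1 exp_subst_X)

lemma exp_subst_del: "exp_subst (del f) = fps_deriv (exp_subst f)"
proof -
  have "fps_deriv (exp_subst f) = (fps_deriv (padic_fps f) oo (fps_exp 1 - 1)) * fps_exp 1"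
    unfolding exp_subst_def fps_compose_deriv[OF exp_base] by simp
  also have "\<dots> = exp_subst (fps_deriv f) * exp_subst (1 + fps_X)"
    by (simp add: exp_subst_def[of "fps_deriv f"] padic_fps_deriv exp_subst_1_X)
  finally show ?thesis by (simp add: del_def exp_subst_mult mult.commute)
qed

lemma del_funpow_exp_subst: "Fract (((del ^^ j) f) $ 0) 1 = fact j * exp_subst f $ j"
proof -
  have "exp_subst ((del ^^ j) f) = (fps_deriv ^^ j) (exp_subst f)"
    by (induction j) (simp_all add: exp_subst_del)
  moreover have "exp_subst g $ 0 = Fract (g $ 0) 1" for g :: "'a padic_int fps"
    by (simp add: exp_subst_def padic_fps_def)
  ultimately have "Fract (((del ^^ j) f) $ 0) 1 = (fps_deriv ^^ j) (exp_subst f) $ 0" by metis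
  also have "\<dots> = fact j * exp_subst f $ j" by (simp add: fps_0th_higher_deriv)
  finally show ?thesis .
qed

text \<open>After T = e^t - 1 the logarithmic derivative is a e^(a t)/(e^(a t) - 1) - e^t/(e^t - 1),
  so t times it equals B(a t) - B(t) with B(t) = t e^t/(e^t - 1) = t/(e^t - 1) + t. The extra t
  changes B_1 from -1/2 to 1/2, which is the correction at j = 0.\<close>

lemma exp_subst_del_log_cyc_series:
  assumes a: "\<not> int CARD('p :: prime_card) dvd a"
  shows "exp_subst (del_log (cyc_series a :: 'p padic_int fps)) $ j =
    (of_int a ^ Suc j - 1) * of_rat (bern_coeff (Suc j) + (if j = 0 then 1 else 0))"
proof -
  let ?h = "del_log (cyc_series a) :: 'p padic_int fps"
  define n where "n = nat a"
  define m where "m = nat (- a)"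
  have a0: "a \<noteq> 0" using a by auto
  have an: "of_int a + of_nat m = (of_nat n :: 'p padic)" unfolding n_def m_def by (cases "a \<ge> 0") simp_all
  let ?E = "\<lambda>c. fps_exp c :: 'p padic fps"
  define B :: "'p padic fps" where "B = bern_series + fps_X"
  define Ba where "Ba = B oo (fps_const (of_int a) * fps_X)"
  have B: "B * (?E 1 - 1) = fps_X * ?E 1"
    unfolding B_def using bern_series_mult_exp[where 'a = "'p padic"] by (simp add: algebra_simps)
  have "(B * (?E 1 - 1)) oo (fps_const (of_int a) * fps_X) = (fps_X * ?E 1) oo (fps_const (of_int a) * fps_X)"
    by (simp only: B)
  hence Ba: "Ba * (?E (of_int a) - 1) = fps_const (of_int a) * fps_X * ?E (of_int a)"
    by (simp add: fps_compose_mult_distrib fps_compose_sub_distrib Ba_def)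
  have En: "?E (of_int a) * ?E (of_nat m) = ?E (of_nat n)" by (simp add: an flip: fps_exp_add_mult)
  have "exp_subst (?h * fps_X * ((1 + fps_X) ^ n - (1 + fps_X) ^ m)) =
     exp_subst (fps_const (of_int a) * fps_X * (1 + fps_X) ^ n - (1 + fps_X) * ((1 + fps_X) ^ n - (1 + fps_X) ^ m))"
    using del_log_cyc_series[OF a] by (simp add: n_def m_def fps_of_int)
  moreover have "Fract (of_int a) 1 = (of_int a :: 'p padic)"
    by (cases a) (simp_all add: of_nat_fract One_fract_def)
  ultimately have h: "exp_subst ?h * (?E 1 - 1) * (?E (of_nat n) - ?E (of_nat m)) =
     fps_const (of_int a) * (?E 1 - 1) * ?E (of_nat n) - ?E 1 * (?E (of_nat n) - ?E (of_nat m))"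
    by (simp add: exp_subst_mult exp_subst_diff exp_subst_const exp_subst_power exp_subst_X exp_subst_1_X fps_exp_power_mult)
  have "(Ba - B) * ((?E 1 - 1) * (?E (of_nat n) - ?E (of_nat m)))
      = (Ba * (?E (of_int a) - 1)) * ?E (of_nat m) * (?E 1 - 1) - (B * (?E 1 - 1)) * (?E (of_nat n) - ?E (of_nat m))"
    unfolding En[symmetric] by (simp add: algebra_simps)
  also have "\<dots> = fps_const (of_int a) * fps_X * (?E (of_int a) * ?E (of_nat m)) * (?E 1 - 1)
      - fps_X * ?E 1 * (?E (of_nat n) - ?E (of_nat m))" unfolding Ba B by (simp only: mult_ac)
  also have "\<dots> = fps_X * (exp_subst ?h * (?E 1 - 1) * (?E (of_nat n) - ?E (of_nat m)))"
    unfolding En h by (simp add: algebra_simps)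
  finally have "(Ba - B) * ((?E 1 - 1) * (?E (of_nat n) - ?E (of_nat m)))
      = (fps_X * exp_subst ?h) * ((?E 1 - 1) * (?E (of_nat n) - ?E (of_nat m)))" by (simp only: mult.assoc)
  note prod_eq = this
  have nz: "(?E 1 - 1) * (?E (of_nat n) - ?E (of_nat m)) \<noteq> 0"
  proof -
    have "?E 1 $ 1 \<noteq> 1 $ 1" by simp
    hence "?E 1 \<noteq> 1" by metis
    moreover have "?E (of_nat n) $ 1 \<noteq> ?E (of_nat m) $ 1" using a0 by (auto simp: n_def m_def)
    hence "?E (of_nat n) \<noteq> ?E (of_nat m)" by metis
    ultimately show ?thesis by simp
  qed
  have eq: "Ba - B = fps_X * exp_subst ?h" by (rule iffD1[OF mult_right_cancel[OF nz] prod_eq])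
  have "exp_subst ?h $ j = (fps_X * exp_subst ?h) $ Suc j" by simp
  also have "\<dots> = (of_int a ^ Suc j - 1) * B $ Suc j"
    unfolding eq[symmetric] Ba_def by (simp add: fps_compose_linear left_diff_distrib del: power_Suc)
  also have "B $ Suc j = of_rat (bern_coeff (Suc j) + (if j = 0 then 1 else 0))"
    by (simp add: B_def bern_series_def of_rat_add)
  finally show ?thesis .
qed

text \<open>The chain rule contributes the factor p. Consequently h - \<open>phi\<close> h has at T
  = 0 the iterated derivatives of h multiplied by 1 - p^j, the Euler factor on the side of the
  Coleman map.\<close>

lemma del_phi: "del (phi (f :: 'p :: prime_card padic_int fps)) = fps_const pp * phi (del f)"
proof -
  let ?b = "(1 + fps_X :: 'p padic_int fps) ^ CARD('p) - 1"
  have "del (phi f) = (fps_deriv f oo ?b) * ((1 + fps_X) * fps_deriv ?b)"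
    unfolding del_def phi_def fps_compose_deriv[OF phi_base] by (simp only: mult_ac)
  also have "(1 + fps_X) * fps_deriv ?b = del ((1 + fps_X) ^ CARD('p))" by (simp add: del_def)
  also have "\<dots> = fps_const pp * phi (1 + fps_X)"
    unfolding del_one_plus_X_power phi_1_X by (simp add: fps_of_nat)
  finally show ?thesis unfolding del_def phi_mult by (simp add: phi_def mult_ac)
qed

lemma del_funpow_phi: "(del ^^ j) (phi (f :: 'p :: prime_card padic_int fps)) $ 0 = pp ^ j * (del ^^ j) f $ 0"
proof -
  have c: "del (fps_const c * g) = fps_const c * del g" for c and g :: "'p padic_int fps"
    by (simp add: del_def algebra_simps)
  have "(del ^^ j) (phi f) = fps_const (pp ^ j) * phi ((del ^^ j) f)"
  proof (induction j)
    case (Suc j)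
    have "(del ^^ Suc j) (phi f) = fps_const (pp ^ j) * (fps_const pp * phi ((del ^^ Suc j) f))"
      by (simp add: Suc c del_phi)
    thus ?case by (simp add: mult.commute flip: mult.assoc)
  qed simp
  thus ?thesis by simp
qed

lemma Fract_bern_measure_moment:
  fixes g :: "'p :: prime_card padic_int"
  assumes "odd CARD('p)" "g \<in> padic_units"
  shows "Fract (measure_integral (\<lambda>x. x ^ k) (bern_measure g)) 1 =
    (Fract g 1 ^ Suc k - 1) * (1 - of_nat CARD('p) ^ k) * of_rat (fact k * bern_coeff (Suc k))"
proof -
  let ?I = "measure_integral (\<lambda>x. x ^ k) (bern_measure g)"
  obtain D c where D: "D > 0" "of_int c = of_nat D * (fact (Suc k) * bern_coeff (Suc k))"
    "of_nat (D * Suc k) * ?I = (g ^ Suc k - 1) * (1 - pp ^ k) * of_int c"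
    using assms by (rule bern_measure_moment)
  have nat: "Fract (of_nat i) 1 = (of_nat i :: 'p padic)" for i by (simp only: of_nat_fract)
  have int: "Fract (of_int i) 1 = (of_int i :: 'p padic)" for i
    by (cases i) (simp_all add: of_nat_fract One_fract_def)
  have "(of_int c :: 'p padic) = of_rat (of_int c)" by simp
  also have "\<dots> = of_nat D * of_nat (Suc k) * of_rat (fact k * bern_coeff (Suc k))"
    unfolding D(2) by (simp add: of_rat_mult of_rat_add algebra_simps)
  finally have c: "(of_int c :: 'p padic) = of_nat (D * Suc k) * of_rat (fact k * bern_coeff (Suc k))" by (simp only: of_nat_mult)
  have "of_nat (D * Suc k) * Fract ?I 1 = Fract (of_nat (D * Suc k) * ?I) 1"
    unfolding nat[symmetric] by simp
  also have "\<dots> = (Fract g 1 ^ Suc k - 1) * (1 - of_nat CARD('p) ^ k) * of_int c"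
    unfolding D(3) int[symmetric] nat[symmetric] Fract_power[symmetric] One_fract_def by simp
  also have "\<dots> =
    of_nat (D * Suc k) * ((Fract g 1 ^ Suc k - 1) * (1 - of_nat CARD('p) ^ k) * of_rat (fact k * bern_coeff (Suc k)))"
    unfolding c by (simp only: mult_ac)
  finally have eq: "of_nat (D * Suc k) * Fract ?I 1 =
    of_nat (D * Suc k) * ((Fract g 1 ^ Suc k - 1) * (1 - of_nat CARD('p) ^ k) * of_rat (fact k * bern_coeff (Suc k)))" .
  have nz: "(of_nat (D * Suc k) :: 'p padic) \<noteq> 0" using D(1) by (simp only: of_nat_eq_0_iff) simp
  show ?thesis by (rule iffD1[OF mult_left_cancel[OF nz] eq])
qed

text \<open>Both sides have the same iterated derivatives at T = 0. The two conventions for B_1 meet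
  at j = 0, where the Euler factor 1 - p^0 vanishes.\<close>

lemma mahler_bern_measure:
  fixes a :: int
  defines "h \<equiv> del_log (cyc_series a :: 'p :: prime_card padic_int fps)"
  assumes odd: "odd CARD('p)" and a: "\<not> int CARD('p) dvd a"
  shows "mahler (bern_measure (of_int a)) = h - phi h"
proof (rule fps_eq_if_del_funpow_eq)
  fix j
  have unit: "(of_int a :: 'p padic_int) \<in> padic_units" using a by (simp add: padic_units_def of_int_unit_iff)
  have int: "Fract (of_int i) 1 = (of_int i :: 'p padic)" for i
    by (cases i) (simp_all add: of_nat_fract One_fract_def)
  have diff: "(del ^^ j) (F - G) = (del ^^ j) F - (del ^^ j) G" for j and F G :: "'p padic_int fps"
    by (induction j) (simp_all add: del_diff)
  have P: "Fract ((pp :: 'p padic_int) ^ j) 1 = (of_nat CARD('p) ^ j :: 'p padic)"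
    using of_nat_fract[of "CARD('p) ^ j", where 'a = "'p padic_int"] by (simp only: of_nat_power)
  have hj: "Fract ((del ^^ j) h $ 0) 1 = fact j * ((of_int a ^ Suc j - 1) * of_rat (bern_coeff (Suc j) + (if j = 0 then 1 else 0)) :: 'p padic)"
    unfolding del_funpow_exp_subst h_def exp_subst_del_log_cyc_series[OF a] ..
  have "Fract ((del ^^ j) (h - phi h) $ 0) 1 = Fract ((1 - pp ^ j) * (del ^^ j) h $ 0) 1"
    by (simp add: diff del_funpow_phi left_diff_distrib)
  also have "\<dots> = (1 - of_nat CARD('p) ^ j) * Fract ((del ^^ j) h $ 0) 1"
    unfolding P[symmetric] One_fract_def by simp
  also have "\<dots> = (of_int a ^ Suc j - 1) * (1 - of_nat CARD('p) ^ j) * of_rat (fact j * bern_coeff (Suc j))"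
  proof -
    have "of_rat (fact n) = (fact n :: 'p padic)" for n by (metis of_nat_fact of_rat_of_nat_eq)
    thus ?thesis unfolding hj by (cases "j = 0") (simp_all add: of_rat_mult mult_ac)
  qed
  also have "\<dots> = Fract (measure_integral (\<lambda>x. x ^ j) (bern_measure (of_int a))) 1"
    unfolding Fract_bern_measure_moment[OF odd unit] int ..
  also have "measure_integral (\<lambda>x. x ^ j) (bern_measure (of_int a :: 'p padic_int)) = (del ^^ j) (mahler (bern_measure (of_int a))) $ 0"
    unfolding mahler_eq_weighted del_funpow_mahler_weighted[OF ucont_const] mahler_weighted_nth_0 by simp
  finally show "(del ^^ j) (mahler (bern_measure (of_int a))) $ 0 = (del ^^ j) (h - phi h) $ 0"
    by (simp add: eq_fract)
qed

definition zeta_measure :: "'p :: prime_card padic_int \<Rightarrow> 'p iwasawa" where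
  "zeta_measure g = density_measure padic_inv (bern_measure g)"

lemma Fract_zeta_measure_moment:
  fixes g :: "'p :: prime_card padic_int"
  assumes "odd CARD('p)" "g \<in> padic_units"
  shows "Fract (measure_integral (\<lambda>x. x ^ Suc k) (zeta_measure g)) 1 =
    (Fract g 1 ^ Suc k - 1) * (1 - of_nat CARD('p) ^ k) * of_rat (fact k * bern_coeff (Suc k))"
proof -
  have "measure_integral (\<lambda>x. x ^ Suc k) (zeta_measure g) = measure_integral (\<lambda>x. x ^ Suc k * padic_inv x) (bern_measure g)"
    unfolding zeta_measure_def
    by (rule measure_integral_density[OF ucont_power[OF ucont_id] ucont_padic_inv])
  also have "\<dots> = measure_integral (\<lambda>x. x ^ k) (bern_measure g)"
    by (rule measure_integral_cong[symmetric]) (auto simp: padic_inv mult.assoc mult.left_commute)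
  finally show ?thesis by (simp only: Fract_bern_measure_moment[OF assms])
qed

text \<open>Since \<open>psi\<close> fixes h, the series to be integrated is h - \<open>phi\<close>
  h, the Mahler transform of the Bernoulli measure. The inverse of \<open>del\<close> amounts to the
  density 1/x, because \<open>del\<close> multiplies a measure by x.\<close>

lemma (in cyclotomic_tower) Col_cyclotomic_unit:
  assumes a: "\<not> int CARD('p) dvd a"
  shows "Col \<xi> (cyclotomic_unit \<xi> a) = zeta_measure (of_int a)"
proof -
  define h where "h = del_log (cyc_series a :: 'p padic_int fps)"
  have psi_h: "psi h = h" unfolding h_def by (rule psi_del_log_cyc_series[OF a])
  let ?\<mu> = "zeta_measure (of_int a) :: 'p iwasawa"
  have "del (mahler ?\<mu>) = mahler_weighted (\<lambda>x. x * padic_inv x) (bern_measure (of_int a))"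
    unfolding zeta_measure_def mahler_density[OF ucont_padic_inv] by (rule del_mahler_weighted[OF ucont_padic_inv])
  also have "\<dots> = mahler (bern_measure (of_int a))"
    unfolding mahler_weighted_def mahler_def
    by (intro arg_cong[where f = Abs_fps] ext measure_integral_cong[symmetric]) (auto simp: padic_inv)
  finally have del: "del (mahler ?\<mu>) = h - phi (psi h)"
    unfolding psi_h using mahler_bern_measure[OF odd_p a] by (simp add: h_def)
  have "the_inv_into {g. psi g = 0} del (h - phi (psi h)) = mahler ?\<mu>"
    unfolding the_inv_into_def
  proof (rule the_equality)
    show "mahler ?\<mu> \<in> {g. psi g = 0} \<and> del (mahler ?\<mu>) = h - phi (psi h)" by (simp add: psi_mahler del)
    fix f assume "f \<in> {g. psi g = 0} \<and> del f = h - phi (psi h)"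
    thus "f = mahler ?\<mu>" using del_inj_of_psi_zero[OF refl, of f ?\<mu>] by (simp add: del)
  qed
  hence "the_inv_into UNIV mahler (the_inv_into {g. psi g = 0} del (h - phi (psi h))) = ?\<mu>"
    using the_inv_into_f_f[OF inj_mahler, of ?\<mu>] by simp
  thus ?thesis
    unfolding Col_def by (simp add: cyclotomic_unit_norm_compatible[OF a] coleman_series_cyclotomic_unit[OF a] h_def Let_def)
qed

section \<open>Values of the Riemann zeta function at non-positive integers\<close>

text \<open>Euler--Maclaurin summation: \<open>em_deriv j s\<close> is the \<open>j\<close>-th derivative of
  $z \mapsto z^{1-s}/(s-1)$, and \<open>em_sum M s z\<close> is the truncation at order \<open>M\<close> of the asymptotic expansion
  of the tail $\sum_{i \ge 0} (z+i)^{-s}$.\<close>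

definition em_coeff :: "nat \<Rightarrow> complex \<Rightarrow> complex" where
  "em_coeff j s = (\<Prod>i<j. 1 - s - of_nat i) / (s - 1)"

definition em_deriv :: "nat \<Rightarrow> complex \<Rightarrow> complex \<Rightarrow> complex" where
  "em_deriv j s z = em_coeff j s * z powr (1 - s - of_nat j)"

definition em_sum :: "nat \<Rightarrow> complex \<Rightarrow> complex \<Rightarrow> complex" where
  "em_sum M s z = (\<Sum>j\<le>M. of_rat (bern_coeff j) * em_deriv j s z)"

text \<open>An exact tail S would satisfy S(z + 1) - S(z) + z^(-s) = 0. This is the defect of the
  truncation at z = n + 1. It decays like n^(-(Re s + M)), so its sum converges far to the left of
  Re s = 1.\<close>

definition em_rem :: "nat \<Rightarrow> complex \<Rightarrow> nat \<Rightarrow> complex" where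
  "em_rem M s n = em_sum M s (of_nat (Suc (Suc n))) - em_sum M s (of_nat (Suc n)) + of_nat (Suc n) powr (- s)"

definition em_zeta :: "nat \<Rightarrow> complex \<Rightarrow> complex" where
  "em_zeta M s = em_sum M s 1 + (\<Sum>n. em_rem M s n)"

lemma em_deriv_has_derivative:
  assumes "z \<notin> \<real>\<^sub>\<le>\<^sub>0"
  shows "(em_deriv j s has_field_derivative em_deriv (Suc j) s z) (at z within A)"
proof -
  have "((\<lambda>z. em_coeff j s * z powr (1 - s - of_nat j)) has_field_derivative
      em_coeff j s * ((1 - s - of_nat j) * z powr (1 - s - of_nat j - 1))) (at z within A)"
    by (rule DERIV_cmult[OF has_field_derivative_at_within[OF has_field_derivative_powr[OF assms]]])
  moreover have "em_coeff j s * ((1 - s - of_nat j) * z powr (1 - s - of_nat j - 1)) = em_deriv (Suc j) s z"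
  proof -
    have e: "1 - s - of_nat j - 1 = 1 - s - of_nat (Suc j)" by simp
    show ?thesis unfolding em_deriv_def em_coeff_def e prod.lessThan_Suc
      by (simp only: times_divide_eq_left times_divide_eq_right mult_ac)
  qed
  ultimately show ?thesis by (simp only: em_deriv_def[abs_def])
qed

lemma norm_em_deriv:
  assumes "x > 0"
  shows "norm (em_deriv j s (of_real x)) = norm (em_coeff j s) * x powr (1 - Re s - of_nat j)"
  using assms by (simp add: em_deriv_def norm_mult norm_powr_real_powr)

text \<open>Taylor expansion over a unit step, broken off at total order M, so that the error
  involves the derivative of order M + 1 for every j. Its norm is largest at the left end because
  the exponent is nonpositive.\<close>

lemma em_deriv_taylor:
  assumes x: "x > 0" and j: "j \<le> M" and s: "Re s + of_nat M \<ge> 0"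
  shows "norm (em_deriv j s (of_real (x + 1)) - (\<Sum>i\<le>M - j. em_deriv (j + i) s (of_real x) / fact i))
    \<le> norm (em_coeff (Suc M) s) * x powr (- (Re s + of_nat M))"
proof -
  let ?A = "closed_segment (of_real x) (of_real (x + 1)) :: complex set"
  let ?B = "norm (em_coeff (Suc M) s) * x powr (- (Re s + of_nat M))"
  have A: "\<exists>y\<ge>x. z = of_real y" if zA: "z \<in> ?A" for z
  proof -
    obtain u where u: "0 \<le> u" "z = (1 - u) *\<^sub>R of_real x + u *\<^sub>R of_real (x + 1)"
      using zA unfolding closed_segment_def by blast
    have "z = of_real (x + u)" unfolding u(2) by (simp add: scaleR_conv_of_real algebra_simps)
    thus ?thesis using u(1) by (intro exI[of _ "x + u"]) simp
  qed
  have "norm (em_deriv (j + 0) s (of_real (x + 1)) -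
      (\<Sum>i\<le>M - j. em_deriv (j + i) s (of_real x) * (of_real (x + 1) - of_real x) ^ i / fact i))
    \<le> ?B * norm (of_real (x + 1) - of_real x :: complex) ^ Suc (M - j) / fact (M - j)"
  proof (rule complex_Taylor[where f = "\<lambda>i. em_deriv (j + i) s" and S = ?A])
    fix i z assume "z \<in> ?A"
    then obtain y where "y \<ge> x" "z = of_real y" using A by blast
    hence "z \<notin> \<real>\<^sub>\<le>\<^sub>0" using x by (auto simp: complex_nonpos_Reals_iff)
    thus "(em_deriv (j + i) s has_field_derivative em_deriv (j + Suc i) s z) (at z within ?A)"
      using em_deriv_has_derivative by simp
  next
    fix z assume "z \<in> ?A"
    then obtain y where y: "y \<ge> x" "z = of_real y" using A by blast
    have "norm (em_deriv (j + Suc (M - j)) s z) = norm (em_coeff (Suc M) s) * y powr (- (Re s + of_nat M))"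
      using y x j by (simp add: norm_em_deriv algebra_simps)
    also have "\<dots> \<le> ?B"
      using y x s by (intro mult_left_mono powr_mono2') auto
    finally show "norm (em_deriv (j + Suc (M - j)) s z) \<le> ?B" .
  qed auto
  also have "\<dots> = ?B / fact (M - j)" by (simp flip: of_real_diff)
  also have "\<dots> \<le> ?B / 1" by (rule divide_left_mono) (auto simp: fact_ge_1)
  finally show ?thesis by (simp flip: of_real_diff)
qed

definition em_const :: "nat \<Rightarrow> real" where
  "em_const M = (\<Sum>j\<le>M. norm (of_rat (bern_coeff j) :: complex))"

lemma em_const_nonneg [simp]: "em_const M \<ge> 0"
  by (simp add: em_const_def sum_nonneg)

text \<open>Formally em_sum applies D/(e^D - 1) to z^(1-s)/(s - 1), and the difference operator is
  e^D - 1. Their composite D gives -z^(-s), which the last term of the defect cancels, so only the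
  Taylor errors remain.\<close>

lemma norm_em_rem:
  assumes s: "s \<noteq> 1" "Re s + of_nat M \<ge> 0" and M: "M \<ge> 1"
  shows "norm (em_rem M s n) \<le> em_const M * norm (em_coeff (Suc M) s) * of_nat (Suc n) powr (- (Re s + of_nat M))"
proof -
  define x where "x = real (Suc n)"
  define b where "b = (\<lambda>j. of_rat (bern_coeff j) :: complex)"
  define d where "d = (\<lambda>j. em_deriv j s (of_real x))"
  let ?B = "norm (em_coeff (Suc M) s) * x powr (- (Re s + of_nat M))"
  have x: "x > 0" by (simp add: x_def)
  have rat: "of_rat (p / fact i) = (of_rat p / fact i :: complex)" for p i
    by (metis of_nat_fact of_rat_divide of_rat_of_nat_eq)
  have rec: "(\<Sum>i\<le>m. b i / fact (Suc m - i)) = (if m = 0 then 1 else 0)" for m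
  proof -
    have "(\<Sum>i\<le>m. b i / fact (Suc m - i)) = of_rat (\<Sum>i\<le>m. bern_coeff i / fact (Suc m - i))"
      unfolding of_rat_sum rat b_def ..
    thus ?thesis by (simp only: bern_coeff_recurrence) simp
  qed
  have "(\<Sum>j\<le>M. b j * (\<Sum>i\<le>M - j. d (j + i) / fact i)) = (\<Sum>(j, i)\<in>(SIGMA j:{..M}. {..M - j}). b j * d (j + i) / fact i)"
    by (simp add: sum_distrib_left sum.Sigma)
  \<comment> \<open>Terms are collected by the order m = j + i of the derivative.\<close>
  also have "\<dots> = (\<Sum>(m, j)\<in>(SIGMA m:{..M}. {..m}). b j * d m / fact (m - j))"
    by (rule sum.reindex_bij_witness[of _ "\<lambda>(m, j). (j, m - j)" "\<lambda>(j, i). (j + i, j)"]) auto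
  also have "\<dots> = (\<Sum>m\<le>M. d m * (\<Sum>j\<le>m. b j / fact (m - j)))"
    by (subst sum.Sigma[symmetric]) (auto simp: sum_distrib_left mult_ac)
  \<comment> \<open>The inner sum is the coefficient of t^m in e^t t/(e^t - 1) = t/(e^t - 1) +
    t.\<close>
  also have "\<dots> = (\<Sum>m\<le>M. d m * (b m + (if m = 1 then 1 else 0)))"
  proof (rule sum.cong[OF refl])
    fix m assume "m \<in> {..M}"
    show "d m * (\<Sum>j\<le>m. b j / fact (m - j)) = d m * (b m + (if m = 1 then 1 else 0))"
    proof (cases m)
      case (Suc m')
      have "(\<Sum>j\<le>m. b j / fact (m - j)) = (\<Sum>j\<le>m'. b j / fact (Suc m' - j)) + b m" by (simp add: Suc)
      thus ?thesis using rec[of m'] Suc by (simp add: add.commute)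
    qed simp
  qed
  also have "\<dots> = (\<Sum>m\<le>M. b m * d m + (if m = 1 then d 1 else 0))"
    by (intro sum.cong refl) (simp add: algebra_simps)
  also have "\<dots> = (\<Sum>m\<le>M. b m * d m) + (\<Sum>m\<le>M. if m = 1 then d 1 else 0)"
    by (rule sum.distrib)
  also have "(\<Sum>m\<le>M. if m = 1 then d 1 else 0) = d 1" using M by simp
  also have "d 1 = - (of_nat (Suc n) powr (- s))"
    using s(1) by (simp add: d_def em_deriv_def em_coeff_def x_def) (simp add: field_simps)
  finally have main: "(\<Sum>j\<le>M. b j * (\<Sum>i\<le>M - j. d (j + i) / fact i)) = (\<Sum>m\<le>M. b m * d m) - of_nat (Suc n) powr (- s)"
    by simp
  have "em_rem M s n = (\<Sum>j\<le>M. b j * em_deriv j s (of_real (x + 1))) - ((\<Sum>m\<le>M. b m * d m) - of_nat (Suc n) powr (- s))"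
    by (simp add: em_rem_def em_sum_def b_def d_def x_def algebra_simps)
  also have "\<dots> = (\<Sum>j\<le>M. b j * (em_deriv j s (of_real (x + 1)) - (\<Sum>i\<le>M - j. d (j + i) / fact i)))"
    unfolding main[symmetric] by (simp add: sum_subtractf right_diff_distrib)
  also have "norm \<dots> \<le> (\<Sum>j\<le>M. norm (b j) * ?B)"
  proof (rule sum_norm_le)
    fix j assume "j \<in> {..M}"
    thus "norm (b j * (em_deriv j s (of_real (x + 1)) - (\<Sum>i\<le>M - j. d (j + i) / fact i))) \<le> norm (b j) * ?B"
      unfolding norm_mult d_def by (intro mult_left_mono em_deriv_taylor x s) simp_all
  qed
  also have "\<dots> = em_const M * ?B" by (simp add: em_const_def b_def sum_distrib_right)
  finally show ?thesis by (simp add: x_def mult.assoc)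
qed

section \<open>Analytic continuation by the corrected series\<close>

lemma summable_em_bound:
  assumes "\<sigma> > 1"
  shows "summable (\<lambda>n. c * of_nat (Suc n) powr (- \<sigma>) :: real)"
  using assms by (intro summable_mult) (subst summable_Suc_iff, simp add: summable_real_powr_iff)

lemma summable_em_rem:
  assumes "s \<noteq> 1" "Re s + of_nat M > 1" "M \<ge> 1"
  shows "summable (em_rem M s)"
  by (rule summable_comparison_test[OF _ summable_em_bound[OF assms(2)]])
     (use assms norm_em_rem[of s M] in \<open>auto intro!: exI[of _ 0]\<close>)

lemma em_coeff_holomorphic: "em_coeff j holomorphic_on - {1}"
  unfolding em_coeff_def[abs_def] by (intro holomorphic_intros) auto

lemma em_sum_holomorphic: "z \<noteq> 0 \<Longrightarrow> (\<lambda>s. em_sum M s z) holomorphic_on - {1}"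
  unfolding em_sum_def em_deriv_def
  by (intro holomorphic_intros em_coeff_holomorphic)

lemma em_rem_holomorphic: "(\<lambda>s. em_rem M s n) holomorphic_on - {1}"
  unfolding em_rem_def by (intro holomorphic_intros em_sum_holomorphic) (simp_all del: of_nat_Suc)

lemma em_zeta_holomorphic:
  assumes M: "M \<ge> 1"
  shows "em_zeta M holomorphic_on {s. Re s > 1 - of_nat M} - {1}"
proof -
  let ?A = "{s. Re s > 1 - of_nat M} - {1 :: complex}"
  have op: "open ?A" by (intro open_Diff open_halfspace_Re_gt) auto
  have sub: "?A \<subseteq> - {1}" by auto
  have "(\<lambda>s. \<Sum>n. em_rem M s n) holomorphic_on ?A"
  proof (rule holomorphic_uniform_sequence[where f = "\<lambda>N s. \<Sum>n<N. em_rem M s n", OF op])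
    show "(\<lambda>s. \<Sum>n<N. em_rem M s n) holomorphic_on ?A" for N
      by (intro holomorphic_intros holomorphic_on_subset[OF em_rem_holomorphic sub])
    fix s0 assume s0: "s0 \<in> ?A"
    then obtain d where d: "d > 0" "cball s0 d \<subseteq> ?A" using op open_contains_cball by blast
    \<comment> \<open>Half the distance to the line Re s = 1 - M at most, which keeps the exponent
      \<open>\<sigma>\<close> of the majorant above 1 on the whole disc.\<close>
    define d' where "d' = min d ((Re s0 - (1 - of_nat M)) / 2)"
    have d': "d' > 0" "cball s0 d' \<subseteq> ?A" using s0 d by (auto simp: d'_def)
    define \<sigma> where "\<sigma> = Re s0 - d' + of_nat M"
    have \<sigma>: "\<sigma> > 1"
    proof -
      have "d' \<le> (Re s0 - (1 - of_nat M)) / 2" unfolding d'_def by (rule min.cobounded2)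
      moreover have "Re s0 > 1 - of_nat M" using s0 by simp
      ultimately show ?thesis unfolding \<sigma>_def by (simp add: field_simps)
    qed
    have "continuous_on (cball s0 d') (em_coeff (Suc M))"
      by (rule continuous_on_subset[OF holomorphic_on_imp_continuous_on[OF em_coeff_holomorphic]])
         (use d'(2) in auto)
    hence "bounded (em_coeff (Suc M) ` cball s0 d')"
      by (intro compact_imp_bounded compact_continuous_image) auto
    then obtain K where K: "K > 0" "\<And>s. s \<in> cball s0 d' \<Longrightarrow> norm (em_coeff (Suc M) s) \<le> K"
      unfolding bounded_pos by auto
    have "uniform_limit (cball s0 d') (\<lambda>N s. \<Sum>n<N. em_rem M s n) (\<lambda>s. \<Sum>n. em_rem M s n) sequentially"
    proof (rule Weierstrass_m_test)
      fix n s assume s: "s \<in> cball s0 d'"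
      hence s': "s \<noteq> 1" "Re s > 1 - of_nat M" using d'(2) by auto
      have "\<bar>Re s0 - Re s\<bar> \<le> norm (s0 - s)" using abs_Re_le_cmod[of "s0 - s"] by simp
      hence Re: "Re s + of_nat M \<ge> \<sigma>" using s by (auto simp: \<sigma>_def dist_norm)
      have "norm (em_rem M s n) \<le> em_const M * norm (em_coeff (Suc M) s) * of_nat (Suc n) powr (- (Re s + of_nat M))"
        using s' M by (intro norm_em_rem) auto
      also have "\<dots> \<le> em_const M * K * of_nat (Suc n) powr (- \<sigma>)"
        using K(2)[OF s] Re K(1) by (intro mult_mono mult_left_mono powr_mono) auto
      finally show "norm (em_rem M s n) \<le> em_const M * K * of_nat (Suc n) powr (- \<sigma>)" .
    qed (rule summable_em_bound[OF \<sigma>])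
    thus "\<exists>d>0. cball s0 d \<subseteq> ?A \<and> uniform_limit (cball s0 d) (\<lambda>N s. \<Sum>n<N. em_rem M s n) (\<lambda>s. \<Sum>n. em_rem M s n) sequentially"
      using d' by blast
  qed
  moreover have "(\<lambda>s. em_sum M s 1) holomorphic_on ?A"
    by (rule holomorphic_on_subset[OF em_sum_holomorphic sub]) simp
  ultimately show ?thesis unfolding em_zeta_def[abs_def] by (intro holomorphic_intros)
qed

lemma em_deriv_tendsto_0:
  assumes "1 - Re s - of_nat j < 0"
  shows "(\<lambda>N. em_deriv j s (of_nat (Suc N))) \<longlonglongrightarrow> 0"
proof (rule tendsto_norm_zero_cancel)
  have lim: "(\<lambda>N. real (Suc N) powr (1 - Re s - of_nat j)) \<longlonglongrightarrow> 0"
    by (rule tendsto_neg_powr[OF assms]) (rule filterlim_compose[OF filterlim_real_sequentially filterlim_Suc])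
  have eq: "norm (em_deriv j s (of_nat (Suc N))) = norm (em_coeff j s) * real (Suc N) powr (1 - Re s - of_nat j)" for N
    using norm_em_deriv[of "real (Suc N)" j s] by (simp only: of_real_of_nat_eq of_nat_0_less_iff zero_less_Suc)
  show "(\<lambda>N. norm (em_deriv j s (of_nat (Suc N)))) \<longlonglongrightarrow> 0"
    unfolding eq using tendsto_mult_right_zero[OF lim] by simp
qed

lemma em_rem_partial_sum:
  "(\<Sum>n<N. em_rem M s n) = em_sum M s (of_nat (Suc N)) - em_sum M s 1 + (\<Sum>n<N. of_nat (Suc n) powr (- s))"
  by (induction N) (simp_all add: em_rem_def)

text \<open>The defects telescope to the Dirichlet series plus the boundary terms of
  \<open>em_sum\<close>. The one at infinity tends to 0 for Re s > 1, and the one at 1 is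
  compensated in \<open>em_zeta\<close>.\<close>

lemma em_zeta_dirichlet:
  assumes s: "Re s > 1" and M: "M \<ge> 1"
  shows "(\<lambda>n. 1 / of_nat (Suc n) powr s) sums em_zeta M s"
proof -
  have "s \<noteq> 1" using s by auto
  hence "em_rem M s sums (\<Sum>n. em_rem M s n)"
    using s by (intro summable_sums summable_em_rem M) auto
  hence 1: "(\<lambda>N. \<Sum>n<N. em_rem M s n) \<longlonglongrightarrow> (\<Sum>n. em_rem M s n)" by (simp add: sums_def)
  have "(\<lambda>N. em_sum M s (of_nat (Suc N))) \<longlonglongrightarrow> (\<Sum>j\<le>M. of_rat (bern_coeff j) * 0)"
    unfolding em_sum_def using s by (intro tendsto_sum tendsto_mult tendsto_const em_deriv_tendsto_0) auto
  hence "(\<lambda>N. (\<Sum>n<N. em_rem M s n) - em_sum M s (of_nat (Suc N)) + em_sum M s 1)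
     \<longlonglongrightarrow> (\<Sum>n. em_rem M s n) - 0 + em_sum M s 1"
    by (intro tendsto_add tendsto_diff 1 tendsto_const) simp
  thus ?thesis unfolding em_rem_partial_sum sums_def
    by (simp add: powr_minus_divide em_zeta_def add.commute)
qed

text \<open>The additional term of the expansion telescopes too: its value at 1 cancels in
  \<open>em_zeta\<close>, and its value at infinity is 0 in this half-plane.\<close>

lemma em_zeta_Suc:
  assumes s: "s \<noteq> 1" "Re s + of_nat M > 1" and M: "M \<ge> 1"
  shows "em_zeta (Suc M) s = em_zeta M s"
proof -
  let ?d = "\<lambda>z. of_rat (bern_coeff (Suc M)) * em_deriv (Suc M) s z"
  have sum: "em_sum (Suc M) s z = em_sum M s z + ?d z" for z by (simp add: em_sum_def)
  have 1: "(\<lambda>N. \<Sum>n<N. em_rem M s n) \<longlonglongrightarrow> (\<Sum>n. em_rem M s n)"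
    using summable_sums[OF summable_em_rem[OF s M]] by (simp add: sums_def)
  have 2: "(\<lambda>N. \<Sum>n<N. em_rem (Suc M) s n) \<longlonglongrightarrow> (\<Sum>n. em_rem (Suc M) s n)"
    using summable_sums[OF summable_em_rem[of s "Suc M"]] s by (simp add: sums_def)
  have "(\<lambda>N. ?d (of_nat (Suc N))) \<longlonglongrightarrow> of_rat (bern_coeff (Suc M)) * 0"
    using s by (intro tendsto_mult tendsto_const em_deriv_tendsto_0) auto
  hence "(\<lambda>N. (\<Sum>n<N. em_rem M s n) + ?d (of_nat (Suc N)) - ?d 1) \<longlonglongrightarrow> (\<Sum>n. em_rem M s n) + 0 - ?d 1"
    by (intro tendsto_add tendsto_diff 1 tendsto_const) simp
  moreover have "(\<Sum>n<N. em_rem M s n) + ?d (of_nat (Suc N)) - ?d 1 = (\<Sum>n<N. em_rem (Suc M) s n)" for N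
    unfolding em_rem_partial_sum sum by (simp add: algebra_simps)
  ultimately have "(\<lambda>N. \<Sum>n<N. em_rem (Suc M) s n) \<longlonglongrightarrow> (\<Sum>n. em_rem M s n) - ?d 1" by simp
  with 2 have "(\<Sum>n. em_rem (Suc M) s n) = (\<Sum>n. em_rem M s n) - ?d 1" by (rule LIMSEQ_unique)
  thus ?thesis by (simp add: em_zeta_def sum)
qed

lemma em_zeta_eq:
  assumes "s \<noteq> 1" "Re s + of_nat M > 1" "M \<ge> 1" "M \<le> M'"
  shows "em_zeta M' s = em_zeta M s"
  using assms(4)
proof (induction M' rule: dec_induct)
  case (step N)
  have "em_zeta (Suc N) s = em_zeta N s" using assms(1-3) step.hyps by (intro em_zeta_Suc) auto
  thus ?case using step.IH by simp
qed simp

text \<open>At s = 1 - k the function z^(1-s) = z^k is a polynomial, so the expansion of order k + 1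
  is exact and all defects vanish. What remains is the finite sum at z = 1, evaluated by the
  Bernoulli recurrence.\<close>

lemma em_zeta_at_nonpos_int:
  assumes k: "k > 0"
  shows "em_zeta (Suc k) (1 - of_nat k) = of_rat (- (fact (k - 1) * (bern_coeff k + (if k = 1 then 1 else 0))))"
proof -
  let ?s = "1 - of_nat k :: complex"
  have s: "?s \<noteq> 1" "Re ?s + of_nat (Suc k) \<ge> 0" "Re ?s + of_nat (Suc k) > 1" using k by simp_all
  have coeff: "em_coeff j ?s = - of_nat (fact j * (k choose j)) / of_nat k" for j
    unfolding em_coeff_def using falling_factorial_of_nat[of k j, where 'a = complex] by simp
  have "em_coeff (Suc (Suc k)) ?s = 0" by (simp add: coeff binomial_eq_0 del: fact_Suc)
  hence rem: "em_rem (Suc k) ?s n = 0" for n using norm_em_rem[OF s(1,2), of n] by simp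
  have "em_zeta (Suc k) ?s = (\<Sum>j\<le>Suc k. of_rat (bern_coeff j) * em_coeff j ?s)"
    by (simp add: em_zeta_def rem em_sum_def em_deriv_def)
  also have "\<dots> = (\<Sum>j\<le>k. of_rat (bern_coeff j) * em_coeff j ?s)"
    by (simp add: coeff binomial_eq_0)
  also have "\<dots> = (\<Sum>j\<le>k. of_rat (- (fact (k - 1) * (bern_coeff j / fact (k - j)))))"
  proof (rule sum.cong[OF refl])
    fix j assume "j \<in> {..k}"
    hence "(of_nat (fact j * (k choose j)) :: rat) = fact k / fact (k - j)" by (simp add: binomial_fact)
    also have "(fact k :: rat) = of_nat k * fact (k - 1)" using k by (cases k) simp_all
    finally have "of_nat (fact j * (k choose j)) / of_nat k = (fact (k - 1) / fact (k - j) :: rat)"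
      using k by simp
    hence "(of_rat (of_nat (fact j * (k choose j)) / of_nat k) :: complex) = of_rat (fact (k - 1) / fact (k - j))" by simp
    hence "(of_nat (fact j * (k choose j)) / of_nat k :: complex) = of_rat (fact (k - 1) / fact (k - j))"
      by (simp only: of_rat_divide of_rat_of_nat_eq)
    hence "of_rat (bern_coeff j) * em_coeff j ?s = of_rat (bern_coeff j) * - of_rat (fact (k - 1) / fact (k - j))"
      unfolding coeff by (simp only: minus_divide_left[symmetric])
    also have "\<dots> = of_rat (- (fact (k - 1) * (bern_coeff j / fact (k - j))))"
      by (simp only: of_rat_mult[symmetric] of_rat_minus[symmetric]) (simp add: mult.commute)
    finally show "of_rat (bern_coeff j) * em_coeff j ?s = of_rat (- (fact (k - 1) * (bern_coeff j / fact (k - j))))" .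
  qed
  also have "\<dots> = of_rat (- (fact (k - 1) * (\<Sum>j\<le>k. bern_coeff j / fact (k - j))))"
    by (simp only: of_rat_sum[symmetric] sum_negf sum_distrib_left)
  also have "(\<Sum>j\<le>k. bern_coeff j / fact (k - j)) = bern_coeff k + (if k = 1 then 1 else 0)"
  proof -
    obtain m where m: "k = Suc m" using k by (cases k) auto
    have "(\<Sum>j\<le>k. bern_coeff j / fact (k - j)) = (\<Sum>j\<le>m. bern_coeff j / fact (Suc m - j)) + bern_coeff k"
      by (simp add: m)
    thus ?thesis unfolding bern_coeff_recurrence by (simp add: m)
  qed
  finally show ?thesis .
qed

lemma riemann_zeta_nonpos_int:
  assumes k: "k > 0"
  shows "riemann_zeta (1 - of_nat k) = of_rat (- (fact (k - 1) * (bern_coeff k + (if k = 1 then 1 else 0))))"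
proof -
  \<comment> \<open>The order grows as Re s decreases, so that each s \<noteq> 1 lies in the
    half-plane where its truncation is valid. Independence of the order makes the pieces
    agree.\<close>
  define f where "f = (\<lambda>s. em_zeta (nat \<lceil>2 - Re s\<rceil> + 1) s)"
  have f_eq: "f s = em_zeta M s" if "s \<noteq> 1" "Re s > 1 - of_nat M" "M \<ge> 1" for s M
  proof -
    let ?N = "nat \<lceil>2 - Re s\<rceil> + 1"
    have N: "Re s + of_nat ?N > 1" by linarith
    show ?thesis
    proof (cases "M \<le> ?N")
      case True
      thus ?thesis unfolding f_def using that by (intro em_zeta_eq) auto
    next
      case False
      have "em_zeta M s = em_zeta ?N s" using that N False by (intro em_zeta_eq) auto
      thus ?thesis by (simp only: f_def)
    qed
  qed
  have "f holomorphic_on (\<Union>M\<in>{1..}. {s. Re s > 1 - of_nat M} - {1})"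
  proof (rule holomorphic_on_UN_open)
    fix M :: nat assume M: "M \<in> {1..}"
    show "open ({s. Re s > 1 - of_nat M} - {1})" by (intro open_Diff open_halfspace_Re_gt) auto
    show "f holomorphic_on {s. Re s > 1 - of_nat M} - {1}"
      by (rule holomorphic_transform[OF em_zeta_holomorphic[of M]]) (use M f_eq in auto)
  qed
  also have "(\<Union>M\<in>{1..}. {s. Re s > 1 - of_nat M} - {1}) = - {1 :: complex}"
  proof (intro equalityI subsetI)
    fix s :: complex assume s: "s \<in> - {1}"
    have "Re s > 1 - of_nat (nat \<lceil>2 - Re s\<rceil> + 1)" by linarith
    thus "s \<in> (\<Union>M\<in>{1..}. {s. Re s > 1 - of_nat M} - {1})" using s by (intro UN_I[of "nat \<lceil>2 - Re s\<rceil> + 1"]) auto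
  qed auto
  finally have hol: "f holomorphic_on - {1}" .
  have dir: "(\<lambda>n. 1 / of_nat (Suc n) powr w) sums f w" if "Re w > 1" for w
  proof -
    have "w \<noteq> 1" using that by auto
    hence "f w = em_zeta 1 w" using that by (intro f_eq) auto
    thus ?thesis using em_zeta_dirichlet[OF that, of 1] by simp
  qed
  let ?s = "1 - of_nat k :: complex"
  have s: "?s \<in> - {1}" using k by simp
  have "riemann_zeta ?s = f ?s"
    unfolding riemann_zeta_def
  proof (rule the_equality)
    show "\<exists>g. g holomorphic_on - {1} \<and> (\<forall>w. Re w > 1 \<longrightarrow> (\<lambda>n. 1 / of_nat (Suc n) powr w) sums g w) \<and> f ?s = g ?s"
      using hol dir by blast
    fix z assume "\<exists>g. g holomorphic_on - {1} \<and> (\<forall>w. Re w > 1 \<longrightarrow> (\<lambda>n. 1 / of_nat (Suc n) powr w) sums g w) \<and> z = g ?s"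
    then obtain g where g: "g holomorphic_on - {1}" "\<And>w. Re w > 1 \<Longrightarrow> (\<lambda>n. 1 / of_nat (Suc n) powr w) sums g w" "z = g ?s"
      by blast
    \<comment> \<open>Identity theorem: the punctured plane is connected, and for Re w > 1 both
      functions are the sum of the Dirichlet series.\<close>
    have "g ?s = f ?s"
    proof (rule analytic_continuation_open[of "{w. Re w > 1}" "- {1}" g f])
      show "open {w. 1 < Re w}" by (rule open_halfspace_Re_gt)
      show "{w. 1 < Re w} \<noteq> {}" by (auto intro!: exI[of _ 2])
      show "connected (- {1 :: complex})" by (rule connected_punctured_universe) simp
      show "g w = f w" if "w \<in> {w. 1 < Re w}" for w
        using that sums_unique2[OF g(2) dir] by auto
    qed (use g hol s in auto)
    thus "z = f ?s" using g by simp
  qed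
  also have "\<dots> = em_zeta (Suc k) ?s" using k by (intro f_eq) auto
  also have "\<dots> = of_rat (- (fact (k - 1) * (bern_coeff k + (if k = 1 then 1 else 0))))"
    by (rule em_zeta_at_nonpos_int[OF k])
  finally show ?thesis .
qed

section \<open>Pseudo-measures\<close>

lemma Total_Frac_eq_iff:
  "nonzerodivisor s \<Longrightarrow> nonzerodivisor t \<Longrightarrow> Total_Frac a s = Total_Frac b t \<longleftrightarrow> a * t = b * s"
  by transfer (simp add: total_fracrel_def)

lemma Total_Frac_mult:
  "nonzerodivisor s \<Longrightarrow> nonzerodivisor t \<Longrightarrow> Total_Frac a s * Total_Frac b t = Total_Frac (a * b) (s * t)"
  by transfer (simp add: total_fracrel_def)

lemma Total_Frac_uminus: "nonzerodivisor s \<Longrightarrow> - Total_Frac a s = Total_Frac (- a) s"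
  by transfer (simp add: total_fracrel_def)

lemma Total_Frac_cases:
  obtains a s where "nonzerodivisor s" "x = Total_Frac a s"
proof -
  have "\<exists>a s. nonzerodivisor s \<and> x = Total_Frac a s"
  proof transfer
    fix x :: "'a \<times> 'a" assume "total_fracrel x x"
    thus "\<exists>a s. nonzerodivisor s \<and> total_fracrel x (if nonzerodivisor s then (a, s) else (0, 1))"
      by (intro exI[of _ "fst x"] exI[of _ "snd x"]) (simp add: total_fracrel_def)
  qed
  thus ?thesis using that by blast
qed

lemma to_total_frac_eq_iff [simp]: "to_total_frac x = to_total_frac y \<longleftrightarrow> x = y"
  by (simp add: Total_Frac_eq_iff)

lemma to_total_frac_mult: "to_total_frac x * to_total_frac y = to_total_frac (x * y)"
  by (simp add: Total_Frac_mult)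

abbreviation moment :: "nat \<Rightarrow> 'p :: prime_card iwasawa \<Rightarrow> 'p padic_int" where
  "moment k \<mu> \<equiv> measure_integral (\<lambda>x. x ^ k) \<mu>"

lemma moment_times: "moment k (\<mu> * \<nu>) = moment k \<mu> * moment k \<nu>"
  by (rule measure_integral_times) (auto simp: power_mult_distrib)

lemma moment_minus: "moment k (\<mu> - \<nu>) = moment k \<mu> - moment k \<nu>"
  by (rule measure_integral_minus_measure) auto

lemma moment_uminus: "moment k (- \<mu>) = - moment k \<mu>"
  using moment_minus[of k 0 \<mu>] by simp

lemma moment_dirac_diff: "g \<in> padic_units \<Longrightarrow> moment k (dirac g - dirac 1) = g ^ k - 1"
  by (simp add: moment_minus measure_integral_dirac ucont_power)

text \<open>Independence of g: the measures \<mu> and \<nu> obtained from g and h satisfy ([g] -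
  [1]) \<nu> = ([h] - [1]) \<mu>, and taking moments is multiplicative.\<close>

lemma pseudo_integral_power:
  fixes g :: "'p :: prime_card padic_int"
  assumes g: "g \<in> padic_units" "g ^ k \<noteq> 1"
    and \<mu>: "to_total_frac \<mu> = to_total_frac (dirac g - dirac 1) * \<Lambda>"
  shows "pseudo_integral (\<lambda>x. x ^ k) \<Lambda> = Fract (moment k \<mu>) (g ^ k - 1)"
  unfolding pseudo_integral_def
proof (rule the_equality)
  show "\<forall>h\<in>padic_units. \<forall>\<nu>. h ^ k \<noteq> 1 \<longrightarrow> to_total_frac \<nu> = to_total_frac (dirac h - dirac 1) * \<Lambda> \<longrightarrow>
      Fract (moment k \<mu>) (g ^ k - 1) = Fract (moment k \<nu>) (h ^ k - 1)"
  proof (intro ballI allI impI)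
    fix h :: "'p padic_int" and \<nu>
    assume h: "h \<in> padic_units" "h ^ k \<noteq> 1" and \<nu>: "to_total_frac \<nu> = to_total_frac (dirac h - dirac 1) * \<Lambda>"
    have "to_total_frac ((dirac g - dirac 1) * \<nu>) = to_total_frac ((dirac h - dirac 1) * \<mu>)"
      unfolding to_total_frac_mult[symmetric] \<mu> \<nu> by (simp only: mult_ac)
    hence "moment k ((dirac g - dirac 1) * \<nu>) = moment k ((dirac h - dirac 1) * \<mu>)" by simp
    hence "(g ^ k - 1) * moment k \<nu> = (h ^ k - 1) * moment k \<mu>"
      by (simp only: moment_times moment_dirac_diff g h)
    thus "Fract (moment k \<mu>) (g ^ k - 1) = Fract (moment k \<nu>) (h ^ k - 1)"
      using g h by (simp add: eq_fract mult.commute)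
  qed
  show "I = Fract (moment k \<mu>) (g ^ k - 1)"
    if "\<forall>h\<in>padic_units. \<forall>\<nu>. h ^ k \<noteq> 1 \<longrightarrow> to_total_frac \<nu> = to_total_frac (dirac h - dirac 1) * \<Lambda> \<longrightarrow>
      I = Fract (moment k \<nu>) (h ^ k - 1)" for I
    using that g \<mu> by blast
qed

lemma infinite_padic_units: "infinite (padic_units :: 'p :: prime_card padic_int set)"
proof
  assume fin: "finite (padic_units :: 'p padic_int set)"
  have "range (\<lambda>n. of_int (1 + int CARD('p) * int n)) \<subseteq> (padic_units :: 'p padic_int set)"
  proof clarify
    fix n
    have "\<not> int CARD('p) dvd 1 + int CARD('p) * int n"
    proof
      assume "int CARD('p) dvd 1 + int CARD('p) * int n"
      hence "int CARD('p) dvd 1" by (simp add: dvd_add_left_iff)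
      thus False using CARD_gt_1[where 'p = 'p] by simp
    qed
    thus "(of_int (1 + int CARD('p) * int n) :: 'p padic_int) \<in> padic_units"
      unfolding padic_units_def mem_Collect_eq of_int_unit_iff .
  qed
  hence "finite (range (\<lambda>n. of_int (1 + int CARD('p) * int n) :: 'p padic_int))" using fin finite_subset by blast
  moreover have "inj (\<lambda>n. of_int (1 + int CARD('p) * int n) :: 'p padic_int)"
    by (rule injI) (simp only: of_int_eq_iff add_left_cancel mult_cancel_left of_nat_eq_iff, simp)
  ultimately show False using finite_imageD infinite_UNIV_nat by blast
qed

text \<open>A generator of finite order would have a finite, hence closed, set of powers, whereas
  the unit group is infinite.\<close>

lemma topological_generator_power_ne_1:
  fixes a :: "'p :: prime_card padic_int"
  assumes "topological_generator a" "k > 0"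
  shows "a ^ k \<noteq> 1"
proof
  assume 1: "a ^ k = 1"
  let ?S = "{x. \<exists>j. x = a ^ j \<or> x * a ^ j = 1}"
  have red: "a ^ j \<in> (\<lambda>j. a ^ j) ` {..<k}" for j
  proof -
    have "a ^ j = a ^ (k * (j div k) + j mod k)" by simp
    also have "\<dots> = a ^ (j mod k)" by (simp only: power_add power_mult 1 power_one mult_1)
    finally show ?thesis using assms(2) by auto
  qed
  have "?S \<subseteq> (\<lambda>j. a ^ j) ` {..<k}"
  proof
    fix x assume "x \<in> ?S"
    then obtain j where "x = a ^ j \<or> x * a ^ j = 1" by blast
    thus "x \<in> (\<lambda>j. a ^ j) ` {..<k}"
    proof
      assume x: "x * a ^ j = 1"
      have "k * j = j + (k * j - j)" using assms(2) by simp
      hence "a ^ (k * j) = a ^ j * a ^ (k * j - j)" by (metis power_add)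
      hence "x = (x * a ^ j) * a ^ (k * j - j)" by (simp only: mult.assoc) (simp add: power_mult 1)
      hence "x = a ^ (k * j - j)" by (simp add: x)
      thus ?thesis using red by simp
    qed (use red in simp)
  qed
  hence fin: "finite ?S" by (rule finite_subset) simp
  hence "closure ?S = ?S" by (intro closure_closed finite_imp_closed)
  hence "padic_units \<subseteq> ?S" using assms(1) unfolding topological_generator_def by (simp only:)
  hence "finite (padic_units :: 'p padic_int set)" using fin by (rule finite_subset)
  thus False using infinite_padic_units by blast
qed

lemma (in cyclotomic_tower) measure_eq_if_moments_eq:
  fixes \<mu> \<nu> :: "'p iwasawa"
  assumes "\<And>k. k > 0 \<Longrightarrow> moment k \<mu> = moment k \<nu>"
  shows "\<mu> = \<nu>"
  using measure_zero_if_moments_zero[of "\<mu> - \<nu>"] assms by (simp add: moment_minus)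

theorem theorem10p15:
  fixes \<xi> :: "nat \<Rightarrow> 'p :: prime_card padic_closure" and a :: int
  assumes "odd CARD('p)"
    and "compatible_primitive_roots \<xi>"
    and "topological_generator (of_int a :: 'p padic_int)"
  shows "kubota_leopoldt = - Total_Frac (Col \<xi> (cyclotomic_unit \<xi> a)) (theta a)"
proof -
  interpret cyclotomic_tower \<xi> using assms(1,2) by unfold_locales
  let ?a = "of_int a :: 'p padic_int"
  define \<mu> :: "'p padic_int \<Rightarrow> 'p iwasawa" where "\<mu> = zeta_measure"
  have unit: "?a \<in> padic_units" using assms(3) by (simp add: topological_generator_def)
  hence a: "\<not> int CARD('p) dvd a" by (simp add: padic_units_def of_int_unit_iff)
  have ne1: "?a ^ k \<noteq> 1" if "k > 0" for k
    using topological_generator_power_ne_1[OF assms(3) that] .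
  have theta: "theta a = dirac ?a - dirac 1" by (simp add: theta_def)
  \<comment> \<open>The moments of \<theta>_a are a^k - 1, which are nonzero for k > 0, so a product
    with \<theta>_a vanishes only if all positive moments of the other factor do.\<close>
  have nzd: "nonzerodivisor (theta a :: 'p iwasawa)"
    unfolding nonzerodivisor_def
  proof (intro allI impI)
    fix \<nu> :: "'p iwasawa" assume 0: "theta a * \<nu> = 0"
    show "\<nu> = 0"
    proof (rule measure_zero_if_moments_zero)
      fix k :: nat assume k: "k > 0"
      have "(?a ^ k - 1) * moment k \<nu> = moment k (theta a * \<nu>)"
        by (simp only: moment_times theta moment_dirac_diff[OF unit])
      also have "\<dots> = 0" by (simp add: 0)
      finally show "moment k \<nu> = 0" using ne1[OF k] by simp
    qed
  qed
  have mom: "Fract (moment k (\<mu> g)) 1 = (Fract g 1 ^ k - 1) * (1 - of_nat CARD('p) ^ (k - 1))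
      * of_rat (fact (k - 1) * bern_coeff k)" if "k > 0" "g \<in> padic_units" for k g
    using Fract_zeta_measure_moment[OF assms(1) that(2), of "k - 1"] that(1) by (simp add: \<mu>_def del: power_Suc)
  \<comment> \<open>The moments of \<mu>_g depend on g only through the factor g^k - 1, so the k-th
    moment of either side carries the symmetric product (g^k - 1)(a^k - 1).\<close>
  have swap: "(dirac g - dirac 1) * \<mu> ?a = theta a * \<mu> g" if g: "g \<in> padic_units" for g
  proof (rule measure_eq_if_moments_eq)
    fix k :: nat assume k: "k > 0"
    have F: "Fract (h ^ k - 1) 1 = Fract h 1 ^ k - 1" for h :: "'p padic_int"
      by (simp add: One_fract_def flip: Fract_power)
    have "Fract ((g ^ k - 1) * moment k (\<mu> ?a)) 1 = Fract (g ^ k - 1) 1 * Fract (moment k (\<mu> ?a)) 1" by simp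
    also have "\<dots> = Fract (?a ^ k - 1) 1 * Fract (moment k (\<mu> g)) 1"
      unfolding F mom[OF k unit] mom[OF k g] by (simp only: mult_ac)
    also have "\<dots> = Fract ((?a ^ k - 1) * moment k (\<mu> g)) 1" by simp
    finally have "(g ^ k - 1) * moment k (\<mu> ?a) = (?a ^ k - 1) * moment k (\<mu> g)" by (simp add: eq_fract)
    thus "moment k ((dirac g - dirac 1) * \<mu> ?a) = moment k (theta a * \<mu> g)"
      by (simp only: moment_times theta moment_dirac_diff[OF unit] moment_dirac_diff[OF g])
  qed
  \<comment> \<open>The values of zeta at 1 - k, in the convention B_1 = -1/2: the summand 1 at k =
    1 makes zeta(0) = -1/2.\<close>
  define r where "r = (\<lambda>k. - (fact (k - 1) * (bern_coeff k + (if k = 1 then 1 else 0))) :: rat)"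
  have zeta: "riemann_zeta (1 - of_nat k) = of_rat (r k)" if "k > 0" for k
    unfolding r_def by (rule riemann_zeta_nonpos_int[OF that])
  have special_value: "Fract (moment k (- \<mu> ?a)) (?a ^ k - 1) = (1 - of_nat CARD('p) ^ (k - 1)) * of_rat (r k)"
    if k: "k > 0" for k
  proof -
    have nz: "Fract ?a 1 ^ k - 1 \<noteq> 0"
      using ne1[OF k] by (simp add: One_fract_def Zero_fract_def eq_fract flip: Fract_power)
    have "Fract (moment k (- \<mu> ?a)) (?a ^ k - 1) = - Fract (moment k (\<mu> ?a)) 1 / (Fract ?a 1 ^ k - 1)"
      by (simp add: moment_uminus One_fract_def flip: Fract_power)
    also have "\<dots> = - ((1 - of_nat CARD('p) ^ (k - 1)) * of_rat (fact (k - 1) * bern_coeff k))"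
      unfolding mom[OF k unit] using nz by simp
    also have "\<dots> = (1 - of_nat CARD('p) ^ (k - 1)) * of_rat (r k)"
      by (cases "k = 1") (simp_all add: r_def of_rat_minus)
    finally show ?thesis .
  qed
  let ?L = "- Total_Frac (\<mu> ?a) (theta a)"
  \<comment> \<open>By \<open>swap\<close> the denominator \<theta>_a cancels for every g, not only
    for g = a.\<close>
  have L: "to_total_frac (dirac g - dirac 1) * ?L = to_total_frac (- \<mu> g)" if "g \<in> padic_units" for g
    using nzd swap[OF that] by (simp add: Total_Frac_uminus Total_Frac_mult Total_Frac_eq_iff mult.commute)
  have "kubota_leopoldt = ?L"
    unfolding kubota_leopoldt_def
  proof (rule the_equality)
    have "pseudo_measure ?L" unfolding pseudo_measure_def using L by auto
    moreover have "pseudo_integral (\<lambda>x. x ^ k) ?L = (1 - of_nat CARD('p) ^ (k - 1)) * of_rat (r k)" if "k > 0" for k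
      unfolding pseudo_integral_power[OF unit ne1[OF that] L[OF unit, symmetric]] by (rule special_value[OF that])
    ultimately show "pseudo_measure ?L \<and> (\<forall>k>0. \<exists>r. riemann_zeta (1 - of_nat k) = of_rat r \<and>
        pseudo_integral (\<lambda>x. x ^ k) ?L = (1 - of_nat CARD('p) ^ (k - 1)) * of_rat r)"
      using zeta by blast
  next
    fix \<Lambda> :: "'p iwasawa total_frac"
    assume *: "pseudo_measure \<Lambda> \<and> (\<forall>k>0. \<exists>r. riemann_zeta (1 - of_nat k) = of_rat r \<and>
        pseudo_integral (\<lambda>x. x ^ k) \<Lambda> = (1 - of_nat CARD('p) ^ (k - 1)) * of_rat r)"
    then obtain \<nu> where \<nu>: "to_total_frac \<nu> = to_total_frac (dirac ?a - dirac 1) * \<Lambda>"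
      using unit unfolding pseudo_measure_def by (metis rangeE)
    \<comment> \<open>The prescribed values fix all positive moments of \<theta>_a \<Lambda>, hence
      this measure, and \<theta>_a can then be divided out in the ring of fractions.\<close>
    have "\<nu> = - \<mu> ?a"
    proof (rule measure_eq_if_moments_eq)
      fix k :: nat assume k: "k > 0"
      then obtain r' where r': "riemann_zeta (1 - of_nat k) = of_rat r'"
        "pseudo_integral (\<lambda>x. x ^ k) \<Lambda> = (1 - of_nat CARD('p) ^ (k - 1)) * of_rat r'" using * by blast
      have "r' = r k" using r'(1) zeta[OF k] by simp
      hence "Fract (moment k \<nu>) (?a ^ k - 1) = Fract (moment k (- \<mu> ?a)) (?a ^ k - 1)"
        using r'(2) special_value[OF k] pseudo_integral_power[OF unit ne1[OF k] \<nu>] by simp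
      thus "moment k \<nu> = moment k (- \<mu> ?a)" using ne1[OF k] by (simp add: eq_fract)
    qed
    moreover obtain l s where ls: "nonzerodivisor s" "\<Lambda> = Total_Frac l s" by (rule Total_Frac_cases)
    ultimately have "theta a * l = - \<mu> ?a * s"
      using \<nu> by (simp add: theta Total_Frac_mult Total_Frac_eq_iff)
    thus "\<Lambda> = ?L"
      using ls nzd by (simp add: Total_Frac_uminus Total_Frac_eq_iff mult.commute)
  qed
  thus ?thesis unfolding Col_cyclotomic_unit[OF a] \<mu>_def .
qed

end
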